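(* Let $\mu\in\mathscr H$ be a measure closed in the open set $U\subset\mathbb R^n$, and let $X$ be a Borel-measurable vector field on $T\mathbb R^n\times I$ supported in $TU\times I$. Let $\eta_X$ be the distribution given by $$\langle\eta_X,\varphi\rangle=\int_{T\mathbb R^n\times I}X\varphi\,d\mu,\qquad\varphi\in C^\infty(T\mathbb R^n\times I).$$ Assume that, for all $\phi\in C^\infty(\mathbb R^n\times I)$, $$\int_{T\mathbb R^n\times I}X(d\phi\circ\sigma)\,d\mu=0,$$ where $\sigma(x,v,t)=((x,t),(v,\mathbf 1))$, i.e. $(d\phi\circ\sigma)(x,v,t)=\phi_x(x,t)\cdot v+\phi_t(x,t)$. Then $\mu$ can be deformed in the direction $\eta_X$.
   Context: $U\subset\mathbb R^n$ is open, $I=[0,t_0]$ with $t_0>0$, $T\mathbb R^n\cong\mathbb R^n\times\mathbb R^n$, and coordinates on $T\mathbb R^n\times I$ are $(x,v,t)$. $\mathbf 1=\partial/\partial t$ is the unit vector field on $I$. $X\varphi=d\varphi(X)$ denotes the derivative of $\varphi$ in the direction of $X$; $X$ is such that the integral defining $\eta_X$ gives an element of $\mathscr E'$. $\mathscr E'$ is the space of compactly-supported distributions on $TU\times I$, with the weak* topology with respect to $C^\infty(TU\times I)$. $\mathscr H\subset\mathscr E'$ (the measures closed in $U$) is the set of positive, compactly-supported Radon measures $\mu$, supported in $TU\times I$, such that $\int[\phi_x(x,t)\cdot v+\phi_t(x,t)]\,d\mu(x,v,t)=0$ for all $\phi\in C^\infty(U\times I)$ vanishing on $U\times\{0,t_0\}$.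 For $\mu\in\mathscr H$ and $\eta\in\mathscr E'$, $\mu$ can be deformed in direction $\eta$ if there is a family of measures $(\mu_s)_{s\ge0}\subset\mathscr H$ with $\mu_0=\mu$ and, for all $\varphi\in C^\infty(T\mathbb R^n\times I)$ supported in $TU\times I$, $$\left.\frac{d}{ds}\right|_{s=0^+}\int_{T\mathbb R^n\times I}\varphi\,d\mu_s=\langle\eta,\varphi\rangle.$$ *)

theory Defs
  imports "HOL-Analysis.Analysis"
begin

text \<open>
  \<open>TI U t0\<close> is the manifold with boundary \<open>TU \<times> I\<close>, \<open>I = [0,t0]\<close>, with coordinates \<open>(x,v,t)\<close>; in
  particular \<open>TI UNIV t0\<close> is the whole \<open>T\<real>\<^sup>n \<times> I\<close>. \<open>BI U t0\<close> is the base \<open>U \<times> I\<close>.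
  Functions on these sets are total functions whose values elsewhere are irrelevant: derivatives
  are taken within the set, and integrals are over the set. For \<open>U\<close> open and \<open>t0 > 0\<close> the
  derivative within \<open>TI U t0\<close> or \<open>BI U t0\<close> is unique (one-sided in \<open>t\<close> at the boundary), and at a
  point over \<open>U\<close> it is the same as the derivative within \<open>TI UNIV t0\<close> or \<open>BI UNIV t0\<close>.
\<close>

definition TI :: "'a::euclidean_space set \<Rightarrow> real \<Rightarrow> ('a \<times> 'a \<times> real) set" where
  "TI U t0 = U \<times> UNIV \<times> {0..t0}"

definition BI :: "'a::euclidean_space set \<Rightarrow> real \<Rightarrow> ('a \<times> real) set" where
  "BI U t0 = U \<times> {0..t0}"

fun iter_deriv :: "'b::real_normed_vector set \<Rightarrow> 'b list \<Rightarrow> ('b \<Rightarrow> real) \<Rightarrow> 'b \<Rightarrow> real" where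
  "iter_deriv A [] f = f"
| "iter_deriv A (w # ws) f = (\<lambda>p. frechet_derivative (iter_deriv A ws f) (at p within A) w)"

text \<open>
  \<open>C\<^sup>\<infinity>(A)\<close>, smoothness up to the boundary: all iterated directional derivatives exist on \<open>A\<close> and
  are differentiable there (hence they are also continuous on \<open>A\<close>).
\<close>

definition smooth :: "'b::real_normed_vector set \<Rightarrow> ('b \<Rightarrow> real) set" where
  "smooth A = {f. \<forall>ws. iter_deriv A ws f differentiable_on A}"

text \<open>
  Compactly supported distributions on \<open>A\<close>, as the continuous linear functionals on \<open>C\<^sup>\<infinity>(A)\<close>. The
  topology of \<open>C\<^sup>\<infinity>(A)\<close> is uniform convergence of all derivatives on compact subsets of \<open>A\<close>, so
  continuity is the bound by finitely many of the corresponding seminorms, where \<open>B\<close> below ranges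
  over the upper bounds of the \<open>C\<^sup>N\<close> norm of \<open>f\<close> on \<open>K\<close>. The bound also makes \<open>\<eta> f\<close> depend only
  on the restriction of \<open>f\<close> to \<open>A\<close>.
\<close>

definition compact_distributions :: "'b::euclidean_space set \<Rightarrow> (('b \<Rightarrow> real) \<Rightarrow> real) set" where
  "compact_distributions A = {\<eta>.
     (\<forall>f\<in>smooth A. \<forall>g\<in>smooth A. \<eta> (\<lambda>p. f p + g p) = \<eta> f + \<eta> g) \<and>
     (\<forall>f\<in>smooth A. \<forall>c. \<eta> (\<lambda>p. c * f p) = c * \<eta> f) \<and>
     (\<exists>K N C. compact K \<and> K \<subseteq> A \<and>
        (\<forall>f\<in>smooth A. \<forall>B\<ge>0.
           (\<forall>ws. length ws \<le> N \<longrightarrow> set ws \<subseteq> Basis \<longrightarrow> (\<forall>p\<in>K. \<bar>iter_deriv A ws f p\<bar> \<le> B))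
           \<longrightarrow> \<bar>\<eta> f\<bar> \<le> C * B))}"

text \<open>
  On a Euclidean space the locally finite Borel measures are automatically regular.
\<close>

definition radon_measure :: "'b::euclidean_space measure \<Rightarrow> bool" where
  "radon_measure M \<longleftrightarrow> sets M = sets borel \<and> (\<forall>K. compact K \<longrightarrow> emeasure M K < \<infinity>)"

definition measure_support :: "'b::topological_space measure \<Rightarrow> 'b set" where
  "measure_support M = {p. \<forall>W. open W \<longrightarrow> p \<in> W \<longrightarrow> emeasure M W > 0}"

text \<open>\<open>(d\<phi> \<circ> \<sigma>)(x,v,t) = \<phi>\<^sub>x(x,t) \<cdot> v + \<phi>\<^sub>t(x,t)\<close>, with \<open>\<phi>\<close> defined on \<open>BI U t0\<close>.\<close>

definition d_sigma ::
  "'a::euclidean_space set \<Rightarrow> real \<Rightarrow> ('a \<times> real \<Rightarrow> real) \<Rightarrow> 'a \<times> 'a \<times> real \<Rightarrow> real" where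
  "d_sigma U t0 \<phi> = (\<lambda>(x, v, t). frechet_derivative \<phi> (at (x, t) within BI U t0) (v, 1))"

definition closed_measures ::
  "'a::euclidean_space set \<Rightarrow> real \<Rightarrow> ('a \<times> 'a \<times> real) measure set" where
  "closed_measures U t0 = {\<mu>. radon_measure \<mu> \<and>
     compact (measure_support \<mu>) \<and> measure_support \<mu> \<subseteq> TI U t0 \<and>
     (\<forall>\<phi>\<in>smooth (BI U t0). (\<forall>x\<in>U. \<phi> (x, 0) = 0 \<and> \<phi> (x, t0) = 0) \<longrightarrow>
        (LINT p:TI U t0|\<mu>. d_sigma U t0 \<phi> p) = 0)}"

definition can_be_deformed ::
  "'a::euclidean_space set \<Rightarrow> real \<Rightarrow> ('a \<times> 'a \<times> real) measure \<Rightarrow>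
    (('a \<times> 'a \<times> real \<Rightarrow> real) \<Rightarrow> real) \<Rightarrow> bool" where
  "can_be_deformed U t0 \<mu> \<eta> \<longleftrightarrow>
     (\<exists>m :: real \<Rightarrow> ('a \<times> 'a \<times> real) measure.
        m 0 = \<mu> \<and> (\<forall>s\<ge>0. m s \<in> closed_measures U t0) \<and>
        (\<forall>\<phi>\<in>smooth (TI UNIV t0). closure (support_on (TI UNIV t0) \<phi>) \<subseteq> TI U t0 \<longrightarrow>
           ((\<lambda>s. LINT p:TI UNIV t0|m s. \<phi> p) has_real_derivative \<eta> \<phi>) (at_right 0)))"

text \<open>\<open>X\<phi> = d\<phi>(X)\<close> for a vector field \<open>X\<close> on \<open>TI UNIV t0\<close>, which may point out of it at the boundary.\<close>

definition vf_deriv ::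
  "real \<Rightarrow> ('a::euclidean_space \<times> 'a \<times> real \<Rightarrow> 'a \<times> 'a \<times> real) \<Rightarrow>
    ('a \<times> 'a \<times> real \<Rightarrow> real) \<Rightarrow> 'a \<times> 'a \<times> real \<Rightarrow> real" where
  "vf_deriv t0 X \<phi> = (\<lambda>p. frechet_derivative \<phi> (at p within TI UNIV t0) (X p))"

end

theory Submission
  imports Defs
begin

text \<open>
  The deformation is \<open>(1 - s c) \<mu> + s \<nu>\<close> with closed measures \<open>\<nu>\<close> and \<open>c \<ge> 0\<close> chosen depending on \<open>s\<close>, so
  it is enough to approximate \<open>\<eta>\<close> by functionals \<open>\<nu> - c \<mu>\<close>, uniformly on test functions with bounded
  second derivatives. Such functions, recorded together with their gradients as jets \<open>(\<phi>, G)\<close>, form a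
  compact convex set, and a minimax argument reduces the approximation to one jet at a time. If it fails
  for a jet then, after a change of sign, \<open>\<phi>\<close> has nonnegative integral against every closed measure,
  \<open>\<integral>\<phi> d\<mu> \<le> 0\<close> and \<open>\<integral>G \<cdot> X d\<mu> \<noteq> 0\<close>.

  This is excluded as in weak KAM theory. Take a semiconcave extension of \<open>\<phi>\<close> as Lagrangian, with
  forward value function \<open>f\<close> (zero at time \<open>0\<close>) and backward value function \<open>g\<close> (zero at time \<open>t0\<close>).
  Nonnegativity on closed measures gives \<open>g \<le> f\<close>; integrating the subsolution inequalities against \<open>\<mu>\<close>
  gives \<open>f = g\<close> almost everywhere and \<open>df \<circ> \<sigma> = \<phi>\<close> in an integrated sense. Since \<open>f\<close> is semiconcave and
  \<open>g\<close> semiconvex, \<open>f\<close> has quadratic contact with an affine function at almost every point, so that its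
  mollifications \<open>W\<^sub>e\<close> satisfy second order estimates there. The defect \<open>\<gamma>\<^sub>e = \<phi> - dW\<^sub>e \<circ> \<sigma>\<close> is at least
  \<open>- C e\<^sup>2\<close> everywhere and \<open>o(e)\<close> at the contact points of a subsequence, hence nearly minimal there,
  so its derivative along \<open>X\<close> tends to \<open>0\<close>. As \<open>\<integral>X(dW\<^sub>e \<circ> \<sigma>) d\<mu> = 0\<close> by hypothesis,
  \<open>\<integral>G \<cdot> X d\<mu> = 0\<close>.
\<close>

section \<open>Smooth functions and mollification\<close>

text \<open>The deforming measures have to be fixed before the test function is known, so
  approximating \<open>\<eta>\<close> separately for each test function is not enough; this forces a
  compact class of test functions. Compactness is bought with regularity: limits of smooth functions
  with bounded second derivatives are only of class C^{1,1}. Hence the Lagrangian is controlled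
  through Lipschitz bounds and one-sided second differences only. Two further obstacles shape the
  proof. A closed measure is tested only by functions over \<open>U\<close> vanishing at times 0 and
  \<open>t0\<close>; the localisation is met by nested tubes around the projected support and a
  penalty, the end times by polynomial weights in time. And at a contact point the first derivatives
  of a mollification at scale e have a quadratic error of size 1/e, so a displacement
  \<open>\<lambda> e\<close> leaves an error \<open>\<lambda>^2 e\<close>, of the order of e itself.
  The defect must therefore be o(e), while the layers at the end times contribute O(e) a priori; the
  gain comes from \<open>\<mu>\<close> giving no mass to the end times.\<close>

primrec times_differentiable :: "nat \<Rightarrow> ('b::real_normed_vector \<Rightarrow> real) \<Rightarrow> bool" where
  "times_differentiable 0 f = True"
| "times_differentiable (Suc n) f =
     (\<exists>f'. (\<forall>p. (f has_derivative f' p) (at p)) \<and> (\<forall>v. times_differentiable n (\<lambda>p. f' p v)))"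

text \<open>Smoothness on the whole space, with derivatives given existentially. Asking only that
  every directional derivative be \<open>n\<close> times differentiable keeps the closure proofs
  one-step inductions; \<open>smooth_fun_imp_smooth\<close> passes to the iterated derivatives
  within a set.\<close>

definition smooth_fun :: "('b::real_normed_vector \<Rightarrow> real) \<Rightarrow> bool" where
  "smooth_fun f \<longleftrightarrow> (\<forall>n. times_differentiable n f)"

lemma times_differentiable_SucD: "times_differentiable (Suc n) f \<Longrightarrow> times_differentiable n f"
proof (induction n arbitrary: f)
  case (Suc n)
  from Suc.prems obtain f' where d: "\<And>p. (f has_derivative f' p) (at p)"
    and s: "\<And>v. times_differentiable (Suc n) (\<lambda>p. f' p v)"
    unfolding times_differentiable.simps(2)[of "Suc n"] by blast
  show ?case unfolding times_differentiable.simps(2)[of n]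
    by (intro exI[of _ f'] conjI allI d Suc.IH s)
qed simp

lemma times_differentiable_const: "times_differentiable n (\<lambda>p. c)"
proof (induction n arbitrary: c)
  case (Suc n)
  show ?case unfolding times_differentiable.simps
    by (rule exI[of _ "\<lambda>p v. 0"]) (use Suc in auto)
qed simp

lemma times_differentiable_linear: "bounded_linear f \<Longrightarrow> times_differentiable n f"
proof (cases n)
  case (Suc m)
  assume "bounded_linear f"
  then show ?thesis unfolding Suc times_differentiable.simps
    by (intro exI[of _ "\<lambda>p. f"])
       (auto simp: times_differentiable_const bounded_linear_imp_has_derivative)
qed simp

lemma times_differentiable_add:
  "times_differentiable n f \<Longrightarrow> times_differentiable n g \<Longrightarrow> times_differentiable n (\<lambda>p. f p + g p)"
proof (induction n arbitrary: f g)
  case (Suc n)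
  then obtain f' g' where "\<And>p. (f has_derivative f' p) (at p)"
    "\<And>p. (g has_derivative g' p) (at p)"
    "\<And>v. times_differentiable n (\<lambda>p. f' p v)" "\<And>v. times_differentiable n (\<lambda>p. g' p v)"
    by auto
  with Suc.IH show ?case unfolding times_differentiable.simps
    by (intro exI[of _ "\<lambda>p v. f' p v + g' p v"]) (auto intro: has_derivative_add)
qed simp

lemma times_differentiable_mult:
  fixes f g :: "'b::real_normed_vector \<Rightarrow> real"
  shows "times_differentiable n f \<Longrightarrow> times_differentiable n g \<Longrightarrow> times_differentiable n (\<lambda>p. f p * g p)"
proof (induction n arbitrary: f g)
  case (Suc n)
  note fg = Suc.prems[THEN times_differentiable_SucD]
  from Suc.prems obtain f' g' where d: "\<And>p. (f has_derivative f' p) (at p)"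
    "\<And>p. (g has_derivative g' p) (at p)"
    "\<And>v. times_differentiable n (\<lambda>p. f' p v)" "\<And>v. times_differentiable n (\<lambda>p. g' p v)"
    by auto
  show ?case unfolding times_differentiable.simps
  proof (intro exI[of _ "\<lambda>p v. f p * g' p v + f' p v * g p"] conjI allI)
    show "((\<lambda>p. f p * g p) has_derivative (\<lambda>v. f p * g' p v + f' p v * g p)) (at p)" for p
      by (rule has_derivative_mult[OF d(1,2)])
    show "times_differentiable n (\<lambda>p. f p * g' p v + f' p v * g p)" for v
      by (intro times_differentiable_add Suc.IH fg d)
  qed
qed simp

lemma times_differentiable_compose:
  fixes g :: "real \<Rightarrow> real" and f :: "'b::real_normed_vector \<Rightarrow> real"
  shows "times_differentiable n g \<Longrightarrow> times_differentiable n f \<Longrightarrow> times_differentiable n (\<lambda>p. g (f p))"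
proof (induction n arbitrary: f g)
  case (Suc n)
  from Suc.prems obtain f' g' where d: "\<And>p. (f has_derivative f' p) (at p)"
    "\<And>p. (g has_derivative g' p) (at p)"
    "\<And>v. times_differentiable n (\<lambda>p. f' p v)" "\<And>v. times_differentiable n (\<lambda>p. g' p v)"
    by auto
  have e: "g' x h = g' x 1 * h" for x h
  proof -
    have "linear (g' x)" by (rule has_derivative_linear[OF d(2)])
    from linear_scale[OF this, of h 1] show ?thesis by simp
  qed
  show ?case unfolding times_differentiable.simps
  proof (intro exI[of _ "\<lambda>p v. g' (f p) 1 * f' p v"] conjI allI)
    show "((\<lambda>p. g (f p)) has_derivative (\<lambda>v. g' (f p) 1 * f' p v)) (at p)" for p
    proof -
      have "(\<lambda>v. g' (f p) 1 * f' p v) = g' (f p) \<circ> f' p"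
        by (rule ext) (simp only: o_def e[of "f p" "f' p _"])
      then show ?thesis using diff_chain_at[OF d(1) d(2)] by (simp add: o_def)
    qed
    show "times_differentiable n (\<lambda>p. g' (f p) 1 * f' p v)" for v
      by (rule times_differentiable_mult[OF Suc.IH[OF d(4) times_differentiable_SucD[OF Suc.prems(2)]] d(3)])
  qed
qed simp

lemma smooth_fun_const [simp]: "smooth_fun (\<lambda>p. c)"
  and smooth_fun_linear: "bounded_linear f \<Longrightarrow> smooth_fun f"
  by (auto simp: smooth_fun_def times_differentiable_const times_differentiable_linear)

lemma smooth_fun_add: "smooth_fun f \<Longrightarrow> smooth_fun g \<Longrightarrow> smooth_fun (\<lambda>p. f p + g p)"
  unfolding smooth_fun_def by (intro allI times_differentiable_add) auto

lemma smooth_fun_mult: "smooth_fun f \<Longrightarrow> smooth_fun g \<Longrightarrow> smooth_fun (\<lambda>p. f p * g p)"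
  unfolding smooth_fun_def by (intro allI times_differentiable_mult) auto

lemma smooth_fun_compose: "smooth_fun g \<Longrightarrow> smooth_fun f \<Longrightarrow> smooth_fun (\<lambda>p. g (f p))"
  for g :: "real \<Rightarrow> real"
  unfolding smooth_fun_def by (intro allI times_differentiable_compose[of _ g f]) auto

lemma smooth_fun_diff: "smooth_fun f \<Longrightarrow> smooth_fun g \<Longrightarrow> smooth_fun (\<lambda>p. f p - g p)"
  using smooth_fun_add[of f "\<lambda>p. (-1) * g p"] smooth_fun_mult[of "\<lambda>p. -1" g] by simp

lemma smooth_fun_sum: "(\<And>i. i \<in> I \<Longrightarrow> smooth_fun (f i)) \<Longrightarrow> smooth_fun (\<lambda>p. \<Sum>i\<in>I. f i p)"
  by (induction I rule: infinite_finite_induct) (auto intro: smooth_fun_add)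

lemma smooth_fun_has_derivative: "smooth_fun f \<Longrightarrow> (f has_derivative frechet_derivative f (at p)) (at p)"
proof -
  assume "smooth_fun f"
  then have "times_differentiable (Suc 0) f" unfolding smooth_fun_def by blast
  then obtain f' where f': "(f has_derivative f' p) (at p)" by auto
  then show ?thesis using frechet_derivative_at[OF f'] by simp
qed

lemma smooth_fun_frechet_derivative: 
  assumes "smooth_fun f" shows "smooth_fun (\<lambda>p. frechet_derivative f (at p) v)"
  unfolding smooth_fun_def
proof
  fix n
  have "times_differentiable (Suc n) f" using assms by (simp add: smooth_fun_def)
  then obtain f' where "\<And>p. (f has_derivative f' p) (at p)" "\<And>v. times_differentiable n (\<lambda>p. f' p v)"
    by auto
  moreover from this have "f' = (\<lambda>p. frechet_derivative f (at p))"
    using frechet_derivative_at by blast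
  ultimately show "times_differentiable n (\<lambda>p. frechet_derivative f (at p) v)"
    by simp
qed

lemma smooth_fun_continuous: "smooth_fun f \<Longrightarrow> continuous_on A f"
  by (meson continuous_at_imp_continuous_on has_derivative_continuous smooth_fun_has_derivative)

text \<open>\<open>frechet_derivative\<close> within a set is a choice among the admissible
  derivatives; under this property it is the one that a calculation produces. For \<open>TI\<close>
  and \<open>BI\<close> it holds up to the boundary times.\<close>

definition unique_derivatives :: "'b::real_normed_vector set \<Rightarrow> bool" where
  "unique_derivatives A \<longleftrightarrow> (\<forall>p\<in>A. \<forall>(f::'b \<Rightarrow> real) f' f''. (f has_derivative f') (at p within A) \<longrightarrow>
     (f has_derivative f'') (at p within A) \<longrightarrow> f' = f'')"

lemma frechet_derivative_within_eq:
  fixes f :: "'b::real_normed_vector \<Rightarrow> real"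
  assumes "unique_derivatives A" "p \<in> A" "(f has_derivative f') (at p within A)"
  shows "frechet_derivative f (at p within A) = f'"
proof -
  have "(f has_derivative frechet_derivative f (at p within A)) (at p within A)"
    using assms(3) differentiableI frechet_derivative_works by blast
  from assms(1)[unfolded unique_derivatives_def, rule_format, OF assms(2) this assms(3)]
  show ?thesis .
qed

text \<open>The induction carries a whole-space smooth function agreeing on \<open>A\<close> with
  the iterated derivative; uniqueness of derivatives within \<open>A\<close> transfers the next
  derivative from one to the other.\<close>

lemma smooth_fun_imp_smooth:
  assumes A: "unique_derivatives A" and f: "smooth_fun f"
  shows "f \<in> smooth A"
proof -
  have "\<exists>g. smooth_fun g \<and> (\<forall>p\<in>A. iter_deriv A ws f p = g p)" for ws
  proof (induction ws)
    case (Cons w ws)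
    then obtain g where g: "smooth_fun g" "\<And>p. p \<in> A \<Longrightarrow> iter_deriv A ws f p = g p" by blast
    have "iter_deriv A (w # ws) f p = frechet_derivative g (at p) w" if p: "p \<in> A" for p
    proof -
      have "(g has_derivative frechet_derivative g (at p)) (at p within A)"
        by (rule has_derivative_at_withinI[OF smooth_fun_has_derivative[OF g(1)]])
      then have "(iter_deriv A ws f has_derivative frechet_derivative g (at p)) (at p within A)"
        using has_derivative_transform[OF p, of "iter_deriv A ws f" g] g(2) by auto
      then show ?thesis by (simp add: frechet_derivative_within_eq[OF A p])
    qed
    then show ?case using smooth_fun_frechet_derivative[OF g(1)] by blast
  qed (use f in auto)
  moreover have "h differentiable_on A" if "smooth_fun g" "\<And>p. p \<in> A \<Longrightarrow> h p = g p" for g h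
    unfolding differentiable_on_def differentiable_def
    using has_derivative_transform[OF _ that(2) has_derivative_at_withinI[OF smooth_fun_has_derivative[OF that(1)]]]
    by blast
  ultimately show ?thesis unfolding smooth_def by blast
qed

section \<open>The flat exponential and the bump kernel\<close>

text \<open>Closed under differentiation up to a change of \<open>q\<close>, also at \<open>0\<close>.\<close>

definition inv_exp_poly :: "real poly \<Rightarrow> real \<Rightarrow> real" where
  "inv_exp_poly q x = (if x > 0 then poly q (1/x) * exp (- (1/x)) else 0)"

lemma poly_exp_tendsto_0: "((\<lambda>y. poly q y * exp (- y)) \<longlongrightarrow> 0) (at_top :: real filter)"
proof -
  have "((\<lambda>y. \<Sum>i\<le>degree q. coeff q i * (y ^ i / exp y)) \<longlongrightarrow> (\<Sum>i\<le>degree q. coeff q i * 0)) at_top"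
    by (intro tendsto_sum tendsto_mult tendsto_const tendsto_power_div_exp_0)
  then show ?thesis
    by (simp add: poly_altdef sum_distrib_right exp_minus divide_inverse mult.assoc)
qed

text \<open>With \<open>y = 1/x\<close>, the derivative of \<open>q(y) exp(-y)\<close> is
  \<open>y^2 (q - q')(y) exp(-y)\<close>, whence the polynomial. At 0 the difference quotient from
  the right is \<open>y q(y) exp(-y)\<close>, which exponential decay sends to 0.\<close>

lemma inv_exp_poly_deriv:
  "(inv_exp_poly q has_real_derivative inv_exp_poly ([:0,0,1:] * (q - pderiv q)) x) (at x)"
proof -
  consider "x > 0" | "x < 0" | "x = 0" by linarith
  then show ?thesis
  proof cases
    case 1
    have "((\<lambda>x. poly q (1/x) * exp (- (1/x))) has_real_derivative
        inv_exp_poly ([:0,0,1:] * (q - pderiv q)) x) (at x)"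
      using 1 by (auto intro!: derivative_eq_intros simp: inv_exp_poly_def field_simps power2_eq_square)
    then show ?thesis
      by (rule DERIV_cong_ev[THEN iffD1, rotated 3])
        (use 1 in \<open>auto simp: inv_exp_poly_def intro: eventually_mono[OF eventually_nhds_in_open[of "{0<..}"]]\<close>)
  next
    case 2
    have "((\<lambda>x. 0) has_real_derivative inv_exp_poly ([:0,0,1:] * (q - pderiv q)) x) (at x)"
      using 2 by (auto simp: inv_exp_poly_def)
    then show ?thesis
      by (rule DERIV_cong_ev[THEN iffD1, rotated 3])
        (use 2 in \<open>auto simp: inv_exp_poly_def intro: eventually_mono[OF eventually_nhds_in_open[of "{..<0}"]]\<close>)
  next
    case 3
    have "((\<lambda>h. poly (q * [:0,1:]) (1/h) * exp (- (1/h))) \<longlongrightarrow> 0) (at_right 0)"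
      using filterlim_compose[OF poly_exp_tendsto_0 filterlim_inverse_at_top_right]
      by (simp only: inverse_eq_divide)
    then have r: "((\<lambda>h. inv_exp_poly q h / h) \<longlongrightarrow> 0) (at_right 0)"
      by (rule Lim_transform_eventually)
         (auto simp: inv_exp_poly_def eventually_at_filter field_simps)
    have l: "((\<lambda>h. inv_exp_poly q h / h) \<longlongrightarrow> 0) (at_left 0)"
      by (rule Lim_transform_eventually[OF tendsto_const])
         (auto simp: inv_exp_poly_def eventually_at_filter)
    have "((\<lambda>h. inv_exp_poly q h / h) \<longlongrightarrow> 0) (at 0)"
      using l r by (simp add: filterlim_split_at)
    then show ?thesis using 3 by (simp add: DERIV_def inv_exp_poly_def)
  qed
qed

lemma smooth_fun_inv_exp_poly: "smooth_fun (inv_exp_poly q)"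
proof -
  have "times_differentiable n (inv_exp_poly q)" for n
  proof (induction n arbitrary: q)
    case (Suc n)
    show ?case unfolding times_differentiable.simps
      by (rule exI[of _ "\<lambda>x v. v * inv_exp_poly ([:0,0,1:] * (q - pderiv q)) x"])
         (use inv_exp_poly_deriv[of q] Suc in
          \<open>auto simp: has_field_derivative_def mult.commute[of _ "inv_exp_poly _ _"]
             intro!: times_differentiable_mult times_differentiable_const\<close>)
  qed simp
  then show ?thesis by (simp add: smooth_fun_def)
qed

lemma integrable_lborel_compact_support:
  fixes f :: "'e::euclidean_space \<Rightarrow> real"
  assumes "continuous_on UNIV f" "\<And>z. norm z > r \<Longrightarrow> f z = 0"
  shows "integrable lborel f"
proof -
  have "integrable lborel (\<lambda>x. indicator (cball 0 r) x *\<^sub>R f x)"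
    by (rule borel_integrable_compact) (auto intro: continuous_on_subset[OF assms(1)])
  moreover have "(\<lambda>x. indicator (cball 0 r) x *\<^sub>R f x) = f"
    using assms(2) by (auto simp: indicator_def fun_eq_iff not_le)
  ultimately show ?thesis by simp
qed

lemma lborel_integral_translate:
  fixes f :: "'e::euclidean_space \<Rightarrow> real"
  assumes "continuous_on UNIV f"
  shows "(\<integral>z. f (c + z) \<partial>lborel) = (\<integral>z. f z \<partial>lborel)"
proof -
  have [measurable]: "f \<in> borel_measurable borel" 
    by (rule borel_measurable_continuous_onI[OF assms])
  have "(\<integral>z. f z \<partial>lborel) = (\<integral>z. f z \<partial>distr lborel borel ((+) c))"
    by (simp add: lborel_distr_plus)
  also have "\<dots> = (\<integral>z. f (c + z) \<partial>lborel)"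
    by (subst integral_distr) auto
  finally show ?thesis by simp
qed

lemma lborel_integral_reflect:
  fixes f :: "'e::euclidean_space \<Rightarrow> real"
  assumes "continuous_on UNIV f"
  shows "(\<integral>z. f (- z) \<partial>lborel) = (\<integral>z. f z \<partial>lborel)"
proof -
  have [measurable]: "f \<in> borel_measurable borel" 
    by (rule borel_measurable_continuous_onI[OF assms])
  have d: "distr lborel borel (\<lambda>x::'e. - x) = lborel"
  proof -
    show ?thesis using lborel_affine[of "-1" "0::'e"] by (simp add: density_1)
  qed
  have "(\<integral>z. f z \<partial>lborel) = (\<integral>z. f z \<partial>distr lborel borel (\<lambda>x. - x))"
    by (simp only: d)
  also have "\<dots> = (\<integral>z. f (- z) \<partial>lborel)"
    by (subst integral_distr) auto
  finally show ?thesis by simp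
qed

text \<open>The standard bump \<open>exp (- 1 / (1 - |z|^2))\<close> on the unit ball, extended by
  0.\<close>

definition bump0 :: "'e::euclidean_space \<Rightarrow> real" where
  "bump0 z = inv_exp_poly 1 (1 - z \<bullet> z)"

definition bump :: "'e::euclidean_space \<Rightarrow> real" where
  "bump z = inverse (\<integral>y. bump0 (y::'e) \<partial>lborel) * bump0 z"

text \<open>Neither sign nor mass is prescribed, so the directional derivatives of
  \<open>bump\<close> are kernels too and the mollification estimates apply to them.\<close>

definition test_kernel :: "('e::euclidean_space \<Rightarrow> real) \<Rightarrow> bool" where
  "test_kernel K \<longleftrightarrow> smooth_fun K \<and> (\<forall>z. norm z > 1 \<longrightarrow> K z = 0)"

lemma smooth_fun_inner_self: "smooth_fun (\<lambda>z::'e::euclidean_space. z \<bullet> z)"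
proof -
  have "smooth_fun (\<lambda>z::'e. \<Sum>b\<in>Basis. (z \<bullet> b) * (z \<bullet> b))"
    by (intro smooth_fun_sum smooth_fun_mult smooth_fun_linear bounded_linear_inner_left)
  then show ?thesis by (simp add: euclidean_inner[symmetric])
qed

lemma smooth_fun_bump0: "smooth_fun (bump0 :: 'e::euclidean_space \<Rightarrow> real)"
  unfolding bump0_def
  by (rule smooth_fun_compose[OF smooth_fun_inv_exp_poly]) (intro smooth_fun_diff smooth_fun_const smooth_fun_inner_self)

lemma bump0_nonneg: "bump0 z \<ge> 0"
  by (auto simp: bump0_def inv_exp_poly_def)

lemma bump0_pos: "norm z < 1 \<Longrightarrow> bump0 z > 0"
  by (auto simp: bump0_def inv_exp_poly_def dot_square_norm power_less_one_iff abs_square_less_1)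

lemma bump0_zero: "norm z > 1 \<Longrightarrow> bump0 z = 0"
  by (auto simp: bump0_def inv_exp_poly_def dot_square_norm not_less)

lemma integrable_bump0: "integrable lborel (bump0 :: 'e::euclidean_space \<Rightarrow> real)"
  by (rule integrable_lborel_compact_support[OF smooth_fun_continuous[OF smooth_fun_bump0] bump0_zero])

lemma integral_bump0_pos: "(\<integral>y. bump0 (y::'e::euclidean_space) \<partial>lborel) > 0"
proof -
  have "(\<integral>y. bump0 (y::'e) \<partial>lborel) \<noteq> 0"
  proof
    assume "(\<integral>y. bump0 (y::'e) \<partial>lborel) = 0"
    then have "AE y in lborel. bump0 (y::'e) = 0"
      by (simp add: integral_nonneg_eq_0_iff_AE[OF integrable_bump0] bump0_nonneg)
    then have "AE y in lborel. (y::'e) \<notin> ball 0 1"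
      by eventually_elim (use bump0_pos in force)
    then have "emeasure lborel (ball 0 (1::real) :: 'e set) = 0"
      by (subst (asm) AE_iff_measurable[of "ball 0 1"]) auto
    then have "negligible (ball 0 (1::real) :: 'e set)"
      by (simp add: negligible_iff_emeasure0 emeasure_completion)
    then show False using open_not_negligible[of "ball 0 (1::real) :: 'e set"] by simp
  qed
  moreover have "(\<integral>y. bump0 (y::'e) \<partial>lborel) \<ge> 0"
    by (simp add: bump0_nonneg)
  ultimately show ?thesis by simp
qed

lemma kernel_bump: "test_kernel (bump :: 'e::euclidean_space \<Rightarrow> real)"
  unfolding test_kernel_def bump_def by (auto simp: bump0_zero intro!: smooth_fun_mult smooth_fun_bump0)

lemma bump_nonneg: "bump z \<ge> 0"
  unfolding bump_def by (intro mult_nonneg_nonneg less_imp_le[OF positive_imp_inverse_positive] integral_bump0_pos bump0_nonneg)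

lemma bump_minus: "bump (- z) = bump z"
  by (simp add: bump_def bump0_def)

lemma integral_bump: "(\<integral>y. bump (y::'e::euclidean_space) \<partial>lborel) = 1"
  unfolding bump_def using integral_bump0_pos[where 'e='e] by simp

lemma kernel_frechet_derivative:
  assumes "test_kernel K" shows "test_kernel (\<lambda>z. frechet_derivative K (at z) u)"
proof -
  have "frechet_derivative K (at z) u = 0" if z: "norm z > 1" for z
  proof -
    have "open {z::'a. norm z > 1}" by (intro open_Collect_less continuous_intros)
    then have "((\<lambda>_. 0) has_derivative (\<lambda>_. 0)) (at z) \<Longrightarrow> (K has_derivative (\<lambda>_. 0)) (at z)"
      by (rule has_derivative_transform_within_open[rotated 1]) (use assms z in \<open>auto simp: test_kernel_def\<close>)
    then have "(K has_derivative (\<lambda>_. 0)) (at z)" by simp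
    then show ?thesis using frechet_derivative_at by (metis (no_types))
  qed
  with assms show ?thesis by (auto simp: test_kernel_def intro: smooth_fun_frechet_derivative)
qed

lemma kernel_derivative_linear: 
  "test_kernel K \<Longrightarrow> bounded_linear (frechet_derivative K (at z))"
  using smooth_fun_has_derivative has_derivative_bounded_linear by (auto simp: test_kernel_def)

lemma kernel_bounded:
  assumes "test_kernel K" obtains C where "C \<ge> 0" "\<And>z. \<bar>K z\<bar> \<le> C"
proof -
  have "bounded (K ` cball 0 1)"
    by (intro compact_imp_bounded compact_continuous_image smooth_fun_continuous)
       (use assms in \<open>auto simp: test_kernel_def\<close>)
  then obtain C where C: "\<And>z. z \<in> cball 0 1 \<Longrightarrow> \<bar>K z\<bar> \<le> C"
    unfolding bounded_iff by (metis image_eqI real_norm_def)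
  have "\<bar>K z\<bar> \<le> max C 0" for z
    using C[of z] assms by (cases "norm z \<le> 1") (auto simp: test_kernel_def)
  then show ?thesis using that[of "max C 0"] by auto
qed

lemma kernel_derivative_bounded:
  fixes K :: "'e::euclidean_space \<Rightarrow> real"
  assumes "test_kernel K" obtains C where "C \<ge> 0" "\<And>z u. \<bar>frechet_derivative K (at z) u\<bar> \<le> C * norm u"
proof -
  have "\<forall>b. \<exists>C\<ge>0. \<forall>z. \<bar>frechet_derivative K (at z) b\<bar> \<le> C"
    using kernel_bounded[OF kernel_frechet_derivative[OF assms]] by metis
  then obtain C where C: "\<And>b. C b \<ge> 0" "\<And>b z. \<bar>frechet_derivative K (at z) b\<bar> \<le> C b" by metis
  have "\<bar>frechet_derivative K (at z) u\<bar> \<le> (\<Sum>b\<in>Basis. C b) * norm u" for z u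
  proof -
    interpret bounded_linear "frechet_derivative K (at z)" by (rule kernel_derivative_linear[OF assms])
    have "frechet_derivative K (at z) u = frechet_derivative K (at z) (\<Sum>b\<in>Basis. (u \<bullet> b) *\<^sub>R b)"
      by (simp add: euclidean_representation)
    also have "\<dots> = (\<Sum>b\<in>Basis. (u \<bullet> b) * frechet_derivative K (at z) b)"
      by (simp add: sum scaleR)
    also have "\<bar>\<dots>\<bar> \<le> (\<Sum>b\<in>Basis. norm u * C b)"
      by (rule order_trans[OF sum_abs]) 
         (auto simp: abs_mult intro!: sum_mono mult_mono C Basis_le_norm)
    finally show ?thesis by (simp add: sum_distrib_left mult.commute)
  qed
  then show ?thesis using that[of "\<Sum>b\<in>Basis. C b"] C(1) by (auto intro: sum_nonneg)
qed

lemma kernel_lipschitz: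
  fixes K :: "'e::euclidean_space \<Rightarrow> real"
  assumes "test_kernel K" obtains C where "C \<ge> 0" "\<And>y z. \<bar>K y - K z\<bar> \<le> C * norm (y - z)"
proof -
  obtain C where C: "C \<ge> 0" "\<And>z u. \<bar>frechet_derivative K (at z) u\<bar> \<le> C * norm u"
    using kernel_derivative_bounded[OF assms] by blast
  have "\<bar>K y - K z\<bar> \<le> C * norm (y - z)" for y z
  proof -
    have "norm (K y - K z) \<le> C * norm (y - z)"
    proof (rule differentiable_bound[of UNIV K "\<lambda>z. frechet_derivative K (at z)"])
      show "onorm (frechet_derivative K (at x)) \<le> C" for x
        by (rule onorm_bound[OF C(1)]) (simp add: C(2))
    qed (use assms in \<open>auto simp: test_kernel_def smooth_fun_has_derivative\<close>)
    then show ?thesis by simp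
  qed
  with C that show ?thesis by blast
qed

lemma kernel_taylor:
  fixes K :: "'e::euclidean_space \<Rightarrow> real"
  assumes "test_kernel K"
  obtains C where "C \<ge> 0" "\<And>z h. \<bar>K (z + h) - K z - frechet_derivative K (at z) h\<bar> \<le> C * (norm h)\<^sup>2"
proof -
  let ?D = "\<lambda>z. frechet_derivative K (at z)"
  have "\<forall>b. \<exists>C\<ge>0. \<forall>y z. \<bar>?D y b - ?D z b\<bar> \<le> C * norm (y - z)"
    using kernel_lipschitz[OF kernel_frechet_derivative[OF assms]] by metis
  then obtain C where C: "\<And>b. C b \<ge> 0" "\<And>b y z. \<bar>?D y b - ?D z b\<bar> \<le> C b * norm (y - z)" by metis
  define B where "B = (\<Sum>b\<in>Basis. C b)"
  have B0: "B \<ge> 0" unfolding B_def using C(1) by (auto intro: sum_nonneg)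
  have D: "\<bar>?D y u - ?D z u\<bar> \<le> B * norm (y - z) * norm u" for y z u
  proof -
    interpret y: bounded_linear "?D y" by (rule kernel_derivative_linear[OF assms])
    interpret z: bounded_linear "?D z" by (rule kernel_derivative_linear[OF assms])
    have "?D y u - ?D z u = ?D y (\<Sum>b\<in>Basis. (u \<bullet> b) *\<^sub>R b) - ?D z (\<Sum>b\<in>Basis. (u \<bullet> b) *\<^sub>R b)"
      by (simp add: euclidean_representation)
    also have "\<dots> = (\<Sum>b\<in>Basis. (u \<bullet> b) * (?D y b - ?D z b))"
      by (simp add: y.sum z.sum y.scaleR z.scaleR sum_subtractf right_diff_distrib)
    also have "\<bar>\<dots>\<bar> \<le> (\<Sum>b\<in>Basis. norm u * (C b * norm (y - z)))"
      by (rule order_trans[OF sum_abs]) 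
         (auto simp: abs_mult intro!: sum_mono mult_mono C Basis_le_norm)
    finally show ?thesis by (simp add: B_def sum_distrib_left sum_distrib_right algebra_simps)
  qed
  have "\<bar>K (z + h) - K z - ?D z h\<bar> \<le> B * (norm h)\<^sup>2" for z h
  proof -
    have "norm (K (z + h) - K z - ?D z ((z + h) - z)) \<le> norm ((z + h) - z) * (B * norm h)"
    proof (rule differentiable_bound_linearization[where S = "closed_segment z (z + h)"])
      show "z + t *\<^sub>R (z + h - z) \<in> closed_segment z (z + h)" if "t \<in> {0..1}" for t
        using that by (auto simp: in_segment algebra_simps intro!: exI[of _ t])
      show "(K has_derivative ?D x) (at x within closed_segment z (z + h))" for x
        using assms by (auto simp: test_kernel_def intro: has_derivative_at_withinI smooth_fun_has_derivative)
      show "z \<in> closed_segment z (z + h)" by simp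
      show "onorm (?D x - ?D z) \<le> B * norm h" if "x \<in> closed_segment z (z + h)" for x
      proof (rule onorm_bound)
        have "norm (x - z) \<le> norm h" using segment_bound(1)[OF that] by (simp add: norm_minus_commute)
        then have "B * norm (x - z) * norm u \<le> B * norm h * norm u" for u::'e
          using B0 by (intro mult_right_mono mult_left_mono) auto
        then show "norm ((?D x - ?D z) u) \<le> B * norm h * norm u" for u
          using D[of x u z] order_trans by fastforce
      qed (use B0 in auto)
    qed
    then show ?thesis by (simp add: power2_eq_square algebra_simps)
  qed
  with B0 that show ?thesis by blast
qed

lemma kernel_continuous: "test_kernel K \<Longrightarrow> continuous_on A K"
  by (simp add: test_kernel_def smooth_fun_continuous)

section \<open>Mollification at scale \<open>e\<close>\<close>

lemma continuous_on_affine_arg: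
  fixes w :: "'e::real_normed_vector \<Rightarrow> real"
  assumes "continuous_on UNIV w"
  shows "continuous_on A (\<lambda>z. w (p + e *\<^sub>R z))"
  by (rule continuous_on_compose2[OF assms]) (auto intro!: continuous_intros)

text \<open>Convolution with the reflected kernel: the argument is \<open>p + e z\<close>. Each
  derivative in \<open>p\<close> therefore falls on the kernel with a factor
  \<open>- 1 / e\<close>.\<close>

definition mollify ::
  "('e::euclidean_space \<Rightarrow> real) \<Rightarrow> real \<Rightarrow> ('e \<Rightarrow> real) \<Rightarrow> 'e \<Rightarrow> real" where
  "mollify K e w p = (\<integral>z. w (p + e *\<^sub>R z) * K z \<partial>lborel)"

lemma mollify_integrable:
  assumes "test_kernel K" "continuous_on UNIV w"
  shows "integrable lborel (\<lambda>z. w (p + e *\<^sub>R z) * K z)"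
  by (rule integrable_lborel_compact_support[of _ 1])
     (use assms(1) in \<open>auto simp: test_kernel_def
     intro!: continuous_on_mult continuous_on_affine_arg[OF assms(2)] kernel_continuous[OF assms(1)]\<close>)

lemma mollify_bound:
  assumes "test_kernel K" "continuous_on UNIV w" "\<And>z. norm z \<le> 1 \<Longrightarrow> \<bar>w (p + e *\<^sub>R z)\<bar> \<le> M"
  shows "\<bar>mollify K e w p\<bar> \<le> M * (\<integral>z. \<bar>K z\<bar> \<partial>lborel)"
proof -
  have "integrable lborel K" using mollify_integrable[of K "\<lambda>_. 1" p e] assms by simp
  then have "norm (mollify K e w p) \<le> (\<integral>z. M * norm (K z) \<partial>lborel)"
    unfolding mollify_def
  proof (intro order_trans[OF integral_norm_bound] integral_mono)
    show "integrable lborel (\<lambda>z. norm (w (p + e *\<^sub>R z) * K z))"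
      by (intro integrable_norm mollify_integrable assms)
    show "norm (w (p + e *\<^sub>R z) * K z) \<le> M * norm (K z)" for z
      using assms(1) assms(3)[of z] 
      by (cases "norm z \<le> 1") (auto simp: test_kernel_def abs_mult intro!: mult_right_mono)
  qed auto
  then show ?thesis by simp
qed

text \<open>Translating the integration variable moves the increment \<open>d\<close> from
  \<open>w\<close> to the kernel, so the second order expansion uses only a bound for
  \<open>w\<close>. The ball of radius 2 contains the supports of the kernel and of its translates
  by at most 1. Later \<open>w\<close> is a remainder of order \<open>e^2\<close>.\<close>

lemma mollify_taylor:
  fixes K :: "'e::euclidean_space \<Rightarrow> real"
  assumes K: "test_kernel K"
  obtains C where "C \<ge> 0" 
   "\<And>w e M p d. continuous_on UNIV w \<Longrightarrow> e > 0 \<Longrightarrow> norm d \<le> e \<Longrightarrow>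
      (\<And>z. norm z \<le> 2 \<Longrightarrow> \<bar>w (p + e *\<^sub>R z)\<bar> \<le> M) \<Longrightarrow>
      \<bar>mollify K e w (p + d) - mollify K e w p
        + mollify (\<lambda>z. frechet_derivative K (at z) d) e w p / e\<bar> \<le> C * M * (norm d / e)\<^sup>2"
proof -
  obtain C where C: "C \<ge> 0"
    "\<And>z h. \<bar>K (z + h) - K z - frechet_derivative K (at z) h\<bar> \<le> C * (norm h)\<^sup>2"
    using kernel_taylor[OF K] by blast
  let ?m = "measure lborel (cball (0::'e) 2)"
  have "\<bar>mollify K e w (p + d) - mollify K e w p
        + mollify (\<lambda>z. frechet_derivative K (at z) d) e w p / e\<bar> \<le> (C * ?m) * M * (norm d / e)\<^sup>2"
    if w: "continuous_on UNIV w" and e: "e > 0" and d: "norm d \<le> e"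
    and M: "\<And>z. norm z \<le> 2 \<Longrightarrow> \<bar>w (p + e *\<^sub>R z)\<bar> \<le> M" for w e M p d
  proof -
    define h where "h = (- (1 / e)) *\<^sub>R d"
    have h: "norm h \<le> 1" "norm h = norm d / e" using d e by (simp_all add: h_def)
    let ?D = "\<lambda>z. frechet_derivative K (at z)"
    have lin: "?D z d = - (e * ?D z h)" for z
    proof -
      interpret bounded_linear "?D z" by (rule kernel_derivative_linear[OF K])
      show ?thesis unfolding h_def scaleR using e by simp
    qed
    have cont: "continuous_on UNIV (\<lambda>z. w (p + d + e *\<^sub>R z) * K z)"
      by (intro continuous_on_mult continuous_on_affine_arg[OF w] kernel_continuous[OF K])
    have "mollify K e w (p + d) = (\<integral>z. w (p + d + e *\<^sub>R (h + z)) * K (h + z) \<partial>lborel)"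
      unfolding mollify_def using lborel_integral_translate[OF cont, of h] by simp
    also have "\<dots> = (\<integral>z. w (p + e *\<^sub>R z) * K (z + h) \<partial>lborel)"
      using e by (simp add: h_def algebra_simps)
    finally have 1: "mollify K e w (p + d) = (\<integral>z. w (p + e *\<^sub>R z) * K (z + h) \<partial>lborel)" .
    have 2: "mollify (\<lambda>z. ?D z d) e w p / e = - (\<integral>z. w (p + e *\<^sub>R z) * ?D z h \<partial>lborel)"
      unfolding mollify_def lin using e by (simp add: mult.left_commute[of _ e])
    have i1: "integrable lborel (\<lambda>z. w (p + e *\<^sub>R z) * K (z + h))"
    proof (rule integrable_lborel_compact_support[of _ 2])
      show "continuous_on UNIV (\<lambda>z. w (p + e *\<^sub>R z) * K (z + h))"
        using continuous_on_affine_arg[OF kernel_continuous[OF K], of UNIV h 1]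
        by (intro continuous_on_mult continuous_on_affine_arg[OF w]) (simp add: add.commute)
      show "w (p + e *\<^sub>R z) * K (z + h) = 0" if "norm z > 2" for z
        using K that h(1) norm_diff_ineq[of z h] by (auto simp: test_kernel_def)
    qed
    note i2 = mollify_integrable[OF K w, of p e] mollify_integrable[OF kernel_frechet_derivative[OF K, of h] w, of p e]
    have "mollify K e w (p + d) - mollify K e w p + mollify (\<lambda>z. ?D z d) e w p / e
      = (\<integral>z. w (p + e *\<^sub>R z) * (K (z + h) - K z - ?D z h) \<partial>lborel)"
      unfolding 1 2 unfolding mollify_def using i1 i2 by (simp add: right_diff_distrib)
    moreover have "norm (\<integral>z. w (p + e *\<^sub>R z) * (K (z + h) - K z - ?D z h) \<partial>lborel)
      \<le> (\<integral>z. M * (C * (norm h)\<^sup>2) * indicator (cball (0::'e) 2) z \<partial>lborel)"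
    proof (rule order_trans[OF integral_norm_bound], rule integral_mono)
      show "integrable lborel (\<lambda>z. norm (w (p + e *\<^sub>R z) * (K (z + h) - K z - ?D z h)))"
        using i1 i2 by (intro integrable_norm) (simp add: right_diff_distrib)
      show "integrable lborel (\<lambda>z::'e. M * (C * (norm h)\<^sup>2) * indicator (cball 0 2) z)"
        using emeasure_lborel_cball_finite[of "0::'e" 2]
        by (intro integrable_mult_right integrable_real_indicator) (auto simp: less_top)
      show "norm (w (p + e *\<^sub>R z) * (K (z + h) - K z - ?D z h))
         \<le> M * (C * (norm h)\<^sup>2) * indicator (cball 0 2) z" for z
      proof (cases "norm z \<le> 2")
        case True
        then show ?thesis using M[OF True] C(2)[of z h] 
          by (auto simp: abs_mult indicator_def intro!: mult_mono)
      next
        case False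
        then have "norm z > 1" "norm (z + h) > 1" using h(1) norm_diff_ineq[of z h] by auto
        then show ?thesis using False K kernel_frechet_derivative[OF K, of h] by (auto simp: test_kernel_def)
      qed
    qed
    ultimately show ?thesis by (simp add: h algebra_simps)
  qed
  with that[of "C * ?m"] C(1) show ?thesis by auto
qed

lemma frechet_derivative_eqI: "(f has_derivative f') (at p) \<Longrightarrow> frechet_derivative f (at p) u = f' u"
  by (drule frechet_derivative_at) simp

lemma mollify_kernel_linear:
  fixes K :: "'e::euclidean_space \<Rightarrow> real"
  assumes K: "test_kernel K" and w: "continuous_on UNIV w"
  shows "bounded_linear (\<lambda>u. mollify (\<lambda>z. frechet_derivative K (at z) u) e w p)"
proof -
  have "linear (\<lambda>u. mollify (\<lambda>z. frechet_derivative K (at z) u) e w p)"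
  proof (rule linearI)
    fix u v :: 'e and c :: real
    have l: "linear (frechet_derivative K (at z))" for z
      using kernel_derivative_linear[OF K] by (rule bounded_linear.linear)
    show "mollify (\<lambda>z. frechet_derivative K (at z) (u + v)) e w p
       = mollify (\<lambda>z. frechet_derivative K (at z) u) e w p + mollify (\<lambda>z. frechet_derivative K (at z) v) e w p"
      unfolding mollify_def linear_add[OF l] distrib_left
      by (rule Bochner_Integration.integral_add)
         (intro mollify_integrable kernel_frechet_derivative K w)+
    show "mollify (\<lambda>z. frechet_derivative K (at z) (c *\<^sub>R v)) e w p
       = c *\<^sub>R mollify (\<lambda>z. frechet_derivative K (at z) v) e w p"
      unfolding mollify_def linear_scale[OF l] real_scaleR_def
      by (simp add: mult.left_commute[of _ c])
  qed
  then show ?thesis by (simp add: linear_conv_bounded_linear)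
qed

lemma mollify_has_derivative:
  fixes K :: "'e::euclidean_space \<Rightarrow> real"
  assumes K: "test_kernel K" and w: "continuous_on UNIV w" and e: "e > 0"
  shows "(mollify K e w has_derivative
     (\<lambda>u. - (mollify (\<lambda>z. frechet_derivative K (at z) u) e w p / e))) (at p)"
proof -
  obtain C where C: "C \<ge> 0" 
   "\<And>w e M p d. continuous_on UNIV w \<Longrightarrow> e > 0 \<Longrightarrow> norm d \<le> e \<Longrightarrow>
      (\<And>z. norm z \<le> 2 \<Longrightarrow> \<bar>w (p + e *\<^sub>R z)\<bar> \<le> M) \<Longrightarrow>
      \<bar>mollify K e w (p + d) - mollify K e w p
        + mollify (\<lambda>z. frechet_derivative K (at z) d) e w p / e\<bar> \<le> C * M * (norm d / e)\<^sup>2"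
    using mollify_taylor[OF K] by blast
  have "bounded ((\<lambda>z. w (p + e *\<^sub>R z)) ` cball 0 2)"
    by (intro compact_imp_bounded compact_continuous_image continuous_on_affine_arg[OF w]) simp
  then obtain M where M: "\<And>z. norm z \<le> 2 \<Longrightarrow> \<bar>w (p + e *\<^sub>R z)\<bar> \<le> M"
    unfolding bounded_iff by (metis image_eqI mem_cball_0 real_norm_def)
  show ?thesis
  proof (rule has_derivativeI_sandwich[OF e])
    show "bounded_linear (\<lambda>u. - (mollify (\<lambda>z. frechet_derivative K (at z) u) e w p / e))"
      by (intro bounded_linear_minus bounded_linear_compose[OF bounded_linear_divide] mollify_kernel_linear K w)
    show "norm (mollify K e w y - mollify K e w p - - (mollify (\<lambda>z. frechet_derivative K (at z) (y - p)) e w p / e))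
       / norm (y - p) \<le> C * M / e\<^sup>2 * norm (y - p)" if "y \<noteq> p" "dist y p < e" for y
    proof -
      have "\<bar>mollify K e w (p + (y - p)) - mollify K e w p
        + mollify (\<lambda>z. frechet_derivative K (at z) (y - p)) e w p / e\<bar> \<le> C * M * (norm (y - p) / e)\<^sup>2"
        by (rule C(2)[OF w e]) (use that M in \<open>auto simp: dist_norm\<close>)
      then show ?thesis using that by (simp add: divide_le_eq power2_eq_square)
    qed
    show "((\<lambda>y. C * M / e\<^sup>2 * norm (y - p)) \<longlongrightarrow> 0) (at p)"
      by (rule tendsto_eq_intros refl | simp)+
  qed
qed

lemma frechet_derivative_mollify:
  fixes K :: "'e::euclidean_space \<Rightarrow> real"
  assumes K: "test_kernel K" and w: "continuous_on UNIV w" and e: "e > 0"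
  shows "frechet_derivative (mollify K e w) (at p) u
    = - (mollify (\<lambda>z. frechet_derivative K (at z) u) e w p / e)"
  by (rule frechet_derivative_eqI[OF mollify_has_derivative[OF assms]])

lemma smooth_fun_mollify:
  fixes K :: "'e::euclidean_space \<Rightarrow> real"
  assumes "test_kernel K" and w: "continuous_on UNIV w" and e: "e > 0"
  shows "smooth_fun (mollify K e w)"
proof -
  have "times_differentiable n (mollify K e w)" for n
    using assms(1)
  proof (induction n arbitrary: K)
    case (Suc n)
    have "times_differentiable n (\<lambda>p. (- 1 / e) * mollify (\<lambda>z. frechet_derivative K (at z) u) e w p)" for u
      by (intro times_differentiable_mult times_differentiable_const Suc kernel_frechet_derivative)
    then have t: "times_differentiable n (\<lambda>p. - (mollify (\<lambda>z. frechet_derivative K (at z) u) e w p / e))" for u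
      by simp
    show ?case unfolding times_differentiable.simps
      by (rule exI[of _ "\<lambda>p u. - (mollify (\<lambda>z. frechet_derivative K (at z) u) e w p / e)"])
         (use t mollify_has_derivative[OF Suc.prems w e] in blast)
  qed simp
  then show ?thesis by (simp add: smooth_fun_def)
qed

lemma mollify_diff:
  assumes "test_kernel K" "continuous_on UNIV w" "continuous_on UNIV w'"
  shows "mollify K e (\<lambda>q. w q - w' q) p = mollify K e w p - mollify K e w' p"
  unfolding mollify_def left_diff_distrib
  by (intro Bochner_Integration.integral_diff mollify_integrable assms)

lemma integral_inner_bump: "(\<integral>z. (g \<bullet> z) * bump (z::'e::euclidean_space) \<partial>lborel) = 0"
proof -
  have "continuous_on UNIV (\<lambda>z. (g \<bullet> z) * bump z)"
    by (intro continuous_intros kernel_continuous kernel_bump)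
  from lborel_integral_reflect[OF this] show ?thesis by (simp add: bump_minus)
qed

text \<open>Unit mass reproduces constants and evenness of \<open>bump\<close> kills the first
  moment, so affine functions pass through unchanged.\<close>

lemma mollify_bump_affine:
  fixes g :: "'e::euclidean_space"
  shows "mollify bump e (\<lambda>q. c + g \<bullet> (q - p0)) p = c + g \<bullet> (p - p0)"
proof -
  have i: "integrable lborel (bump :: 'e \<Rightarrow> real)" "integrable lborel (\<lambda>z. (g \<bullet> z) * bump z)"
    using mollify_integrable[OF kernel_bump, of "\<lambda>_. 1" p e] 
      mollify_integrable[OF kernel_bump linear_continuous_on[OF bounded_linear_inner_right], of g 0 1]
    by auto
  have "mollify bump e (\<lambda>q. c + g \<bullet> (q - p0)) p
    = (\<integral>z. (c + g \<bullet> (p - p0)) * bump z + e * ((g \<bullet> z) * bump z) \<partial>lborel)"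
    unfolding mollify_def by (simp add: algebra_simps inner_add_right inner_diff_right)
  also have "\<dots> = c + g \<bullet> (p - p0)"
    using i by (simp add: integral_bump integral_inner_bump)
  finally show ?thesis .
qed

lemma continuous_affine: "continuous_on A (\<lambda>q::'e::euclidean_space. c + g \<bullet> (q - p0))"
  by (intro continuous_intros)

lemma mollify_bump_affine_deriv:
  fixes g :: "'e::euclidean_space"
  assumes e: "e > 0"
  shows "mollify (\<lambda>z. frechet_derivative bump (at z) u) e (\<lambda>q. c + g \<bullet> (q - p0)) p = - (e * (g \<bullet> u))"
proof -
  have "(mollify bump e (\<lambda>q. c + g \<bullet> (q - p0)) has_derivative (\<lambda>u. g \<bullet> u)) (at p)"
    unfolding mollify_bump_affine[abs_def] by (auto intro!: derivative_eq_intros)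
  then have "g \<bullet> u = frechet_derivative (mollify bump e (\<lambda>q. c + g \<bullet> (q - p0))) (at p) u"
    by (rule frechet_derivative_eqI[symmetric])
  also have "\<dots> = - (mollify (\<lambda>z. frechet_derivative bump (at z) u) e (\<lambda>q. c + g \<bullet> (q - p0)) p / e)"
    by (rule frechet_derivative_mollify[OF kernel_bump continuous_affine e])
  finally show ?thesis using e by simp
qed

lemma mollify_bump_affine_deriv2:
  fixes g :: "'e::euclidean_space"
  assumes e: "e > 0"
  shows "mollify (\<lambda>z. frechet_derivative (\<lambda>z. frechet_derivative bump (at z) u) (at z) u') e
    (\<lambda>q. c + g \<bullet> (q - p0)) p = 0"
proof -
  have "(mollify (\<lambda>z. frechet_derivative bump (at z) u) e (\<lambda>q. c + g \<bullet> (q - p0))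
     has_derivative (\<lambda>u. 0)) (at p)"
    unfolding mollify_bump_affine_deriv[OF e, abs_def] by simp
  then have "0 = frechet_derivative (mollify (\<lambda>z. frechet_derivative bump (at z) u) e (\<lambda>q. c + g \<bullet> (q - p0))) (at p) u'"
    by (rule frechet_derivative_eqI[symmetric])
  also have "\<dots> = - (mollify (\<lambda>z. frechet_derivative (\<lambda>z. frechet_derivative bump (at z) u) (at z) u') e
    (\<lambda>q. c + g \<bullet> (q - p0)) p / e)"
    by (rule frechet_derivative_mollify[OF kernel_frechet_derivative[OF kernel_bump] continuous_affine e])
  finally show ?thesis using e by simp
qed

section \<open>Mollification at a point of quadratic contact\<close>

lemma linear_bound_Basis:
  fixes L :: "'e::euclidean_space \<Rightarrow> real" and C :: real
  assumes "linear L" "\<And>b. b \<in> Basis \<Longrightarrow> \<bar>L b\<bar> \<le> C"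
  shows "\<bar>L u\<bar> \<le> DIM('e) * C * norm u"
proof -
  have "L u = L (\<Sum>b\<in>Basis. (u \<bullet> b) *\<^sub>R b)" by (simp add: euclidean_representation)
  also have "\<dots> = (\<Sum>b\<in>Basis. (u \<bullet> b) * L b)" by (simp add: linear_sum linear_scale assms(1))
  also have "\<bar>\<dots>\<bar> \<le> (\<Sum>b\<in>(Basis::'e set). norm u * C)"
  proof (rule order_trans[OF sum_abs], rule sum_mono)
    fix b :: 'e assume b: "b \<in> Basis"
    show "\<bar>(u \<bullet> b) * L b\<bar> \<le> norm u * C"
      unfolding abs_mult using Basis_le_norm[OF b, of u] assms(2)[OF b] by (intro mult_mono) auto
  qed
  finally show ?thesis by (simp add: mult.commute mult.left_commute)
qed

abbreviation deriv1 :: "('e::euclidean_space \<Rightarrow> real) \<Rightarrow> 'e \<Rightarrow> 'e \<Rightarrow> real" where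
  "deriv1 w u p \<equiv> frechet_derivative w (at p) u"

lemma deriv_linear: "smooth_fun w \<Longrightarrow> linear (\<lambda>u. deriv1 w u p)"
  using has_derivative_linear[OF smooth_fun_has_derivative] .

lemma deriv2_linear1:
  assumes "smooth_fun w" shows "linear (\<lambda>u. deriv1 (deriv1 w u) u' p)"
proof -
  note l = deriv_linear[OF assms]
  note d = smooth_fun_has_derivative[OF smooth_fun_frechet_derivative[OF assms]]
  have 1: "deriv1 w (u + v) = (\<lambda>p. deriv1 w u p + deriv1 w v p)" for u v
    by (rule ext) (rule linear_add[OF l])
  have 2: "deriv1 w (c *\<^sub>R v) = (\<lambda>p. c *\<^sub>R deriv1 w v p)" for c v
    by (rule ext) (rule linear_scale[OF l])
  show ?thesis
  proof (rule linearI)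
    show "deriv1 (deriv1 w (u + v)) u' p = deriv1 (deriv1 w u) u' p + deriv1 (deriv1 w v) u' p" for u v
      unfolding 1 by (rule frechet_derivative_eqI[OF has_derivative_add[OF d d]])
    show "deriv1 (deriv1 w (c *\<^sub>R v)) u' p = c *\<^sub>R deriv1 (deriv1 w v) u' p" for c v
      unfolding 2 by (rule frechet_derivative_eqI[OF has_derivative_scaleR_right[OF d]])
  qed
qed

lemma finite_max_bound:
  fixes f :: "'i \<Rightarrow> real"
  assumes "finite I" obtains C where "C \<ge> 0" "\<And>i. i \<in> I \<Longrightarrow> f i \<le> C"
  using assms by (intro that[of "\<Sum>i\<in>I. \<bar>f i\<bar>"]) 
    (auto intro: sum_nonneg order_trans[OF abs_ge_self] member_le_sum[of _ I "\<lambda>i. \<bar>f i\<bar>", simplified])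

text \<open>Named as a predicate so that one constant per direction can be selected, independently
  of \<open>w\<close>, \<open>e\<close>, \<open>p\<close> and \<open>d\<close>.\<close>

definition taylor_const :: "('e::euclidean_space \<Rightarrow> real) \<Rightarrow> real \<Rightarrow> bool" where
  "taylor_const K C \<longleftrightarrow> C \<ge> 0 \<and> (\<forall>w e M p d. continuous_on UNIV w \<longrightarrow> e > 0 \<longrightarrow> norm d \<le> e \<longrightarrow>
      (\<forall>z. norm z \<le> 2 \<longrightarrow> \<bar>w (p + e *\<^sub>R z)\<bar> \<le> M) \<longrightarrow>
      \<bar>mollify K e w (p + d) - mollify K e w p
        + mollify (\<lambda>z. frechet_derivative K (at z) d) e w p / e\<bar> \<le> C * M * (norm d / e)\<^sup>2)"

lemma ex_taylor_const:
  assumes "test_kernel K" shows "\<exists>C. taylor_const K C"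
  unfolding taylor_const_def by (rule mollify_taylor[OF assms]) blast

lemma taylor_constD:
  assumes "taylor_const K C" "continuous_on UNIV w" "e > 0" "norm d \<le> e"
    "\<And>z. norm z \<le> 2 \<Longrightarrow> \<bar>w (p + e *\<^sub>R z)\<bar> \<le> M"
  shows "\<bar>mollify K e w (p + d) - mollify K e w p
        + mollify (\<lambda>z. frechet_derivative K (at z) d) e w p / e\<bar> \<le> C * M * (norm d / e)\<^sup>2"
  using assms unfolding taylor_const_def by blast

text \<open>Subtract the affine contact function, which mollification reproduces. The remainder is
  at most \<open>4 C e^2\<close> on the ball of radius \<open>2 e\<close>, and every derivative of
  the mollification costs a factor \<open>1 / e\<close>. This gives the orders \<open>e^2\<close>,
  \<open>e\<close> and \<open>1\<close> for value, gradient and second derivatives, and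
  \<open>1 / e\<close> for the quadratic error of the first derivatives.\<close>

proposition mollify_second_order_contact:
  obtains A where "A \<ge> 0"
    "\<And>(w::'e::euclidean_space \<Rightarrow> real) p g C e. continuous_on UNIV w \<Longrightarrow> e > 0 \<Longrightarrow> C \<ge> 0 \<Longrightarrow>
      (\<And>q. norm (q - p) \<le> 2 * e \<Longrightarrow> \<bar>w q - w p - g \<bullet> (q - p)\<bar> \<le> C * (norm (q - p))\<^sup>2) \<Longrightarrow>
      \<bar>mollify bump e w p - w p\<bar> \<le> A * C * e\<^sup>2 \<and>
      (\<forall>u. \<bar>deriv1 (mollify bump e w) u p - g \<bullet> u\<bar> \<le> A * C * e * norm u) \<and>
      (\<forall>u u'. \<bar>deriv1 (deriv1 (mollify bump e w) u) u' p\<bar> \<le> A * C * norm u * norm u') \<and>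
      (\<forall>u d. norm d \<le> e \<longrightarrow> 
        \<bar>deriv1 (mollify bump e w) u (p + d) - deriv1 (mollify bump e w) u p
           - deriv1 (deriv1 (mollify bump e w) u) d p\<bar> \<le> A * C * norm u * (norm d)\<^sup>2 / e)"
proof -
  let ?K = "bump :: 'e \<Rightarrow> real"
  let ?K1 = "\<lambda>u z. frechet_derivative ?K (at z) u"
  let ?K2 = "\<lambda>u u' z. frechet_derivative (?K1 u) (at z) u'"
  let ?n = "\<lambda>K. \<integral>z. \<bar>K z\<bar> \<partial>(lborel::'e measure)"
  note k = kernel_bump and k1 = kernel_frechet_derivative[OF kernel_bump]
    and k2 = kernel_frechet_derivative[OF kernel_frechet_derivative[OF kernel_bump]]
  obtain CT where CT: "\<And>u. taylor_const (?K1 u) (CT u)"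
    using ex_taylor_const[OF k1] by metis
  obtain A1 where A1: "A1 \<ge> 0" "\<And>b. b \<in> Basis \<Longrightarrow> ?n (?K1 b) \<le> A1"
    using finite_max_bound[of "Basis::'e set" "\<lambda>b. ?n (?K1 b)"] by auto
  obtain A2 where A2: "A2 \<ge> 0" "\<And>b b'. b \<in> Basis \<Longrightarrow> b' \<in> Basis \<Longrightarrow> ?n (?K2 b b') \<le> A2"
  proof -
    obtain C where "C \<ge> 0" and C: "\<And>i. i \<in> (Basis::'e set) \<times> Basis \<Longrightarrow> ?n (?K2 (fst i) (snd i)) \<le> C"
      using finite_max_bound[of "(Basis::'e set) \<times> Basis" "\<lambda>i. ?n (?K2 (fst i) (snd i))"] by auto
    then show ?thesis using that[of C] C[of "(_, _)"] by simp
  qed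
  obtain A3 where A3: "A3 \<ge> 0" "\<And>b. b \<in> Basis \<Longrightarrow> CT b \<le> A3"
    using finite_max_bound[of "Basis::'e set" CT] by auto
  have n0: "?n ?K \<ge> 0" by simp
  define D where "D = real DIM('e)"
  have D: "D \<ge> 1" unfolding D_def using DIM_positive[where 'a='e] by linarith
  \<comment> \<open>The 4 is \<open>2^2\<close> from the radius \<open>2 e\<close>; each expansion
    of a direction in the basis costs one factor \<open>D\<close>, and the second derivative has two
    directions.\<close>
  define A where "A = 4 * D * D * (?n ?K + A1 + A2 + A3)"
  have D2: "D * x \<le> D * D * y" if "x \<le> y" "0 \<le> y" for x y
  proof -
    have "D * x \<le> D * y" using that D by (intro mult_left_mono) auto
    also have "\<dots> = 1 * (D * y)" by simp
    also have "\<dots> \<le> D * (D * y)" using that D by (intro mult_right_mono) auto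
    finally show ?thesis by simp
  qed
  have A_ge: "?n ?K * 4 \<le> A" "D * (A1 * 4) \<le> A" "D * (D * (A2 * 4)) \<le> A" "D * (A3 * 4) \<le> A"
  proof -
    let ?s = "?n ?K + A1 + A2 + A3"
    have s: "?s \<ge> 0" "?n ?K \<le> ?s" "A1 \<le> ?s" "A2 \<le> ?s" "A3 \<le> ?s" using n0 A1(1) A2(1) A3(1) by linarith+
    have Aeq: "A = 4 * (D * D * ?s)" by (simp add: A_def)
    show "D * (A1 * 4) \<le> A" "D * (A3 * 4) \<le> A"
      using D2[of A1 ?s] D2[of A3 ?s] s(1,3,5) unfolding Aeq by linarith+
    have "D * (D * A2) \<le> D * (D * ?s)" using s D by (intro mult_left_mono) auto
    then have "4 * (D * (D * A2)) \<le> 4 * (D * (D * ?s))" by simp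
    then show "D * (D * (A2 * 4)) \<le> A" unfolding Aeq by (simp only: mult_ac)
    have "?n ?K \<le> D * ?n ?K" using D n0 mult_right_mono[of 1 D "?n ?K"] by simp
    then show "?n ?K * 4 \<le> A" using D2[of "?n ?K" ?s] s by (simp add: A_def)
  qed
  show ?thesis
  proof (rule that)
    show "A \<ge> 0" unfolding A_def using D n0 A1 A2 A3 by auto
    fix w :: "'e \<Rightarrow> real" and p g :: 'e and C e :: real
    assume w: "continuous_on UNIV w" and e: "e > 0" and C: "C \<ge> 0"
      and contact: "\<And>q. norm (q - p) \<le> 2 * e \<Longrightarrow> \<bar>w q - w p - g \<bullet> (q - p)\<bar> \<le> C * (norm (q - p))\<^sup>2"
    define l where "l = (\<lambda>q. w p + g \<bullet> (q - p))"
    define r where "r = (\<lambda>q. w q - l q)"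
    have lc: "continuous_on UNIV l" unfolding l_def by (rule continuous_affine)
    have rc: "continuous_on UNIV r" unfolding r_def by (intro continuous_intros w lc)
    have split: "mollify K e w q = mollify K e r q + mollify K e l q" if "test_kernel K" for K q
      unfolding r_def mollify_diff[OF that w lc] by simp
    have M: "\<bar>r (p + e *\<^sub>R z)\<bar> \<le> 4 * C * e\<^sup>2" if z: "norm z \<le> 2" for z
    proof -
      have "e * norm z \<le> 2 * e" using z e by simp
      then have "\<bar>r (p + e *\<^sub>R z)\<bar> \<le> C * (e * norm z)\<^sup>2"
        using contact[of "p + e *\<^sub>R z"] e by (simp add: r_def l_def algebra_simps)
      also have "\<dots> \<le> C * (2 * e)\<^sup>2" 
        using z e C by (intro mult_left_mono power_mono) auto
      finally show ?thesis by (simp add: power2_eq_square)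
    qed
    have b: "\<bar>mollify K e r p\<bar> \<le> 4 * C * e\<^sup>2 * ?n K" if "test_kernel K" for K
      by (rule mollify_bound[OF that rc]) (use M in auto)
    let ?f = "mollify bump e w"
    have sf: "smooth_fun ?f" by (rule smooth_fun_mollify[OF k w e])
    have d1: "deriv1 ?f u = (\<lambda>q. - (mollify (?K1 u) e w q / e))" for u
      by (rule ext) (rule frechet_derivative_mollify[OF k w e])
    have d1p: "deriv1 ?f u q = - (mollify (?K1 u) e w q / e)" for u q
      by (rule frechet_derivative_mollify[OF k w e])
    have l1: "mollify (?K1 u) e l q = - (e * (g \<bullet> u))" for u q
      unfolding l_def by (rule mollify_bump_affine_deriv[OF e])
    have l2: "mollify (?K2 u u') e l q = 0" for u u' q
      unfolding l_def by (rule mollify_bump_affine_deriv2[OF e])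
    have d2: "deriv1 (deriv1 ?f u) u' q = mollify (?K2 u u') e w q / e\<^sup>2" for u u' q
    proof -
      have "((\<lambda>q. - (mollify (?K1 u) e w q / e)) has_derivative
         (\<lambda>u'. - ((- (mollify (?K2 u u') e w q / e)) / e))) (at q)"
        by (intro has_derivative_minus bounded_linear.has_derivative[OF bounded_linear_divide]
              mollify_has_derivative[OF k1 w e])
      from frechet_derivative_eqI[OF this, of u'] show ?thesis unfolding d1
        by (simp add: power2_eq_square)
    qed
    have 1: "\<bar>?f p - w p\<bar> \<le> A * C * e\<^sup>2"
    proof -
      have "?f p - w p = mollify bump e r p"
        using split[OF k, of p] mollify_bump_affine[of e "w p" g p p] by (simp add: l_def)
      also have "\<bar>\<dots>\<bar> \<le> (?n ?K * 4) * (C * e\<^sup>2)" using b[OF k] by (simp add: algebra_simps)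
      also have "\<dots> \<le> A * (C * e\<^sup>2)" using C by (intro mult_right_mono A_ge) auto
      finally show ?thesis by simp
    qed
    have 2: "\<bar>deriv1 ?f u p - g \<bullet> u\<bar> \<le> A * C * e * norm u" for u
    proof -
      have "linear (\<lambda>u. deriv1 ?f u p - g \<bullet> u)"
        by (intro linear_compose_sub deriv_linear[OF sf] bounded_linear.linear bounded_linear_inner_right)
      moreover have "\<bar>deriv1 ?f b p - g \<bullet> b\<bar> \<le> 4 * C * e * A1" if bB: "b \<in> Basis" for b
      proof -
        have "deriv1 ?f b p - g \<bullet> b = - (mollify (?K1 b) e r p / e)"
          using e unfolding d1p split[OF k1] l1 by (simp add: field_simps)
        then have "\<bar>deriv1 ?f b p - g \<bullet> b\<bar> \<le> 4 * C * e\<^sup>2 * ?n (?K1 b) / e"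
          using b[OF k1, of b] e by (simp add: divide_right_mono)
        also have "\<dots> = 4 * C * e * ?n (?K1 b)" using e by (simp add: power2_eq_square)
        also have "\<dots> \<le> 4 * C * e * A1" using C e A1(2)[OF bB] by (intro mult_left_mono) auto
        finally show ?thesis .
      qed
      ultimately have "\<bar>deriv1 ?f u p - g \<bullet> u\<bar> \<le> D * (4 * C * e * A1) * norm u"
        unfolding D_def by (rule linear_bound_Basis)
      also have "\<dots> = (D * (A1 * 4)) * (C * e * norm u)" by simp
      also have "\<dots> \<le> A * (C * e * norm u)" using C e by (intro mult_right_mono A_ge) auto
      finally show ?thesis by simp
    qed
    have 3: "\<bar>deriv1 (deriv1 ?f u) u' p\<bar> \<le> A * C * norm u * norm u'" for u u'
    proof -
      have bb: "\<bar>deriv1 (deriv1 ?f b) b' p\<bar> \<le> 4 * C * A2" if "b \<in> Basis" "b' \<in> Basis" for b b'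
      proof -
        have "\<bar>deriv1 (deriv1 ?f b) b' p\<bar> \<le> 4 * C * e\<^sup>2 * ?n (?K2 b b') / e\<^sup>2"
          unfolding d2 split[OF k2] l2 using b[OF k2, of b b'] e by (simp add: pos_divide_le_eq mult_ac)
        also have "\<dots> = 4 * C * ?n (?K2 b b')" using e by simp
        also have "\<dots> \<le> 4 * C * A2" using C A2(2)[OF that] by (intro mult_left_mono) auto
        finally show ?thesis .
      qed
      have "\<bar>deriv1 (deriv1 ?f b) u' p\<bar> \<le> D * (4 * C * A2) * norm u'" if "b \<in> Basis" for b
        unfolding D_def by (rule linear_bound_Basis[OF deriv_linear[OF smooth_fun_frechet_derivative[OF sf]] bb[OF that]])
      then have "\<bar>deriv1 (deriv1 ?f u) u' p\<bar> \<le> D * (D * (4 * C * A2) * norm u') * norm u"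
        unfolding D_def by (rule linear_bound_Basis[OF deriv2_linear1[OF sf]])
      also have "\<dots> = (D * (D * (A2 * 4))) * (C * norm u * norm u')" by simp
      also have "\<dots> \<le> A * (C * norm u * norm u')" using C by (intro mult_right_mono A_ge) auto
      finally show ?thesis by simp
    qed
    have 4: "\<bar>deriv1 ?f u (p + d) - deriv1 ?f u p - deriv1 (deriv1 ?f u) d p\<bar> 
       \<le> A * C * norm u * (norm d)\<^sup>2 / e" if d: "norm d \<le> e" for u d
    proof -
      let ?L = "\<lambda>u. deriv1 ?f u (p + d) - deriv1 ?f u p - deriv1 (deriv1 ?f u) d p"
      have "linear ?L" by (intro linear_compose_sub deriv_linear[OF sf] deriv2_linear1[OF sf])
      moreover have "\<bar>?L b\<bar> \<le> 4 * C * A3 * (norm d)\<^sup>2 / e" if bB: "b \<in> Basis" for b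
      proof -
        have "?L b = - ((mollify (?K1 b) e r (p + d) - mollify (?K1 b) e r p + mollify (?K2 b d) e r p / e) / e)"
          using e unfolding d2 unfolding d1p split[OF k1] split[OF k2] l1 l2 
          by (simp add: field_simps power2_eq_square)
        also have "\<bar>\<dots>\<bar> \<le> CT b * (4 * C * e\<^sup>2) * (norm d / e)\<^sup>2 / e"
          using taylor_constD[OF CT rc e d M, of b] e by (simp add: divide_right_mono)
        also have "\<dots> = (4 * C * (norm d)\<^sup>2 / e) * CT b" using e by (simp add: field_simps power2_eq_square)
        also have "\<dots> \<le> (4 * C * (norm d)\<^sup>2 / e) * A3" using C e A3(2)[OF bB] by (intro mult_left_mono) auto
        finally show ?thesis by (simp add: algebra_simps)
      qed
      ultimately have "\<bar>?L u\<bar> \<le> D * (4 * C * A3 * (norm d)\<^sup>2 / e) * norm u"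
        unfolding D_def by (rule linear_bound_Basis)
      also have "\<dots> = (D * (A3 * 4)) * (C * norm u * (norm d)\<^sup>2 / e)" by (simp add: field_simps)
      also have "\<dots> \<le> A * (C * norm u * (norm d)\<^sup>2 / e)" using C e by (intro mult_right_mono A_ge) auto
      finally show ?thesis by (simp add: algebra_simps)
    qed
    show "\<bar>?f p - w p\<bar> \<le> A * C * e\<^sup>2 \<and>
      (\<forall>u. \<bar>deriv1 ?f u p - g \<bullet> u\<bar> \<le> A * C * e * norm u) \<and>
      (\<forall>u u'. \<bar>deriv1 (deriv1 ?f u) u' p\<bar> \<le> A * C * norm u * norm u') \<and>
      (\<forall>u d. norm d \<le> e \<longrightarrow> \<bar>deriv1 ?f u (p + d) - deriv1 ?f u p - deriv1 (deriv1 ?f u) d p\<bar> 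
         \<le> A * C * norm u * (norm d)\<^sup>2 / e)"
      using 1 2 3 4 by blast
  qed
qed

section \<open>Value functions of semiconcave Lagrangians\<close>

text \<open>Polygonal curves inside \<open>D\<close>, starting anywhere at time 0, with speed at
  most \<open>R\<close>; the last argument is the accumulated cost. A cost per straight step
  replaces the action integral, so that only finitely many velocities occur on a curve.\<close>

inductive chain :: "'a::real_normed_vector set \<Rightarrow> real \<Rightarrow> ('a \<Rightarrow> 'a \<Rightarrow> real \<Rightarrow> real \<Rightarrow> real) \<Rightarrow>
    'a \<Rightarrow> real \<Rightarrow> real \<Rightarrow> bool" for D R cst where
  chain_start: "x \<in> D \<Longrightarrow> chain D R cst x 0 0"
| chain_step: "chain D R cst x t c \<Longrightarrow> norm v \<le> R \<Longrightarrow> 0 \<le> h \<Longrightarrow> closed_segment x (x + h *\<^sub>R v) \<subseteq> D \<Longrightarrow>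
    chain D R cst (x + h *\<^sub>R v) (t + h) (c + cst x v t h)"

text \<open>The inequality \<open>dw (v, 1) \<le> L\<close> integrated along straight steps, a form
  that makes sense for \<open>w\<close> without derivatives.\<close>

definition subsolution :: "'a::real_normed_vector set \<Rightarrow> real \<Rightarrow> ('a \<Rightarrow> 'a \<Rightarrow> real \<Rightarrow> real \<Rightarrow> real) \<Rightarrow>
    real set \<Rightarrow> ('a \<Rightarrow> real \<Rightarrow> real) \<Rightarrow> bool" where
  "subsolution D R cst T w \<longleftrightarrow> (\<forall>x v t h. norm v \<le> R \<longrightarrow> 0 \<le> h \<longrightarrow> t \<in> T \<longrightarrow> t + h \<in> T \<longrightarrow>
     closed_segment x (x + h *\<^sub>R v) \<subseteq> D \<longrightarrow> w (x + h *\<^sub>R v) (t + h) \<le> w x t + cst x v t h)"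

definition min_cost :: "'a::real_normed_vector set \<Rightarrow> real \<Rightarrow> ('a \<Rightarrow> 'a \<Rightarrow> real \<Rightarrow> real \<Rightarrow> real) \<Rightarrow>
    'a \<Rightarrow> real \<Rightarrow> real" where
  "min_cost D R cst x t = Inf {c. chain D R cst x t c}"

lemma chain_time_nonneg: "chain D R cst x t c \<Longrightarrow> 0 \<le> t"
  by (induction rule: chain.induct) auto

lemma chain_in: "chain D R cst x t c \<Longrightarrow> x \<in> D"
  by (induction rule: chain.induct) auto

lemma subsolution_le_chain:
  assumes "chain D R cst x t c" "subsolution D R cst T w" "\<And>s. s \<in> T \<Longrightarrow> {0..s} \<subseteq> T"
    "\<And>x. x \<in> D \<Longrightarrow> w x 0 \<le> 0" "t \<in> T"
  shows "w x t \<le> c"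
  using assms(1,5)
proof (induction rule: chain.induct)
  case (chain_start x)
  then show ?case using assms(4) by simp
next
  case (chain_step x t c v h)
  have t: "t \<in> T" using assms(3)[OF chain_step.prems] chain_time_nonneg[OF chain_step.hyps(1)] chain_step.hyps by auto
  then have "w (x + h *\<^sub>R v) (t + h) \<le> w x t + cst x v t h"
    using assms(2) chain_step by (auto simp: subsolution_def)
  with chain_step.IH[OF t] show ?case by simp
qed

text \<open>Regularity is prescribed in \<open>(x, t)\<close> at a fixed velocity because every
  comparison below translates a step without changing its velocity. Semiconcavity is a one-sided
  bound on second differences, a kind of bound that passes to infima.\<close>

locale lagrangian =
  fixes L :: "'a::euclidean_space \<Rightarrow> 'a \<Rightarrow> real \<Rightarrow> real" and R K C B :: real
  assumes R: "R \<ge> 0" and K: "K \<ge> 0" and C: "C \<ge> 0" and B: "B \<ge> 0"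
    and lip: "\<And>x y v s t. norm v \<le> R \<Longrightarrow> \<bar>L x v t - L y v s\<bar> \<le> K * (norm (x - y) + \<bar>t - s\<bar>)"
    and semiconcave: "\<And>x d v t h. norm v \<le> R \<Longrightarrow>
       L (x + d) v (t + h) + L (x - d) v (t - h) \<le> 2 * L x v t + C * ((norm d)\<^sup>2 + h\<^sup>2)"
    and lower: "\<And>x v t. norm v \<le> R \<Longrightarrow> - B \<le> L x v t"
begin

definition K1 where "K1 = K * (R + 1)"

text \<open>The quadratic term ensures that subdividing a step does not increase its cost.\<close>

definition cost :: "'a \<Rightarrow> 'a \<Rightarrow> real \<Rightarrow> real \<Rightarrow> real" where
  "cost x v t h = h * L (x + (h / 2) *\<^sub>R v) v (t + h / 2) + K1 * h\<^sup>2"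

abbreviation V where "V \<equiv> min_cost UNIV R cost"

lemma K1: "K1 \<ge> 0" unfolding K1_def using K R by simp

lemma lip_le: "norm v \<le> R \<Longrightarrow> L x v t \<le> L y v s + K * (norm (x - y) + \<bar>t - s\<bar>)"
  using lip[of v x t y s] by linarith

lemma lip_along: 
  assumes "norm v \<le> R" 
  shows "L (x + a *\<^sub>R v) v (t + a) \<le> L (x + b *\<^sub>R v) v (t + b) + K1 * \<bar>a - b\<bar>"
proof -
  have "norm (x + a *\<^sub>R v - (x + b *\<^sub>R v)) = \<bar>a - b\<bar> * norm v"
    by (simp add: scaleR_left_diff_distrib[symmetric])
  also have "\<dots> \<le> \<bar>a - b\<bar> * R" using assms by (intro mult_left_mono) auto
  finally have "norm (x + a *\<^sub>R v - (x + b *\<^sub>R v)) + \<bar>(t + a) - (t + b)\<bar> \<le> (R + 1) * \<bar>a - b\<bar>"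
    by (simp add: algebra_simps)
  then have "K * (norm (x + a *\<^sub>R v - (x + b *\<^sub>R v)) + \<bar>(t + a) - (t + b)\<bar>) \<le> K * ((R + 1) * \<bar>a - b\<bar>)"
    using K by (intro mult_left_mono)
  with lip_le[OF assms, of "x + a *\<^sub>R v" "t + a" "x + b *\<^sub>R v" "t + b"] show ?thesis
    by (simp add: K1_def)
qed

text \<open>Evaluating \<open>L\<close> at the midpoints of the two parts instead of the common
  midpoint costs at most \<open>K1 h k\<close>, while \<open>(h + k)^2\<close> exceeds
  \<open>h^2 + k^2\<close> by \<open>2 h k\<close>.\<close>

lemma cost_split:
  assumes "norm v \<le> R" "0 \<le> h" "0 \<le> k"
  shows "cost x v t h + cost (x + h *\<^sub>R v) v (t + h) k \<le> cost x v t (h + k)"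
proof -
  let ?m = "L (x + ((h + k) / 2) *\<^sub>R v) v (t + (h + k) / 2)"
  have 1: "L (x + (h / 2) *\<^sub>R v) v (t + h / 2) \<le> ?m + K1 * (k / 2)"
    using lip_along[OF assms(1), of x "h/2" t "(h + k)/2"] assms by (simp add: field_simps abs_if split: if_splits)
  have 2: "L (x + (h + k / 2) *\<^sub>R v) v (t + (h + k / 2)) \<le> ?m + K1 * (h / 2)"
    using lip_along[OF assms(1), of x "h + k/2" t "(h + k)/2"] assms by (simp add: field_simps abs_if split: if_splits)
  have e: "x + h *\<^sub>R v + (k / 2) *\<^sub>R v = x + (h + k / 2) *\<^sub>R v" "t + h + k / 2 = t + (h + k / 2)"
    by (simp_all add: scaleR_left_distrib)
  have "h * L (x + (h / 2) *\<^sub>R v) v (t + h / 2) + k * L (x + (h + k / 2) *\<^sub>R v) v (t + (h + k / 2))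
     \<le> h * (?m + K1 * (k / 2)) + k * (?m + K1 * (h / 2))"
    using 1 2 assms by (intro add_mono mult_left_mono) auto
  also have "\<dots> = (h + k) * ?m + K1 * (h * k)" by (simp add: field_simps)
  also have "\<dots> \<le> (h + k) * ?m + K1 * (2 * (h * k))"
    using K1 assms by (intro add_left_mono mult_left_mono) auto
  finally show ?thesis unfolding cost_def e by (simp add: power2_eq_square algebra_simps)
qed

lemma cost_lower: "norm v \<le> R \<Longrightarrow> 0 \<le> h \<Longrightarrow> - (B * h) \<le> cost x v t h"
proof -
  assume v: "norm v \<le> R" and h: "0 \<le> h"
  have "h * (- B) \<le> h * L (x + (h / 2) *\<^sub>R v) v (t + h / 2)" by (intro mult_left_mono lower v h)
  moreover have "0 \<le> K1 * h\<^sup>2" using K1 by simp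
  ultimately show ?thesis unfolding cost_def by (simp add: mult.commute)
qed

lemma chain_lower: "chain D R cost x t c \<Longrightarrow> - (B * t) \<le> c"
proof (induction rule: chain.induct)
  case (chain_step x t c v h)
  then show ?case using cost_lower[of v h x t] by (simp add: algebra_simps)
qed simp

lemma chain_single:
  assumes "norm v \<le> R" "0 \<le> t" shows "chain UNIV R cost x t (cost (x - t *\<^sub>R v) v 0 t)"
  using chain_step[OF chain_start[of "x - t *\<^sub>R v" UNIV R cost], of v t] assms by simp

lemma V_le: "chain UNIV R cost x t c \<Longrightarrow> V x t \<le> c"
  unfolding min_cost_def by (rule cInf_lower) (auto intro: bdd_belowI[of _ "- (B * t)"] chain_lower)

lemma V_ge: "0 \<le> t \<Longrightarrow> (\<And>c. chain UNIV R cost x t c \<Longrightarrow> z \<le> c) \<Longrightarrow> z \<le> V x t"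
proof -
  assume t: "0 \<le> t" and z: "\<And>c. chain UNIV R cost x t c \<Longrightarrow> z \<le> c"
  have "\<exists>c. chain UNIV R cost x t c" using chain_single[of 0 t x] R t norm_zero by metis
  then show ?thesis unfolding min_cost_def by (intro cInf_greatest) (use z in blast)+
qed

lemma V_single: "norm v \<le> R \<Longrightarrow> 0 \<le> t \<Longrightarrow> V x t \<le> cost (x - t *\<^sub>R v) v 0 t"
  by (intro V_le chain_single)

lemma V_step:
  assumes "norm v \<le> R" "0 \<le> h" "0 \<le> t"
  shows "V (x + h *\<^sub>R v) (t + h) \<le> V x t + cost x v t h"
proof -
  have "V (x + h *\<^sub>R v) (t + h) - cost x v t h \<le> c" if "chain UNIV R cost x t c" for c
    using V_le[OF chain_step[OF that assms(1,2)]] by simp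
  then show ?thesis using V_ge[OF assms(3), of x "V (x + h *\<^sub>R v) (t + h) - cost x v t h"] by simp
qed

text \<open>Comparisons of \<open>V\<close> with its own translates rest on this, or on its variant
  \<open>V_compare\<close> started at a later time: the translate, suitably corrected, is shown to
  be a subsolution.\<close>

lemma V_maximal:
  assumes "subsolution UNIV R cost T w" "\<And>s. s \<in> T \<Longrightarrow> {0..s} \<subseteq> T" "T \<subseteq> {0..}"
    "\<And>x. w x 0 \<le> 0" "t \<in> T"
  shows "w x t \<le> V x t"
proof (rule V_ge)
  show "0 \<le> t" using assms(3,5) by auto
  show "w x t \<le> c" if "chain UNIV R cost x t c" for c
    by (rule subsolution_le_chain[OF that assms(1) assms(2) assms(4) assms(5)])
qed

lemma V_lower: "0 \<le> t \<Longrightarrow> - (B * t) \<le> V x t"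
  by (intro V_ge chain_lower)

lemma V_0: "V x 0 = 0"
  using V_le[OF chain_start[of x UNIV]] V_lower[of 0 x] by simp

text \<open>Glue \<open>V\<close> before time \<open>a\<close> to \<open>w - c\<close> after it. The
  glued function is a subsolution from time 0: a step across \<open>a\<close> is cut there, and by
  \<open>cost_split\<close> cutting does not increase the cost.\<close>

lemma V_compare:
  assumes w: "subsolution UNIV R cost {a..} w" and a: "0 \<le> a"
    and init: "\<And>x. w x a \<le> V x a + c" and t: "a \<le> t"
  shows "w x t \<le> V x t + c"
proof -
  define W where "W x t = (if t \<ge> a then w x t - c else V x t)" for x t
  have "W (x + h *\<^sub>R v) (t + h) \<le> W x t + cost x v t h" if v: "norm v \<le> R" and h: "0 \<le> h" and t: "0 \<le> t" for x v t h
  proof -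
    consider "a \<le> t" | "t < a" "t + h < a" | "t < a" "a \<le> t + h" by linarith
    then show ?thesis
    proof cases
      case 1
      then show ?thesis using w v h by (auto simp: W_def subsolution_def)
    next
      case 2
      then show ?thesis using V_step[OF v h t] by (auto simp: W_def)
    next
      case 3
      define h1 h2 where "h1 = a - t" and "h2 = t + h - a"
      have h12: "0 \<le> h1" "0 \<le> h2" "h1 + h2 = h" "t + h1 = a" "a + h2 = t + h"
        using 3 by (auto simp: h1_def h2_def)
      have "w ((x + h1 *\<^sub>R v) + h2 *\<^sub>R v) (a + h2) \<le> w (x + h1 *\<^sub>R v) a + cost (x + h1 *\<^sub>R v) v a h2"
        by (rule w[unfolded subsolution_def, rule_format]) (use v h12 in auto)
      moreover have "(x + h1 *\<^sub>R v) + h2 *\<^sub>R v = x + h *\<^sub>R v"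
        using h12(3) by (metis add.assoc scaleR_left_distrib)
      moreover have "V (x + h1 *\<^sub>R v) (t + h1) \<le> V x t + cost x v t h1" by (rule V_step[OF v h12(1) t])
      moreover have "cost x v t h1 + cost (x + h1 *\<^sub>R v) v (t + h1) h2 \<le> cost x v t (h1 + h2)"
        by (rule cost_split[OF v h12(1,2)])
      ultimately show ?thesis using init[of "x + h1 *\<^sub>R v"] 3 h12 by (simp add: W_def)
    qed
  qed
  then have "subsolution UNIV R cost {0..} W" by (auto simp: subsolution_def)
  moreover have "W x 0 \<le> 0" for x
    using init[of x] a V_0[of x] by (auto simp: W_def)
  ultimately have "W x t \<le> V x t" using t a by (intro V_maximal[of "{0..}"]) auto
  then show ?thesis using t by (simp add: W_def)
qed

section \<open>Lipschitz bounds for the value function\<close>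

lemma cost_shift:
  assumes "norm v \<le> R" "0 \<le> h"
  shows "cost (x + d) v (t + s) h \<le> cost x v t h + h * (K * (norm d + \<bar>s\<bar>))"
proof -
  have "L (x + (h / 2) *\<^sub>R v + d) v (t + h / 2 + s) \<le> L (x + (h / 2) *\<^sub>R v) v (t + h / 2) + K * (norm d + \<bar>s\<bar>)"
    using lip_le[OF assms(1), of "x + (h / 2) *\<^sub>R v + d" "t + h / 2 + s" "x + (h / 2) *\<^sub>R v" "t + h / 2"] by simp
  from mult_left_mono[OF this assms(2)] show ?thesis by (simp add: cost_def algebra_simps)
qed

text \<open>A space translation by \<open>d\<close> changes the rate of cost by at most
  \<open>K * norm d\<close>, so the translated function minus that rate times \<open>t\<close> is a
  subsolution with initial value 0.\<close>

lemma V_lip_x: 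
  assumes "0 \<le> t" shows "V (x + d) t \<le> V x t + K * norm d * t"
proof -
  have "subsolution UNIV R cost {0..} (\<lambda>x t. V (x + d) t - K * norm d * t)"
    unfolding subsolution_def
  proof (intro allI impI)
    fix x v :: 'a and t h :: real assume v: "norm v \<le> R" and h: "0 \<le> h" and t: "t \<in> {0..}"
    have "V (x + d + h *\<^sub>R v) (t + h) \<le> V (x + d) t + cost (x + d) v t h" using V_step[OF v h] t by auto
    also have "cost (x + d) v t h \<le> cost x v t h + h * (K * norm d)" using cost_shift[OF v h, of x d t 0] by simp
    finally show "V (x + h *\<^sub>R v + d) (t + h) - K * norm d * (t + h) \<le> V (x + d) t - K * norm d * t + cost x v t h"
      by (simp add: algebra_simps)
  qed
  from V_maximal[OF this, of t x] show ?thesis using assms by (auto simp: V_0)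
qed

text \<open>A time translation by \<open>h\<close> is corrected at the rate \<open>K * h\<close>. It
  can be compared only from time \<open>h\<close> on, where \<open>V\<close> may have dropped to
  \<open>- B * h\<close>; hence the two terms of the constant.\<close>

lemma V_lip_t_lower:
  assumes "0 \<le> h" "h \<le> t" shows "V x (t - h) \<le> V x t + (K * t + B) * h"
proof -
  have "subsolution UNIV R cost {h..} (\<lambda>x t. V x (t - h) - K * h * t)"
    unfolding subsolution_def
  proof (intro allI impI)
    fix x v :: 'a and t k :: real assume v: "norm v \<le> R" and k: "0 \<le> k" and t: "t \<in> {h..}"
    have "V (x + k *\<^sub>R v) ((t - h) + k) \<le> V x (t - h) + cost x v (t - h) k" using V_step[OF v k] t by auto
    also have "cost x v (t - h) k \<le> cost x v t k + k * (K * h)"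
      using cost_shift[OF v k, of x 0 t "- h"] assms by simp
    finally show "V (x + k *\<^sub>R v) (t + k - h) - K * h * (t + k) \<le> V x (t - h) - K * h * t + cost x v t k"
      by (simp add: algebra_simps)
  qed
  moreover have "V x (h - h) - K * h * h \<le> V x h + B * h" for x
  proof -
    have "0 \<le> K * h * h" using K assms by simp
    then show ?thesis using V_lower[of h x] assms by (simp add: V_0)
  qed
  ultimately have "V x (t - h) - K * h * t \<le> V x t + B * h"
    by (rule V_compare[OF _ assms(1) _ assms(2), of "\<lambda>x t. V x (t - h) - K * h * t"])
  then show ?thesis by (simp add: algebra_simps)
qed

lemma V_lip_t_upper:
  assumes "0 \<le> h" "0 \<le> t" shows "V x (t + h) \<le> V x t + h * (L 0 0 0 + K * (norm x + t + h) + K1 * h)"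
proof -
  have "V x (t + h) \<le> V x t + cost x 0 t h" using V_step[of 0 h t x] R assms by simp
  also have "cost x 0 t h = h * (L x 0 (t + h / 2) + K1 * h)" 
    unfolding cost_def power2_eq_square by (simp add: distrib_left)
  also have "\<dots> \<le> h * (L 0 0 0 + K * (norm x + t + h) + K1 * h)"
  proof -
    have "L x 0 (t + h / 2) \<le> L 0 0 0 + K * (norm x + (t + h / 2))"
      using lip_le[of 0 x "t + h / 2" 0 0] R assms by simp
    also have "\<dots> \<le> L 0 0 0 + K * (norm x + t + h)" 
      using K assms by (intro add_left_mono mult_left_mono) auto
    finally show ?thesis using assms by (intro mult_left_mono add_right_mono) auto
  qed
  finally show ?thesis by simp
qed

lemma V_lipschitz:
  obtains M where "M \<ge> 0"
    "\<And>x y s t. norm x \<le> r \<Longrightarrow> norm y \<le> r \<Longrightarrow> 0 \<le> s \<Longrightarrow> s \<le> T \<Longrightarrow> 0 \<le> t \<Longrightarrow> t \<le> T \<Longrightarrow>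
       \<bar>V x t - V y s\<bar> \<le> M * (norm (x - y) + \<bar>t - s\<bar>)"
proof -
  define M where "M = max 0 (max (K * T) (max (K * T + B) (L 0 0 0 + K * (r + T) + K1 * T)))"
  have le: "V x t - V y s \<le> M * (norm (x - y) + \<bar>t - s\<bar>)"
    if "norm x \<le> r" "norm y \<le> r" "0 \<le> s" "s \<le> T" "0 \<le> t" "t \<le> T" for x y s t
  proof -
    have "V x t \<le> V y t + K * norm (x - y) * t" using V_lip_x[of t y "x - y"] that by simp
    also have "K * norm (x - y) * t \<le> M * norm (x - y)"
    proof -
      have "K * t \<le> K * T" using that K by (intro mult_left_mono) auto
      also have "\<dots> \<le> M" by (simp add: M_def)
      finally have "(K * t) * norm (x - y) \<le> M * norm (x - y)" by (intro mult_right_mono) auto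
      then show ?thesis by (simp add: mult_ac)
    qed
    finally have 1: "V x t \<le> V y t + M * norm (x - y)" by simp
    have 2: "V y t \<le> V y s + M * \<bar>t - s\<bar>"
    proof (cases "t \<le> s")
      case True
      have "V y t \<le> V y s + (K * s + B) * (s - t)" using V_lip_t_lower[of "s - t" s y] that True by simp
      also have "(K * s + B) * (s - t) \<le> M * (s - t)"
      proof (rule mult_right_mono)
        have "K * s + B \<le> K * T + B" using that K by (intro add_right_mono mult_left_mono) auto
        also have "\<dots> \<le> M" by (simp add: M_def)
        finally show "K * s + B \<le> M" .
      qed (use True in simp)
      finally show ?thesis using True by simp
    next
      case False
      have "V y t \<le> V y s + (t - s) * (L 0 0 0 + K * (norm y + s + (t - s)) + K1 * (t - s))"
        using V_lip_t_upper[of "t - s" s y] that False by simp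
      also have "(t - s) * (L 0 0 0 + K * (norm y + s + (t - s)) + K1 * (t - s)) \<le> (t - s) * M"
      proof (rule mult_left_mono)
        have "K * (norm y + s + (t - s)) \<le> K * (r + T)" using that K by (intro mult_left_mono) auto
        moreover have "K1 * (t - s) \<le> K1 * T" using that K1 by (intro mult_left_mono) auto
        ultimately show "L 0 0 0 + K * (norm y + s + (t - s)) + K1 * (t - s) \<le> M"
          unfolding M_def by linarith
      qed (use False in simp)
      finally show ?thesis using False by (simp add: mult.commute)
    qed
    from 1 2 show ?thesis by (simp add: algebra_simps)
  qed
  show ?thesis
  proof (rule that[of M])
    show "M \<ge> 0" by (simp add: M_def)
    show "\<bar>V x t - V y s\<bar> \<le> M * (norm (x - y) + \<bar>t - s\<bar>)"
      if "norm x \<le> r" "norm y \<le> r" "0 \<le> s" "s \<le> T" "0 \<le> t" "t \<le> T" for x y s t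
      using le[OF that] le[OF that(2,1) that(5,6) that(3,4)]
      by (simp add: norm_minus_commute abs_minus_commute abs_le_iff)
  qed
qed

text \<open>The initial growth rate of \<open>V\<close>: to first order \<open>V x t\<close> is
  \<open>t * min_rate x\<close>. It enters because a second difference may place one of the two
  translates at time 0.\<close>

definition min_rate :: "'a \<Rightarrow> real" where
  "min_rate x = (INF v\<in>{v. norm v \<le> R}. L x v 0)"

lemma min_rate_le: "norm v \<le> R \<Longrightarrow> min_rate x \<le> L x v 0"
  unfolding min_rate_def by (rule cINF_lower) (auto intro!: bdd_belowI2 lower)

lemma min_rate_ge: "(\<And>v. norm v \<le> R \<Longrightarrow> z \<le> L x v 0) \<Longrightarrow> z \<le> min_rate x"
  proof -
  assume z: "\<And>v. norm v \<le> R \<Longrightarrow> z \<le> L x v 0"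
  have "0 \<in> {v::'a. norm v \<le> R}" using R by simp
  then show ?thesis unfolding min_rate_def by (intro cINF_greatest) (use z in blast)+
qed

lemma min_rate_lip: "min_rate (x + d) \<le> min_rate x + K * norm d"
proof -
  have "min_rate (x + d) - K * norm d \<le> L x v 0" if "norm v \<le> R" for v
    using min_rate_le[OF that, of "x + d"] lip_le[OF that, of "x + d" 0 x 0] by simp
  from min_rate_ge[OF this] show ?thesis by simp
qed

text \<open>The left side is itself a subsolution: a step of duration \<open>h\<close> changes
  \<open>min_rate\<close> by at most \<open>K * R * h\<close>, and the quadratic term absorbs the
  cross terms in \<open>t h\<close>.\<close>

lemma V_initial_lower:
  assumes "0 \<le> t" shows "t * min_rate x - K1 * t\<^sup>2 \<le> V x t"
proof -
  have "subsolution UNIV R cost {0..} (\<lambda>x t. t * min_rate x - K1 * t\<^sup>2)"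
    unfolding subsolution_def
  proof (intro allI impI)
    fix x v :: 'a and t h :: real assume v: "norm v \<le> R" and h: "0 \<le> h" and t: "t \<in> {0..}"
    have "norm (h *\<^sub>R v) \<le> h * R" using v h by (auto intro: mult_left_mono)
    then have "min_rate (x + h *\<^sub>R v) \<le> min_rate x + K * (h * R)"
      using min_rate_lip[of x "h *\<^sub>R v"] mult_left_mono[OF _ K, of "norm (h *\<^sub>R v)" "h * R"] by linarith
    then have 1: "(t + h) * min_rate (x + h *\<^sub>R v) \<le> (t + h) * (min_rate x + K * (h * R))"
      using t h by (intro mult_left_mono) auto
    have "min_rate x \<le> L x v 0" by (rule min_rate_le[OF v])
    also have "L x v 0 \<le> L (x + (h / 2) *\<^sub>R v) v (t + h / 2) + K * (norm ((h / 2) *\<^sub>R v) + (t + h / 2))"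
    proof -
      have "norm (x - (x + (h / 2) *\<^sub>R v)) = norm ((h / 2) *\<^sub>R v)" "\<bar>0 - (t + h / 2)\<bar> = t + h / 2"
        using t h by simp_all
      then show ?thesis using lip_le[OF v, of x 0 "x + (h / 2) *\<^sub>R v" "t + h / 2"] by (simp only:)
    qed
    also have "K * (norm ((h / 2) *\<^sub>R v) + (t + h / 2)) \<le> K * ((h / 2) * R + (t + h / 2))"
      using v h K by (intro mult_left_mono add_right_mono) (auto intro: mult_left_mono)
    finally have "h * min_rate x \<le> h * (L (x + (h / 2) *\<^sub>R v) v (t + h / 2) + K * ((h / 2) * R + (t + h / 2)))"
      using h by (intro mult_left_mono) auto
    moreover have "0 \<le> K * (R * (t * h))" "0 \<le> K * (t * h)" "0 \<le> K * (R * (h * h))" "0 \<le> K * (h * h)"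
      using K R t h by auto
    moreover have "(t + h) * (min_rate x + K * (h * R)) = t * min_rate x + h * min_rate x + K * (R * (t * h)) + K * (R * (h * h))"
      by (simp add: algebra_simps)
    moreover have "h * (L (x + (h / 2) *\<^sub>R v) v (t + h / 2) + K * ((h / 2) * R + (t + h / 2)))
      = h * L (x + (h / 2) *\<^sub>R v) v (t + h / 2) + K * (R * (h * h)) / 2 + K * (t * h) + K * (h * h) / 2"
      by (simp add: algebra_simps)
    moreover have "K1 * (t + h)\<^sup>2 = K1 * t\<^sup>2 + 2 * (K * (R * (t * h))) + 2 * (K * (t * h)) + K1 * h\<^sup>2"
      by (simp add: K1_def power2_eq_square algebra_simps)
    moreover have "K1 * h\<^sup>2 = K * (R * (h * h)) + K * (h * h)"
      by (simp add: K1_def power2_eq_square algebra_simps)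
    ultimately show "(t + h) * min_rate (x + h *\<^sub>R v) - K1 * (t + h)\<^sup>2 \<le> t * min_rate x - K1 * t\<^sup>2 + cost x v t h"
      using 1 unfolding cost_def by linarith
  qed
  from V_maximal[OF this, of t x] show ?thesis using assms by auto
qed

text \<open>For each velocity take one straight step of duration \<open>2 * h\<close> ending at
  \<open>x + d\<close>. The time is \<open>2 * h\<close> because the forward translate stands there
  when the backward one is at time 0.\<close>

lemma V_initial_upper:
  assumes h: "0 \<le> h" shows "V (x + d) (2 * h) \<le> 2 * h * min_rate x + (K + 6 * K1) * ((norm d)\<^sup>2 + h\<^sup>2)"
proof -
  have *: "V (x + d) (2 * h) - (K + 6 * K1) * ((norm d)\<^sup>2 + h\<^sup>2) \<le> 2 * h * L x v 0" if v: "norm v \<le> R" for v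
  proof -
    have "V (x + d) (2 * h) \<le> cost (x + d - (2 * h) *\<^sub>R v) v 0 (2 * h)"
      using h by (intro V_single v) auto
    also have "\<dots> = 2 * h * L (x + d - h *\<^sub>R v) v h + 4 * K1 * h\<^sup>2"
    proof -
      have "x + d - (2 * h) *\<^sub>R v + h *\<^sub>R v = x + d - h *\<^sub>R v"
      proof -
        have "(2 * h) *\<^sub>R v = h *\<^sub>R v + h *\<^sub>R v" unfolding mult_2 by (rule scaleR_left_distrib)
        then show ?thesis by simp
      qed
      moreover have "(2 * h) / 2 = h" by simp
      ultimately show ?thesis unfolding cost_def by (simp only: add_0 power2_eq_square)
    qed
    also have "\<dots> \<le> 2 * h * (L x v 0 + K * (norm d + h * R + h)) + 4 * K1 * h\<^sup>2"
    proof -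
      have "norm (h *\<^sub>R v) \<le> h * R" using mult_left_mono[OF v h] h by simp
      then have "norm (x + d - h *\<^sub>R v - x) + \<bar>h - 0\<bar> \<le> norm d + h * R + h"
        using norm_triangle_ineq4[of d "h *\<^sub>R v"] h by simp
      then have "K * (norm (x + d - h *\<^sub>R v - x) + \<bar>h - 0\<bar>) \<le> K * (norm d + h * R + h)"
        using K by (rule mult_left_mono)
      then have "L (x + d - h *\<^sub>R v) v h \<le> L x v 0 + K * (norm d + h * R + h)"
        using lip_le[OF v, of "x + d - h *\<^sub>R v" h x 0] by linarith
      then show ?thesis using h by (intro add_right_mono mult_left_mono) auto
    qed
    also have "\<dots> = 2 * h * L x v 0 + K * (2 * h * norm d) + 6 * K1 * h\<^sup>2"
      by (simp add: K1_def power2_eq_square algebra_simps)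
    finally have "V (x + d) (2 * h) \<le> 2 * h * L x v 0 + K * (2 * h * norm d) + 6 * K1 * h\<^sup>2" .
    moreover have "K * (2 * h * norm d) \<le> K * ((norm d)\<^sup>2 + h\<^sup>2)"
      using sum_squares_bound[of h "norm d"] K by (intro mult_left_mono) linarith+
    moreover have "6 * K1 * h\<^sup>2 \<le> 6 * K1 * ((norm d)\<^sup>2 + h\<^sup>2)"
      using K1 by (intro mult_left_mono) auto
    moreover have "(K + 6 * K1) * ((norm d)\<^sup>2 + h\<^sup>2) = K * ((norm d)\<^sup>2 + h\<^sup>2) + 6 * K1 * ((norm d)\<^sup>2 + h\<^sup>2)"
      by (rule distrib_right)
    ultimately show ?thesis by linarith
  qed
  show ?thesis
  proof (cases "h = 0")
    case True
    then show ?thesis using K K1 by (simp add: V_0)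
  next
    case False
    then have "h > 0" using h by simp
    have "(V (x + d) (2 * h) - (K + 6 * K1) * ((norm d)\<^sup>2 + h\<^sup>2)) / (2 * h) \<le> min_rate x"
    proof (rule min_rate_ge)
      fix v :: 'a assume "norm v \<le> R"
      from *[OF this] show "(V (x + d) (2 * h) - (K + 6 * K1) * ((norm d)\<^sup>2 + h\<^sup>2)) / (2 * h) \<le> L x v 0"
        using \<open>h > 0\<close> by (subst pos_divide_le_eq) (simp_all add: mult.commute[of "L x v 0"])
    qed
    then have "V (x + d) (2 * h) - (K + 6 * K1) * ((norm d)\<^sup>2 + h\<^sup>2) \<le> min_rate x * (2 * h)"
      using \<open>h > 0\<close> by (subst (asm) pos_divide_le_eq) simp_all
    then show ?thesis by (simp add: mult.commute[of "min_rate x"])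
  qed
qed

text \<open>Average the translates of \<open>V\<close> by \<open>(d, h)\<close> and
  \<open>(- d, - h)\<close>. Semiconcavity of \<open>L\<close> makes the average, corrected at the
  rate \<open>C q / 2\<close>, a subsolution from time \<open>h\<close> on. At that time the
  backward translate is 0 and the forward one is \<open>V (x + d) (2 h)\<close>, so the average and
  \<open>V x h\<close> are both compared with \<open>h * min_rate x\<close> up to
  \<open>O(q)\<close>, and \<open>V_compare\<close> concludes.\<close>

proposition V_semiconcave:
  assumes h: "0 \<le> h" "h \<le> t" and T: "t \<le> T"
  shows "V (x + d) (t + h) + V (x - d) (t - h) \<le> 2 * V x t + (C * T + K + 8 * K1) * ((norm d)\<^sup>2 + h\<^sup>2)"
proof -
  define q where "q = (norm d)\<^sup>2 + h\<^sup>2"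
  have q: "q \<ge> 0" by (simp add: q_def)
  define w where "w x t = (V (x + d) (t + h) + V (x - d) (t - h)) / 2 - C / 2 * q * (t - h)" for x t
  have "subsolution UNIV R cost {h..} w"
    unfolding subsolution_def
  proof (intro allI impI)
    fix x v :: 'a and t k :: real assume v: "norm v \<le> R" and k: "0 \<le> k" and t: "t \<in> {h..}"
    have 1: "V (x + k *\<^sub>R v + d) (t + k + h) \<le> V (x + d) (t + h) + cost (x + d) v (t + h) k"
      using V_step[OF v k, of "t + h" "x + d"] t h by (simp add: add_ac)
    have "x - d + k *\<^sub>R v = x + k *\<^sub>R v - d" "t - h + k = t + k - h" by simp_all
    note e = this
    have "V (x - d + k *\<^sub>R v) (t - h + k) \<le> V (x - d) (t - h) + cost (x - d) v (t - h) k"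
      using t h by (intro V_step v k) auto
    then have 2: "V (x + k *\<^sub>R v - d) (t + k - h) \<le> V (x - d) (t - h) + cost (x - d) v (t - h) k"
      by (simp only: e)
    let ?m = "L (x + (k / 2) *\<^sub>R v) v (t + k / 2)"
    have "x + (k / 2) *\<^sub>R v + d = x + d + (k / 2) *\<^sub>R v" "t + k / 2 + h = t + h + k / 2"
      "x + (k / 2) *\<^sub>R v - d = x - d + (k / 2) *\<^sub>R v" "t + k / 2 - h = t - h + k / 2" by simp_all
    note e2 = this
    have "L (x + d + (k / 2) *\<^sub>R v) v (t + h + k / 2) + L (x - d + (k / 2) *\<^sub>R v) v (t - h + k / 2)
       \<le> 2 * ?m + C * q"
      using semiconcave[OF v, of "x + (k / 2) *\<^sub>R v" d "t + k / 2" h, folded q_def] by (simp only: e2)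
    from mult_left_mono[OF this k]
    have "k * L (x + d + (k / 2) *\<^sub>R v) v (t + h + k / 2) + k * L (x - d + (k / 2) *\<^sub>R v) v (t - h + k / 2)
       \<le> 2 * (k * ?m) + C * q * k"
      unfolding distrib_left by (simp only: mult_ac)
    then have 3: "cost (x + d) v (t + h) k + cost (x - d) v (t - h) k \<le> 2 * cost x v t k + C * q * k"
      unfolding cost_def by simp
    have "C / 2 * q * (t + k - h) = C / 2 * q * (t - h) + C * q * k / 2" by (simp add: field_simps)
    note 4 = this
    have "(a + d) / 2 - n \<le> (b + e) / 2 - p + g"
      if "a \<le> b + c" "d \<le> e + f" "c + f \<le> 2 * g + m" "n = p + m / 2" for a b c d e f g m n p :: real
      using that by argo
    from this[OF 1 2 3 4] show "w (x + k *\<^sub>R v) (t + k) \<le> w x t + cost x v t k"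
      unfolding w_def .
  qed
  moreover have "w x h \<le> V x h + (K / 2 + 4 * K1) * q" for x
  proof -
    have "w x h = V (x + d) (2 * h) / 2" by (simp add: w_def V_0)
    also have "\<dots> \<le> h * min_rate x + (K / 2 + 3 * K1) * q"
      using V_initial_upper[OF h(1), of x d, folded q_def] by (simp add: algebra_simps)
    also have "h * min_rate x \<le> V x h + K1 * q"
    proof -
      have "K1 * h\<^sup>2 \<le> K1 * q" using K1 by (intro mult_left_mono) (auto simp: q_def)
      then show ?thesis using V_initial_lower[OF h(1), of x] by linarith
    qed
    finally show ?thesis by (simp add: algebra_simps)
  qed
  ultimately have "w x t \<le> V x t + (K / 2 + 4 * K1) * q"
    by (rule V_compare[OF _ h(1) _ h(2)])
  moreover have "C * q * (t - h) \<le> C * q * T"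
    using C q h T by (intro mult_left_mono) auto
  moreover have "(C * T + K + 8 * K1) * q = C * q * T + 2 * ((K / 2 + 4 * K1) * q)" by (simp add: algebra_simps)
  moreover have "C / 2 * q * (t - h) = (C * q * (t - h)) / 2" by simp
  moreover have "a \<le> 2 * b + k" if "a / 2 - m \<le> b + r" "z \<le> y" "k = y + 2 * r" "m = z / 2"
    for a b k m r y z :: real using that by argo
  ultimately show ?thesis unfolding w_def q_def[symmetric] by blast
qed

end

section \<open>Jets and their semiconcave extension\<close>

text \<open>A \<open>C\<^sup>1\<^sup>,\<^sup>1\<close> function in the sense of Whitney, with all bounds normalised to \<open>1\<close>.\<close>

definition is_jet :: "'p::euclidean_space set \<Rightarrow> ('p \<Rightarrow> real) \<Rightarrow> ('p \<Rightarrow> 'p) \<Rightarrow> bool" where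
  "is_jet P \<phi> G \<longleftrightarrow> (\<forall>p\<in>P. \<bar>\<phi> p\<bar> \<le> 1 \<and> norm (G p) \<le> 1 \<and>
     (\<forall>q\<in>P. \<bar>\<phi> p - \<phi> q\<bar> \<le> norm (p - q) \<and> norm (G p - G q) \<le> norm (p - q) \<and>
        \<bar>\<phi> q - \<phi> p - G p \<bullet> (q - p)\<bar> \<le> (norm (q - p))\<^sup>2))"

lemma is_jetD:
  assumes "is_jet P \<phi> G" "p \<in> P"
  shows "\<bar>\<phi> p\<bar> \<le> 1" "norm (G p) \<le> 1"
    "q \<in> P \<Longrightarrow> \<bar>\<phi> p - \<phi> q\<bar> \<le> norm (p - q)" "q \<in> P \<Longrightarrow> norm (G p - G q) \<le> norm (p - q)"
    "q \<in> P \<Longrightarrow> \<bar>\<phi> q - \<phi> p - G p \<bullet> (q - p)\<bar> \<le> (norm (q - p))\<^sup>2"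
  using assms by (auto simp: is_jet_def)

lemma jet_continuous: "is_jet P \<phi> G \<Longrightarrow> continuous_on P \<phi>"
proof (rule continuous_onI)
  fix p and e :: real assume jet: "is_jet P \<phi> G" and p: "p \<in> P" and e: "e > 0"
  have "dist (\<phi> q) (\<phi> p) \<le> e" if "q \<in> P" "dist q p < e" for q
    using is_jetD(3)[OF jet that(1) p] that(2) by (simp add: dist_norm)
  then show "\<exists>d>0. \<forall>q\<in>P. dist q p < d \<longrightarrow> dist (\<phi> q) (\<phi> p) \<le> e"
    using e by blast
qed

lemma jet_gradient_continuous: "is_jet P \<phi> G \<Longrightarrow> continuous_on P G"
proof (rule continuous_onI)
  fix p and e :: real assume jet: "is_jet P \<phi> G" and p: "p \<in> P" and e: "e > 0"
  have "dist (G q) (G p) \<le> e" if "q \<in> P" "dist q p < e" for q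
    using is_jetD(4)[OF jet that(1) p] that(2) by (simp add: dist_norm)
  then show "\<exists>d>0. \<forall>q\<in>P. dist q p < d \<longrightarrow> dist (G q) (G p) \<le> e"
    using e by blast
qed

text \<open>A smooth substitute for the norm: \<open>jnorm z - 1\<close> is comparable with
  \<open>|z|^2\<close> near 0 and with \<open>|z|\<close> far away, so it bends like a paraboloid
  and yet stays Lipschitz.\<close>

definition jnorm :: "'p::real_normed_vector \<Rightarrow> real" where
  "jnorm z = sqrt (1 + (norm z)\<^sup>2)"

lemma jnorm_eq: "jnorm z = norm (1::real, z)"
  by (simp add: jnorm_def norm_Pair)

lemma jnorm_ge_1: "jnorm z \<ge> 1"
  by (simp add: jnorm_def)

lemma jnorm_ge_norm: "jnorm z \<ge> norm z"
  by (simp add: jnorm_def real_le_rsqrt)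

lemma jnorm_lip: "\<bar>jnorm y - jnorm z\<bar> \<le> norm (y - z)"
  using norm_triangle_ineq3[of "(1::real, y)" "(1, z)"] by (simp add: jnorm_eq norm_Pair)

lemma jnorm_square: "(jnorm z)\<^sup>2 = 1 + (norm z)\<^sup>2"
  by (simp add: jnorm_def)

lemma jnorm_tangent:
  "jnorm y \<le> ((jnorm y)\<^sup>2 + (jnorm z)\<^sup>2) / (2 * jnorm z)"
proof -
  have "2 * jnorm y * jnorm z \<le> (jnorm y)\<^sup>2 + (jnorm z)\<^sup>2" by (rule sum_squares_bound)
  then show ?thesis using jnorm_ge_1[of z] by (subst pos_le_divide_eq) auto
qed

text \<open>The inequality of arithmetic and geometric means puts a quadratic above
  \<open>jnorm\<close> that touches it at \<open>z\<close>, and the parallelogram law evaluates the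
  second difference of that quadratic; \<open>jnorm z \<ge> 1\<close> bounds its curvature.\<close>

lemma jnorm_second_diff:
  fixes z d :: "'p::real_inner"
  shows "jnorm (z + d) + jnorm (z - d) \<le> 2 * jnorm z + (norm d)\<^sup>2"
proof -
  let ?n = "jnorm z"
  have n: "?n \<ge> 1" by (rule jnorm_ge_1)
  have "(norm (z + d))\<^sup>2 + (norm (z - d))\<^sup>2 = 2 * (norm z)\<^sup>2 + 2 * (norm d)\<^sup>2"
    by (simp add: power2_norm_eq_inner inner_add_left inner_add_right inner_diff_left inner_diff_right inner_commute)
  then have s: "(jnorm (z + d))\<^sup>2 + (jnorm (z - d))\<^sup>2 = 2 * ?n\<^sup>2 + 2 * (norm d)\<^sup>2"
    by (simp add: jnorm_square)
  have "jnorm (z + d) + jnorm (z - d) 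
     \<le> ((jnorm (z + d))\<^sup>2 + ?n\<^sup>2) / (2 * ?n) + ((jnorm (z - d))\<^sup>2 + ?n\<^sup>2) / (2 * ?n)"
    by (intro add_mono jnorm_tangent)
  also have "\<dots> = (4 * ?n\<^sup>2 + 2 * (norm d)\<^sup>2) / (2 * ?n)"
    using s by (simp add: add_divide_distrib[symmetric])
  also have "\<dots> = 2 * ?n + (norm d)\<^sup>2 / ?n" using n by (simp add: field_simps power2_eq_square)
  also have "(norm d)\<^sup>2 / ?n \<le> (norm d)\<^sup>2" using n by (simp add: divide_le_eq mult_le_cancel_left1)
  finally show ?thesis by simp
qed

lemma jnorm_upper:
  fixes d :: "'p::real_inner"
  shows "jnorm d - 1 \<le> (norm d)\<^sup>2"
proof -
  have "2 * jnorm d \<le> 2 + (norm d)\<^sup>2" using jnorm_second_diff[of 0 d] by (simp add: jnorm_def)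
  then show ?thesis using zero_le_power2[of "norm d"] by linarith
qed

lemma jnorm_lower:
  assumes "norm z \<le> D" shows "(norm z)\<^sup>2 \<le> (D + 2) * (jnorm z - 1)"
proof -
  have "jnorm z \<le> 1 + norm z"
    using jnorm_lip[of z 0] by (simp add: jnorm_def)
  then have "jnorm z + 1 \<le> D + 2" using assms by simp
  then have "(jnorm z + 1) * (jnorm z - 1) \<le> (D + 2) * (jnorm z - 1)"
    using jnorm_ge_1[of z] by (intro mult_right_mono) auto
  moreover have "(jnorm z + 1) * (jnorm z - 1) = (norm z)\<^sup>2"
    using jnorm_square[of z] by (simp add: power2_eq_square algebra_simps)
  ultimately show ?thesis by simp
qed

lemma jnorm_mono: "norm y \<le> norm z \<Longrightarrow> jnorm y \<le> jnorm z"
  by (simp add: jnorm_def power_mono)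

section \<open>Extension of a jet as an infimum\<close>

lemma INF_lipschitz:
  fixes F :: "'i \<Rightarrow> 'p::real_normed_vector \<Rightarrow> real"
  assumes "I \<noteq> {}" "\<And>i p. i \<in> I \<Longrightarrow> - B \<le> F i p" "\<And>i. i \<in> I \<Longrightarrow> F i p \<le> F i q + c"
  shows "(INF i\<in>I. F i p) \<le> (INF i\<in>I. F i q) + c"
proof -
  have "bdd_below ((\<lambda>i. F i p) ` I)" using assms(2) by (rule bdd_belowI2)
  then have "(INF i\<in>I. F i p) - c \<le> F i q" if "i \<in> I" for i
    using cINF_lower[of "\<lambda>i. F i p" I i] assms(3)[OF that] that by simp
  then have "(INF i\<in>I. F i p) - c \<le> (INF i\<in>I. F i q)" by (intro cINF_greatest assms(1))
  then show ?thesis by simp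
qed

lemma INF_second_diff:
  fixes F :: "'i \<Rightarrow> 'p::real_normed_vector \<Rightarrow> real"
  assumes "I \<noteq> {}" "\<And>i p. i \<in> I \<Longrightarrow> - B \<le> F i p" "\<And>i. i \<in> I \<Longrightarrow> F i p + F i q \<le> 2 * F i r + c"
  shows "(INF i\<in>I. F i p) + (INF i\<in>I. F i q) \<le> 2 * (INF i\<in>I. F i r) + c"
proof -
  have b: "bdd_below ((\<lambda>i. F i p) ` I)" for p using assms(2) by (rule bdd_belowI2)
  have "((INF i\<in>I. F i p) + (INF i\<in>I. F i q) - c) / 2 \<le> F i r" if "i \<in> I" for i
    using cINF_lower[OF b[of p] that] cINF_lower[OF b[of q] that] assms(3)[OF that] by simp
  then have "((INF i\<in>I. F i p) + (INF i\<in>I. F i q) - c) / 2 \<le> (INF i\<in>I. F i r)" 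
    by (intro cINF_greatest assms(1))
  then show ?thesis by simp
qed

text \<open>An index is a pair \<open>(q, y)\<close>: \<open>q\<close> is the point whose Taylor
  polynomial is used, \<open>y\<close> the centre of a penalty acting on the first component
  alone.\<close>

definition jet_para :: "('a::euclidean_space \<times> 'b::euclidean_space \<Rightarrow> real) \<Rightarrow> ('a \<times> 'b \<Rightarrow> 'a \<times> 'b) \<Rightarrow>
    real \<Rightarrow> real \<Rightarrow> ('a \<times> 'b) \<times> 'a \<Rightarrow> 'a \<times> 'b \<Rightarrow> real" where
  "jet_para \<phi> G C \<Lambda> i p = \<phi> (fst i) + G (fst i) \<bullet> (p - fst i) + C * (jnorm (p - fst i) - 1)
     + \<Lambda> * (jnorm (fst p - snd i) - 1)"

text \<open>An infimum of uniformly semiconcave functions; the \<open>C\<close> term makes it agree with \<open>\<phi>\<close> over \<open>S\<close>, and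
  the \<open>\<Lambda>\<close> term makes it large far from \<open>S\<close>.\<close>

definition jet_ext :: "('a::euclidean_space \<times> 'b::euclidean_space) set \<Rightarrow> 'a set \<Rightarrow> real \<Rightarrow> real \<Rightarrow>
    ('a \<times> 'b \<Rightarrow> real) \<Rightarrow> ('a \<times> 'b \<Rightarrow> 'a \<times> 'b) \<Rightarrow> 'a \<times> 'b \<Rightarrow> real" where
  "jet_ext P S C \<Lambda> \<phi> G p = (INF i\<in>P \<times> S. jet_para \<phi> G C \<Lambda> i p)"

text \<open>\<open>D\<close> bounds the diameter of \<open>P\<close>, and \<open>D + 2\<close> is
  the constant of \<open>jnorm_lower\<close>: with it the \<open>C\<close> term dominates the
  Whitney remainder on \<open>P\<close>.\<close>

locale jet_extension =
  fixes P :: "('a::euclidean_space \<times> 'b::euclidean_space) set" and S :: "'a set" and C \<Lambda> D :: real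
    and \<phi> :: "'a \<times> 'b \<Rightarrow> real" and G :: "'a \<times> 'b \<Rightarrow> 'a \<times> 'b"
  assumes jet: "is_jet P \<phi> G" and P: "P \<noteq> {}" and S: "S \<noteq> {}" and L: "\<Lambda> \<ge> 0"
    and D: "\<And>p q. p \<in> P \<Longrightarrow> q \<in> P \<Longrightarrow> norm (p - q) \<le> D" and C: "C \<ge> D + 2"
begin

abbreviation F where "F \<equiv> jet_para \<phi> G C \<Lambda>"
abbreviation E where "E \<equiv> jet_ext P S C \<Lambda> \<phi> G"

lemma C1: "C \<ge> 1"
proof -
  obtain p where "p \<in> P" using P by blast
  from D[OF this this] C show ?thesis by simp
qed

lemma F_lower_pen:
  assumes "q \<in> P" shows "- 2 + \<Lambda> * (jnorm (fst p - y) - 1) \<le> F (q, y) p"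
proof -
  let ?z = "norm (p - q)"
  have "\<bar>G q \<bullet> (p - q)\<bar> \<le> 1 * ?z" 
    by (rule order_trans[OF Cauchy_Schwarz_ineq2]) (intro mult_right_mono is_jetD[OF jet assms], simp)
  moreover have "\<bar>\<phi> q\<bar> \<le> 1" by (rule is_jetD[OF jet assms])
  moreover have "?z - 1 \<le> C * (jnorm (p - q) - 1)"
  proof -
    have "?z - 1 \<le> 1 * (jnorm (p - q) - 1)" using jnorm_ge_norm[of "p - q"] by simp
    also have "\<dots> \<le> C * (jnorm (p - q) - 1)" using C1 jnorm_ge_1[of "p - q"] by (intro mult_right_mono) auto
    finally show ?thesis .
  qed
  ultimately show ?thesis unfolding jet_para_def by simp
qed

lemma F_lower: "i \<in> P \<times> S \<Longrightarrow> - 2 \<le> F i p"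
proof -
  assume "i \<in> P \<times> S"
  then obtain q y where i: "i = (q, y)" "q \<in> P" by auto
  have "0 \<le> \<Lambda> * (jnorm (fst p - y) - 1)" using L jnorm_ge_1[of "fst p - y"] by simp
  with F_lower_pen[OF i(2), of p y] show ?thesis by (simp add: i)
qed

lemma E_le: "i \<in> P \<times> S \<Longrightarrow> E p \<le> F i p"
  unfolding jet_ext_def by (rule cINF_lower) (auto intro!: bdd_belowI2 F_lower)

lemma E_ge: "(\<And>q y. q \<in> P \<Longrightarrow> y \<in> S \<Longrightarrow> z \<le> F (q, y) p) \<Longrightarrow> z \<le> E p"
  unfolding jet_ext_def by (rule cINF_greatest) (use P S in auto)

lemma E_lower: "- 2 \<le> E p"
  by (rule E_ge) (use F_lower in auto)

lemma E_penalty: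
  assumes "\<And>y. y \<in> S \<Longrightarrow> r \<le> norm (fst p - y)" "r \<ge> 0"
  shows "- 2 + \<Lambda> * (sqrt (1 + r\<^sup>2) - 1) \<le> E p"
proof (rule E_ge)
  fix q y assume qy: "q \<in> P" "y \<in> S"
  have "sqrt (1 + r\<^sup>2) \<le> jnorm (fst p - y)" using jnorm_mono[of r "fst p - y"] assms qy by (simp add: jnorm_def)
  then have "\<Lambda> * (sqrt (1 + r\<^sup>2) - 1) \<le> \<Lambda> * (jnorm (fst p - y) - 1)" using L by (intro mult_left_mono) auto
  with F_lower_pen[OF qy(1), of p y] show "- 2 + \<Lambda> * (sqrt (1 + r\<^sup>2) - 1) \<le> F (q, y) p" by linarith
qed

lemma E_lipschitz: "\<bar>E p - E p'\<bar> \<le> (1 + C + \<Lambda>) * norm (p - p')"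
proof -
  have F: "F i p \<le> F i p' + (1 + C + \<Lambda>) * norm (p - p')" if i: "i \<in> P \<times> S" for i p p'
  proof -
    obtain q y where i: "i = (q, y)" "q \<in> P" using i by auto
    have "G q \<bullet> (p - q) - G q \<bullet> (p' - q) = G q \<bullet> (p - p')" by (simp add: inner_diff_right)
    also have "\<dots> \<le> 1 * norm (p - p')" 
      by (rule order_trans[OF norm_cauchy_schwarz]) (intro mult_right_mono is_jetD[OF jet i(2)], simp)
    finally have 1: "G q \<bullet> (p - q) - G q \<bullet> (p' - q) \<le> norm (p - p')" by simp
    have 2: "C * (jnorm (p - q) - 1) \<le> C * (jnorm (p' - q) - 1 + norm (p - p'))"
      using jnorm_lip[of "p - q" "p' - q"] C1 by (intro mult_left_mono) auto
    have "norm (fst p - fst p') \<le> norm (p - p')"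
    proof -
      have "norm (fst (p - p')) \<le> norm (p - p')" by (metis norm_fst_le prod.collapse)
      then show ?thesis by simp
    qed
    then have "jnorm (fst p - y) \<le> jnorm (fst p' - y) + norm (p - p')"
      using jnorm_lip[of "fst p - y" "fst p' - y"] by simp
    then have 3: "\<Lambda> * (jnorm (fst p - y) - 1) \<le> \<Lambda> * (jnorm (fst p' - y) - 1 + norm (p - p'))"
      using L by (intro mult_left_mono) auto
    from 1 2 3 show ?thesis unfolding jet_para_def i by (simp add: algebra_simps)
  qed
  have le: "E p \<le> E p' + (1 + C + \<Lambda>) * norm (p - p')" for p p'
    unfolding jet_ext_def by (rule INF_lipschitz[where B = 2]) (use P S F F_lower in auto)
  show ?thesis using le[of p p'] le[of p' p] by (simp add: norm_minus_commute abs_le_iff)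
qed

lemma E_semiconcave: "E (p + d) + E (p - d) \<le> 2 * E p + (C + \<Lambda>) * (norm d)\<^sup>2"
  unfolding jet_ext_def
proof (rule INF_second_diff[where B = 2])
  fix i assume "i \<in> P \<times> S"
  obtain q y where i: "i = (q, y)" by (cases i)
  have "jnorm (p - q + d) + jnorm (p - q - d) \<le> 2 * jnorm (p - q) + (norm d)\<^sup>2" by (rule jnorm_second_diff)
  then have 1: "C * (jnorm (p + d - q) + jnorm (p - d - q)) \<le> C * (2 * jnorm (p - q) + (norm d)\<^sup>2)"
    using C1 by (intro mult_left_mono) (auto simp: algebra_simps)
  have "norm (fst d) \<le> norm d" using norm_fst_le[of "fst d" "snd d"] by simp
  then have "(norm (fst d))\<^sup>2 \<le> (norm d)\<^sup>2" by (intro power_mono) auto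
  then have "jnorm (fst p - y + fst d) + jnorm (fst p - y - fst d) \<le> 2 * jnorm (fst p - y) + (norm d)\<^sup>2"
    using jnorm_second_diff[of "fst p - y" "fst d"] by linarith
  then have 2: "\<Lambda> * (jnorm (fst (p + d) - y) + jnorm (fst (p - d) - y)) \<le> \<Lambda> * (2 * jnorm (fst p - y) + (norm d)\<^sup>2)"
    using L by (intro mult_left_mono) (auto simp: algebra_simps)
  show "F i (p + d) + F i (p - d) \<le> 2 * F i p + (C + \<Lambda>) * (norm d)\<^sup>2"
    using 1 2 unfolding jet_para_def i by (simp add: inner_add_right inner_diff_right distrib_left distrib_right right_diff_distrib)
qed (use P S F_lower in auto)

text \<open>The Whitney remainder at \<open>q\<close> is at most \<open>|p - q|^2\<close>, which
  \<open>C * (jnorm (p - q) - 1)\<close> dominates, and the penalty only raises the right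
  side.\<close>

lemma E_ge_jet:
  assumes p: "p \<in> P" shows "\<phi> p \<le> E p"
proof (rule E_ge)
  fix q y assume qy: "q \<in> P" "y \<in> S"
  have "(norm (p - q))\<^sup>2 \<le> (D + 2) * (jnorm (p - q) - 1)" by (rule jnorm_lower[OF D[OF p qy(1)]])
  also have "\<dots> \<le> C * (jnorm (p - q) - 1)" using C jnorm_ge_1[of "p - q"] by (intro mult_right_mono) auto
  finally have "(norm (p - q))\<^sup>2 \<le> C * (jnorm (p - q) - 1)" .
  moreover have "\<bar>\<phi> p - \<phi> q - G q \<bullet> (p - q)\<bar> \<le> (norm (p - q))\<^sup>2" by (rule is_jetD(5)[OF jet qy(1) p])
  moreover have "0 \<le> \<Lambda> * (jnorm (fst p - y) - 1)" using L jnorm_ge_1[of "fst p - y"] by simp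
  ultimately show "\<phi> p \<le> F (q, y) p" unfolding jet_para_def by simp
qed

text \<open>Choose the index \<open>(p, fst p)\<close>: the penalty is then centred at the point
  itself and is quadratic in \<open>d\<close>. With \<open>E_ge_jet\<close> this gives equality at
  \<open>d = 0\<close> over \<open>S\<close>, and a paraboloid above \<open>E\<close> with gradient
  \<open>G p\<close>.\<close>

lemma E_le_jet:
  assumes p: "p \<in> P" "fst p \<in> S"
  shows "E (p + d) \<le> \<phi> p + G p \<bullet> d + (C + \<Lambda>) * (norm d)\<^sup>2"
proof -
  have "norm (fst d) \<le> norm d" using norm_fst_le[of "fst d" "snd d"] by simp
  then have "(norm (fst d))\<^sup>2 \<le> (norm d)\<^sup>2" by (intro power_mono) auto
  then have 1: "\<Lambda> * (jnorm (fst d) - 1) \<le> \<Lambda> * (norm d)\<^sup>2"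
    using jnorm_upper[of "fst d"] L by (intro mult_left_mono) linarith+
  have 2: "C * (jnorm d - 1) \<le> C * (norm d)\<^sup>2"
    using jnorm_upper[of d] C1 by (intro mult_left_mono) auto
  have "E (p + d) \<le> F (p, fst p) (p + d)" by (rule E_le) (use p in auto)
  also have "\<dots> \<le> \<phi> p + G p \<bullet> d + (C + \<Lambda>) * (norm d)\<^sup>2"
    using 1 2 unfolding jet_para_def by (simp add: distrib_right)
  finally show ?thesis .
qed

end

lemma lagrangian_jet_ext:
  fixes P :: "('a::euclidean_space \<times> 'a \<times> real) set"
  assumes "jet_extension P S C \<Lambda> D \<phi> G" "R \<ge> 0"
  shows "lagrangian (\<lambda>x v t. jet_ext P S C \<Lambda> \<phi> G (x, v, t)) R (1 + C + \<Lambda>) (C + \<Lambda>) 2"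
proof -
  interpret jet_extension P S C \<Lambda> D \<phi> G by fact
  show ?thesis
  proof
    show "\<bar>E (x, v, t) - E (y, v, s)\<bar> \<le> (1 + C + \<Lambda>) * (norm (x - y) + \<bar>t - s\<bar>)" for x y v s t
    proof -
      have "norm ((x, v, t) - (y, v, s)) \<le> norm (x - y) + norm (0::'a, t - s)"
        using norm_Pair_le[of "x - y" "(0::'a, t - s)"] by simp
      also have "norm (0::'a, t - s) = \<bar>t - s\<bar>" by (simp add: norm_Pair)
      finally have "(1 + C + \<Lambda>) * norm ((x, v, t) - (y, v, s)) \<le> (1 + C + \<Lambda>) * (norm (x - y) + \<bar>t - s\<bar>)"
        using C1 L by (intro mult_left_mono) auto
      with E_lipschitz[of "(x, v, t)" "(y, v, s)"] show ?thesis by linarith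
    qed
    show "E (x + d, v, t + h) + E (x - d, v, t - h) \<le> 2 * E (x, v, t) + (C + \<Lambda>) * ((norm d)\<^sup>2 + h\<^sup>2)" for x d v t h
    proof -
      have "(norm (d, 0::'a, h))\<^sup>2 = (norm d)\<^sup>2 + h\<^sup>2" by (simp add: norm_Pair)
      with E_semiconcave[of "(x, v, t)" "(d, 0, h)"] show ?thesis by simp
    qed
    show "- 2 \<le> E (x, v, t)" for x v t by (rule E_lower)
  qed (use assms C1 L in auto)
qed

section \<open>Closed measures\<close>

definition add_measure :: "'a measure \<Rightarrow> 'a measure \<Rightarrow> 'a measure" where
  "add_measure M N = measure_of (space M) (sets M) (\<lambda>A. emeasure M A + emeasure N A)"

lemma sets_add_measure [simp, measurable_cong]: "sets (add_measure M N) = sets M"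
  and space_add_measure [simp]: "space (add_measure M N) = space M"
  by (auto simp: add_measure_def sets.space_closed)

lemma emeasure_add_measure:
  assumes N: "sets N = sets M" and A: "A \<in> sets M"
  shows "emeasure (add_measure M N) A = emeasure M A + emeasure N A"
  unfolding add_measure_def
proof (rule emeasure_measure_of_sigma[OF _ _ _ A])
  show "sigma_algebra (space M) (sets M)" by (rule sets.sigma_algebra_axioms)
  show "positive (sets M) (\<lambda>A. emeasure M A + emeasure N A)" by (simp add: positive_def)
  show "countably_additive (sets M) (\<lambda>A. emeasure M A + emeasure N A)"
    unfolding countably_additive_def
  proof (intro allI impI)
    fix B :: "nat \<Rightarrow> _" assume B: "range B \<subseteq> sets M" "disjoint_family B"
    have "(\<Sum>i. emeasure M (B i) + emeasure N (B i)) = (\<Sum>i. emeasure M (B i)) + (\<Sum>i. emeasure N (B i))"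
      by (rule suminf_add[symmetric]) auto
    then show "(\<Sum>i. emeasure M (B i) + emeasure N (B i)) = emeasure M (\<Union> (range B)) + emeasure N (\<Union> (range B))"
      using B N by (simp add: suminf_emeasure)
  qed
qed

lemma nn_integral_add_measure:
  assumes N: "sets N = sets M" and f: "f \<in> borel_measurable M"
  shows "(\<integral>\<^sup>+x. f x \<partial>add_measure M N) = (\<integral>\<^sup>+x. f x \<partial>M) + (\<integral>\<^sup>+x. f x \<partial>N)"
  using f
proof (induction f rule: borel_measurable_induct)
  case (cong f g)
  then show ?case
    using nn_integral_cong[of M f g] nn_integral_cong[of N f g] nn_integral_cong[of "add_measure M N" f g]
      sets_eq_imp_space_eq[OF N] by simp
next
  case (set A)
  then show ?case using N by (simp add: emeasure_add_measure)
next
  case (mult u c)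
  then have "u \<in> borel_measurable N" "u \<in> borel_measurable (add_measure M N)"
    using measurable_cong_sets[OF N, of borel borel] measurable_cong_sets[OF sets_add_measure, of borel borel] by auto
  with mult show ?case by (simp add: nn_integral_cmult distrib_left)
next
  case (add u v)
  then have "u \<in> borel_measurable N" "u \<in> borel_measurable (add_measure M N)"
     "v \<in> borel_measurable N" "v \<in> borel_measurable (add_measure M N)"
    using measurable_cong_sets[OF N, of borel borel] measurable_cong_sets[OF sets_add_measure, of borel borel] by auto
  with add show ?case by (simp add: nn_integral_add add_ac)
next
  case (seq U)
  have m: "U i \<in> borel_measurable N" "U i \<in> borel_measurable (add_measure M N)" for i
    using seq(1)[of i] measurable_cong_sets[OF N, of borel borel] measurable_cong_sets[OF sets_add_measure, of borel borel] by auto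
  have inc: "incseq (\<lambda>i. integral\<^sup>N K (U i))" for K :: "'a measure"
    using seq(3) by (auto simp: incseq_def le_fun_def intro!: nn_integral_mono)
  have "(\<integral>\<^sup>+x. (SUP i. U i x) \<partial>add_measure M N) = (SUP i. integral\<^sup>N M (U i) + integral\<^sup>N N (U i))"
    using seq m by (simp add: nn_integral_monotone_convergence_SUP)
  also have "\<dots> = (SUP i. integral\<^sup>N M (U i)) + (SUP i. integral\<^sup>N N (U i))"
    by (rule ennreal_SUP_add[OF inc inc])
  also have "\<dots> = (\<integral>\<^sup>+x. (SUP i. U i x) \<partial>M) + (\<integral>\<^sup>+x. (SUP i. U i x) \<partial>N)"
    using seq m by (simp add: nn_integral_monotone_convergence_SUP)
  finally show ?case unfolding seq(4) by (simp add: image_comp)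
qed

lemma has_bochner_integral_add_measure:
  fixes f :: "'a \<Rightarrow> real"
  assumes N: "sets N = sets M" and f: "integrable M f" "integrable N f"
  shows "has_bochner_integral (add_measure M N) f (integral\<^sup>L M f + integral\<^sup>L N f)"
proof -
  have [measurable]: "f \<in> borel_measurable M" using f by auto
  have "(\<integral>\<^sup>+x. norm (f x) \<partial>add_measure M N) < \<infinity>"
    using f by (subst nn_integral_add_measure[OF N]) (auto simp: integrable_iff_bounded)
  then have i: "integrable (add_measure M N) f"
    by (auto simp: integrable_iff_bounded)
  have fin: "(\<integral>\<^sup>+x. ennreal (f x) \<partial>K) < top" "(\<integral>\<^sup>+x. ennreal (- f x) \<partial>K) < top" if "integrable K f" for K
  proof -
    have "(\<integral>\<^sup>+x. norm (f x) \<partial>K) < top" using that by (simp add: integrable_iff_bounded)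
    moreover have "(\<integral>\<^sup>+x. ennreal (f x) \<partial>K) \<le> (\<integral>\<^sup>+x. norm (f x) \<partial>K)"
      "(\<integral>\<^sup>+x. ennreal (- f x) \<partial>K) \<le> (\<integral>\<^sup>+x. norm (f x) \<partial>K)"
      by (intro nn_integral_mono ennreal_leI, simp)+
    ultimately show "(\<integral>\<^sup>+x. ennreal (f x) \<partial>K) < top" "(\<integral>\<^sup>+x. ennreal (- f x) \<partial>K) < top"
      by (auto intro: le_less_trans)
  qed
  have "integral\<^sup>L (add_measure M N) f = integral\<^sup>L M f + integral\<^sup>L N f"
    using fin[OF f(1)] fin[OF f(2)]
    by (simp add: real_lebesgue_integral_def i f nn_integral_add_measure[OF N] enn2real_plus)
  with i show ?thesis by (simp add: has_bochner_integral_iff)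
qed

definition comb_measure :: "real \<Rightarrow> 'a measure \<Rightarrow> real \<Rightarrow> 'a measure \<Rightarrow> 'a measure" where
  "comb_measure a M b N = add_measure (density M (\<lambda>_. ennreal a)) (density N (\<lambda>_. ennreal b))"

lemma sets_comb_measure [simp]: "sets (comb_measure a M b N) = sets M"
  by (simp add: comb_measure_def)

lemma emeasure_comb_measure:
  "sets N = sets M \<Longrightarrow> A \<in> sets M \<Longrightarrow>
    emeasure (comb_measure a M b N) A = ennreal a * emeasure M A + ennreal b * emeasure N A"
  by (simp add: comb_measure_def emeasure_add_measure emeasure_density_const)

lemma has_bochner_integral_comb_measure:
  fixes f :: "'a \<Rightarrow> real"
  assumes N: "sets N = sets M" and f: "integrable M f" "integrable N f" and ab: "0 \<le> a" "0 \<le> b"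
  shows "has_bochner_integral (comb_measure a M b N) f (a * integral\<^sup>L M f + b * integral\<^sup>L N f)"
proof -
  have 1: "integrable (density M (\<lambda>_. ennreal a)) f" "integral\<^sup>L (density M (\<lambda>_. ennreal a)) f = a * integral\<^sup>L M f"
    using f ab by (simp_all add: integrable_density integral_density)
  have 2: "integrable (density N (\<lambda>_. ennreal b)) f" "integral\<^sup>L (density N (\<lambda>_. ennreal b)) f = b * integral\<^sup>L N f"
    using f ab by (simp_all add: integrable_density integral_density)
  have "sets (density N (\<lambda>_. ennreal b)) = sets (density M (\<lambda>_. ennreal a))" using N by simp
  from has_bochner_integral_add_measure[OF this 1(1) 2(1)] show ?thesis
    by (simp add: comb_measure_def 1 2)
qed

section \<open>Derivatives and test functions on \<open>TI\<close> and \<open>BI\<close>\<close>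

lemma TI_borel: "open U \<Longrightarrow> TI U t0 \<in> sets borel"
proof -
  assume U: "open U"
  have "TI U t0 = (U \<times> UNIV \<times> UNIV) \<inter> (UNIV \<times> UNIV \<times> {0..t0})" by (auto simp: TI_def)
  then show ?thesis using U by (metis sets.Int borel_open borel_closed open_Times closed_Times open_UNIV closed_UNIV closed_atLeastAtMost)
qed

lemma unique_derivatives_BI:
  fixes U :: "'a::euclidean_space set"
  assumes U: "open U" and t0: "t0 > 0"
  shows "unique_derivatives (BI U t0)"
  unfolding unique_derivatives_def
proof (intro ballI allI impI)
  fix p :: "'a \<times> real" and f :: "'a \<times> real \<Rightarrow> real" and f' f''
  assume p: "p \<in> BI U t0" and f: "(f has_derivative f') (at p within BI U t0)" "(f has_derivative f'') (at p within BI U t0)"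
  obtain x t where pt: "p = (x, t)" "x \<in> U" "0 \<le> t" "t \<le> t0" using p by (auto simp: BI_def)
  show "f' = f''"
  proof (rule frechet_derivative_unique_within[OF f])
    fix i :: "'a \<times> real" and e :: real assume i: "i \<in> Basis" and e: "e > 0"
    consider b where "b \<in> Basis" "i = (b, 0)" | "i = (0, 1)"
      using i by (auto simp: Basis_prod_def)
    then show "\<exists>d. 0 < \<bar>d\<bar> \<and> \<bar>d\<bar> < e \<and> p + d *\<^sub>R i \<in> BI U t0"
    proof cases
      case 1
      obtain r where r: "r > 0" "ball x r \<subseteq> U" using U pt by (meson openE)
      define d where "d = min r e / 2"
      have "d > 0" "d < e" "d < r" using r e by (auto simp: d_def)
      moreover have "x + d *\<^sub>R b \<in> ball x r" using 1 \<open>d > 0\<close> \<open>d < r\<close> by (simp add: dist_norm)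
      ultimately show ?thesis using r pt 1 by (intro exI[of _ d]) (auto simp: BI_def)
    next
      case 2
      \<comment> \<open>Uniqueness asks for one small increment of either sign in each coordinate
        direction, so at the final time the step goes backwards; \<open>t0 > 0\<close> keeps it
        nonzero.\<close>
      define d where "d = (if t < t0 then min (t0 - t) e / 2 else - min t e / 2)"
      have "0 < \<bar>d\<bar>" "\<bar>d\<bar> < e" "0 \<le> t + d" "t + d \<le> t0"
        using pt e t0 by (auto simp: d_def min_def field_simps)
      then show ?thesis using pt 2 by (intro exI[of _ d]) (auto simp: BI_def)
    qed
  qed
qed

lemma unique_derivatives_TI:
  fixes U :: "'a::euclidean_space set"
  assumes U: "open U" and t0: "t0 > 0"
  shows "unique_derivatives (TI U t0)"
  unfolding unique_derivatives_def
proof (intro ballI allI impI)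
  fix p :: "'a \<times> 'a \<times> real" and f :: "'a \<times> 'a \<times> real \<Rightarrow> real" and f' f''
  assume p: "p \<in> TI U t0" and f: "(f has_derivative f') (at p within TI U t0)" "(f has_derivative f'') (at p within TI U t0)"
  obtain x v t where pt: "p = (x, v, t)" "x \<in> U" "0 \<le> t" "t \<le> t0" using p by (auto simp: TI_def)
  show "f' = f''"
  proof (rule frechet_derivative_unique_within[OF f])
    fix i :: "'a \<times> 'a \<times> real" and e :: real assume i: "i \<in> Basis" and e: "e > 0"
    consider b where "b \<in> Basis" "i = (b, 0, 0)" | b where "i = (0, b, 0)" | "i = (0, 0, 1)"
      using i by (auto simp: Basis_prod_def zero_prod_def)
    then show "\<exists>d. 0 < \<bar>d\<bar> \<and> \<bar>d\<bar> < e \<and> p + d *\<^sub>R i \<in> TI U t0"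
    proof cases
      case 1
      obtain r where r: "r > 0" "ball x r \<subseteq> U" using U pt by (meson openE)
      define d where "d = min r e / 2"
      have "d > 0" "d < e" "d < r" using r e by (auto simp: d_def)
      moreover have "x + d *\<^sub>R b \<in> ball x r" using 1 \<open>d > 0\<close> \<open>d < r\<close> by (simp add: dist_norm)
      ultimately show ?thesis using r pt 1 by (intro exI[of _ d]) (auto simp: TI_def)
    next
      case 2
      then show ?thesis using pt e by (intro exI[of _ "e / 2"]) (auto simp: TI_def)
    next
      case 3
      define d where "d = (if t < t0 then min (t0 - t) e / 2 else - min t e / 2)"
      have "0 < \<bar>d\<bar>" "\<bar>d\<bar> < e" "0 \<le> t + d" "t + d \<le> t0"
        using pt e t0 by (auto simp: d_def min_def field_simps)
      then show ?thesis using pt 3 by (intro exI[of _ d]) (auto simp: TI_def)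
    qed
  qed
qed

lemma smooth_has_derivative:
  assumes "\<psi> \<in> smooth A" "p \<in> A"
  shows "(\<psi> has_derivative frechet_derivative \<psi> (at p within A)) (at p within A)"
proof -
  have "iter_deriv A [] \<psi> differentiable_on A" using assms(1) unfolding smooth_def by blast
  then show ?thesis using assms(2) by (simp add: differentiable_on_def frechet_derivative_works)
qed

lemma continuous_on_d_sigma:
  fixes U :: "'a::euclidean_space set"
  assumes "\<psi> \<in> smooth (BI U t0)"
  shows "continuous_on (TI U t0) (d_sigma U t0 \<psi>)"
proof -
  let ?D = "\<lambda>b q. iter_deriv (BI U t0) [b] \<psi> q"
  have "continuous_on (BI U t0) (?D b)" for b
  proof -
    have "iter_deriv (BI U t0) [b] \<psi> differentiable_on BI U t0" using assms unfolding smooth_def by blast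
    then show ?thesis by (rule differentiable_imp_continuous_on)
  qed
  then have "continuous_on (TI U t0) (\<lambda>p. ?D b (fst p, snd (snd p)))" for b
    by (rule continuous_on_compose2) (auto simp: TI_def BI_def intro!: continuous_intros)
  then have c: "continuous_on (TI U t0) (\<lambda>p. \<Sum>b\<in>Basis. ((fst (snd p), 1::real) \<bullet> b) * ?D b (fst p, snd (snd p)))"
    by (intro continuous_intros) auto
  show ?thesis
  proof (rule continuous_on_cong[THEN iffD1, OF refl _ c])
    fix p assume "p \<in> TI U t0"
    then obtain x v t where p: "p = (x, v, t)" "(x, t) \<in> BI U t0" by (auto simp: TI_def BI_def)
    let ?f = "frechet_derivative \<psi> (at (x, t) within BI U t0)"
    have l: "linear ?f" using smooth_has_derivative[OF assms p(2)] by (rule has_derivative_linear)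
    have "?f (v, 1) = ?f (\<Sum>b\<in>Basis. ((v, 1::real) \<bullet> b) *\<^sub>R b)" by (simp only: euclidean_representation)
    also have "\<dots> = (\<Sum>b\<in>Basis. ((v, 1::real) \<bullet> b) * ?f b)" by (simp add: linear_sum[OF l] linear_scale[OF l])
    finally show "(\<Sum>b\<in>Basis. ((fst (snd p), 1::real) \<bullet> b) * ?D b (fst p, snd (snd p))) = d_sigma U t0 \<psi> p"
      by (simp add: d_sigma_def p)
  qed
qed

text \<open>Finiteness and a null complement are directly stable under nonnegative combinations,
  unlike a statement about supports; \<open>closed_on_imp_closed_measures\<close> and
  \<open>closed_measures_imp_closed_on\<close> translate between the two views.\<close>

definition concentrated_on :: "'p::euclidean_space set \<Rightarrow> 'p measure \<Rightarrow> bool" where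
  "concentrated_on Q \<nu> \<longleftrightarrow> sets \<nu> = sets borel \<and> emeasure \<nu> UNIV < \<infinity> \<and> emeasure \<nu> (- Q) = 0"

lemma concentrated_on_AE:
  assumes "concentrated_on Q \<nu>" "closed Q" shows "AE p in \<nu>. p \<in> Q"
proof (rule AE_I[of _ _ "- Q"])
  show "- Q \<in> sets \<nu>" using assms by (auto simp: concentrated_on_def)
qed (use assms in \<open>auto simp: concentrated_on_def\<close>)

lemma concentrated_on_integrable:
  fixes g :: "'p::euclidean_space \<Rightarrow> real"
  assumes \<nu>: "concentrated_on Q \<nu>" and Q: "compact Q" "Q \<subseteq> A" and A: "A \<in> sets borel" and g: "continuous_on A g"
  shows "set_integrable \<nu> A g"
proof -
  interpret finite_measure \<nu>
    using \<nu> sets_eq_imp_space_eq[of \<nu> borel] by (intro finite_measureI) (auto simp: concentrated_on_def less_top)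
  have "bounded (g ` Q)" by (intro compact_imp_bounded compact_continuous_image continuous_on_subset[OF g] Q)
  then obtain B where B: "\<And>q. q \<in> Q \<Longrightarrow> \<bar>g q\<bar> \<le> B" unfolding bounded_iff by (metis image_eqI real_norm_def)
  have "(\<lambda>p. indicator A p *\<^sub>R g p) \<in> borel_measurable borel"
    by (rule borel_measurable_continuous_on_indicator[OF A g])
  then have m: "(\<lambda>p. indicator A p *\<^sub>R g p) \<in> borel_measurable \<nu>"
    using \<nu> measurable_cong_sets[of \<nu> borel borel borel] by (auto simp: concentrated_on_def)
  have "AE p in \<nu>. norm (indicator A p *\<^sub>R g p) \<le> B"
    using concentrated_on_AE[OF \<nu> compact_imp_closed[OF Q(1)]]
    by eventually_elim (use B Q in auto)
  then show ?thesis unfolding set_integrable_def using m by (intro integrable_const_bound)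
qed

lemma concentrated_on_comb:
  assumes "concentrated_on Q \<mu>" "concentrated_on Q \<nu>" "closed Q"
  shows "concentrated_on Q (comb_measure a \<mu> b \<nu>)"
  using assms by (auto simp: concentrated_on_def emeasure_comb_measure ennreal_mult_less_top)

lemma set_integral_comb:
  fixes g :: "'p::euclidean_space \<Rightarrow> real"
  assumes "sets \<nu> = sets \<mu>" "set_integrable \<mu> A g" "set_integrable \<nu> A g" "0 \<le> a" "0 \<le> b"
  shows "(LINT p:A|comb_measure a \<mu> b \<nu>. g p) = a * (LINT p:A|\<mu>. g p) + b * (LINT p:A|\<nu>. g p)"
  using has_bochner_integral_comb_measure[OF assms(1) assms(2,3)[unfolded set_integrable_def] assms(4,5)]
  by (simp add: set_lebesgue_integral_def has_bochner_integral_iff)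

text \<open>Every point off the support has a null neighbourhood from a countable basis, so the
  complement is a countable union of null sets.\<close>

lemma emeasure_outside_support:
  fixes M :: "'p::euclidean_space measure"
  assumes "sets M = sets borel"
  shows "emeasure M (- measure_support M) = 0"
proof -
  obtain B :: "'p set set" where B: "countable B" "topological_basis B" using ex_countable_basis by blast
  define N where "N = {b\<in>B. emeasure M b = 0}"
  have "- measure_support M = \<Union>N"
  proof (intro equalityI subsetI)
    fix p assume "p \<in> - measure_support M"
    then obtain W where W: "open W" "p \<in> W" "emeasure M W = 0"
      unfolding measure_support_def by (auto simp: zero_less_iff_neq_zero)
    obtain b where b: "b \<in> B" "p \<in> b" "b \<subseteq> W" using topological_basisE[OF B(2) W(1,2)] by blast
    have "emeasure M b \<le> emeasure M W" using W assms b by (intro emeasure_mono) auto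
    with W b show "p \<in> \<Union>N" by (auto simp: N_def)
  next
    fix p assume "p \<in> \<Union>N"
    then obtain b where b: "b \<in> B" "p \<in> b" "emeasure M b = 0" by (auto simp: N_def)
    then show "p \<in> - measure_support M" 
      unfolding measure_support_def using topological_basis_open[OF B(2) b(1)] by auto
  qed
  moreover have "countable N" using B by (auto simp: N_def intro: countable_subset)
  then have "(\<Union>b\<in>N. b) \<in> null_sets M"
    by (rule null_sets_UN') (use topological_basis_open[OF B(2)] assms in \<open>auto simp: N_def null_sets_def\<close>)
  ultimately show ?thesis by auto
qed

lemma measure_support_subset:
  assumes "closed Q" "emeasure M (- Q) = 0" shows "measure_support M \<subseteq> Q"
  using assms unfolding measure_support_def by (force simp: open_Compl)

lemma closed_measure_support: "closed (measure_support M)"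
proof -
  have "- measure_support M = \<Union>{W. open W \<and> emeasure M W = 0}"
    by (auto simp: measure_support_def zero_less_iff_neq_zero)
  then show ?thesis by (metis (mono_tags, lifting) closed_def mem_Collect_eq open_Union)
qed

text \<open>For a fixed compact \<open>Q \<subseteq> TI U t0\<close> these measures form a convex
  cone on which continuous functions are integrable, the form that the minimax argument
  requires.\<close>

definition closed_on :: "'a::euclidean_space set \<Rightarrow> real \<Rightarrow> ('a \<times> 'a \<times> real) set \<Rightarrow> ('a \<times> 'a \<times> real) measure \<Rightarrow> bool" where
  "closed_on U t0 Q \<nu> \<longleftrightarrow> concentrated_on Q \<nu> \<and>
     (\<forall>\<psi>\<in>smooth (BI U t0). (\<forall>x\<in>U. \<psi> (x, 0) = 0 \<and> \<psi> (x, t0) = 0) \<longrightarrow>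
        (LINT p:TI U t0|\<nu>. d_sigma U t0 \<psi> p) = 0)"

lemma closed_on_imp_closed_measures:
  assumes "closed_on U t0 Q \<nu>" "compact Q" "Q \<subseteq> TI U t0"
  shows "\<nu> \<in> closed_measures U t0"
proof -
  have Q: "measure_support \<nu> \<subseteq> Q"
    by (rule measure_support_subset) (use assms compact_imp_closed in \<open>auto simp: closed_on_def concentrated_on_def\<close>)
  have "compact (measure_support \<nu>)"
    using compact_Int_closed[OF assms(2) closed_measure_support[of \<nu>]] Q by (simp add: Int_absorb1)
  moreover have "emeasure \<nu> K < \<infinity>" if "compact K" for K
    using assms emeasure_mono[of K UNIV \<nu>] 
    by (auto simp: closed_on_def concentrated_on_def intro: le_less_trans)
  ultimately show ?thesis using assms Q
    by (auto simp: closed_measures_def radon_measure_def closed_on_def concentrated_on_def)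
qed

text \<open>Compactness of the support makes \<open>\<mu>\<close> finite: the Radon property bounds
  the mass of the support, and the rest of the space is null.\<close>

lemma closed_measures_imp_closed_on:
  assumes "\<mu> \<in> closed_measures U t0" "measure_support \<mu> \<subseteq> Q" "closed Q"
  shows "closed_on U t0 Q \<mu>"
proof -
  let ?S = "measure_support \<mu>"
  have s: "sets \<mu> = sets borel" and fin: "emeasure \<mu> ?S < \<infinity>"
    using assms(1) by (auto simp: closed_measures_def radon_measure_def)
  have S: "?S \<in> sets \<mu>" "- ?S \<in> sets \<mu>" using closed_measure_support[of \<mu>] s by auto
  have z: "emeasure \<mu> (- ?S) = 0" by (rule emeasure_outside_support[OF s])
  have "emeasure \<mu> (?S \<union> - ?S) \<le> emeasure \<mu> ?S + emeasure \<mu> (- ?S)" by (rule emeasure_subadditive[OF S])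
  then have "emeasure \<mu> UNIV < \<infinity>" using fin z by simp
  moreover have "emeasure \<mu> (- Q) = 0"
    using emeasure_mono[of "- Q" "- ?S" \<mu>] assms(2) S z by auto
  ultimately show ?thesis using assms s by (auto simp: closed_on_def concentrated_on_def closed_measures_def)
qed

lemma closed_on_comb:
  fixes U :: "'a::euclidean_space set"
  assumes \<mu>: "closed_on U t0 Q \<mu>" and \<nu>: "closed_on U t0 Q \<nu>" and Q: "compact Q" "Q \<subseteq> TI U t0" and U: "open U" and ab: "0 \<le> a" "0 \<le> b"
  shows "closed_on U t0 Q (comb_measure a \<mu> b \<nu>)"
  unfolding closed_on_def
proof (intro conjI ballI impI)
  note c = \<mu>[unfolded closed_on_def, THEN conjunct1] \<nu>[unfolded closed_on_def, THEN conjunct1]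
  show "concentrated_on Q (comb_measure a \<mu> b \<nu>)"
    by (rule concentrated_on_comb[OF c compact_imp_closed[OF Q(1)]])
  fix \<psi> assume \<psi>: "\<psi> \<in> smooth (BI U t0)" "\<forall>x\<in>U. \<psi> (x, 0) = 0 \<and> \<psi> (x, t0) = 0"
  have s: "sets \<nu> = sets \<mu>" using c by (simp add: concentrated_on_def)
  note i = concentrated_on_integrable[OF _ Q TI_borel[OF U] continuous_on_d_sigma[OF \<psi>(1)]]
  show "(LINT p:TI U t0|comb_measure a \<mu> b \<nu>. d_sigma U t0 \<psi> p) = 0"
    using set_integral_comb[OF s i[OF c(1)] i[OF c(2)] ab] \<mu> \<nu> \<psi> by (simp add: closed_on_def)
qed

text \<open>The occupation measure of a lifted straight segment: the image of Lebesgue measure on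
  \<open>[0, h]\<close>, hence of total mass \<open>h\<close> when \<open>h \<ge> 0\<close>.\<close>

definition segment_measure :: "'a::euclidean_space \<Rightarrow> 'a \<Rightarrow> real \<Rightarrow> real \<Rightarrow> ('a \<times> 'a \<times> real) measure" where
  "segment_measure x v t h =
     distr (density lborel (\<lambda>\<tau>. ennreal (indicator {0..h} \<tau>))) borel (\<lambda>\<tau>. (x + \<tau> *\<^sub>R v, v, t + \<tau>))"

lemma sets_segment_measure [simp]: "sets (segment_measure x v t h) = sets borel"
  by (simp add: segment_measure_def)

lemma borel_measurable_segment:
  fixes x v :: "'a::euclidean_space"
  shows "(\<lambda>\<tau>::real. (x + \<tau> *\<^sub>R v, v, t + \<tau>)) \<in> borel_measurable borel"
  by (intro borel_measurable_continuous_onI continuous_intros)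

lemma emeasure_segment_measure:
  assumes "A \<in> sets borel"
  shows "emeasure (segment_measure x v t h) A = emeasure lborel ({0..h} \<inter> (\<lambda>\<tau>. (x + \<tau> *\<^sub>R v, v, t + \<tau>)) -` A)"
proof -
  let ?g = "\<lambda>\<tau>::real. (x + \<tau> *\<^sub>R v, v, t + \<tau>)"
  have m: "?g -` A \<in> sets borel"
    using measurable_sets[OF borel_measurable_segment assms, of x v t] by simp
  have "emeasure (segment_measure x v t h) A = (\<integral>\<^sup>+\<tau>. indicator {0..h} \<tau> * indicator (?g -` A) \<tau> \<partial>lborel)"
    unfolding segment_measure_def using assms m
    by (simp add: emeasure_distr borel_measurable_segment emeasure_density ennreal_indicator)
  also have "\<dots> = (\<integral>\<^sup>+\<tau>. indicator ({0..h} \<inter> ?g -` A) \<tau> \<partial>lborel)"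
    by (simp add: indicator_inter_arith)
  finally show ?thesis using m by simp
qed

lemma integral_segment_measure:
  fixes f :: "'a::euclidean_space \<times> 'a \<times> real \<Rightarrow> real"
  assumes "f \<in> borel_measurable borel"
  shows "integral\<^sup>L (segment_measure x v t h) f = (\<integral>\<tau>. indicator {0..h} \<tau> *\<^sub>R f (x + \<tau> *\<^sub>R v, v, t + \<tau>) \<partial>lborel)"
proof -
  have m: "(\<lambda>\<tau>. f (x + \<tau> *\<^sub>R v, v, t + \<tau>)) \<in> borel_measurable borel"
    by (rule measurable_compose[OF borel_measurable_segment assms])
  have "integral\<^sup>L (segment_measure x v t h) f =
     (\<integral>\<tau>. f (x + \<tau> *\<^sub>R v, v, t + \<tau>) \<partial>density lborel (\<lambda>\<tau>. ennreal (indicator {0..h} \<tau>)))"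
    unfolding segment_measure_def by (rule integral_distr) (use assms borel_measurable_segment in auto)
  also have "\<dots> = (\<integral>\<tau>. indicator {0..h} \<tau> *\<^sub>R f (x + \<tau> *\<^sub>R v, v, t + \<tau>) \<partial>lborel)"
    by (rule integral_density) (use m in auto)
  finally show ?thesis .
qed

lemma segment_in:
  assumes "closed_segment x (x + h *\<^sub>R v) \<subseteq> D" "0 \<le> \<tau>" "\<tau> \<le> h"
  shows "x + \<tau> *\<^sub>R v \<in> D"
proof (cases "h = 0")
  case True
  then show ?thesis using assms by auto
next
  case False
  then have "x + \<tau> *\<^sub>R v \<in> closed_segment x (x + h *\<^sub>R v)"
    using assms(2,3) by (auto simp: in_segment algebra_simps intro!: exI[of _ "\<tau> / h"])
  then show ?thesis using assms(1) by blast
qed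

lemma concentrated_on_segment:
  fixes D :: "'a::euclidean_space set"
  assumes "closed_segment x (x + h *\<^sub>R v) \<subseteq> D" "norm v \<le> R" "0 \<le> t" "t + h \<le> t0" "0 \<le> h" "closed D"
  shows "concentrated_on (D \<times> cball (0::'a) R \<times> {0..t0}) (segment_measure x v t h)"
proof -
  let ?g = "\<lambda>\<tau>::real. (x + \<tau> *\<^sub>R v, v, t + \<tau>)"
  let ?Q = "D \<times> cball (0::'a) R \<times> {0..t0}"
  have "closed ?Q" by (intro closed_Times assms) auto
  then have b: "- ?Q \<in> sets borel" by auto
  have "{0..h} \<inter> ?g -` (- ?Q) = {}" using segment_in[OF assms(1)] assms by auto
  then have "emeasure (segment_measure x v t h) (- ?Q) = 0"
    by (simp only: emeasure_segment_measure[OF b] emeasure_empty)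
  moreover have "emeasure (segment_measure x v t h) UNIV < \<infinity>"
    using assms by (simp add: emeasure_segment_measure)
  ultimately show ?thesis by (simp add: concentrated_on_def)
qed

text \<open>Along the lifted segment \<open>d\<psi> \<circ> \<sigma>\<close> is the time derivative
  of \<open>\<psi>\<close>, so the integral is a boundary term.\<close>

lemma d_sigma_segment:
  fixes U :: "'a::euclidean_space set"
  assumes U: "open U" and \<psi>: "\<psi> \<in> smooth (BI U t0)"
    and s: "closed_segment x (x + h *\<^sub>R v) \<subseteq> U" and t: "0 \<le> t" "t + h \<le> t0" "0 \<le> h"
  shows "(LINT p:TI U t0|segment_measure x v t h. d_sigma U t0 \<psi> p) = \<psi> (x + h *\<^sub>R v, t + h) - \<psi> (x, t)"
proof -
  let ?g = "\<lambda>\<tau>::real. (x + \<tau> *\<^sub>R v, v, t + \<tau>)"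
  let ?b = "\<lambda>\<tau>::real. (x + \<tau> *\<^sub>R v, t + \<tau>)"
  have m: "(\<lambda>p. indicator (TI U t0) p *\<^sub>R d_sigma U t0 \<psi> p) \<in> borel_measurable borel"
    by (rule borel_measurable_continuous_on_indicator[OF TI_borel[OF U] continuous_on_d_sigma[OF \<psi>]])
  have inU: "?g \<tau> \<in> TI U t0" "?b \<tau> \<in> BI U t0" if "\<tau> \<in> {0..h}" for \<tau>
    using segment_in[OF s, of \<tau>] that t by (auto simp: TI_def BI_def)
  have "(LINT p:TI U t0|segment_measure x v t h. d_sigma U t0 \<psi> p)
    = (\<integral>\<tau>. indicator {0..h} \<tau> *\<^sub>R (indicator (TI U t0) (?g \<tau>) *\<^sub>R d_sigma U t0 \<psi> (?g \<tau>)) \<partial>lborel)"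
    unfolding set_lebesgue_integral_def by (rule integral_segment_measure[OF m])
  also have "\<dots> = (\<integral>\<tau>. indicator {0..h} \<tau> *\<^sub>R d_sigma U t0 \<psi> (?g \<tau>) \<partial>lborel)"
    by (rule Bochner_Integration.integral_cong) (use inU in \<open>auto simp: indicator_def\<close>)
  also have "\<dots> = \<psi> (?b h) - \<psi> (?b 0)"
  proof (rule integral_FTC_Icc[OF t(3)])
    show "continuous_on {0..h} (\<lambda>\<tau>. d_sigma U t0 \<psi> (?g \<tau>))"
      by (rule continuous_on_compose2[OF continuous_on_d_sigma[OF \<psi>]])
         (use inU in \<open>auto intro!: continuous_intros\<close>)
    fix \<tau> assume \<tau>: "0 \<le> \<tau>" "\<tau> \<le> h"
    let ?D = "frechet_derivative \<psi> (at (?b \<tau>) within BI U t0)"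
    have "(?b has_derivative (\<lambda>k. k *\<^sub>R (v, 1))) (at \<tau> within {0..h})"
      by (auto intro!: derivative_eq_intros)
    moreover have "(\<psi> has_derivative ?D) (at (?b \<tau>) within ?b ` {0..h})"
      by (rule has_derivative_subset[OF smooth_has_derivative[OF \<psi> inU(2)]]) (use \<tau> inU in auto)
    ultimately have "((\<lambda>\<tau>. \<psi> (?b \<tau>)) has_derivative (\<lambda>k. ?D (k *\<^sub>R (v, 1)))) (at \<tau> within {0..h})"
      by (rule has_derivative_in_compose)
    moreover have "?D (k *\<^sub>R (v, 1)) = k *\<^sub>R ?D (v, 1)" for k
      by (rule linear_scale[OF has_derivative_linear[OF smooth_has_derivative[OF \<psi> inU(2)]]]) (use \<tau> in auto)
    ultimately show "((\<lambda>\<tau>. \<psi> (?b \<tau>)) has_vector_derivative d_sigma U t0 \<psi> (?g \<tau>)) (at \<tau> within {0..h})"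
      unfolding has_vector_derivative_def d_sigma_def by simp
  qed
  finally show ?thesis by simp
qed

lemma segment_integral_le:
  fixes \<phi> :: "'a::euclidean_space \<times> 'a \<times> real \<Rightarrow> real"
  assumes Q: "compact D" and \<phi>: "continuous_on (D \<times> cball (0::'a) R \<times> {0..t0}) \<phi>"
    and s: "closed_segment x (x + h *\<^sub>R v) \<subseteq> D" "norm v \<le> R" "0 \<le> t" "t + h \<le> t0" "0 \<le> h"
    and b: "\<And>\<tau>. 0 \<le> \<tau> \<Longrightarrow> \<tau> \<le> h \<Longrightarrow> \<phi> (x + \<tau> *\<^sub>R v, v, t + \<tau>) \<le> c"
  shows "(LINT p:D \<times> cball (0::'a) R \<times> {0..t0}|segment_measure x v t h. \<phi> p) \<le> h * c"
proof -
  let ?Q = "D \<times> cball (0::'a) R \<times> {0..t0}"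
  let ?g = "\<lambda>\<tau>::real. (x + \<tau> *\<^sub>R v, v, t + \<tau>)"
  have "closed ?Q" by (intro closed_Times compact_imp_closed[OF Q]) auto
  then have m: "(\<lambda>p. indicator ?Q p *\<^sub>R \<phi> p) \<in> borel_measurable borel"
    by (intro borel_measurable_continuous_on_indicator \<phi>) auto
  have inQ: "?g \<tau> \<in> ?Q" if "\<tau> \<in> {0..h}" for \<tau> using segment_in[OF s(1), of \<tau>] that s by auto
  have "(LINT p:?Q|segment_measure x v t h. \<phi> p) 
    = (\<integral>\<tau>. indicator {0..h} \<tau> *\<^sub>R (indicator ?Q (?g \<tau>) *\<^sub>R \<phi> (?g \<tau>)) \<partial>lborel)"
    unfolding set_lebesgue_integral_def by (rule integral_segment_measure[OF m])
  also have "\<dots> = (\<integral>\<tau>. indicator {0..h} \<tau> *\<^sub>R \<phi> (?g \<tau>) \<partial>lborel)"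
    by (rule Bochner_Integration.integral_cong) (use inQ in \<open>auto simp: indicator_def\<close>)
  also have "\<dots> \<le> (\<integral>\<tau>. indicator {0..h} \<tau> *\<^sub>R c \<partial>lborel)"
  proof (rule integral_mono)
    show "integrable lborel (\<lambda>\<tau>. indicator {0..h} \<tau> *\<^sub>R \<phi> (?g \<tau>))"
      by (rule borel_integrable_compact) 
         (use inQ in \<open>auto intro!: continuous_on_compose2[OF \<phi>] continuous_intros\<close>)
    show "integrable lborel (\<lambda>\<tau>. indicator {0..h} \<tau> *\<^sub>R c)"
      by (rule borel_integrable_compact) auto
  qed (use b in \<open>auto simp: indicator_def\<close>)
  also have "\<dots> = h * c" using s by simp
  finally show ?thesis .
qed

lemma concentrated_on_subset:
  assumes "concentrated_on Q \<nu>" "closed Q" "Q \<subseteq> Q'" "closed Q'"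
  shows "concentrated_on Q' \<nu>"
proof -
  have "emeasure \<nu> (- Q') \<le> emeasure \<nu> (- Q)"
    using assms by (intro emeasure_mono) (auto simp: concentrated_on_def)
  then show ?thesis using assms by (auto simp: concentrated_on_def)
qed

text \<open>Add the occupation measures of the segments. The boundary terms telescope, so a chain
  that reaches time \<open>t0\<close> inside \<open>U\<close> yields a closed measure. The
  hypothesis on \<open>cst\<close> charges each step at least the integral of \<open>\<phi>\<close>
  along it.\<close>

proposition chain_measure:
  fixes D U :: "'a::euclidean_space set"
  assumes U: "open U" and D: "compact D" "D \<subseteq> U" and t0: "t0 > 0"
    and \<phi>: "continuous_on (D \<times> cball (0::'a) R \<times> {0..t0}) \<phi>"
    and cst: "\<And>x v t h \<tau>. norm v \<le> R \<Longrightarrow> 0 \<le> t \<Longrightarrow> t + h \<le> t0 \<Longrightarrow> closed_segment x (x + h *\<^sub>R v) \<subseteq> D \<Longrightarrow>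
       0 \<le> \<tau> \<Longrightarrow> \<tau> \<le> h \<Longrightarrow> h * \<phi> (x + \<tau> *\<^sub>R v, v, t + \<tau>) \<le> cst x v t h"
    and ch: "chain D R cst x t c" "t \<le> t0"
  shows "\<exists>\<nu>. \<exists>x0\<in>D. concentrated_on (D \<times> cball (0::'a) R \<times> {0..t0}) \<nu> \<and>
    (\<forall>\<psi>\<in>smooth (BI U t0). (LINT p:TI U t0|\<nu>. d_sigma U t0 \<psi> p) = \<psi> (x, t) - \<psi> (x0, 0)) \<and>
    (LINT p:D \<times> cball (0::'a) R \<times> {0..t0}|\<nu>. \<phi> p) \<le> c"
  using ch
proof (induction rule: chain.induct)
  case (chain_start x)
  then show ?case
    by (intro exI[of _ "null_measure borel"] bexI[of _ x]) 
       (auto simp: concentrated_on_def set_lebesgue_integral_def)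
next
  case (chain_step x t c v h)
  let ?Q = "D \<times> cball (0::'a) R \<times> {0..t0}"
  have Q: "compact ?Q" "?Q \<subseteq> TI U t0" using D by (auto simp: TI_def intro!: compact_Times)
  have t: "0 \<le> t" "t + h \<le> t0" using chain_step chain_time_nonneg[of D R cst x t c] by auto
  obtain \<nu> x0 where \<nu>: "x0 \<in> D" "concentrated_on ?Q \<nu>"
    "\<And>\<psi>. \<psi> \<in> smooth (BI U t0) \<Longrightarrow> (LINT p:TI U t0|\<nu>. d_sigma U t0 \<psi> p) = \<psi> (x, t) - \<psi> (x0, 0)"
    "(LINT p:?Q|\<nu>. \<phi> p) \<le> c"
    using chain_step t by auto
  let ?s = "segment_measure x v t h"
  let ?n = "comb_measure 1 \<nu> 1 ?s"
  have s: "concentrated_on ?Q ?s"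
    by (rule concentrated_on_segment) (use chain_step t D in \<open>auto intro: compact_imp_closed\<close>)
  have sets: "sets ?s = sets \<nu>" using \<nu>(2) by (simp add: concentrated_on_def)
  have 1: "concentrated_on ?Q ?n" by (rule concentrated_on_comb[OF \<nu>(2) s compact_imp_closed[OF Q(1)]])
  have 2: "(LINT p:TI U t0|?n. d_sigma U t0 \<psi> p) = \<psi> (x + h *\<^sub>R v, t + h) - \<psi> (x0, 0)"
    if \<psi>: "\<psi> \<in> smooth (BI U t0)" for \<psi>
  proof -
    note i = concentrated_on_integrable[OF _ Q TI_borel[OF U] continuous_on_d_sigma[OF \<psi>]]
    have "(LINT p:TI U t0|?n. d_sigma U t0 \<psi> p) = 
       1 * (LINT p:TI U t0|\<nu>. d_sigma U t0 \<psi> p) + 1 * (LINT p:TI U t0|?s. d_sigma U t0 \<psi> p)"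
      by (rule set_integral_comb[OF sets i[OF \<nu>(2)] i[OF s]]) auto
    also have "(LINT p:TI U t0|?s. d_sigma U t0 \<psi> p) = \<psi> (x + h *\<^sub>R v, t + h) - \<psi> (x, t)"
      by (rule d_sigma_segment[OF U \<psi>]) (use chain_step D t in auto)
    finally show ?thesis using \<nu>(3)[OF \<psi>] by simp
  qed
  have Qb: "?Q \<in> sets borel" using compact_imp_closed[OF Q(1)] by auto
  note i = concentrated_on_integrable[OF _ Q(1) order_refl Qb \<phi>]
  have 3: "(LINT p:?Q|?n. \<phi> p) \<le> c + cst x v t h"
  proof -
    have "(LINT p:?Q|?n. \<phi> p) = 1 * (LINT p:?Q|\<nu>. \<phi> p) + 1 * (LINT p:?Q|?s. \<phi> p)"
      by (rule set_integral_comb[OF sets i[OF \<nu>(2)] i[OF s]]) auto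
    also have "(LINT p:?Q|?s. \<phi> p) \<le> cst x v t h"
    proof (cases "h = 0")
      case True
      then show ?thesis 
        using segment_integral_le[OF D(1) \<phi> chain_step.hyps(4,2) t chain_step.hyps(3), of "\<phi> (x, v, t)"]
          cst[OF chain_step.hyps(2) t chain_step.hyps(4), of 0] by simp
    next
      case False
      then have h: "h > 0" using chain_step by simp
      have "(LINT p:?Q|?s. \<phi> p) \<le> h * (cst x v t h / h)"
        by (rule segment_integral_le[OF D(1) \<phi> chain_step.hyps(4,2) t chain_step.hyps(3)])
           (use cst[OF chain_step.hyps(2) t chain_step.hyps(4)] h in \<open>simp add: pos_le_divide_eq mult.commute\<close>)
      then show ?thesis using h by simp
    qed
    finally show ?thesis using \<nu>(4) by simp
  qed
  show ?case using \<nu>(1) 1 2 3 by blast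
qed

section \<open>Forward and backward value functions\<close>

text \<open>Bisect a long step until its parts are short; by \<open>cost_split\<close> the parts
  cost together no more than the step.\<close>

lemma (in lagrangian) subsolution_of_short_steps:
  assumes h0: "h0 > 0" 
    and w: "\<And>x v t h. norm v \<le> R \<Longrightarrow> 0 \<le> h \<Longrightarrow> h \<le> h0 \<Longrightarrow> 0 \<le> t \<Longrightarrow> t + h \<le> T \<Longrightarrow> 
      w (x + h *\<^sub>R v) (t + h) \<le> w x t + cost x v t h"
  shows "subsolution UNIV R cost {0..T} w"
proof -
  have *: "w (x + h *\<^sub>R v) (t + h) \<le> w x t + cost x v t h"
    if "norm v \<le> R" "0 \<le> h" "h \<le> 2 ^ n * h0" "0 \<le> t" "t + h \<le> T" for n x v t h
    using that
  proof (induction n arbitrary: x t h)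
    case 0
    then show ?case by (auto intro: w)
  next
    case (Suc n)
    let ?k = "h / 2"
    have 1: "w (x + ?k *\<^sub>R v) (t + ?k) \<le> w x t + cost x v t ?k" using Suc.prems by (intro Suc.IH) auto
    have 2: "w (x + ?k *\<^sub>R v + ?k *\<^sub>R v) (t + ?k + ?k) \<le> w (x + ?k *\<^sub>R v) (t + ?k) + cost (x + ?k *\<^sub>R v) v (t + ?k) ?k"
      using Suc.prems by (intro Suc.IH) auto
    have 3: "cost x v t ?k + cost (x + ?k *\<^sub>R v) v (t + ?k) ?k \<le> cost x v t (?k + ?k)"
      using Suc.prems by (intro cost_split) auto
    have e: "x + ?k *\<^sub>R v + ?k *\<^sub>R v = x + h *\<^sub>R v" "t + ?k + ?k = t + h" "?k + ?k = h"
      by (simp_all add: scaleR_left_distrib[symmetric] add.assoc)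
    from 1 2 3 show ?case unfolding e by linarith
  qed
  show ?thesis unfolding subsolution_def
  proof (intro allI impI)
    fix x v :: 'a and t h :: real
    assume v: "norm v \<le> R" "0 \<le> h" "t \<in> {0..T}" "t + h \<in> {0..T}"
    obtain n where "h / h0 < 2 ^ n" using real_arch_pow[of 2 "h / h0"] by auto
    then have "h \<le> 2 ^ n * h0" using h0 by (simp add: pos_divide_less_eq)
    then show "w (x + h *\<^sub>R v) (t + h) \<le> w x t + cost x v t h" using * v by auto
  qed
qed

lemma (in lagrangian) lagrangian_reverse: "lagrangian (\<lambda>x v s. L x (- v) (T - s)) R K C B"
proof
  show "\<bar>L x (- v) (T - t) - L y (- v) (T - s)\<bar> \<le> K * (norm (x - y) + \<bar>t - s\<bar>)" if "norm v \<le> R" for x y v s t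
    using lip[of "- v" x "T - t" y "T - s"] that by (simp add: abs_minus_commute)
  show "L (x + d) (- v) (T - (t + h)) + L (x - d) (- v) (T - (t - h)) \<le> 2 * L x (- v) (T - t) + C * ((norm d)\<^sup>2 + h\<^sup>2)"
    if "norm v \<le> R" for x d v t h
    using semiconcave[of "- v" x d "T - t" "- h"] that by (simp add: algebra_simps)
qed (use R K C B lower in auto)

lemma (in lagrangian) V_second_diff:
  assumes "\<bar>h\<bar> \<le> t" "t \<le> T"
  shows "V (x + d) (t + h) + V (x - d) (t - h) \<le> 2 * V x t + (C * T + K + 8 * K1) * ((norm d)\<^sup>2 + h\<^sup>2)"
proof (cases "0 \<le> h")
  case True
  then show ?thesis by (intro V_semiconcave) (use assms in auto)
next
  case False
  then have "V (x + - d) (t + - h) + V (x - - d) (t - - h) \<le> 2 * V x t + (C * T + K + 8 * K1) * ((norm (- d))\<^sup>2 + (- h)\<^sup>2)"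
    by (intro V_semiconcave) (use assms in auto)
  moreover have e: "x + - d = x - d" "t + - h = t - h" "x - - d = x + d" "t - - h = t + h" by simp_all
  ultimately show ?thesis unfolding norm_minus_cancel power2_minus e by argo
qed

lemma half_step_back: "x + h *\<^sub>R v + (h / 2) *\<^sub>R (- v) = x + (h / 2) *\<^sub>R (v::'a::real_vector)"
proof -
  have "(h / 2) *\<^sub>R v + (h / 2) *\<^sub>R v = h *\<^sub>R v" unfolding scaleR_left_distrib[symmetric] by simp
  then show ?thesis by (metis add.assoc add_cancel_right_right add_minus_cancel minus_add_cancel scaleR_minus_right add.commute)
qed

text \<open>The dual situation: a jet nonnegative on all closed measures carried by a tube. The
  radii are used from the inside out: \<open>r\<close> for agreement of extension and jet,
  \<open>2 r\<close> to separate steps handled by \<open>F\<close> from steps paid for by the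
  penalty, \<open>3 r\<close> and \<open>4 r\<close> for the cut-off \<open>\<theta>\<close>,
  \<open>5 r\<close> for the chains.\<close>

locale jet_dual =
  fixes U :: "'a::euclidean_space set" and t0 r R D :: real and S0 :: "'a set"
    and P :: "('a \<times> 'a \<times> real) set" and \<phi> :: "'a \<times> 'a \<times> real \<Rightarrow> real" 
    and G :: "'a \<times> 'a \<times> real \<Rightarrow> 'a \<times> 'a \<times> real"
  assumes U: "open U" and t0: "t0 > 0" and r: "r > 0" and R: "R \<ge> 1"
    and S0: "compact S0" "S0 \<noteq> {}" and K_U: "{x. infdist x S0 \<le> 5 * r} \<subseteq> U"
    and Q_P: "{x. infdist x S0 \<le> 5 * r} \<times> cball 0 R \<times> {0..t0} \<subseteq> P"
    and diam: "\<And>p q. p \<in> P \<Longrightarrow> q \<in> P \<Longrightarrow> norm (p - q) \<le> D"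
    and jet: "is_jet P \<phi> G"
    and nonneg: "\<And>\<nu>. closed_on U t0 ({x. infdist x S0 \<le> 5 * r} \<times> cball 0 R \<times> {0..t0}) \<nu> \<Longrightarrow>
       0 \<le> (LINT p:{x. infdist x S0 \<le> 5 * r} \<times> cball 0 R \<times> {0..t0}|\<nu>. \<phi> p)"
begin

definition \<delta> where "\<delta> x = infdist x S0"
abbreviation Kc where "Kc \<equiv> {x. infdist x S0 \<le> 5 * r}"
abbreviation Qc where "Qc \<equiv> Kc \<times> cball (0::'a) R \<times> {0..t0}"
text \<open>The constant \<open>K1\<close> for a jet, whose Lipschitz constant is 1.\<close>

definition k1 where "k1 = R + 1"
definition cost\<phi> where "cost\<phi> x v t h = h * \<phi> (x + (h / 2) *\<^sub>R v, v, t + h / 2) + k1 * h\<^sup>2"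
text \<open>The chains are confined to the tube, where the jet itself serves as Lagrangian; the
  extension comes in only when \<open>F\<close> is compared with functions on the whole
  space.\<close>

definition F where "F = min_cost Kc R cost\<phi>"
text \<open>A bound for the cost of resting from time 0 to \<open>t0\<close>, the integrand being at
  most 1; it will bound \<open>F\<close> from both sides.\<close>

definition M where "M = t0 + k1 * t0\<^sup>2"
definition \<theta> where "\<theta> x = max 0 (min 1 ((4 * r - \<delta> x) / r))"

lemma \<delta>_lip: "\<bar>\<delta> x - \<delta> y\<bar> \<le> norm (x - y)"
  unfolding \<delta>_def using infdist_triangle_abs[of x S0 y] by (simp add: dist_norm)

lemma \<delta>_step:
  assumes "norm v \<le> R" "\<bar>h\<bar> * R \<le> c" shows "\<bar>\<delta> (x + h *\<^sub>R v) - \<delta> x\<bar> \<le> c"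
proof -
  have "norm (h *\<^sub>R v) \<le> \<bar>h\<bar> * R" using assms by (auto intro: mult_left_mono)
  with \<delta>_lip[of "x + h *\<^sub>R v" x] assms show ?thesis by simp
qed

lemma compact_Kc: "compact Kc"
  by (rule compact_infdist_le) (use S0 r in auto)

lemma k1: "k1 \<ge> 0" using R by (simp add: k1_def)

lemma in_P: "\<delta> x \<le> 5 * r \<Longrightarrow> norm v \<le> R \<Longrightarrow> 0 \<le> t \<Longrightarrow> t \<le> t0 \<Longrightarrow> (x, v, t) \<in> P"
  using Q_P by (auto simp: \<delta>_def)

lemma \<phi>_le1: "p \<in> P \<Longrightarrow> \<bar>\<phi> p\<bar> \<le> 1" by (rule is_jetD(1)[OF jet])

lemma cont_\<phi>: "continuous_on P \<phi>" by (rule jet_continuous[OF jet])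
lemma cont_G: "continuous_on P G" by (rule jet_gradient_continuous[OF jet])

lemma cost\<phi>_le: 
  assumes "\<delta> (x + (h / 2) *\<^sub>R v) \<le> 5 * r" "norm v \<le> R" "0 \<le> t" "t + h \<le> t0" "0 \<le> h"
  shows "cost\<phi> x v t h \<le> h + k1 * h\<^sup>2"
proof -
  have "(x + (h / 2) *\<^sub>R v, v, t + h / 2) \<in> P" by (rule in_P) (use assms in auto)
  from \<phi>_le1[OF this] have "h * \<phi> (x + (h / 2) *\<^sub>R v, v, t + h / 2) \<le> h * 1"
    using assms by (intro mult_left_mono) auto
  then show ?thesis by (simp add: cost\<phi>_def)
qed

text \<open>A chain of full duration carries a closed measure by \<open>chain_measure\<close>; the
  quadratic term of \<open>cost\<phi>\<close> makes up for sampling \<open>\<phi>\<close> at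
  midpoints only. So \<open>nonneg\<close> bounds the cost.\<close>

lemma chain_total_nonneg:
  assumes "chain Kc R cost\<phi> x t0 c" shows "0 \<le> c"
proof -
  have "h * \<phi> (x + \<tau> *\<^sub>R v, v, t + \<tau>) \<le> cost\<phi> x v t h"
    if "norm v \<le> R" "0 \<le> t" "t + h \<le> t0" "closed_segment x (x + h *\<^sub>R v) \<subseteq> Kc" "0 \<le> \<tau>" "\<tau> \<le> h" for x v t h \<tau>
  proof -
    have "x + \<tau> *\<^sub>R v \<in> Kc" by (rule segment_in[OF that(4-6)])
    moreover have "x + (h / 2) *\<^sub>R v \<in> Kc" by (rule segment_in[OF that(4)]) (use that in auto)
    ultimately have p: "(x + \<tau> *\<^sub>R v, v, t + \<tau>) \<in> P" "(x + (h / 2) *\<^sub>R v, v, t + h / 2) \<in> P"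
      using that by (auto intro!: in_P simp: \<delta>_def)
    have "\<phi> (x + \<tau> *\<^sub>R v, v, t + \<tau>) - \<phi> (x + (h / 2) *\<^sub>R v, v, t + h / 2)
       \<le> norm ((x + \<tau> *\<^sub>R v, v, t + \<tau>) - (x + (h / 2) *\<^sub>R v, v, t + h / 2))"
      using is_jetD(3)[OF jet p] by linarith
    also have "\<dots> = norm ((\<tau> - h / 2) *\<^sub>R v, 0::'a, \<tau> - h / 2)" by (simp add: scaleR_left_diff_distrib)
    also have "\<dots> \<le> norm ((\<tau> - h / 2) *\<^sub>R v) + norm (0::'a, \<tau> - h / 2)" by (rule norm_Pair_le)
    also have "\<dots> = \<bar>\<tau> - h / 2\<bar> * norm v + \<bar>\<tau> - h / 2\<bar>" by (simp add: norm_Pair)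
    also have "\<dots> \<le> h * R + h"
      using that R by (intro add_mono mult_mono) (auto simp: abs_le_iff)
    finally have "\<phi> (x + \<tau> *\<^sub>R v, v, t + \<tau>) \<le> \<phi> (x + (h / 2) *\<^sub>R v, v, t + h / 2) + k1 * h"
      by (simp add: k1_def algebra_simps)
    from mult_left_mono[OF this, of h] show ?thesis using that
      by (simp add: cost\<phi>_def power2_eq_square algebra_simps)
  qed
  from chain_measure[OF U compact_Kc K_U t0 continuous_on_subset[OF cont_\<phi> Q_P] this assms order_refl]
  obtain \<nu> x0 where \<nu>: "x0 \<in> Kc" "concentrated_on Qc \<nu>"
    "\<And>\<psi>. \<psi> \<in> smooth (BI U t0) \<Longrightarrow> (LINT p:TI U t0|\<nu>. d_sigma U t0 \<psi> p) = \<psi> (x, t0) - \<psi> (x0, 0)"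
    "(LINT p:Qc|\<nu>. \<phi> p) \<le> c" by blast
  have "x \<in> U" "x0 \<in> U" using chain_in[OF assms] \<nu>(1) K_U by auto
  then have "closed_on U t0 Qc \<nu>" unfolding closed_on_def using \<nu>(2,3) by auto
  from nonneg[OF this] \<nu>(4) show ?thesis by simp
qed

text \<open>Let the chain rest until \<open>t0\<close>: the completed chain has nonnegative cost,
  and resting costs at most \<open>M\<close>.\<close>

lemma chain_bound:
  assumes c: "chain Kc R cost\<phi> x t c" and t: "t \<le> t0" shows "- M \<le> c"
proof -
  have x: "x \<in> Kc" by (rule chain_in[OF c])
  have t': "0 \<le> t" by (rule chain_time_nonneg[OF c])
  have "chain Kc R cost\<phi> (x + (t0 - t) *\<^sub>R 0) (t + (t0 - t)) (c + cost\<phi> x 0 t (t0 - t))"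
    by (rule chain_step[OF c]) (use x t R in auto)
  then have "0 \<le> c + cost\<phi> x 0 t (t0 - t)" using chain_total_nonneg[of x] by simp
  also have "cost\<phi> x 0 t (t0 - t) \<le> (t0 - t) + k1 * (t0 - t)\<^sup>2"
    by (rule cost\<phi>_le) (use x t t' R in \<open>auto simp: \<delta>_def\<close>)
  also have "\<dots> \<le> M" unfolding M_def using t t' k1 
    by (intro add_mono mult_left_mono power_mono) auto
  finally show ?thesis by simp
qed

lemma F_le: "chain Kc R cost\<phi> x t c \<Longrightarrow> t \<le> t0 \<Longrightarrow> F x t \<le> c"
  unfolding F_def min_cost_def by (rule cInf_lower) (auto intro: bdd_belowI[of _ "- M"] chain_bound)

lemma chain_stay: "x \<in> Kc \<Longrightarrow> 0 \<le> t \<Longrightarrow> chain Kc R cost\<phi> x t (cost\<phi> x 0 0 t)"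
  using chain_step[OF chain_start[of x Kc R cost\<phi>], of 0 t] R by simp

lemma F_ge:
  assumes "x \<in> Kc" "0 \<le> t" "\<And>c. chain Kc R cost\<phi> x t c \<Longrightarrow> z \<le> c" shows "z \<le> F x t"
  unfolding F_def min_cost_def 
proof (rule cInf_greatest)
  show "{c. chain Kc R cost\<phi> x t c} \<noteq> {}" using chain_stay[OF assms(1,2)] by blast
qed (use assms in blast)

lemma F_bound: "x \<in> Kc \<Longrightarrow> 0 \<le> t \<Longrightarrow> t \<le> t0 \<Longrightarrow> \<bar>F x t\<bar> \<le> M"
proof -
  assume x: "x \<in> Kc" and t: "0 \<le> t" "t \<le> t0"
  have "F x t \<le> cost\<phi> x 0 0 t" by (rule F_le[OF chain_stay[OF x t(1)] t(2)])
  also have "\<dots> \<le> t + k1 * t\<^sup>2" by (rule cost\<phi>_le) (use x t R in \<open>auto simp: \<delta>_def\<close>)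
  also have "\<dots> \<le> M" unfolding M_def using t k1 by (intro add_mono mult_left_mono power_mono) auto
  finally have "F x t \<le> M" .
  moreover have "- M \<le> F x t" using chain_bound t by (intro F_ge[OF x t(1)]) auto
  ultimately show ?thesis by simp
qed

lemma F_0: "x \<in> Kc \<Longrightarrow> F x 0 \<le> 0"
  using F_le[OF chain_start[of x Kc R cost\<phi>]] t0 by simp

lemma F_t0: "x \<in> Kc \<Longrightarrow> 0 \<le> F x t0"
  by (rule F_ge) (use t0 chain_total_nonneg in auto)

lemma F_step:
  assumes "norm v \<le> R" "0 \<le> h" "0 \<le> t" "t + h \<le> t0" "closed_segment x (x + h *\<^sub>R v) \<subseteq> Kc"
  shows "F (x + h *\<^sub>R v) (t + h) \<le> F x t + cost\<phi> x v t h"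
proof -
  have "F (x + h *\<^sub>R v) (t + h) - cost\<phi> x v t h \<le> F x t"
  proof (rule F_ge)
    show "x \<in> Kc" using assms by auto
    show "F (x + h *\<^sub>R v) (t + h) - cost\<phi> x v t h \<le> c" if "chain Kc R cost\<phi> x t c" for c
      using F_le[OF chain_step[OF that assms(1,2,5)] assms(4)] by simp
  qed fact
  then show ?thesis by simp
qed

lemma M: "M \<ge> 0" unfolding M_def using t0 k1 by simp

lemma \<theta>: "0 \<le> \<theta> x" "\<theta> x \<le> 1" by (auto simp: \<theta>_def)

lemma \<theta>_lip: "\<bar>\<theta> x - \<theta> y\<bar> \<le> \<bar>\<delta> x - \<delta> y\<bar> / r"
proof -
  have "\<bar>\<theta> x - \<theta> y\<bar> \<le> \<bar>(4 * r - \<delta> x) / r - (4 * r - \<delta> y) / r\<bar>"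
    unfolding \<theta>_def by (auto simp: max_def min_def)
  also have "\<dots> = \<bar>\<delta> x - \<delta> y\<bar> / r" using r by (simp add: diff_divide_distrib[symmetric] abs_minus_commute)
  finally show ?thesis .
qed

lemma \<theta>_1: "\<delta> x \<le> 3 * r \<Longrightarrow> \<theta> x = 1" using r by (simp add: \<theta>_def le_divide_eq)
lemma \<theta>_0: "4 * r \<le> \<delta> x \<Longrightarrow> \<theta> x = 0" using r by (simp add: \<theta>_def divide_le_0_iff)

section \<open>The penalised Lagrangian on the whole space\<close>

definition CL where "CL = max 0 D + 2"
text \<open>The denominator is the penalty at distance \<open>r / 2\<close> from \<open>S1\<close>,
  so there \<open>E \<ge> - 2 + (3 + R * M / r)\<close>. Of this, 1 pays for
  \<open>\<phi> \<le> 1\<close> and \<open>R * M / r\<close> for the variation of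
  \<open>\<theta>\<close> times the bound \<open>M\<close> along a curve of speed
  \<open>R\<close>.\<close>

definition \<Lambda> where "\<Lambda> = (3 + R * M / r) / (sqrt (1 + (r / 2)\<^sup>2) - 1)"
definition S1 where "S1 = {x. \<delta> x \<le> r}"
abbreviation E where "E \<equiv> jet_ext P S1 CL \<Lambda> \<phi> G"

lemma pen: "sqrt (1 + (r / 2)\<^sup>2) - 1 > 0" using r by simp

lemma \<Lambda>: "\<Lambda> \<ge> 0" unfolding \<Lambda>_def using pen R M r by simp

lemma jet_extension: "jet_extension P S1 CL \<Lambda> (max 0 D) \<phi> G"
proof
  obtain x where x: "x \<in> S0" using S0 by auto
  then have d: "\<delta> x = 0" by (simp add: \<delta>_def)
  then show "S1 \<noteq> {}" using r by (auto simp: S1_def intro!: exI[of _ x])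
  have "(x, 0, 0) \<in> P" by (rule in_P) (use d r R t0 in auto)
  then show "P \<noteq> {}" by auto
  show "norm (p - q) \<le> max 0 D" if "p \<in> P" "q \<in> P" for p q using diam[OF that] by simp
qed (use jet \<Lambda> in \<open>auto simp: CL_def\<close>)

sublocale je: jet_extension P S1 CL \<Lambda> "max 0 D" \<phi> G by (rule jet_extension)

sublocale lag: lagrangian "\<lambda>x v t. E (x, v, t)" R "1 + CL + \<Lambda>" "CL + \<Lambda>" 2
  by (rule lagrangian_jet_ext[OF jet_extension]) (use R in simp)

lemma k1_le_K1: "k1 \<le> lag.K1"
proof -
  have "1 * (R + 1) \<le> (1 + CL + \<Lambda>) * (R + 1)" using R \<Lambda> by (intro mult_right_mono) (auto simp: CL_def)
  then show ?thesis by (simp add: k1_def lag.K1_def)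
qed

lemma E_far:
  assumes "3 / 2 * r \<le> \<delta> x" shows "1 + R * M / r \<le> E (x, v, t)"
proof -
  have "- 2 + \<Lambda> * (sqrt (1 + (r / 2)\<^sup>2) - 1) \<le> E (x, v, t)"
  proof (rule je.E_penalty)
    fix y assume "y \<in> S1"
    then show "r / 2 \<le> norm (fst (x, v, t) - y)" using \<delta>_lip[of x y] assms by (simp add: S1_def)
  qed (use r in simp)
  moreover have "\<Lambda> * (sqrt (1 + (r / 2)\<^sup>2) - 1) = 3 + R * M / r" using pen by (simp add: \<Lambda>_def)
  ultimately show ?thesis by simp
qed

text \<open>The cut-off turns \<open>F\<close> into a subsolution on the whole space. If
  \<open>\<delta> x \<le> 2 * r\<close>, the cut-off is 1 at both ends of a short step and
  \<open>\<phi> \<le> E\<close> at its midpoint. Farther out the midpoint has distance at least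
  \<open>3 / 2 * r\<close>, where \<open>E\<close> is large enough to pay for \<open>\<phi>\<close>
  and for the change of \<open>\<theta>\<close>.\<close>

lemma subsolution_\<theta>F: "subsolution UNIV R lag.cost {0..t0} (\<lambda>x t. \<theta> x * F x t)"
proof (rule lag.subsolution_of_short_steps)
  show "r / R > 0" using r R by simp
  fix x v :: 'a and t h :: real
  assume v: "norm v \<le> R" and h: "0 \<le> h" "h \<le> r / R" and t: "0 \<le> t" "t + h \<le> t0"
  let ?y = "x + h *\<^sub>R v" and ?m = "x + (h / 2) *\<^sub>R v"
  have hR: "h * R \<le> r" using h R by (simp add: pos_le_divide_eq)
  have seg: "\<bar>\<delta> z - \<delta> x\<bar> \<le> r" if "z \<in> closed_segment x ?y" for z
  proof -
    have "norm (z - x) \<le> norm (h *\<^sub>R v)" using segment_bound(1)[OF that] by (simp add: norm_minus_commute)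
    also have "\<dots> \<le> h * R" using v h by (auto intro: mult_left_mono)
    finally show ?thesis using \<delta>_lip[of z x] hR by simp
  qed
  have y: "\<bar>\<delta> ?y - \<delta> x\<bar> \<le> h * R" by (rule \<delta>_step[OF v]) (use h in simp)
  have m: "\<bar>\<delta> ?m - \<delta> x\<bar> \<le> r / 2" by (rule \<delta>_step[OF v]) (use h hR in simp)
  have m1: "\<delta> ?m \<le> \<delta> x + r / 2" using abs_le_D1[OF m] by argo
  have K1h: "k1 * h\<^sup>2 \<le> lag.K1 * h\<^sup>2" by (intro mult_right_mono k1_le_K1) simp
  have K1h0: "0 \<le> lag.K1 * h\<^sup>2" using lag.K1 by simp
  have \<theta>y: "\<bar>\<theta> ?y - \<theta> x\<bar> \<le> h * R / r" 
    using \<theta>_lip[of ?y x] y r divide_right_mono[OF y, of r] by linarith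
  have far: "h * (1 + R * M / r) \<le> h * E (?m, v, t + h / 2)" if "2 * r < \<delta> x"
  proof -
    have "3 / 2 * r \<le> \<delta> ?m" using abs_le_D2[OF m] that by argo
    then show ?thesis using h by (intro mult_left_mono E_far)
  qed
  \<comment> \<open>The Lipschitz constant \<open>1 / r\<close> of the cut-off meets the bound
    \<open>M\<close> for \<open>F\<close>; the term \<open>R * M / r\<close> in
    \<open>\<Lambda>\<close> is made for this estimate.\<close>
  have smooth_fun: "\<bar>(\<theta> ?y - \<theta> x) * F ?y (t + h)\<bar> \<le> h * R / r * M" if "\<delta> ?y \<le> 5 * r"
    unfolding abs_mult using \<theta>y F_bound[of ?y "t + h"] that t h M by (intro mult_mono) (auto simp: \<delta>_def)
  show "\<theta> ?y * F ?y (t + h) \<le> \<theta> x * F x t + lag.cost x v t h"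
  proof (cases "\<delta> x \<le> 2 * r")
    case True
    have "closed_segment x ?y \<subseteq> Kc" using seg True r by (force simp: \<delta>_def abs_le_iff)
    then have "F ?y (t + h) \<le> F x t + cost\<phi> x v t h" by (intro F_step v h t)
    moreover have "\<theta> ?y = 1" "\<theta> x = 1" using True y hR r by (auto intro!: \<theta>_1 simp: abs_le_iff)
    moreover have "(?m, v, t + h / 2) \<in> P" by (rule in_P) (use True m1 r v t h in auto)
    then have "h * \<phi> (?m, v, t + h / 2) \<le> h * E (?m, v, t + h / 2)"
      using h by (intro mult_left_mono je.E_ge_jet)
    ultimately show ?thesis using K1h unfolding lag.cost_def cost\<phi>_def by simp
  next
    case False
    show ?thesis
    proof (cases "\<delta> x \<le> 4 * r")
      case True
      have "closed_segment x ?y \<subseteq> Kc" using seg True r by (force simp: \<delta>_def abs_le_iff)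
      then have "F ?y (t + h) \<le> F x t + cost\<phi> x v t h" by (intro F_step v h t)
      also have "cost\<phi> x v t h \<le> h + k1 * h\<^sup>2"
        by (rule cost\<phi>_le) (use True m1 r v t h in auto)
      finally have p1: "\<theta> x * F ?y (t + h) \<le> \<theta> x * (F x t + (h + k1 * h\<^sup>2))" by (intro mult_left_mono \<theta>) simp
      have p2: "\<theta> x * (h + k1 * h\<^sup>2) \<le> 1 * (h + k1 * h\<^sup>2)" using h k1 by (intro mult_right_mono \<theta>) auto
      have "\<delta> ?y \<le> 5 * r" using abs_le_D1[OF y] True hR by argo
      then have p3: "(\<theta> ?y - \<theta> x) * F ?y (t + h) \<le> h * R / r * M" by (rule abs_le_D1[OF smooth_fun])
      have p4: "\<theta> ?y * F ?y (t + h) = \<theta> x * F ?y (t + h) + (\<theta> ?y - \<theta> x) * F ?y (t + h)"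
        by (simp add: algebra_simps)
      have p5: "h * (1 + R * M / r) = h + h * R / r * M" by (simp add: algebra_simps)
      have p6: "\<theta> x * (F x t + (h + k1 * h\<^sup>2)) = \<theta> x * F x t + \<theta> x * (h + k1 * h\<^sup>2)" by (rule distrib_left)
      have p7: "h * (1 + R * M / r) \<le> h * E (?m, v, t + h / 2)" using far False by simp
      have "a \<le> p + (e + K)" if "b \<le> q" "w \<le> 1 * (n + k)" "u \<le> s" "a = b + u" "z = n + s" "q = p + w" "z \<le> e" "k \<le> K"
        for a b q w u s z p k K e n :: real using that by argo
      from this[OF p1 p2 p3 p4 p5 p6 p7 K1h] show ?thesis unfolding lag.cost_def .
    next
      case big: False
      have \<theta>x: "\<theta> x = 0" using big by (intro \<theta>_0) simp
      have "\<theta> ?y * F ?y (t + h) \<le> h * R / r * M"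
      proof (cases "\<delta> ?y \<le> 5 * r")
        case True
        then show ?thesis using smooth_fun \<theta>x by simp
      next
        case False
        then have "\<theta> ?y = 0" using r by (intro \<theta>_0) simp
        then show ?thesis using h R r M by simp
      qed
      moreover have "h * (1 + R * M / r) = h + h * R / r * M" by (simp add: algebra_simps)
      ultimately show ?thesis using far False K1h0 h \<theta>x unfolding lag.cost_def by simp
    qed
  qed
qed

sublocale rev: lagrangian "\<lambda>x v s. E (x, - v, t0 - s)" R "1 + CL + \<Lambda>" "CL + \<Lambda>" 2
  by (rule lag.lagrangian_reverse)

lemma rev_cost: "rev.cost (x + h *\<^sub>R v) (- v) (t0 - (t + h)) h = lag.cost x v t h"
proof -
  have "t0 - (t0 - (t + h) + h / 2) = t + h / 2" by simp
  then show ?thesis unfolding rev.cost_def lag.cost_def half_step_back minus_minus by (simp only:)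
qed

definition f where "f = lag.V"
text \<open>Minus the least cost of going from \<open>(x, t)\<close> to time \<open>t0\<close>;
  \<open>rev.V\<close> measures the same curves run backwards from time \<open>t0\<close>.\<close>

definition g where "g x t = - rev.V x (t0 - t)"

lemma f_step: "norm v \<le> R \<Longrightarrow> 0 \<le> h \<Longrightarrow> 0 \<le> t \<Longrightarrow> f (x + h *\<^sub>R v) (t + h) \<le> f x t + lag.cost x v t h"
  unfolding f_def by (rule lag.V_step)

lemma g_step:
  assumes "norm v \<le> R" "0 \<le> h" "0 \<le> t" "t + h \<le> t0"
  shows "g (x + h *\<^sub>R v) (t + h) \<le> g x t + lag.cost x v t h"
proof -
  have "rev.V ((x + h *\<^sub>R v) + h *\<^sub>R (- v)) ((t0 - (t + h)) + h) 
     \<le> rev.V (x + h *\<^sub>R v) (t0 - (t + h)) + rev.cost (x + h *\<^sub>R v) (- v) (t0 - (t + h)) h"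
    by (rule rev.V_step) (use assms in auto)
  moreover have "(x + h *\<^sub>R v) + h *\<^sub>R (- v) = x" "(t0 - (t + h)) + h = t0 - t" by simp_all
  ultimately have "rev.V x (t0 - t) \<le> rev.V (x + h *\<^sub>R v) (t0 - (t + h)) + lag.cost x v t h"
    by (simp only: rev_cost)
  then show ?thesis by (simp add: g_def)
qed

lemma f_0: "f x 0 = 0" by (simp add: f_def lag.V_0)
lemma g_t0: "g x t0 = 0" by (simp add: g_def rev.V_0)

text \<open>Here nonnegativity leaves the tube. Reversed in time and with opposite sign,
  \<open>\<theta> * F\<close> is a subsolution of the reversed problem; \<open>F_t0\<close> gives
  the sign at its start and \<open>F_0\<close> at its end. By maximality no curve of full duration
  has negative cost for \<open>E\<close>.\<close>

lemma rev_V_t0: "0 \<le> rev.V x t0"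
proof -
  have "subsolution UNIV R rev.cost {0..t0} (\<lambda>x s. - (\<theta> x * F x (t0 - s)))"
    unfolding subsolution_def
  proof (intro allI impI)
    fix x v :: 'a and s h :: real
    assume a: "norm v \<le> R" "0 \<le> h" "s \<in> {0..t0}" "s + h \<in> {0..t0}"
    let ?y = "x + h *\<^sub>R v" and ?t = "t0 - (s + h)"
    have e: "?y + h *\<^sub>R (- v) = x" "?t + h = t0 - s" "t0 - (t0 - s) = s" by simp_all
    have "\<theta> (?y + h *\<^sub>R (- v)) * F (?y + h *\<^sub>R (- v)) (?t + h) \<le> \<theta> ?y * F ?y ?t + lag.cost ?y (- v) ?t h"
      by (rule subsolution_\<theta>F[unfolded subsolution_def, rule_format]) (use a in auto)
    then have "\<theta> x * F x (t0 - s) \<le> \<theta> ?y * F ?y ?t + lag.cost ?y (- v) ?t h" unfolding e .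
    moreover have "lag.cost ?y (- v) ?t h = rev.cost x v s h"
      using rev_cost[of ?y h "- v" ?t] unfolding e minus_minus by (rule sym)
    ultimately show "- (\<theta> ?y * F ?y ?t) \<le> - (\<theta> x * F x (t0 - s)) + rev.cost x v s h" by simp
  qed
  then have "- (\<theta> x * F x (t0 - t0)) \<le> rev.V x t0"
  proof (rule rev.V_maximal[where T = "{0..t0}"])
    fix x
    show "- (\<theta> x * F x (t0 - 0)) \<le> 0"
    proof (cases "x \<in> Kc")
      case True
      then show ?thesis using F_t0[OF True] \<theta>(1)[of x] by simp
    next
      case False
      then have "\<theta> x = 0" using r by (intro \<theta>_0) (simp add: \<delta>_def)
      then show ?thesis by simp
    qed
  qed (use t0 in auto)
  moreover have "0 \<le> - (\<theta> x * F x (t0 - t0))"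
  proof (cases "x \<in> Kc")
    case True
    then show ?thesis using F_0[OF True] \<theta>(1)[of x] by (simp add: mult_nonneg_nonpos)
  next
    case False
    then have "\<theta> x = 0" using r by (intro \<theta>_0) (simp add: \<delta>_def)
    then show ?thesis by simp
  qed
  ultimately show ?thesis by simp
qed

text \<open>\<open>g\<close> is a subsolution of the forward problem, \<open>rev_V_t0\<close> makes
  its values at time 0 nonpositive, and \<open>f\<close> is the largest such function.\<close>

lemma g_le_f: "0 \<le> t \<Longrightarrow> t \<le> t0 \<Longrightarrow> g x t \<le> f x t"
  unfolding f_def
proof (rule lag.V_maximal[where T = "{0..t0}"])
  show "subsolution UNIV R lag.cost {0..t0} g" unfolding subsolution_def by (intro allI impI g_step) auto
  show "g x 0 \<le> 0" for x using rev_V_t0[of x] by (simp add: g_def)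
qed auto

definition C2 where "C2 = (CL + \<Lambda>) * t0 + (1 + CL + \<Lambda>) + 8 * lag.K1"

lemma C2: "C2 \<ge> 0" unfolding C2_def using \<Lambda> t0 lag.K1 by (auto simp: CL_def intro!: add_nonneg_nonneg mult_nonneg_nonneg)

lemma f_second_diff:
  assumes "0 \<le> t - \<bar>h\<bar>" "t + \<bar>h\<bar> \<le> t0"
  shows "f (x + d) (t + h) + f (x - d) (t - h) \<le> 2 * f x t + C2 * ((norm d)\<^sup>2 + h\<^sup>2)"
  unfolding f_def C2_def by (rule lag.V_second_diff) (use assms in auto)

lemma g_second_diff:
  assumes "0 \<le> t - \<bar>h\<bar>" "t + \<bar>h\<bar> \<le> t0"
  shows "2 * g x t - C2 * ((norm d)\<^sup>2 + h\<^sup>2) \<le> g (x + d) (t + h) + g (x - d) (t - h)"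
proof -
  have "rev.V (x + d) ((t0 - t) + - h) + rev.V (x - d) ((t0 - t) - - h) \<le> 2 * rev.V x (t0 - t) + C2 * ((norm d)\<^sup>2 + (- h)\<^sup>2)"
    unfolding C2_def by (rule rev.V_second_diff) (use assms in auto)
  moreover have "(t0 - t) + - h = t0 - (t + h)" "(t0 - t) - - h = t0 - (t - h)" by simp_all
  ultimately have "rev.V (x + d) (t0 - (t + h)) + rev.V (x - d) (t0 - (t - h)) \<le> 2 * rev.V x (t0 - t) + C2 * ((norm d)\<^sup>2 + h\<^sup>2)"
    by (simp only: power2_minus)
  then show ?thesis unfolding g_def by argo
qed

end

section \<open>Contact points\<close>

definition clamp_time :: "real \<Rightarrow> real \<Rightarrow> real" where
  "clamp_time T t = max 0 (min T t)"

text \<open>Odd reflection about the endpoints, which preserves two-sided quadratic contact with affine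
  functions.\<close>

definition reflect_ext :: "real \<Rightarrow> ('a \<Rightarrow> real \<Rightarrow> real) \<Rightarrow> 'a \<times> real \<Rightarrow> real" where
  "reflect_ext T w p = 2 * w (fst p) (clamp_time T (snd p))
     - w (fst p) (clamp_time T (2 * clamp_time T (snd p) - snd p))"

lemma clamp_time_bounds: "0 \<le> T \<Longrightarrow> 0 \<le> clamp_time T t" "0 \<le> T \<Longrightarrow> clamp_time T t \<le> T"
  by (auto simp: clamp_time_def)

lemma clamp_time_id: "0 \<le> t \<Longrightarrow> t \<le> T \<Longrightarrow> clamp_time T t = t"
  by (simp add: clamp_time_def)

lemma clamp_time_lip: "\<bar>clamp_time T s - clamp_time T t\<bar> \<le> \<bar>s - t\<bar>"
  by (auto simp: clamp_time_def max_def min_def)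

lemma reflect_ext_id: "0 \<le> t \<Longrightarrow> t \<le> T \<Longrightarrow> reflect_ext T w (x, t) = w x t"
  by (simp add: reflect_ext_def clamp_time_id)

definition time_lipschitz :: "real \<Rightarrow> real \<Rightarrow> real \<Rightarrow> ('a::real_normed_vector \<Rightarrow> real \<Rightarrow> real) \<Rightarrow> bool" where
  "time_lipschitz T \<rho> M w \<longleftrightarrow> M \<ge> 0 \<and> (\<forall>x y s t. norm x \<le> \<rho> \<longrightarrow> norm y \<le> \<rho> \<longrightarrow> 0 \<le> s \<longrightarrow> s \<le> T \<longrightarrow> 0 \<le> t \<longrightarrow> t \<le> T \<longrightarrow>
     \<bar>w x t - w y s\<bar> \<le> M * (norm (x - y) + \<bar>t - s\<bar>))"

lemma reflect_ext_lipschitz: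
  fixes w :: "'a::euclidean_space \<Rightarrow> real \<Rightarrow> real"
  assumes w: "time_lipschitz T \<rho> M w" and T: "0 \<le> T" and p: "norm (fst p) \<le> \<rho>" "norm (fst q) \<le> \<rho>"
  shows "\<bar>reflect_ext T w p - reflect_ext T w q\<bar> \<le> 8 * M * norm (p - q)"
proof -
  have M: "M \<ge> 0" using w by (simp add: time_lipschitz_def)
  let ?d = "norm (fst p - fst q)" and ?h = "\<bar>snd p - snd q\<bar>"
  have l: "\<bar>w (fst p) t - w (fst q) s\<bar> \<le> M * (?d + \<bar>t - s\<bar>)" if "0 \<le> t" "t \<le> T" "0 \<le> s" "s \<le> T" for s t
    using w p that by (simp add: time_lipschitz_def)
  have 1: "\<bar>w (fst p) (clamp_time T (snd p)) - w (fst q) (clamp_time T (snd q))\<bar> \<le> M * (?d + ?h)"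
    by (rule order_trans[OF l]) (use clamp_time_bounds[OF T] clamp_time_lip[of T "snd p" "snd q"] M 
        in \<open>auto intro!: mult_left_mono\<close>)
  have "\<bar>clamp_time T (2 * clamp_time T (snd p) - snd p) - clamp_time T (2 * clamp_time T (snd q) - snd q)\<bar> \<le> 3 * ?h"
  proof (rule order_trans[OF clamp_time_lip])
    have "2 * clamp_time T (snd p) - snd p - (2 * clamp_time T (snd q) - snd q)
      = 2 * (clamp_time T (snd p) - clamp_time T (snd q)) - (snd p - snd q)" by simp
    also have "\<bar>\<dots>\<bar> \<le> \<bar>2 * (clamp_time T (snd p) - clamp_time T (snd q))\<bar> + ?h" by (rule abs_triangle_ineq4)
    also have "\<dots> \<le> 2 * ?h + ?h" using clamp_time_lip[of T "snd p" "snd q"] unfolding abs_mult abs_numeral by simp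
    finally show "\<bar>2 * clamp_time T (snd p) - snd p - (2 * clamp_time T (snd q) - snd q)\<bar> \<le> 3 * ?h" by simp
  qed
  then have 2: "\<bar>w (fst p) (clamp_time T (2 * clamp_time T (snd p) - snd p)) 
     - w (fst q) (clamp_time T (2 * clamp_time T (snd q) - snd q))\<bar> \<le> M * (?d + 3 * ?h)"
    by (intro order_trans[OF l]) (use clamp_time_bounds[OF T] M in \<open>auto intro!: mult_left_mono\<close>)
  have dh: "?d \<le> norm (p - q)" "?h \<le> norm (p - q)"
    using norm_fst_le[of "fst (p - q)" "snd (p - q)"] norm_snd_le[of "snd (p - q)" "fst (p - q)"]
    by (simp_all add: minus_prod_def)
  have "\<bar>reflect_ext T w p - reflect_ext T w q\<bar> \<le> 2 * (M * (?d + ?h)) + M * (?d + 3 * ?h)"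
    unfolding reflect_ext_def using 1 2 by linarith
  also have "\<dots> = M * (3 * ?d + 5 * ?h)" by (simp add: algebra_simps)
  also have "\<dots> \<le> M * (8 * norm (p - q))" using dh M by (intro mult_left_mono) auto
  finally show ?thesis by simp
qed

lemma continuous_reflect_ext:
  fixes w :: "'a::euclidean_space \<Rightarrow> real \<Rightarrow> real"
  assumes w: "\<And>\<rho>. \<exists>M. time_lipschitz T \<rho> M w" and T: "0 \<le> T"
  shows "continuous_on UNIV (reflect_ext T w)"
proof (rule continuous_onI)
  fix p :: "'a \<times> real" and e :: real assume e: "e > 0"
  obtain M where M: "time_lipschitz T (norm (fst p) + 1) M w" using w by blast
  then have M0: "M \<ge> 0" by (simp add: time_lipschitz_def)
  define d where "d = min 1 (e / (8 * M + 1))"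
  have d: "d > 0" "d \<le> 1" "8 * M * d \<le> e"
  proof -
    show "d > 0" "d \<le> 1" using e M0 by (auto simp: d_def)
    have "8 * M * d \<le> (8 * M + 1) * (e / (8 * M + 1))" using e M0 by (intro mult_mono) (auto simp: d_def)
    also have "\<dots> = e" using M0 by simp
    finally show "8 * M * d \<le> e" .
  qed
  have "dist (reflect_ext T w q) (reflect_ext T w p) \<le> e" if "dist q p < d" for q
  proof -
    have "norm (fst (q - p)) \<le> norm (q - p)" by (metis norm_fst_le prod.collapse)
    then have "norm (fst q) \<le> norm (fst p) + 1"
      using that d norm_triangle_ineq2[of "fst q" "fst p"] by (simp add: dist_norm)
    then have "\<bar>reflect_ext T w q - reflect_ext T w p\<bar> \<le> 8 * M * norm (q - p)"
      by (intro reflect_ext_lipschitz[OF M T]) auto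
    also have "\<dots> \<le> 8 * M * d" using that M0 by (intro mult_left_mono) (auto simp: dist_norm)
    finally show ?thesis using d by (simp add: dist_norm)
  qed
  then show "\<exists>d>0. \<forall>q\<in>UNIV. dist q p < d \<longrightarrow> dist (reflect_ext T w q) (reflect_ext T w p) \<le> e"
    using d by blast
qed

section \<open>Mollifying the time reflection\<close>

lemma norm_scaleR_le: "0 \<le> e \<Longrightarrow> norm z \<le> 1 \<Longrightarrow> norm (e *\<^sub>R z) \<le> e"
  using mult_left_mono[of "norm z" 1 e] by simp

lemma integral_abs_bump: "(\<integral>z. \<bar>bump z\<bar> \<partial>(lborel :: 'e::euclidean_space measure)) = 1"
proof -
  have "(\<lambda>z::'e. \<bar>bump z\<bar>) = bump" by (rule ext) (rule abs_of_nonneg[OF bump_nonneg])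
  then show ?thesis using integral_bump[where 'e = 'e] by simp
qed

lemma norm_fst_add_le:
  fixes p u :: "'a::real_normed_vector \<times> 'b::real_normed_vector"
  shows "norm (fst (p + u)) \<le> norm (fst p) + norm u"
proof -
  have "norm (fst u) \<le> norm u" by (metis norm_fst_le prod.collapse)
  then show ?thesis using norm_triangle_ineq[of "fst p" "fst u"] by simp
qed

lemma mollify_close:
  fixes w :: "'a::euclidean_space \<Rightarrow> real \<Rightarrow> real"
  assumes w: "time_lipschitz T (norm (fst p) + 1) M w" and T: "0 \<le> T" and e: "0 < e" "e \<le> 1"
    and cont: "continuous_on UNIV (reflect_ext T w)"
  shows "\<bar>mollify bump e (reflect_ext T w) p - reflect_ext T w p\<bar> \<le> 8 * M * e"
proof -
  let ?c = "reflect_ext T w p"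
  have M0: "M \<ge> 0" using w by (simp add: time_lipschitz_def)
  have "mollify bump e (\<lambda>q. ?c) p = ?c"
    using mollify_bump_affine[of e ?c 0 p p] by simp
  then have "mollify bump e (reflect_ext T w) p - ?c = mollify bump e (\<lambda>q. reflect_ext T w q - ?c) p"
    using mollify_diff[OF kernel_bump cont continuous_on_const, of e ?c p] by simp
  also have "\<bar>\<dots>\<bar> \<le> 8 * M * e * (\<integral>z. \<bar>bump z\<bar> \<partial>(lborel :: ('a \<times> real) measure))"
  proof (rule mollify_bound[OF kernel_bump])
    show "continuous_on UNIV (\<lambda>q. reflect_ext T w q - ?c)" by (intro continuous_intros cont)
    fix z :: "'a \<times> real" assume z: "norm z \<le> 1"
    have ez: "norm (e *\<^sub>R z) \<le> e" using e z by (intro norm_scaleR_le) auto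
    have "norm (fst (p + e *\<^sub>R z)) \<le> norm (fst p) + 1"
      using norm_fst_add_le[of p "e *\<^sub>R z"] ez e by linarith
    then have "\<bar>reflect_ext T w (p + e *\<^sub>R z) - ?c\<bar> \<le> 8 * M * norm (p + e *\<^sub>R z - p)"
      by (intro reflect_ext_lipschitz[OF w T]) auto
    also have "\<dots> \<le> 8 * M * e" using ez M0 by (intro mult_left_mono) auto
    finally show "\<bar>reflect_ext T w (p + e *\<^sub>R z) - ?c\<bar> \<le> 8 * M * e" .
  qed
  also have "(\<integral>z. \<bar>bump z\<bar> \<partial>(lborel :: ('a \<times> real) measure)) = 1"
    by (rule integral_abs_bump)
  finally show ?thesis by simp
qed

lemma mollify_lipschitz:
  fixes w :: "'a::euclidean_space \<Rightarrow> real \<Rightarrow> real"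
  assumes w: "time_lipschitz T (norm (fst p) + 2) M w" and T: "0 \<le> T" and e: "0 < e" "e \<le> 1"
    and cont: "continuous_on UNIV (reflect_ext T w)" and d: "norm d \<le> 1"
  shows "\<bar>mollify bump e (reflect_ext T w) (p + d) - mollify bump e (reflect_ext T w) p\<bar> \<le> 8 * M * norm d"
proof -
  let ?w = "reflect_ext T w"
  have M0: "M \<ge> 0" using w by (simp add: time_lipschitz_def)
  have sh: "continuous_on UNIV (\<lambda>q. ?w (q + d))"
    by (rule continuous_on_compose2[OF cont]) (auto intro!: continuous_intros)
  have "mollify bump e ?w (p + d) = mollify bump e (\<lambda>q. ?w (q + d)) p"
    unfolding mollify_def by (simp add: add_ac)
  then have "mollify bump e ?w (p + d) - mollify bump e ?w p = mollify bump e (\<lambda>q. ?w (q + d) - ?w q) p"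
    using mollify_diff[OF kernel_bump sh cont] by simp
  also have "\<bar>\<dots>\<bar> \<le> 8 * M * norm d * (\<integral>z. \<bar>bump z\<bar> \<partial>(lborel :: ('a \<times> real) measure))"
  proof (rule mollify_bound[OF kernel_bump])
    show "continuous_on UNIV (\<lambda>q. ?w (q + d) - ?w q)" by (intro continuous_intros sh cont)
    fix z :: "'a \<times> real" assume z: "norm z \<le> 1"
    have ez: "norm (e *\<^sub>R z) \<le> e" using e z by (intro norm_scaleR_le) auto
    have a: "norm (fst (p + e *\<^sub>R z)) \<le> norm (fst p) + 1"
      using norm_fst_add_le[of p "e *\<^sub>R z"] ez e by linarith
    have b: "norm (fst (p + e *\<^sub>R z + d)) \<le> norm (fst p) + 2"
      using norm_fst_add_le[of "p + e *\<^sub>R z" d] a d by linarith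
    have "norm (fst (p + e *\<^sub>R z)) \<le> norm (fst p) + 2" using a by linarith
    from reflect_ext_lipschitz[OF w T b this]
    show "\<bar>?w (p + e *\<^sub>R z + d) - ?w (p + e *\<^sub>R z)\<bar> \<le> 8 * M * norm d" by simp
  qed
  also have "(\<integral>z. \<bar>bump z\<bar> \<partial>(lborel :: ('a \<times> real) measure)) = 1"
    by (rule integral_abs_bump)
  finally show ?thesis by simp
qed

lemma directional_derivative_limit:
  fixes F :: "'e::real_normed_vector \<Rightarrow> real"
  assumes "(F has_derivative F') (at p)"
  shows "((\<lambda>h. (F (p + h *\<^sub>R u) - F p) / h) \<longlongrightarrow> F' u) (at 0)"
proof -
  have "((\<lambda>h::real. p + h *\<^sub>R u) has_derivative (\<lambda>h. h *\<^sub>R u)) (at 0)"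
    by (auto intro!: derivative_eq_intros)
  then have "((\<lambda>h. F (p + h *\<^sub>R u)) has_derivative (\<lambda>h. F' (h *\<^sub>R u))) (at 0)"
    using has_derivative_compose[of "\<lambda>h. p + h *\<^sub>R u" _ 0 UNIV F F'] assms by simp
  moreover have "(\<lambda>h. F' (h *\<^sub>R u)) = (*) (F' u)"
    using linear_scale[OF has_derivative_linear[OF assms]] by (simp add: fun_eq_iff mult.commute)
  ultimately have "((\<lambda>h. F (p + h *\<^sub>R u)) has_real_derivative F' u) (at 0)"
    unfolding has_field_derivative_def by (simp only:)
  then show ?thesis by (simp add: DERIV_def)
qed

lemma mollify_deriv_bound:
  fixes w :: "'a::euclidean_space \<Rightarrow> real \<Rightarrow> real"
  assumes w: "time_lipschitz T (norm (fst p) + 2) M w" and T: "0 \<le> T" and e: "0 < e" "e \<le> 1"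
    and cont: "continuous_on UNIV (reflect_ext T w)"
  shows "\<bar>deriv1 (mollify bump e (reflect_ext T w)) u p\<bar> \<le> 8 * M * norm u"
proof -
  let ?F = "mollify bump e (reflect_ext T w)"
  have M0: "M \<ge> 0" using w by (simp add: time_lipschitz_def)
  have "smooth_fun ?F" by (rule smooth_fun_mollify[OF kernel_bump cont e(1)])
  note l = directional_derivative_limit[OF smooth_fun_has_derivative[OF this], of p u]
  have "((\<lambda>h. \<bar>(?F (p + h *\<^sub>R u) - ?F p) / h\<bar>) \<longlongrightarrow> \<bar>deriv1 ?F u p\<bar>) (at 0)"
    by (rule tendsto_rabs[OF l])
  moreover have "eventually (\<lambda>h. \<bar>(?F (p + h *\<^sub>R u) - ?F p) / h\<bar> \<le> 8 * M * norm u) (at 0)"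
  proof -
    have "eventually (\<lambda>h::real. norm (h *\<^sub>R u) < 1) (at 0)"
      by (rule order_tendstoD(2)[where y = 0]) (auto intro!: tendsto_eq_intros)
    moreover have "eventually (\<lambda>h::real. h \<noteq> 0) (at 0)" by (simp add: eventually_at_filter)
    ultimately show ?thesis
    proof eventually_elim
      case (elim h)
      have "\<bar>?F (p + h *\<^sub>R u) - ?F p\<bar> \<le> 8 * M * norm (h *\<^sub>R u)"
        by (rule mollify_lipschitz[OF w T e cont]) (use elim in simp)
      then show ?case using elim by (simp add: divide_le_eq abs_mult algebra_simps)
    qed
  qed
  ultimately show ?thesis by (rule tendsto_upperbound) simp
qed

lemma mollify_mono_combination:
  fixes w1 w2 :: "'e::euclidean_space \<Rightarrow> real"
  assumes "continuous_on UNIV w1" "continuous_on UNIV w2"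
    "\<And>z. norm z \<le> 1 \<Longrightarrow> w1 (p + e *\<^sub>R z) \<le> w2 (p + e *\<^sub>R z)"
  shows "mollify bump e w1 p \<le> mollify bump e w2 p"
  unfolding mollify_def
proof (rule integral_mono)
  show "w1 (p + e *\<^sub>R z) * bump z \<le> w2 (p + e *\<^sub>R z) * bump z" for z
  proof (cases "norm z \<le> 1")
    case True
    then show ?thesis by (intro mult_right_mono assms(3) bump_nonneg)
  next
    case False
    then have "bump z = 0" using kernel_bump unfolding test_kernel_def by (metis not_le)
    then show ?thesis by simp
  qed
qed (intro mollify_integrable kernel_bump assms)+

text \<open>Each halving doubles the value at the half argument and leaves an error; the errors sum
  geometrically to less than \<open>C\<close>, and the doubled values become the difference quotient
  at 0. A midpoint inequality thus turns into a comparison with the tangent.\<close>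

lemma dyadic_superlinear:
  fixes F :: "real \<Rightarrow> real"
  assumes s: "\<And>a. 0 < a \<Longrightarrow> a \<le> 1 \<Longrightarrow> F a \<le> 2 * F (a / 2) + C * a\<^sup>2 / 4" and C: "C \<ge> 0"
    and l: "((\<lambda>h. F h / h) \<longlongrightarrow> D) (at 0)"
  shows "F 1 \<le> D + C"
proof -
  have step: "F 1 \<le> 2 ^ n * F (1 / 2 ^ n) + C * (1 - 1 / 2 ^ n)" for n
  proof (induction n)
    case (Suc n)
    have "F (1 / 2 ^ n) \<le> 2 * F (1 / 2 ^ n / 2) + C * (1 / 2 ^ n)\<^sup>2 / 4" by (rule s) auto
    then have "2 ^ n * F (1 / 2 ^ n) \<le> 2 ^ n * (2 * F (1 / 2 ^ n / 2) + C * (1 / 2 ^ n)\<^sup>2 / 4)"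
      by (intro mult_left_mono) auto
    also have "\<dots> = 2 ^ Suc n * F (1 / 2 ^ Suc n) + C * (1 / 2 ^ n) / 4"
      by (simp add: power2_eq_square field_simps)
    finally have "F 1 \<le> 2 ^ Suc n * F (1 / 2 ^ Suc n) + (C * (1 / 2 ^ n) / 4 + C * (1 - 1 / 2 ^ n))"
      using Suc by simp
    also have "C * (1 / 2 ^ n) / 4 + C * (1 - 1 / 2 ^ n) \<le> C * (1 - 1 / 2 ^ Suc n)"
      using C by (simp add: field_simps)
    finally show ?case by simp
  qed simp
  have "(\<lambda>n. F (1 / 2 ^ n) / (1 / 2 ^ n)) \<longlonglongrightarrow> D"
  proof (rule filterlim_compose[OF l])
    have "(\<lambda>n. (1 / 2) ^ n :: real) \<longlonglongrightarrow> 0" by (rule LIMSEQ_realpow_zero) auto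
    then show "filterlim (\<lambda>n. 1 / 2 ^ n :: real) (at 0) sequentially"
      by (auto simp: filterlim_at power_one_over)
  qed
  then have "(\<lambda>n. 2 ^ n * F (1 / 2 ^ n) + C) \<longlonglongrightarrow> D + C"
    by (intro tendsto_intros) (simp add: mult.commute)
  moreover have "F 1 \<le> 2 ^ n * F (1 / 2 ^ n) + C" for n
  proof -
    have "C * (1 - 1 / 2 ^ n) \<le> C * 1" using C by (intro mult_left_mono) auto
    with step[of n] show ?thesis by simp
  qed
  ultimately show ?thesis by (intro LIMSEQ_le_const) auto
qed

text \<open>Away from the end times the mollifications inherit the second difference bound and are
  differentiable, so \<open>dyadic_superlinear\<close> puts a paraboloid above them. Their gradients
  at the point are bounded by the local Lipschitz constant, and a convergent subsequence supplies
  \<open>l\<close>.\<close>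

proposition supergradient:
  fixes w :: "'a::euclidean_space \<Rightarrow> real \<Rightarrow> real"
  assumes lip: "\<And>\<rho>. \<exists>M. time_lipschitz T \<rho> M w" and C: "C \<ge> 0"
    and sd: "\<And>x d t h. 0 \<le> t - \<bar>h\<bar> \<Longrightarrow> t + \<bar>h\<bar> \<le> T \<Longrightarrow> w (x + d) (t + h) + w (x - d) (t - h) \<le> 2 * w x t + C * ((norm d)\<^sup>2 + h\<^sup>2)"
    and t: "0 < t" "t < T"
  shows "\<exists>l. \<forall>y s. 0 \<le> s \<longrightarrow> s \<le> T \<longrightarrow> w y s \<le> w x t + l \<bullet> ((y, s) - (x, t)) + C * (norm ((y, s) - (x, t)))\<^sup>2"
proof -
  let ?w = "reflect_ext T w"
  let ?p = "(x, t)"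
  have T: "0 \<le> T" using t by simp
  have cont: "continuous_on UNIV ?w" by (rule continuous_reflect_ext[OF lip T])
  define W where "W e = mollify bump e ?w" for e
  obtain M where M: "time_lipschitz T (norm x + 2) M w" using lip by blast
  have M0: "M \<ge> 0" using M by (simp add: time_lipschitz_def)
  have smW: "smooth_fun (W e)" if "e > 0" for e unfolding W_def by (rule smooth_fun_mollify[OF kernel_bump cont that])
  \<comment> \<open>Small enough for the interior time \<open>t\<close> to lie in
    \<open>[e, T - e]\<close> for every scale \<open>e\<close> in use.\<close>
  define e0 where "e0 = min 1 (min t (T - t)) / 2"
  have e0: "e0 > 0" "e0 \<le> 1" "e0 < t" "e0 < T - t" using t by (auto simp: e0_def min_def)
  have upper: "W e (y, s) \<le> W e ?p + deriv1 (W e) ((y, s) - ?p) ?p + C * (norm ((y, s) - ?p))\<^sup>2"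
    if e: "0 < e" "e \<le> e0" and s: "e \<le> s" "s \<le> T - e" for e y s
  proof -
    define u where "u = (y, s) - ?p"
    define F where "F a = W e (?p + a *\<^sub>R u) - W e ?p" for a
    have "F 1 \<le> deriv1 (W e) u ?p + C * (norm u)\<^sup>2"
    proof (rule dyadic_superlinear)
      show "((\<lambda>h. F h / h) \<longlongrightarrow> deriv1 (W e) u ?p) (at 0)"
        unfolding F_def by (rule directional_derivative_limit[OF smooth_fun_has_derivative[OF smW[OF e(1)]]])
      show "C * (norm u)\<^sup>2 \<ge> 0" using C by simp
      fix a :: real assume a: "0 < a" "a \<le> 1"
      define k where "k = (a / 2) *\<^sub>R u"
      have c1: "continuous_on UNIV (\<lambda>q. ?w (q + c))" for c
        by (rule continuous_on_compose2[OF cont]) (auto intro!: continuous_intros)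
      have 1: "mollify bump e (\<lambda>q. ?w (q + c)) r = W e (r + c)" for c r
        unfolding W_def mollify_def by (simp add: add_ac)
      let ?m = "?p + k"
      have "mollify bump e (\<lambda>q. ?w (q + k) + ?w (q + - k) - 2 * ?w q) ?m
         \<le> mollify bump e (\<lambda>q. C * (norm k)\<^sup>2) ?m"
      proof (rule mollify_mono_combination)
        show "continuous_on UNIV (\<lambda>q. ?w (q + k) + ?w (q + - k) - 2 * ?w q)"
          by (intro continuous_on_add continuous_on_diff continuous_on_mult continuous_on_const c1 cont)
        fix z :: "'a \<times> real" assume z: "norm z \<le> 1"
        obtain X S where XS: "?m + e *\<^sub>R z = (X, S)" by (cases "?m + e *\<^sub>R z")
        obtain k1 k2 where k: "k = (k1, k2)" by (cases k)
        have ez: "norm (e *\<^sub>R z) \<le> e" using e z by (intro norm_scaleR_le) auto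
        have "\<bar>snd (e *\<^sub>R z)\<bar> \<le> norm (e *\<^sub>R z)" by (metis norm_snd_le prod.collapse real_norm_def)
        then have se: "\<bar>snd (e *\<^sub>R z)\<bar> \<le> e" using ez by simp
        have k2: "k2 = (a / 2) * (s - t)" using k by (simp add: k_def u_def)
        have S: "S = t + k2 + snd (e *\<^sub>R z)" using XS k by (metis snd_add snd_conv)
        have "t + 2 * k2 = (1 - a) * t + a * s" by (simp add: k2 field_simps)
        have range: "e \<le> t" "t \<le> T - e" using e e0 by auto
        have lo: "e \<le> (1 - a) * t + a * s"
        proof -
          have "(1 - a) * e + a * e \<le> (1 - a) * t + a * s" using a range s by (intro add_mono mult_left_mono) auto
          then show ?thesis by (simp add: algebra_simps)
        qed
        have hi: "(1 - a) * t + a * s \<le> T - e"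
        proof -
          have "(1 - a) * t + a * s \<le> (1 - a) * (T - e) + a * (T - e)" using a range s by (intro add_mono mult_left_mono) auto
          then show ?thesis by (simp add: algebra_simps)
        qed
        have tk: "e \<le> t + 2 * k2" "t + 2 * k2 \<le> T - e" using lo hi \<open>t + 2 * k2 = (1 - a) * t + a * s\<close> by simp_all
        have 3: "0 \<le> S - \<bar>k2\<bar>" "S + \<bar>k2\<bar> \<le> T" using tk range se S by linarith+
        have "w (X + k1) (S + k2) + w (X - k1) (S - k2) \<le> 2 * w X S + C * ((norm k1)\<^sup>2 + k2\<^sup>2)"
          by (rule sd[OF 3])
        moreover have "?w ((X, S) + k) = w (X + k1) (S + k2)" "?w ((X, S) + - k) = w (X - k1) (S - k2)" "?w (X, S) = w X S"
          using 3 by (simp_all add: k reflect_ext_id)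
        moreover have "(norm k)\<^sup>2 = (norm k1)\<^sup>2 + k2\<^sup>2" by (simp add: k norm_Pair)
        ultimately show "?w (?m + e *\<^sub>R z + k) + ?w (?m + e *\<^sub>R z + - k) - 2 * ?w (?m + e *\<^sub>R z) \<le> C * (norm k)\<^sup>2"
          unfolding XS by simp
      qed (intro continuous_intros)
      also have "mollify bump e (\<lambda>q. C * (norm k)\<^sup>2) ?m = C * (norm k)\<^sup>2"
        using mollify_bump_affine[of e "C * (norm k)\<^sup>2" 0 0 ?m] by simp
      also have "mollify bump e (\<lambda>q. ?w (q + k) + ?w (q + - k) - 2 * ?w q) ?m
         = W e (?m + k) + W e (?m + - k) - 2 * W e ?m"
      proof -
        have i: "integrable lborel (\<lambda>z. ?w (?m + e *\<^sub>R z + c) * bump z)" for c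
          by (rule mollify_integrable[OF kernel_bump c1])
        have "mollify bump e (\<lambda>q. ?w (q + k) + ?w (q + - k) - 2 * ?w q) ?m
          = (\<integral>z. ?w (?m + e *\<^sub>R z + k) * bump z + ?w (?m + e *\<^sub>R z + - k) * bump z 
              - 2 * (?w (?m + e *\<^sub>R z + 0) * bump z) \<partial>lborel)"
          unfolding mollify_def by (simp add: algebra_simps)
        also have "\<dots> = mollify bump e (\<lambda>q. ?w (q + k)) ?m + mollify bump e (\<lambda>q. ?w (q + - k)) ?m - 2 * mollify bump e (\<lambda>q. ?w (q + 0)) ?m"
          unfolding mollify_def using i[of k] i[of "- k"] i[of 0] by simp
        finally show ?thesis unfolding 1 by simp
      qed
      finally have "W e (?m + k) + W e (?m + - k) - 2 * W e ?m \<le> C * (norm k)\<^sup>2" .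
      moreover have "k + k = a *\<^sub>R u" by (simp add: k_def scaleR_left_distrib[symmetric])
      then have "?m + k = ?p + a *\<^sub>R u" "?m + - k = ?p" by (simp_all add: add.assoc)
      moreover have "C * (norm k)\<^sup>2 = C * (norm u)\<^sup>2 * a\<^sup>2 / 4" by (simp add: k_def power_mult_distrib power_divide)
      ultimately show "F a \<le> 2 * F (a / 2) + C * (norm u)\<^sup>2 * a\<^sup>2 / 4"
        unfolding F_def k_def[symmetric] by simp
    qed
    then show ?thesis by (simp add: F_def u_def)
  qed
  define e where "e n = e0 / real (n + 1)" for n
  have en: "0 < e n" "e n \<le> e0" "e n \<le> 1" for n
  proof -
    show "0 < e n" using e0 by (simp add: e_def)
    show "e n \<le> e0" using e0 by (simp add: e_def divide_le_eq)
    then show "e n \<le> 1" using e0 by simp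
  qed
  have elim: "e \<longlonglongrightarrow> 0"
    unfolding e_def using LIMSEQ_Suc[OF lim_const_over_n[of e0]] by simp
  define G where "G n = (\<Sum>b\<in>Basis. deriv1 (W (e n)) b ?p *\<^sub>R b)" for n
  have G: "deriv1 (W (e n)) u ?p = G n \<bullet> u" for n u
  proof -
    have l: "linear (\<lambda>u. deriv1 (W (e n)) u ?p)" by (rule deriv_linear[OF smW[OF en(1)]])
    have "deriv1 (W (e n)) u ?p = deriv1 (W (e n)) (\<Sum>b\<in>Basis. (u \<bullet> b) *\<^sub>R b) ?p" by (simp only: euclidean_representation)
    also have "\<dots> = (\<Sum>b\<in>Basis. (u \<bullet> b) * deriv1 (W (e n)) b ?p)" by (simp add: linear_sum[OF l] linear_scale[OF l])
    also have "\<dots> = G n \<bullet> u" unfolding G_def inner_sum_left inner_scaleR_left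
      by (simp add: inner_commute mult.commute)
    finally show ?thesis .
  qed
  have "norm (G n) \<le> DIM('a \<times> real) * (8 * M)" for n
  proof -
    have "norm (G n) \<le> (\<Sum>b\<in>Basis. \<bar>G n \<bullet> b\<bar>)" by (rule norm_le_l1)
    also have "\<dots> \<le> (\<Sum>b\<in>(Basis::('a \<times> real) set). 8 * M)"
    proof (rule sum_mono)
      fix b :: "'a \<times> real" assume b: "b \<in> Basis"
      have "\<bar>deriv1 (W (e n)) b ?p\<bar> \<le> 8 * M * norm b"
        unfolding W_def by (rule mollify_deriv_bound[OF _ T en(1,3) cont]) (use M in simp)
      then show "\<bar>G n \<bullet> b\<bar> \<le> 8 * M" using G[of n b] b by simp
    qed
    finally show ?thesis by simp
  qed
  then have "bounded (range G)" unfolding bounded_iff by blast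
  then obtain l r where r: "strict_mono (r :: nat \<Rightarrow> nat)" and l: "(G \<circ> r) \<longlonglongrightarrow> l"
    using bounded_imp_convergent_subsequence by blast
  have er: "(\<lambda>n. e (r n)) \<longlonglongrightarrow> 0" using LIMSEQ_subseq_LIMSEQ[OF elim r] by (simp add: o_def)
  have close: "(\<lambda>n. W (e (r n)) (q n)) \<longlonglongrightarrow> ?w q0" if "q \<longlonglongrightarrow> q0" for q q0
  proof -
    have "bounded (range q)" using that convergent_imp_bounded by blast
    then obtain B where B: "\<And>n. norm (q n) \<le> B" by (auto simp: bounded_iff)
    obtain M' where M': "time_lipschitz T (B + 1) M' w" using lip by blast
    have "(\<lambda>n. W (e (r n)) (q n) - ?w (q n)) \<longlonglongrightarrow> 0"
    proof (rule Lim_null_comparison)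
      show "\<forall>\<^sub>F n in sequentially. norm (W (e (r n)) (q n) - ?w (q n)) \<le> 8 * M' * e (r n)"
      proof (rule always_eventually, rule allI)
        fix n
        have "norm (fst (q n)) \<le> B" using B[of n] norm_fst_le[of "fst (q n)" "snd (q n)"] by simp
        then have "time_lipschitz T (norm (fst (q n)) + 1) M' w" using M' by (auto simp: time_lipschitz_def)
        then show "norm (W (e (r n)) (q n) - ?w (q n)) \<le> 8 * M' * e (r n)"
          unfolding W_def real_norm_def by (rule mollify_close[OF _ T en(1,3) cont])
      qed
      show "(\<lambda>n. 8 * M' * e (r n)) \<longlonglongrightarrow> 0" using tendsto_mult_right_zero[OF er] by simp
    qed
    moreover have "(\<lambda>n. ?w (q n)) \<longlonglongrightarrow> ?w q0"
      by (rule continuous_on_tendsto_compose[OF cont that]) auto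
    ultimately show ?thesis using tendsto_add by force
  qed
  have "w y s \<le> w x t + l \<bullet> ((y, s) - ?p) + C * (norm ((y, s) - ?p))\<^sup>2" if s: "0 \<le> s" "s \<le> T" for y s
  proof -
    \<comment> \<open>The bound for the mollification holds for times in \<open>[e, T - e]\<close>;
      the target time is pushed into that interval and returns to \<open>s\<close> in the limit,
      which covers the end times as well.\<close>
    define sn where "sn n = max (e (r n)) (min (T - e (r n)) s)" for n
    have "sn \<longlonglongrightarrow> max 0 (min (T - 0) s)" unfolding sn_def
      by (intro tendsto_intros er)
    then have sn: "sn \<longlonglongrightarrow> s" using s by simp
    have q: "(\<lambda>n. (y, sn n)) \<longlonglongrightarrow> (y, s)" by (intro tendsto_intros sn)
    have "W (e (r n)) (y, sn n) \<le> W (e (r n)) ?p + G (r n) \<bullet> ((y, sn n) - ?p) + C * (norm ((y, sn n) - ?p))\<^sup>2" for n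
    proof -
      have "e (r n) \<le> T - e (r n)" using en(2)[of "r n"] e0 by linarith
      then show ?thesis unfolding G[symmetric] by (intro upper en) (auto simp: sn_def)
    qed
    moreover have "(\<lambda>n. W (e (r n)) ?p + G (r n) \<bullet> ((y, sn n) - ?p) + C * (norm ((y, sn n) - ?p))\<^sup>2)
       \<longlonglongrightarrow> ?w ?p + l \<bullet> ((y, s) - ?p) + C * (norm ((y, s) - ?p))\<^sup>2"
      using l by (intro tendsto_intros close q) (auto simp: o_def)
    ultimately have "?w (y, s) \<le> ?w ?p + l \<bullet> ((y, s) - ?p) + C * (norm ((y, s) - ?p))\<^sup>2"
      by (intro LIMSEQ_le[OF close[OF q]]) auto
    then show ?thesis using s t by (simp add: reflect_ext_id)
  qed
  then show ?thesis by blast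
qed

text \<open>The time of \<open>q\<close> is \<open>2 * s1 - s2\<close>, with \<open>s1\<close> and
  \<open>s2\<close> in the interval and no farther from \<open>t\<close>. An affine function is
  reproduced by this combination, and the two errors enter with weights 2 and 1, whence the factor
  3.\<close>

lemma reflect_ext_contact:
  fixes w :: "'a::euclidean_space \<Rightarrow> real \<Rightarrow> real"
  assumes t: "0 \<le> t" "t \<le> T" and C: "C \<ge> 0"
    and contact: "\<And>y s. 0 \<le> s \<Longrightarrow> s \<le> T \<Longrightarrow> \<bar>w y s - w x t - l \<bullet> ((y, s) - (x, t))\<bar> \<le> C * (norm ((y, s) - (x, t)))\<^sup>2"
    and q: "\<bar>snd q - t\<bar> \<le> T"
  shows "\<bar>reflect_ext T w q - reflect_ext T w (x, t) - l \<bullet> (q - (x, t))\<bar> \<le> 3 * C * (norm (q - (x, t)))\<^sup>2"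
proof -
  have T: "0 \<le> T" using t by simp
  obtain y s where ys: "q = (y, s)" by (cases q)
  define s1 where "s1 = clamp_time T s"
  define s2 where "s2 = 2 * s1 - s"
  have s1: "0 \<le> s1" "s1 \<le> T" using clamp_time_bounds[OF T] by (auto simp: s1_def)
  have s2: "0 \<le> s2" "s2 \<le> T" "\<bar>s1 - t\<bar> \<le> \<bar>s - t\<bar>" "\<bar>s2 - t\<bar> \<le> \<bar>s - t\<bar>"
    using q t unfolding s2_def s1_def ys clamp_time_def by (auto simp: max_def min_def abs_if)
  have near: "(norm ((y, s') - (x, t)))\<^sup>2 \<le> (norm (q - (x, t)))\<^sup>2" if "\<bar>s' - t\<bar> \<le> \<bar>s - t\<bar>" for s'
  proof -
    have "(s' - t)\<^sup>2 \<le> (s - t)\<^sup>2" using power_mono[OF that, of 2] by simp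
    then show ?thesis by (simp add: ys norm_Pair)
  qed
  have b: "\<bar>w y s' - w x t - l \<bullet> ((y, s') - (x, t))\<bar> \<le> C * (norm (q - (x, t)))\<^sup>2"
    if "0 \<le> s'" "s' \<le> T" "\<bar>s' - t\<bar> \<le> \<bar>s - t\<bar>" for s'
    using contact[OF that(1,2), of y] mult_left_mono[OF near[OF that(3)] C] by linarith
  have ext: "reflect_ext T w q = 2 * w y s1 - w y s2"
    using s2(1,2) by (simp add: reflect_ext_def ys s1_def[symmetric] s2_def[symmetric] clamp_time_id)
  have "(y, s) - (x, t) = 2 *\<^sub>R ((y, s1) - (x, t)) - ((y, s2) - (x, t))"
    by (simp add: s2_def scaleR_2)
  then have lin: "l \<bullet> (q - (x, t)) = 2 * (l \<bullet> ((y, s1) - (x, t))) - l \<bullet> ((y, s2) - (x, t))"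
    unfolding ys by (simp only: inner_diff_right inner_scaleR_right)
  define a1 where "a1 = l \<bullet> ((y, s1) - (x, t))"
  define a2 where "a2 = l \<bullet> ((y, s2) - (x, t))"
  define N where "N = C * (norm (q - (x, t)))\<^sup>2"
  have "\<bar>w y s1 - w x t - a1\<bar> \<le> N" "\<bar>w y s2 - w x t - a2\<bar> \<le> N"
    unfolding a1_def a2_def N_def using b[OF s1 s2(3)] b[OF s2(1,2,4)] by auto
  then have "\<bar>(2 * w y s1 - w y s2) - w x t - (2 * a1 - a2)\<bar> \<le> 3 * N" by linarith
  then show ?thesis unfolding ext lin a1_def a2_def N_def reflect_ext_id[OF t] by simp
qed

text \<open>Insert a small multiple of \<open>l' - l\<close>: the linear gain beats the quadratic
  term unless the difference vanishes.\<close>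

lemma contact_unique_gradient:
  fixes l l' :: "'e::euclidean_space"
  assumes e: "e > 0" and C: "C \<ge> 0" and b: "\<And>u. norm u \<le> e \<Longrightarrow> l' \<bullet> u \<le> l \<bullet> u + C * (norm u)\<^sup>2"
  shows "l = l'"
proof -
  let ?d = "l' - l"
  have "(norm ?d)\<^sup>2 \<le> 0"
  proof (rule field_le_epsilon)
    fix k :: real assume k: "k > 0"
    define a where "a = min (e / (norm ?d + 1)) (k / (C * (norm ?d)\<^sup>2 + 1))"
    have n: "norm ?d + 1 > 0" "C * (norm ?d)\<^sup>2 + 1 > 0" using C by (auto intro: add_nonneg_pos)
    have a: "a > 0" unfolding a_def using e k n by simp
    have "a * norm ?d \<le> e / (norm ?d + 1) * (norm ?d + 1)" unfolding a_def using n e by (intro mult_mono) auto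
    then have "norm (a *\<^sub>R ?d) \<le> e" using a n by simp
    from b[OF this] have "a * (l' \<bullet> ?d) \<le> a * (l \<bullet> ?d) + C * (a\<^sup>2 * (norm ?d)\<^sup>2)"
      using a by (simp add: power_mult_distrib)
    then have "a * (?d \<bullet> ?d) \<le> a * (a * (C * (norm ?d)\<^sup>2))"
      by (simp add: inner_diff_left power2_eq_square algebra_simps)
    then have "?d \<bullet> ?d \<le> a * (C * (norm ?d)\<^sup>2)" using a by simp
    also have "\<dots> \<le> k / (C * (norm ?d)\<^sup>2 + 1) * (C * (norm ?d)\<^sup>2 + 1)"
      unfolding a_def using n k C by (intro mult_mono) auto
    also have "\<dots> = k" using n by simp
    finally show "(norm ?d)\<^sup>2 \<le> 0 + k" by (simp add: power2_norm_eq_inner)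
  qed
  then show ?thesis by simp
qed

section \<open>Jets minimised by a closed measure\<close>

text \<open>Carried by \<open>S0\<close> and by speeds at most \<open>R - 1\<close>,
  \<open>\<mu>\<close> leaves room for displacing its points in space and velocity within the region
  of the estimates. By \<open>minimal\<close> and \<open>nonneg\<close> it minimises the integral of
  \<open>\<phi>\<close> among the closed measures of the tube.\<close>

locale jet_dual_measure = jet_dual U t0 r R D S0 P \<phi> G
  for U :: "'a::euclidean_space set" and t0 r R D :: real and S0 :: "'a set"
    and P :: "('a \<times> 'a \<times> real) set" and \<phi> :: "'a \<times> 'a \<times> real \<Rightarrow> real" 
    and G :: "'a \<times> 'a \<times> real \<Rightarrow> 'a \<times> 'a \<times> real" +
  fixes \<mu> :: "('a \<times> 'a \<times> real) measure"
  assumes mu: "closed_on U t0 (S0 \<times> cball 0 (R - 1) \<times> {0..t0}) \<mu>"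
    and minimal: "(LINT p:S0 \<times> cball 0 (R - 1) \<times> {0..t0}|\<mu>. \<phi> p) \<le> 0"
begin

definition Q0 where "Q0 = S0 \<times> cball (0::'a) (R - 1) \<times> {0..t0}"
definition I where "I h = (LINT p:Q0|\<mu>. h p)" for h :: "'a \<times> 'a \<times> real \<Rightarrow> real"

lemma compact_Q0: "compact Q0" unfolding Q0_def by (intro compact_Times S0) auto
lemma borel_Q0: "Q0 \<in> sets borel" using compact_imp_closed[OF compact_Q0] by auto
lemma conc: "concentrated_on Q0 \<mu>" using mu unfolding closed_on_def Q0_def by blast
lemma sets_mu: "sets \<mu> = sets borel" using conc by (simp add: concentrated_on_def)

sublocale fin: finite_measure \<mu>
  using conc sets_eq_imp_space_eq[OF sets_mu] by (intro finite_measureI) (auto simp: concentrated_on_def less_top)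

lemma AE_Q0: "AE p in \<mu>. p \<in> Q0"
  by (rule concentrated_on_AE[OF conc compact_imp_closed[OF compact_Q0]])

lemma \<delta>_S0: "x \<in> S0 \<Longrightarrow> \<delta> x = 0" by (simp add: \<delta>_def)

lemma Q0D: assumes "(x, v, t) \<in> Q0" shows "x \<in> S0" "norm v \<le> R - 1" "0 \<le> t" "t \<le> t0"
  using assms by (auto simp: Q0_def)

lemma Q0_P: "Q0 \<subseteq> P"
proof
  fix p assume "p \<in> Q0"
  then obtain x v t where p: "p = (x, v, t)" "x \<in> S0" "norm v \<le> R - 1" "0 \<le> t" "t \<le> t0" by (auto simp: Q0_def)
  then show "p \<in> P" using r by (auto intro!: in_P simp: \<delta>_S0)
qed

lemma S0_U: "S0 \<subseteq> U" using K_U r by (auto simp: subset_iff)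

lemma Q0_TI: "Q0 \<subseteq> TI U t0" using S0_U by (auto simp: Q0_def TI_def)

lemma I_integrable: "continuous_on Q0 h \<Longrightarrow> set_integrable \<mu> Q0 h"
  for h :: "'a \<times> 'a \<times> real \<Rightarrow> real"
  by (rule concentrated_on_integrable[OF conc compact_Q0 order_refl borel_Q0])

lemma I_add: "continuous_on Q0 h \<Longrightarrow> continuous_on Q0 k \<Longrightarrow> I (\<lambda>p. h p + k p) = I h + I k"
  unfolding I_def by (intro set_integral_add I_integrable)

lemma I_diff: "continuous_on Q0 h \<Longrightarrow> continuous_on Q0 k \<Longrightarrow> I (\<lambda>p. h p - k p) = I h - I k"
  unfolding I_def by (intro set_integral_diff I_integrable)

lemma I_cmult: "I (\<lambda>p. c * h p) = c * I h"
  unfolding I_def by (rule set_integral_mult_right)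

lemma I_mono_AE: 
  assumes "continuous_on Q0 h" "continuous_on Q0 k" "AE p in \<mu>. p \<in> Q0 \<longrightarrow> h p \<le> k p" shows "I h \<le> I k"
  unfolding I_def set_lebesgue_integral_def
proof (rule integral_mono_AE)
  show "AE p in \<mu>. indicator Q0 p *\<^sub>R h p \<le> indicator Q0 p *\<^sub>R k p"
    using assms(3) by eventually_elim (auto simp: indicator_def)
qed (use assms I_integrable in \<open>auto simp: set_integrable_def\<close>)

lemma I_mono:
  assumes "continuous_on Q0 h" "continuous_on Q0 k" "\<And>p. p \<in> Q0 \<Longrightarrow> h p \<le> k p" shows "I h \<le> I k"
  by (rule I_mono_AE) (use assms in auto)

lemma I_const: "I (\<lambda>p. c) = c * measure \<mu> UNIV"
proof -
  have "I (\<lambda>p. c) = c * measure \<mu> Q0" unfolding I_def set_lebesgue_integral_def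
    using borel_Q0 sets_mu by (simp add: mult.commute)
  also have "measure \<mu> Q0 = measure \<mu> UNIV"
    using AE_Q0 borel_Q0 sets_mu by (intro fin.finite_measure_eq_AE) auto
  finally show ?thesis .
qed

definition \<mu>1 where "\<mu>1 = measure \<mu> UNIV"
lemma \<mu>1: "\<mu>1 \<ge> 0" by (simp add: \<mu>1_def)

lemma I_le_const: "continuous_on Q0 h \<Longrightarrow> (\<And>p. p \<in> Q0 \<Longrightarrow> h p \<le> c) \<Longrightarrow> I h \<le> c * \<mu>1"
  using I_mono[of h "\<lambda>p. c"] by (simp add: I_const \<mu>1_def)

definition dsig where "dsig \<psi> p = deriv1 \<psi> (fst (snd p), 1) (fst p, snd (snd p))" for \<psi> :: "'a \<times> real \<Rightarrow> real"

lemma d_sigma_sm: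
  assumes "smooth_fun \<psi>" "p \<in> TI V t0" "open V" shows "d_sigma V t0 \<psi> p = dsig \<psi> p"
proof -
  obtain x v t where p: "p = (x, v, t)" "(x, t) \<in> BI V t0" using assms(2) by (auto simp: TI_def BI_def)
  have "frechet_derivative \<psi> (at (x, t) within BI V t0) = frechet_derivative \<psi> (at (x, t))"
    by (rule frechet_derivative_within_eq[OF unique_derivatives_BI[OF assms(3) t0] p(2)
          has_derivative_at_withinI[OF smooth_fun_has_derivative[OF assms(1)]]])
  then show ?thesis by (simp add: p d_sigma_def dsig_def)
qed

lemma cont_dsig: "smooth_fun \<psi> \<Longrightarrow> continuous_on Q0 (dsig \<psi>)"
  using continuous_on_subset[OF continuous_on_d_sigma[OF smooth_fun_imp_smooth[OF unique_derivatives_BI[OF U t0]]] Q0_TI]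
    continuous_on_cong[OF refl, of Q0 "d_sigma U t0 \<psi>" "dsig \<psi>"] d_sigma_sm[OF _ _ U] Q0_TI by (metis subsetD)

lemma closedness:
  assumes \<psi>: "smooth_fun \<psi>" "\<And>x. \<psi> (x, 0) = 0" "\<And>x. \<psi> (x, t0) = 0"
  shows "I (dsig \<psi>) = 0"
proof -
  have s: "\<psi> \<in> smooth (BI U t0)" by (rule smooth_fun_imp_smooth[OF unique_derivatives_BI[OF U t0] \<psi>(1)])
  have "(LINT p:TI U t0|\<mu>. d_sigma U t0 \<psi> p) = 0"
    using mu s \<psi>(2,3) unfolding closed_on_def by auto
  also have "(LINT p:TI U t0|\<mu>. d_sigma U t0 \<psi> p) = I (dsig \<psi>)"
    unfolding I_def set_lebesgue_integral_def
  proof (rule integral_cong_AE)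
    show "(\<lambda>p. indicator (TI U t0) p *\<^sub>R d_sigma U t0 \<psi> p) \<in> borel_measurable \<mu>"
      using concentrated_on_integrable[OF conc compact_Q0 Q0_TI TI_borel[OF U] continuous_on_d_sigma[OF s]]
      unfolding set_integrable_def by (rule borel_measurable_integrable)
    show "(\<lambda>p. indicator Q0 p *\<^sub>R dsig \<psi> p) \<in> borel_measurable \<mu>"
      using I_integrable[OF cont_dsig[OF \<psi>(1)]] unfolding set_integrable_def by (rule borel_measurable_integrable)
    show "AE p in \<mu>. indicator (TI U t0) p *\<^sub>R d_sigma U t0 \<psi> p = indicator Q0 p *\<^sub>R dsig \<psi> p"
      using AE_Q0
    proof eventually_elim
      case (elim p)
      then have "p \<in> TI U t0" using Q0_TI by blast
      then show ?case using elim d_sigma_sm[OF \<psi>(1) _ U] by simp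
    qed
  qed
  finally show ?thesis by simp
qed

lemma smooth_fun_poly_time: "smooth_fun (\<lambda>p::'a \<times> real. poly a (snd p))"
proof (induction a)
  case (pCons c a)
  show ?case unfolding poly_pCons
    by (rule smooth_fun_add[OF smooth_fun_const smooth_fun_mult[OF smooth_fun_linear[OF bounded_linear_snd] pCons(2)]])
qed simp

lemma deriv_poly_time: "((\<lambda>p::'a \<times> real. poly a (snd p)) has_derivative (\<lambda>u. poly (pderiv a) (snd p) * snd u)) (at p)"
proof -
  have "(poly a has_derivative (\<lambda>h. poly (pderiv a) (snd p) * h)) (at (snd p))"
    using poly_DERIV[of a "snd p"] by (simp add: has_field_derivative_def)
  then show ?thesis
    by (rule has_derivative_compose[OF bounded_linear_imp_has_derivative[OF bounded_linear_snd], rotated])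
qed

abbreviation tm where "tm \<equiv> \<lambda>p::'a \<times> 'a \<times> real. snd (snd p)"
abbreviation bs where "bs \<equiv> \<lambda>p::'a \<times> 'a \<times> real. (fst p, snd (snd p))"

lemma dsig_poly_mult:
  assumes "smooth_fun W"
  shows "dsig (\<lambda>q. poly a (snd q) * W q) p = poly (pderiv a) (tm p) * W (bs p) + poly a (tm p) * dsig W p"
proof -
  have "((\<lambda>q. poly a (snd q) * W q) has_derivative
     (\<lambda>u. poly a (snd (bs p)) * frechet_derivative W (at (bs p)) u + poly (pderiv a) (snd (bs p)) * snd u * W (bs p))) (at (bs p))"
    by (rule has_derivative_mult[OF deriv_poly_time smooth_fun_has_derivative[OF assms]])
  from frechet_derivative_eqI[OF this, of "(fst (snd p), 1)"] show ?thesis by (simp add: dsig_def)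
qed

text \<open>A mollified value function need not vanish at the end times; a polynomial factor in time
  does so instead, at the price of the term with \<open>pderiv a\<close>.\<close>

lemma poly_closedness:
  assumes "smooth_fun W" "poly a 0 = 0" "poly a t0 = 0"
  shows "I (\<lambda>p. poly (pderiv a) (tm p) * W (bs p) + poly a (tm p) * dsig W p) = 0"
proof -
  have "I (dsig (\<lambda>q. poly a (snd q) * W q)) = 0"
    by (rule closedness) (use assms in \<open>auto intro!: smooth_fun_mult smooth_fun_poly_time\<close>)
  then show ?thesis unfolding dsig_poly_mult[OF assms(1), abs_def] .
qed

lemma cont_poly: "continuous_on A (\<lambda>p. poly a (tm p))"
  by (rule continuous_on_compose2[of UNIV "poly a" A tm]) (auto intro!: continuous_intros)

lemma cont_W: "smooth_fun W \<Longrightarrow> continuous_on A (\<lambda>p. W (bs p))"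
  by (rule continuous_on_compose2[OF smooth_fun_continuous[of W UNIV]]) (auto intro!: continuous_intros)

lemma cont_\<phi>Q: "continuous_on Q0 \<phi>" by (rule continuous_on_subset[OF cont_\<phi> Q0_P])

end

lemma time_lipschitzD:
  "time_lipschitz T \<rho> M w \<Longrightarrow> norm x \<le> \<rho> \<Longrightarrow> norm y \<le> \<rho> \<Longrightarrow> 0 \<le> s \<Longrightarrow> s \<le> T \<Longrightarrow> 0 \<le> t \<Longrightarrow> t \<le> T \<Longrightarrow>
    \<bar>w x t - w y s\<bar> \<le> M * (norm (x - y) + \<bar>t - s\<bar>)"
  by (simp add: time_lipschitz_def)

section \<open>Polynomial weights in time\<close>

lemma poly_bounded_on:
  obtains B where "B \<ge> 0" "\<And>t::real. 0 \<le> t \<Longrightarrow> t \<le> T \<Longrightarrow> \<bar>poly a t\<bar> \<le> B"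
proof -
  have "bounded (poly a ` {0..T})" by (intro compact_imp_bounded compact_continuous_image continuous_intros) auto
  then obtain B where B: "\<And>t. t \<in> {0..T} \<Longrightarrow> \<bar>poly a t\<bar> \<le> B" unfolding bounded_iff by (metis image_eqI real_norm_def)
  show ?thesis by (rule that[of "max B 0"]) (use B in \<open>auto intro: max.coboundedI1\<close>)
qed

lemma poly_lipschitz_on:
  obtains L where "L \<ge> 0" "\<And>s t::real. 0 \<le> s \<Longrightarrow> s \<le> T \<Longrightarrow> 0 \<le> t \<Longrightarrow> t \<le> T \<Longrightarrow> \<bar>poly a s - poly a t\<bar> \<le> L * \<bar>s - t\<bar>"
proof -
  obtain B where B: "B \<ge> 0" "\<And>t. 0 \<le> t \<Longrightarrow> t \<le> T \<Longrightarrow> \<bar>poly (pderiv a) t\<bar> \<le> B" using poly_bounded_on by blast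
  have "norm (poly a s - poly a t) \<le> B * norm (s - t)" if "0 \<le> s" "s \<le> T" "0 \<le> t" "t \<le> T" for s t
  proof (rule field_differentiable_bound[of "{0..T}" "poly a" "poly (pderiv a)"])
    show "(poly a has_field_derivative poly (pderiv a) z) (at z within {0..T})" for z
      by (rule has_field_derivative_at_within[OF poly_DERIV])
  qed (use B that in auto)
  with B that show ?thesis by auto
qed

text \<open>Each of the terms \<open>y^0, ..., y^n\<close> is at least \<open>y^n\<close>, and their
  sum times \<open>1 - y\<close> is at most 1. It bounds
  \<open>(n + 1) \<sigma> (1 - \<sigma>)^n\<close> uniformly in \<open>n\<close>, the factor
  produced by differentiating a power of \<open>1 - \<sigma>\<close>.\<close>

lemma geometric_weight_bound:
  fixes y :: real
  assumes "0 \<le> y" "y \<le> 1" shows "real (Suc n) * (1 - y) * y ^ n \<le> 1"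
proof -
  have "real (Suc n) * y ^ n = (\<Sum>i<Suc n. y ^ n)" by simp
  also have "\<dots> \<le> (\<Sum>i<Suc n. y ^ i)" by (intro sum_mono power_decreasing) (use assms in auto)
  finally have "(1 - y) * (real (Suc n) * y ^ n) \<le> (1 - y) * (\<Sum>i<Suc n. y ^ i)" using assms by (intro mult_left_mono) auto
  also have "\<dots> = 1 - y ^ Suc n" by (rule one_diff_power_eq[symmetric])
  also have "\<dots> \<le> 1" using assms by simp
  finally show ?thesis by (simp only: mult_ac)
qed

lemma geometric_weight_lim:
  fixes y :: real
  assumes "0 \<le> y" "y < 1" shows "(\<lambda>n. real (Suc n) * y ^ n) \<longlonglongrightarrow> 0"
proof -
  have "(\<lambda>n. real n * y ^ n + y ^ n) \<longlonglongrightarrow> 0 + 0"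
    using assms by (intro tendsto_add powser_times_n_limit_0 LIMSEQ_realpow_zero) auto
  then show ?thesis by (simp add: algebra_simps)
qed

lemma pderiv_layer:
  fixes q :: "real poly"
  shows "poly (pderiv (q * (1 - q) ^ Suc n)) t
    = poly (pderiv q) t * ((1 - poly q t) ^ Suc n - real (Suc n) * poly q t * (1 - poly q t) ^ n)"
proof -
  have "pderiv (q * (1 - q) ^ Suc n) = q * (smult (of_nat (Suc n)) ((1 - q) ^ n) * (- pderiv q)) + (1 - q) ^ Suc n * pderiv q" (is "?l = ?r")
    unfolding pderiv_mult pderiv_power_Suc pderiv_diff pderiv_1 by simp
  then have *: "poly ?l t = poly ?r t" by (rule arg_cong)
  show ?thesis unfolding * poly_add poly_mult poly_smult poly_minus poly_power poly_diff poly_1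
    by (simp add: right_diff_distrib mult.commute mult.left_commute del: of_nat_Suc power_Suc)
qed

section \<open>Integrated subsolution inequalities\<close>

context jet_dual_measure
begin

text \<open>The properties shared by \<open>f\<close> and \<open>g\<close> on which the integrated
  inequalities rest.\<close>

definition adm :: "('a \<Rightarrow> real \<Rightarrow> real) \<Rightarrow> bool" where
  "adm w \<longleftrightarrow> (\<forall>\<rho>. \<exists>M. time_lipschitz t0 \<rho> M w) \<and> (\<forall>x v t h. norm v \<le> R \<longrightarrow> 0 \<le> h \<longrightarrow> 0 \<le> t \<longrightarrow> t + h \<le> t0 \<longrightarrow>
     w (x + h *\<^sub>R v) (t + h) \<le> w x t + lag.cost x v t h)"

lemma adm_lip: "adm w \<Longrightarrow> \<exists>M. time_lipschitz t0 \<rho> M w" by (simp add: adm_def)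
lemma adm_step: "adm w \<Longrightarrow> norm v \<le> R \<Longrightarrow> 0 \<le> h \<Longrightarrow> 0 \<le> t \<Longrightarrow> t + h \<le> t0 \<Longrightarrow>
     w (x + h *\<^sub>R v) (t + h) \<le> w x t + lag.cost x v t h" by (simp add: adm_def)

abbreviation ext where "ext \<equiv> reflect_ext t0"

lemma t0_nonneg: "0 \<le> t0" using t0 by simp

lemma cont_ext: "adm w \<Longrightarrow> continuous_on UNIV (ext w)"
  by (rule continuous_reflect_ext[OF adm_lip t0_nonneg])

lemma lip_f: "\<exists>M. time_lipschitz t0 \<rho> M f"
proof -
  obtain M where "M \<ge> 0" "\<And>x y s t. norm x \<le> \<rho> \<Longrightarrow> norm y \<le> \<rho> \<Longrightarrow> 0 \<le> s \<Longrightarrow> s \<le> t0 \<Longrightarrow> 0 \<le> t \<Longrightarrow> t \<le> t0 \<Longrightarrow>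
       \<bar>lag.V x t - lag.V y s\<bar> \<le> M * (norm (x - y) + \<bar>t - s\<bar>)"
    using lag.V_lipschitz[of \<rho> t0] by metis
  then show ?thesis by (intro exI[of _ M]) (auto simp: time_lipschitz_def f_def)
qed

lemma lip_g: "\<exists>M. time_lipschitz t0 \<rho> M g"
proof -
  obtain M where M: "M \<ge> 0" "\<And>x y s t. norm x \<le> \<rho> \<Longrightarrow> norm y \<le> \<rho> \<Longrightarrow> 0 \<le> s \<Longrightarrow> s \<le> t0 \<Longrightarrow> 0 \<le> t \<Longrightarrow> t \<le> t0 \<Longrightarrow>
       \<bar>rev.V x t - rev.V y s\<bar> \<le> M * (norm (x - y) + \<bar>t - s\<bar>)"
    using rev.V_lipschitz[of \<rho> t0] by metis
  have "\<bar>g x t - g y s\<bar> \<le> M * (norm (x - y) + \<bar>t - s\<bar>)"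
    if "norm x \<le> \<rho>" "norm y \<le> \<rho>" "0 \<le> s" "s \<le> t0" "0 \<le> t" "t \<le> t0" for x y s t
  proof -
    have "\<bar>rev.V x (t0 - t) - rev.V y (t0 - s)\<bar> \<le> M * (norm (x - y) + \<bar>(t0 - t) - (t0 - s)\<bar>)"
      by (rule M(2)) (use that in auto)
    then show ?thesis by (simp add: g_def abs_minus_commute)
  qed
  then show ?thesis using M(1) by (intro exI[of _ M]) (auto simp: time_lipschitz_def)
qed

lemma adm_f: "adm f" unfolding adm_def using lip_f f_step by blast
lemma adm_g: "adm g" unfolding adm_def using lip_g g_step by blast

definition C3 where "C3 = CL + \<Lambda>"
lemma C3: "C3 \<ge> 0" unfolding C3_def by (rule lag.C)

text \<open>Average the step inequality over the bump. \<open>E_le_jet\<close> bounds the cost of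
  the displaced steps by a Taylor polynomial at the centre; its linear part in the displacement
  averages out, which is why the error is of order \<open>e^2\<close> and not \<open>e\<close>. Then
  the duration \<open>h\<close> of the step tends to 0.\<close>

lemma moll_sub:
  assumes w: "adm w" and x: "\<delta> x \<le> r" and v: "norm v \<le> R" and e: "0 < e" "e < t" "t + e < t0"
  shows "deriv1 (mollify bump e (ext w)) (v, 1) (x, t) \<le> \<phi> (x, v, t) + C3 * e\<^sup>2"
proof -
  let ?W = "mollify bump e (ext w)" and ?q = "(x, t)" and ?u = "(v, 1::real)" and ?p = "(x, v, t)"
  define gx where "gx = (fst (G ?p), snd (snd (G ?p)))"
  define gv where "gv = G ?p \<bullet> (v, 0, 1)"
  define B where "B h = \<phi> ?p + (h / 2) * gv + C3 * (e + h * ((R + 1) / 2))\<^sup>2 + lag.K1 * h" for h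
  note cont = cont_ext[OF w]
  have smW: "smooth_fun ?W" by (rule smooth_fun_mollify[OF kernel_bump cont e(1)])
  have p: "?p \<in> P" by (rule in_P) (use x v e r in auto)
  have xS: "fst ?p \<in> S1" using x by (simp add: S1_def)
  have ineq: "?W (?q + h *\<^sub>R ?u) - ?W ?q \<le> h * B h" if h: "0 < h" "t + h + e \<le> t0" for h
  proof -
    \<comment> \<open>Affine in the displacement, so that mollifying it returns the value at the
      centre and the gradient term \<open>gx\<close> drops out.\<close>
    define af where "af y = - (h * B h) + (- (h *\<^sub>R gx)) \<bullet> (y - ?q)" for y
    have afc: "continuous_on UNIV af" unfolding af_def by (intro continuous_intros)
    have sh: "continuous_on UNIV (\<lambda>y. ext w (y + h *\<^sub>R ?u))"
      by (rule continuous_on_compose2[OF cont]) (auto intro!: continuous_intros)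
    have "?W (?q + h *\<^sub>R ?u) = mollify bump e (\<lambda>y. ext w (y + h *\<^sub>R ?u)) ?q"
      unfolding mollify_def add.assoc add.commute[of "h *\<^sub>R ?u"] by (rule refl)
    also have "\<dots> \<le> mollify bump e (\<lambda>y. ext w y - af y) ?q"
    proof (rule mollify_mono_combination[OF sh])
      show "continuous_on UNIV (\<lambda>y. ext w y - af y)" by (intro continuous_on_diff cont afc)
      fix z :: "'a \<times> real" assume z: "norm z \<le> 1"
      obtain z1 z2 where zz: "z = (z1, z2)" by (cases z)
      have ez: "norm (e *\<^sub>R z) \<le> e" using e z by (intro norm_scaleR_le) auto
      have "\<bar>z2\<bar> \<le> 1" using z norm_snd_le[of z2 z1] zz by simp
      then have "\<bar>e * z2\<bar> \<le> e" using e by (simp add: abs_mult mult_le_cancel_left1)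
      then have time: "0 \<le> t + e * z2" "t + e * z2 + h \<le> t0" "t + e * z2 \<le> t0" using e h by linarith+
      define X where "X = x + e *\<^sub>R z1"
      define a where "a = t + e * z2"
      define d where "d = (e *\<^sub>R z1 + (h / 2) *\<^sub>R v, 0::'a, e * z2 + h / 2)"
      have "ext w (?q + e *\<^sub>R z + h *\<^sub>R ?u) = w (X + h *\<^sub>R v) (a + h)"
        using time h by (simp add: zz X_def a_def reflect_ext_id)
      also have "\<dots> \<le> w X a + lag.cost X v a h"
        by (rule adm_step[OF w v]) (use time h in \<open>auto simp: a_def\<close>)
      also have "w X a = ext w (?q + e *\<^sub>R z)" using time by (simp add: zz X_def a_def reflect_ext_id)
      also have "lag.cost X v a h \<le> h * (\<phi> ?p + (gx \<bullet> (e *\<^sub>R z) + (h / 2) * gv) + C3 * (e + h * ((R + 1) / 2))\<^sup>2) + lag.K1 * h\<^sup>2"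
      proof -
        have dd: "(X + (h / 2) *\<^sub>R v, v, a + h / 2) = ?p + d" by (simp add: X_def a_def d_def)
        have "d = (e *\<^sub>R z1, 0, e * z2) + (h / 2) *\<^sub>R (v, 0, 1)" by (simp add: d_def)
        then have Gd: "G ?p \<bullet> d = G ?p \<bullet> (e *\<^sub>R z1, 0, e * z2) + (h / 2) * gv" 
          unfolding gv_def by (simp only: inner_add_right inner_scaleR_right)
        have "G ?p \<bullet> (e *\<^sub>R z1, 0, e * z2) = gx \<bullet> (e *\<^sub>R z)"
          by (cases "G ?p") (auto simp: gx_def zz inner_Pair)
        note Gd = Gd[unfolded this]
        have "norm d \<le> norm (e *\<^sub>R z1, 0::'a, e * z2) + norm ((h / 2) *\<^sub>R (v, 0::'a, 1::real))"
          unfolding \<open>d = (e *\<^sub>R z1, 0, e * z2) + (h / 2) *\<^sub>R (v, 0, 1)\<close> by (rule norm_triangle_ineq)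
        also have "norm (e *\<^sub>R z1, 0::'a, e * z2) = norm (e *\<^sub>R z)" by (simp add: zz norm_Pair)
        also have "norm ((h / 2) *\<^sub>R (v, 0::'a, 1::real)) \<le> (h / 2) * (R + 1)"
        proof -
          have "norm (v, 0::'a, 1::real) \<le> norm v + norm (0::'a, 1::real)" by (rule norm_Pair_le)
          also have "\<dots> \<le> R + 1" using v by (simp add: norm_Pair)
          finally show ?thesis using h by (simp del: scaleR_Pair)
        qed
        finally have "norm d \<le> e + h * ((R + 1) / 2)" using ez by simp
        then have "C3 * (norm d)\<^sup>2 \<le> C3 * (e + h * ((R + 1) / 2))\<^sup>2" using C3 by (intro mult_left_mono power_mono) auto
        then have "E (?p + d) \<le> \<phi> ?p + (gx \<bullet> (e *\<^sub>R z) + (h / 2) * gv) + C3 * (e + h * ((R + 1) / 2))\<^sup>2"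
          using je.E_le_jet[OF p xS, of d] unfolding Gd C3_def by linarith
        then show ?thesis unfolding lag.cost_def dd using h by (intro add_right_mono mult_left_mono) auto
      qed
      also have "\<dots> = - af (?q + e *\<^sub>R z)" 
        unfolding af_def B_def by (simp add: power2_eq_square algebra_simps)
      finally show "ext w (?q + e *\<^sub>R z + h *\<^sub>R ?u) \<le> ext w (?q + e *\<^sub>R z) - af (?q + e *\<^sub>R z)" by simp
    qed
    also have "\<dots> = ?W ?q - mollify bump e af ?q" by (rule mollify_diff[OF kernel_bump cont afc])
    also have "mollify bump e af ?q = - (h * B h)" unfolding af_def mollify_bump_affine by simp
    finally show ?thesis by simp
  qed
  have "deriv1 ?W ?u ?q \<le> B 0"
  proof (rule tendsto_le[of "at_right 0"])
    have "isCont B 0" unfolding B_def by (intro continuous_intros) auto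
    then show "(B \<longlongrightarrow> B 0) (at_right 0)" unfolding isCont_def by (rule filterlim_mono[OF _ order_refl at_le]) simp
    show "((\<lambda>h. (?W (?q + h *\<^sub>R ?u) - ?W ?q) / h) \<longlongrightarrow> deriv1 ?W ?u ?q) (at_right 0)"
      by (rule filterlim_mono[OF directional_derivative_limit[OF smooth_fun_has_derivative[OF smW]] order_refl]) (simp add: at_le)
    show "\<forall>\<^sub>F h in at_right 0. (?W (?q + h *\<^sub>R ?u) - ?W ?q) / h \<le> B h"
      unfolding eventually_at_right_field
      by (rule exI[of _ "t0 - t - e"]) (use ineq e in \<open>auto simp: pos_divide_le_eq mult.commute\<close>)
  qed simp
  then show ?thesis by (simp add: B_def)
qed

lemma S0_bound: obtains \<rho> where "\<And>x. x \<in> S0 \<Longrightarrow> norm x \<le> \<rho>"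
  using compact_imp_bounded[OF S0(1)] unfolding bounded_iff by blast

lemma adm_lip_S0:
  assumes "adm w" 
  obtains M where "M \<ge> 0" "\<And>x k. x \<in> S0 \<Longrightarrow> k \<le> 2 \<Longrightarrow> time_lipschitz t0 (norm x + k) M w"
proof -
  obtain \<rho> where \<rho>: "\<And>x. x \<in> S0 \<Longrightarrow> norm x \<le> \<rho>" by (rule S0_bound) blast
  obtain M where M: "time_lipschitz t0 (\<rho> + 2) M w" using adm_lip[OF assms] by blast
  have "time_lipschitz t0 (norm x + k) M w" if "x \<in> S0" "k \<le> 2" for x k
    using M \<rho>[OF that(1)] that(2) unfolding time_lipschitz_def by force
  moreover have "M \<ge> 0" using M by (simp add: time_lipschitz_def)
  ultimately show ?thesis using that by blast
qed

lemma cont_w: "adm w \<Longrightarrow> continuous_on Q0 (\<lambda>p. w (fst p) (tm p))"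
proof -
  assume w: "adm w"
  have "continuous_on Q0 (\<lambda>p. ext w (bs p))"
    by (rule continuous_on_compose2[OF cont_ext[OF w]]) (auto intro!: continuous_intros)
  then show ?thesis
    by (rule continuous_on_cong[THEN iffD1, OF refl, rotated]) (auto simp: Q0_def reflect_ext_id)
qed

lemma norm_v1: "norm v \<le> R \<Longrightarrow> norm (v, 1::real) \<le> R + 1" for v :: 'a
  using norm_Pair_le[of v "1::real"] by simp

lemma dsig_bound:
  fixes M :: real
  assumes "adm w" "M \<ge> 0" "time_lipschitz t0 (norm x + 2) M w" "0 < e" "e \<le> 1" "norm v \<le> R"
  shows "\<bar>dsig (mollify bump e (ext w)) (x, v, t)\<bar> \<le> 8 * M * (R + 1)"
proof -
  have "\<bar>dsig (mollify bump e (ext w)) (x, v, t)\<bar> \<le> 8 * M * norm (v, 1::real)"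
    unfolding dsig_def fst_conv snd_conv
    by (rule mollify_deriv_bound[OF _ t0_nonneg assms(4,5) cont_ext[OF assms(1)]]) (use assms in simp)
  also have "\<dots> \<le> 8 * M * (R + 1)" using assms norm_v1[of v] by (intro mult_left_mono) auto
  finally show ?thesis .
qed

text \<open>Test closedness with \<open>a\<close> times the mollified \<open>w\<close> and let
  \<open>e\<close> tend to 0. In the interior \<open>moll_sub\<close> applies; within
  \<open>e\<close> of an end time the weight is \<open>O(e)\<close> and \<open>dsig - \<phi>\<close>
  is bounded. Replacing the mollification by \<open>w\<close> also costs
  \<open>O(e)\<close>.\<close>

lemma subsolution_integral_nonneg:
  assumes w: "adm w" and a: "\<And>t. 0 \<le> t \<Longrightarrow> t \<le> t0 \<Longrightarrow> 0 \<le> poly a t" "poly a 0 = 0" "poly a t0 = 0"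
  shows "0 \<le> I (\<lambda>p. poly a (tm p) * \<phi> p + poly (pderiv a) (tm p) * w (fst p) (tm p))"
proof -
  obtain M where M: "M \<ge> 0" "\<And>x k. x \<in> S0 \<Longrightarrow> k \<le> 2 \<Longrightarrow> time_lipschitz t0 (norm x + k) M w"
    using adm_lip_S0[OF w] by blast
  obtain La where La: "La \<ge> 0" "\<And>s t. 0 \<le> s \<Longrightarrow> s \<le> t0 \<Longrightarrow> 0 \<le> t \<Longrightarrow> t \<le> t0 \<Longrightarrow> \<bar>poly a s - poly a t\<bar> \<le> La * \<bar>s - t\<bar>"
    using poly_lipschitz_on by blast
  obtain Ba where Ba: "Ba \<ge> 0" "\<And>t. 0 \<le> t \<Longrightarrow> t \<le> t0 \<Longrightarrow> \<bar>poly a t\<bar> \<le> Ba" using poly_bounded_on by blast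
  obtain Bd where Bd: "Bd \<ge> 0" "\<And>t. 0 \<le> t \<Longrightarrow> t \<le> t0 \<Longrightarrow> \<bar>poly (pderiv a) t\<bar> \<le> Bd" using poly_bounded_on by blast
  define c1 where "c1 = Ba * C3 + La * (1 + 8 * M * (R + 1))"
  define c where "c = (c1 + Bd * (8 * M)) * \<mu>1"
  let ?J = "I (\<lambda>p. poly a (tm p) * \<phi> p + poly (pderiv a) (tm p) * w (fst p) (tm p))"
  note cc = continuous_on_add continuous_on_diff continuous_on_mult cont_poly cont_\<phi>Q cont_w[OF w]
  have le: "- ?J \<le> c * e" if e: "0 < e" "e \<le> 1" for e
  proof -
    let ?W = "mollify bump e (ext w)"
    have smW: "smooth_fun ?W" by (rule smooth_fun_mollify[OF kernel_bump cont_ext[OF w] e(1)])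
    have "- ?J = I (\<lambda>p. poly (pderiv a) (tm p) * ?W (bs p) + poly a (tm p) * dsig ?W p) - ?J"
      using poly_closedness[OF smW a(2,3)] by simp
    also have "\<dots> = I (\<lambda>p. (poly (pderiv a) (tm p) * ?W (bs p) + poly a (tm p) * dsig ?W p)
       - (poly a (tm p) * \<phi> p + poly (pderiv a) (tm p) * w (fst p) (tm p)))"
      by (rule I_diff[symmetric]) (intro cc cont_W[OF smW] cont_dsig[OF smW])+
    also have "\<dots> \<le> ((c1 + Bd * (8 * M)) * e) * \<mu>1"
    proof (rule I_le_const)
      fix p assume "p \<in> Q0"
      then obtain x v t where p: "p = (x, v, t)" and "(x, v, t) \<in> Q0" by (cases p) auto
      note q = Q0D[OF this(2)]
      have t: "0 \<le> t" "t \<le> t0" and vR: "norm v \<le> R" using q by auto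
      have "\<bar>?W (x, t) - ext w (x, t)\<bar> \<le> 8 * M * e"
        by (rule mollify_close[OF _ t0_nonneg e cont_ext[OF w]]) (use M(2)[OF q(1), of 1] in simp)
      then have "\<bar>poly (pderiv a) t * (?W (x, t) - w x t)\<bar> \<le> Bd * (8 * M * e)"
        unfolding abs_mult reflect_ext_id[OF t] using Bd t by (intro mult_mono) auto
      then have 1: "poly (pderiv a) t * (?W (x, t) - w x t) \<le> Bd * (8 * M) * e" by simp
      have pP: "(x, v, t) \<in> P" using q Q0_P p \<open>p \<in> Q0\<close> by auto
      have 2: "poly a t * (dsig ?W (x, v, t) - \<phi> (x, v, t)) \<le> c1 * e"
      proof (cases "e < t \<and> t + e < t0")
        case True
        have "dsig ?W (x, v, t) - \<phi> (x, v, t) \<le> C3 * e\<^sup>2"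
          using moll_sub[OF w _ vR e(1), of x t] True q r by (simp add: dsig_def \<delta>_S0)
        also have "\<dots> \<le> C3 * e" using C3 e by (intro mult_left_mono) (auto simp: power2_eq_square mult_le_cancel_left1)
        finally have "poly a t * (dsig ?W (x, v, t) - \<phi> (x, v, t)) \<le> poly a t * (C3 * e)"
          using a(1)[OF t] by (intro mult_left_mono)
        also have "\<dots> \<le> Ba * (C3 * e)" using Ba(2)[OF t] C3 e by (intro mult_right_mono) auto
        also have "\<dots> \<le> c1 * e" using La M R e by (simp add: c1_def algebra_simps)
        finally show ?thesis .
      next
        case False
        have "poly a t \<le> La * e"
        proof (cases "t \<le> e")
          case True
          have "poly a t \<le> La * t" using La(2)[of t 0] t a(2) t0 by simp
          also have "\<dots> \<le> La * e" using True La by (intro mult_left_mono)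
          finally show ?thesis .
        next
          case te: False
          have "poly a t \<le> La * (t0 - t)" using La(2)[of t t0] t a(3) t0 by simp
          also have "\<dots> \<le> La * e" using False te La by (intro mult_left_mono) auto
          finally show ?thesis .
        qed
        moreover have "dsig ?W (x, v, t) - \<phi> (x, v, t) \<le> 1 + 8 * M * (R + 1)"
          using dsig_bound[OF w M(1) M(2)[OF q(1) order_refl] e vR, of t] \<phi>_le1[OF pP] by linarith
        moreover have "0 \<le> 1 + 8 * M * (R + 1)" using M R by simp
        ultimately have "poly a t * (dsig ?W (x, v, t) - \<phi> (x, v, t)) \<le> (La * e) * (1 + 8 * M * (R + 1))"
          using a(1)[OF t] La e
          by (intro order_trans[OF mult_left_mono mult_right_mono]) auto
        also have "\<dots> \<le> c1 * e" using Ba C3 e by (simp add: c1_def algebra_simps)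
        finally show ?thesis .
      qed
      show "(poly (pderiv a) (tm p) * ?W (bs p) + poly a (tm p) * dsig ?W p)
         - (poly a (tm p) * \<phi> p + poly (pderiv a) (tm p) * w (fst p) (tm p)) \<le> (c1 + Bd * (8 * M)) * e"
        using 1 2 by (simp add: p algebra_simps)
    qed (intro cc cont_W[OF smW] cont_dsig[OF smW])+
    finally show ?thesis by (simp add: c_def mult_ac)
  qed
  have c: "c \<ge> 0" unfolding c_def c1_def using Ba C3 La M R Bd \<mu>1 by auto
  have "- ?J \<le> 0 + k" if "k > 0" for k
  proof -
    have "- ?J \<le> c * min 1 (k / (c + 1))" using that c by (intro le) auto
    also have "\<dots> \<le> (c + 1) * (k / (c + 1))" using that c by (intro mult_mono) auto
    also have "\<dots> = k" using c by simp
    finally show ?thesis by simp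
  qed
  then have "- ?J \<le> 0" by (rule field_le_epsilon)
  then show ?thesis by simp
qed

lemma I_dominated:
  assumes "\<And>n. continuous_on Q0 (h n)" "(\<lambda>p. indicator Q0 p *\<^sub>R k p) \<in> borel_measurable \<mu>"
    "AE p in \<mu>. p \<in> Q0 \<longrightarrow> (\<lambda>n. h n p) \<longlonglongrightarrow> k p" "\<And>n p. p \<in> Q0 \<Longrightarrow> \<bar>h n p\<bar> \<le> B"
  shows "(\<lambda>n. I (h n)) \<longlonglongrightarrow> I k"
  unfolding I_def set_lebesgue_integral_def
proof (rule integral_dominated_convergence[where w = "\<lambda>p. \<bar>B\<bar>"])
  show "AE p in \<mu>. (\<lambda>n. indicator Q0 p *\<^sub>R h n p) \<longlonglongrightarrow> indicator Q0 p *\<^sub>R k p"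
    using assms(3) by eventually_elim (auto simp: indicator_def)
  show "AE p in \<mu>. norm (indicator Q0 p *\<^sub>R h n p) \<le> \<bar>B\<bar>" for n
  proof (intro AE_I2)
    fix p show "norm (indicator Q0 p *\<^sub>R h n p) \<le> \<bar>B\<bar>" using assms(4)[of p n] by (cases "p \<in> Q0") auto
  qed
  show "(\<lambda>p. indicator Q0 p *\<^sub>R h n p) \<in> borel_measurable \<mu>" for n
    using I_integrable[OF assms(1)] unfolding set_integrable_def by (rule borel_measurable_integrable)
qed (use assms(2) in auto)

lemma cont_measurable: "continuous_on Q0 k \<Longrightarrow> (\<lambda>p. indicator Q0 p *\<^sub>R (k p :: real)) \<in> borel_measurable \<mu>"
  using I_integrable unfolding set_integrable_def by (rule borel_measurable_integrable)

text \<open>\<open>\<alpha> + t * \<beta>\<close> is \<open>t / t0\<close> or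
  \<open>1 - t / t0\<close>, the normalised distance from the initial or the final time; one proof
  serves both ends.\<close>

definition time_scale :: "real \<Rightarrow> real \<Rightarrow> bool" where
  "time_scale \<alpha> \<beta> \<longleftrightarrow> (\<alpha> = 0 \<and> \<beta> = 1 / t0) \<or> (\<alpha> = 1 \<and> \<beta> = - 1 / t0)"

lemma time_scale_range: "time_scale \<alpha> \<beta> \<Longrightarrow> 0 \<le> t \<Longrightarrow> t \<le> t0 \<Longrightarrow> 0 \<le> \<alpha> + t * \<beta> \<and> \<alpha> + t * \<beta> \<le> 1"
  unfolding time_scale_def using t0 by (elim disjE conjE) (simp_all add: divide_le_eq)

text \<open>Test with \<open>\<sigma> (1 - \<sigma>)^{n+1}\<close>, where
  \<open>\<sigma> = \<alpha> + t * \<beta>\<close>. It vanishes at both ends, and its time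
  derivative divided by \<open>\<beta>\<close> is bounded by 2 and converges to the indicator of
  \<open>\<sigma> = 0\<close>. All these integrals are 0, so the end time is null.\<close>

lemma AE_time_scale_pos:
  assumes ts: "time_scale \<alpha> \<beta>"
  shows "AE p in \<mu>. p \<in> Q0 \<longrightarrow> 0 < \<alpha> + tm p * \<beta>"
proof -
  let ?q = "[:\<alpha>, \<beta>:]"
  let ?s = "\<lambda>p::'a \<times> 'a \<times> real. \<alpha> + tm p * \<beta>"
  have s01: "0 \<le> ?s p \<and> ?s p \<le> 1" if "p \<in> Q0" for p
    using that time_scale_range[OF ts, of "tm p"] by (auto simp: Q0_def)
  have \<beta>: "\<beta> \<noteq> 0" using ts t0 by (auto simp: time_scale_def)
  define h where "h n p = (1 - ?s p) ^ Suc n - real (Suc n) * ?s p * (1 - ?s p) ^ n" for n and p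
  have I0: "I (h n) = 0" for n
  proof -
    let ?a = "?q * (1 - ?q) ^ Suc n"
    have d: "poly (pderiv ?a) t = \<beta> * ((1 - (\<alpha> + t * \<beta>)) ^ Suc n - real (Suc n) * (\<alpha> + t * \<beta>) * (1 - (\<alpha> + t * \<beta>)) ^ n)" for t
      unfolding pderiv_layer by (simp add: pderiv_pCons)
    have "I (\<lambda>p. poly (pderiv ?a) (tm p) * (\<lambda>_. 1) (bs p) + poly ?a (tm p) * dsig (\<lambda>_. 1) p) = 0"
      by (rule poly_closedness) (use ts t0 in \<open>auto simp: time_scale_def\<close>)
    moreover have "dsig (\<lambda>_. 1) p = 0" for p by (simp add: dsig_def)
    ultimately have "I (\<lambda>p. \<beta> * h n p) = 0" unfolding d h_def by simp
    then show ?thesis using \<beta> by (simp add: I_cmult)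
  qed
  let ?Z = "{p \<in> Q0. ?s p = 0}"
  have "(\<lambda>n. I (h n)) \<longlonglongrightarrow> I (indicator ?Z)"
  proof (rule I_dominated)
    show "continuous_on Q0 (h n)" for n unfolding h_def by (intro continuous_intros)
    have "compact ?Z" using compact_Q0 
      by (intro compact_Int_closed[where T = "{p. ?s p = 0}", simplified Int_def mem_Collect_eq] closed_Collect_eq continuous_intros) auto
    then have "?Z \<in> sets \<mu>" unfolding sets_mu by (simp add: compact_imp_closed)
    then have "(indicator ?Z :: _ \<Rightarrow> real) \<in> borel_measurable \<mu>" by simp
    moreover have "(\<lambda>p. indicator Q0 p *\<^sub>R indicator ?Z p :: real) = indicator ?Z" by (auto simp: indicator_def fun_eq_iff)
    ultimately show "(\<lambda>p. indicator Q0 p *\<^sub>R (indicator ?Z p :: real)) \<in> borel_measurable \<mu>" by simp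
    have "(\<lambda>n. h n p) \<longlonglongrightarrow> indicator ?Z p" if p: "p \<in> Q0" for p
    proof (cases "?s p = 0")
      case True
      then show ?thesis using p by (simp add: h_def)
    next
      case False
      then have y: "0 \<le> 1 - ?s p" "1 - ?s p < 1" using s01[OF p] by auto
      have "(\<lambda>n. (1 - ?s p) ^ Suc n - ?s p * (real (Suc n) * (1 - ?s p) ^ n)) \<longlonglongrightarrow> 0 - ?s p * 0"
        by (intro tendsto_diff tendsto_mult tendsto_const geometric_weight_lim y LIMSEQ_Suc LIMSEQ_realpow_zero)
      then show ?thesis using False unfolding h_def by (simp add: mult_ac)
    qed
    then show "AE p in \<mu>. p \<in> Q0 \<longrightarrow> (\<lambda>n. h n p) \<longlonglongrightarrow> indicator ?Z p" by (intro AE_I2) blast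
    show "\<bar>h n p\<bar> \<le> 2" if p: "p \<in> Q0" for n p
    proof -
      have y: "0 \<le> 1 - ?s p" "1 - ?s p \<le> 1" using s01[OF p] by auto
      have "0 \<le> (1 - ?s p) ^ Suc n" "(1 - ?s p) ^ Suc n \<le> 1" using y by (auto intro!: power_le_one simp del: power_Suc)
      moreover have "real (Suc n) * ?s p * (1 - ?s p) ^ n \<le> 1" using geometric_weight_bound[OF y, of n] by simp
      moreover have "0 \<le> real (Suc n) * ?s p * (1 - ?s p) ^ n" using y s01[OF p] by auto
      ultimately show ?thesis unfolding h_def by linarith
    qed
  qed
  then have "I (indicator ?Z) = 0" unfolding I0 using LIMSEQ_unique tendsto_const by blast
  then have "integral\<^sup>L \<mu> (indicator ?Z :: _ \<Rightarrow> real) = 0"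
    unfolding I_def set_lebesgue_integral_def
    by (simp add: indicator_inter_arith[symmetric] Int_absorb1 subset_iff Collect_mono)
  moreover have "closed ?Z"
    using compact_imp_closed[OF compact_Q0] 
    by (intro closed_Collect_conj[of "\<lambda>p. p \<in> Q0", simplified] closed_Collect_eq continuous_intros) auto
  ultimately have "measure \<mu> ?Z = 0" using sets_mu by simp
  then have "emeasure \<mu> ?Z = 0" by (simp add: fin.emeasure_eq_measure)
  then have "AE p in \<mu>. p \<notin> ?Z" using \<open>closed ?Z\<close> sets_mu by (intro AE_not_in) (auto simp: null_sets_def)
  then show ?thesis
  proof eventually_elim
    case (elim p)
    then show ?case using s01[of p] by force
  qed
qed


text \<open>The weights \<open>a (1 - (1 - \<sigma>)\<^sup>n\<^sup>+\<^sup>1)\<close>, with \<open>\<sigma> = \<alpha> + t \<beta>\<close>, vanish at both endpoints and increase to \<open>a\<close>;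
  their derivatives concentrate where \<open>w\<close> is of the order of \<open>\<sigma>\<close>.\<close>

lemma subsolution_integral_limit:
  assumes w: "adm w" and ts: "time_scale \<alpha> \<beta>" and a: "\<And>t. 0 \<le> t \<Longrightarrow> t \<le> t0 \<Longrightarrow> 0 \<le> poly a t"
    and ends: "\<alpha> = 0 \<Longrightarrow> poly a t0 = 0" "\<alpha> = 1 \<Longrightarrow> poly a 0 = 0"
    and c: "c \<ge> 0" "\<And>x t. x \<in> S0 \<Longrightarrow> 0 \<le> t \<Longrightarrow> t \<le> t0 \<Longrightarrow> \<bar>w x t\<bar> \<le> c * (\<alpha> + t * \<beta>)"
  shows "0 \<le> I (\<lambda>p. poly a (tm p) * \<phi> p + poly (pderiv a) (tm p) * w (fst p) (tm p))"
proof -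
  let ?q = "[:\<alpha>, \<beta>:]"
  let ?s = "\<lambda>p::'a \<times> 'a \<times> real. \<alpha> + tm p * \<beta>"
  have s01: "0 \<le> ?s p \<and> ?s p \<le> 1" if "p \<in> Q0" for p
    using that time_scale_range[OF ts, of "tm p"] by (auto simp: Q0_def)
  define u where "u n y = 1 - (1 - y) ^ Suc n" for n and y :: real
  define z where "z n y = real (Suc n) * (1 - y) ^ n" for n and y :: real
  have u01: "0 \<le> u n (?s p)" "u n (?s p) \<le> 1" if "p \<in> Q0" for n p
    using s01[OF that] by (auto simp: u_def intro!: power_le_one simp del: power_Suc)
  define h where "h n p = poly a (tm p) * u n (?s p) * \<phi> p
     + (poly (pderiv a) (tm p) * u n (?s p) + poly a (tm p) * (z n (?s p) * \<beta>)) * w (fst p) (tm p)" for n p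
  have nn: "0 \<le> I (h n)" for n
  proof -
    let ?a = "a * (1 - (1 - ?q) ^ Suc n)"
    have v: "poly ?a t = poly a t * u n (\<alpha> + t * \<beta>)" for t by (simp add: u_def del: power_Suc)
    have pd: "pderiv ?a = pderiv a * (1 - (1 - ?q) ^ Suc n) + a * smult (of_nat (Suc n)) ((1 - ?q) ^ n * pderiv ?q)"
      unfolding pderiv_mult pderiv_power_Suc pderiv_diff pderiv_1 by simp
    have d: "poly (pderiv ?a) t = poly (pderiv a) t * u n (\<alpha> + t * \<beta>) + poly a t * (z n (\<alpha> + t * \<beta>) * \<beta>)" for t
      unfolding pd u_def z_def by (simp add: pderiv_pCons mult.assoc del: power_Suc of_nat_Suc)
    have "0 \<le> I (\<lambda>p. poly ?a (tm p) * \<phi> p + poly (pderiv ?a) (tm p) * w (fst p) (tm p))"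
    proof (rule subsolution_integral_nonneg[OF w])
      show "0 \<le> poly ?a t" if "0 \<le> t" "t \<le> t0" for t
        unfolding v u_def using a[OF that] time_scale_range[OF ts that] 
        by (intro mult_nonneg_nonneg) (auto intro!: power_le_one simp del: power_Suc)
    qed (unfold v u_def, use ts ends t0 in \<open>auto simp: time_scale_def\<close>)
    then show ?thesis unfolding d v h_def .
  qed
  obtain B1 where B1: "B1 \<ge> 0" "\<And>t. 0 \<le> t \<Longrightarrow> t \<le> t0 \<Longrightarrow> \<bar>poly a t\<bar> \<le> B1" using poly_bounded_on by blast
  obtain B2 where B2: "B2 \<ge> 0" "\<And>t. 0 \<le> t \<Longrightarrow> t \<le> t0 \<Longrightarrow> \<bar>poly (pderiv a) t\<bar> \<le> B2" using poly_bounded_on by blast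
  have cont: "continuous_on Q0 (\<lambda>p. poly a (tm p) * \<phi> p + poly (pderiv a) (tm p) * w (fst p) (tm p))"
    by (intro continuous_on_add continuous_on_mult cont_poly cont_\<phi>Q cont_w[OF w])
  have "(\<lambda>n. I (h n)) \<longlonglongrightarrow> I (\<lambda>p. poly a (tm p) * \<phi> p + poly (pderiv a) (tm p) * w (fst p) (tm p))"
  proof (rule I_dominated[where B = "B1 + (B2 * c + B1 * \<bar>\<beta>\<bar> * c)"])
    show "continuous_on Q0 (h n)" for n unfolding h_def u_def z_def
      by (intro continuous_on_add continuous_on_mult cont_poly cont_\<phi>Q cont_w[OF w] continuous_intros)
    show "(\<lambda>p. indicator Q0 p *\<^sub>R (poly a (tm p) * \<phi> p + poly (pderiv a) (tm p) * w (fst p) (tm p))) \<in> borel_measurable \<mu>"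
      by (rule cont_measurable[OF cont])
    show "AE p in \<mu>. p \<in> Q0 \<longrightarrow> (\<lambda>n. h n p) \<longlonglongrightarrow> poly a (tm p) * \<phi> p + poly (pderiv a) (tm p) * w (fst p) (tm p)"
      using AE_time_scale_pos[OF ts]
    proof eventually_elim
      case (elim p)
      show ?case
      proof
        assume p: "p \<in> Q0"
        then have y: "0 \<le> 1 - ?s p" "1 - ?s p < 1" using s01[OF p] elim by auto
        have u: "(\<lambda>n. u n (?s p)) \<longlonglongrightarrow> 1 - 0" unfolding u_def
          by (intro tendsto_diff tendsto_const LIMSEQ_Suc LIMSEQ_realpow_zero y)
        have z: "(\<lambda>n. z n (?s p)) \<longlonglongrightarrow> 0" unfolding z_def by (intro geometric_weight_lim y)
        have "(\<lambda>n. h n p) \<longlonglongrightarrow> poly a (tm p) * (1 - 0) * \<phi> p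
          + (poly (pderiv a) (tm p) * (1 - 0) + poly a (tm p) * (0 * \<beta>)) * w (fst p) (tm p)" unfolding h_def
          by (intro tendsto_add tendsto_mult tendsto_const u z)
        then show "(\<lambda>n. h n p) \<longlonglongrightarrow> poly a (tm p) * \<phi> p + poly (pderiv a) (tm p) * w (fst p) (tm p)" by simp
      qed
    qed
    fix n p assume p: "p \<in> Q0"
    then have t: "0 \<le> tm p" "tm p \<le> t0" and x: "fst p \<in> S0" by (auto simp: Q0_def)
    note s = s01[OF p]
    have b1: "\<bar>poly a (tm p) * u n (?s p) * \<phi> p\<bar> \<le> B1 * 1 * 1"
      unfolding abs_mult using B1 t u01[OF p] \<phi>_le1[of p] Q0_P p by (intro mult_mono) auto
    have wc: "\<bar>w (fst p) (tm p)\<bar> \<le> c * ?s p" by (rule c(2)[OF x t])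
    also have "\<dots> \<le> c * 1" using s c(1) by (intro mult_left_mono) auto
    finally have wc1: "\<bar>w (fst p) (tm p)\<bar> \<le> c" by simp
    have b2: "\<bar>poly (pderiv a) (tm p) * u n (?s p) * w (fst p) (tm p)\<bar> \<le> B2 * 1 * c"
      unfolding abs_mult using B2 t u01[OF p] wc1 by (intro mult_mono) auto
    have z0: "0 \<le> z n (?s p)" using s by (simp add: z_def)
    have "\<bar>z n (?s p) * w (fst p) (tm p)\<bar> \<le> z n (?s p) * (c * ?s p)"
      unfolding abs_mult using z0 wc by (simp add: mult_left_mono)
    also have "\<dots> = c * (real (Suc n) * (1 - (1 - ?s p)) * (1 - ?s p) ^ n)" by (simp add: z_def)
    also have "\<dots> \<le> c * 1" by (intro mult_left_mono geometric_weight_bound c(1)) (use s in auto)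
    finally have zw: "\<bar>z n (?s p) * w (fst p) (tm p)\<bar> \<le> c" by simp
    have b3: "\<bar>poly a (tm p) * \<beta> * (z n (?s p) * w (fst p) (tm p))\<bar> \<le> B1 * \<bar>\<beta>\<bar> * c"
      unfolding abs_mult[of "_ * \<beta>"] abs_mult[of _ \<beta>] using B1 t zw by (intro mult_mono) auto
    have "h n p = poly a (tm p) * u n (?s p) * \<phi> p + (poly (pderiv a) (tm p) * u n (?s p) * w (fst p) (tm p)
      + poly a (tm p) * \<beta> * (z n (?s p) * w (fst p) (tm p)))" by (simp add: h_def algebra_simps)
    then show "\<bar>h n p\<bar> \<le> B1 + (B2 * c + B1 * \<bar>\<beta>\<bar> * c)" using b1 b2 b3 by linarith
  qed
  then show ?thesis using nn by (intro LIMSEQ_le_const) auto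
qed

lemma f_time_bound: obtains c where "c \<ge> 0" "\<And>x t. x \<in> S0 \<Longrightarrow> 0 \<le> t \<Longrightarrow> t \<le> t0 \<Longrightarrow> \<bar>f x t\<bar> \<le> c * (0 + t * (1 / t0))"
proof -
  obtain M where M: "M \<ge> 0" "\<And>x k. x \<in> S0 \<Longrightarrow> k \<le> 2 \<Longrightarrow> time_lipschitz t0 (norm x + k) M f"
    using adm_lip_S0[OF adm_f] by blast
  have "\<bar>f x t\<bar> \<le> (M * t0) * (0 + t * (1 / t0))" if "x \<in> S0" "0 \<le> t" "t \<le> t0" for x t
  proof -
    have "\<bar>f x t - f x 0\<bar> \<le> M * (norm (x - x) + \<bar>t - 0\<bar>)"
      by (rule time_lipschitzD[OF M(2)[OF that(1), of 0]]) (use that t0 in auto)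
    then show ?thesis using t0 that by (simp add: f_0)
  qed
  then show ?thesis using that[of "M * t0"] M(1) t0 by simp
qed

lemma g_time_bound: obtains c where "c \<ge> 0" "\<And>x t. x \<in> S0 \<Longrightarrow> 0 \<le> t \<Longrightarrow> t \<le> t0 \<Longrightarrow> \<bar>g x t\<bar> \<le> c * (1 + t * (- 1 / t0))"
proof -
  obtain M where M: "M \<ge> 0" "\<And>x k. x \<in> S0 \<Longrightarrow> k \<le> 2 \<Longrightarrow> time_lipschitz t0 (norm x + k) M g"
    using adm_lip_S0[OF adm_g] by blast
  have "\<bar>g x t\<bar> \<le> (M * t0) * (1 + t * (- 1 / t0))" if "x \<in> S0" "0 \<le> t" "t \<le> t0" for x t
  proof -
    have "\<bar>g x t - g x t0\<bar> \<le> M * (norm (x - x) + \<bar>t - t0\<bar>)"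
      by (rule time_lipschitzD[OF M(2)[OF that(1), of 0]]) (use that t0 in auto)
    moreover have "norm (x - x) + \<bar>t - t0\<bar> = t0 * (1 + t * (- 1 / t0))"
      using t0 that by (simp add: right_diff_distrib)
    ultimately show ?thesis by (simp add: g_t0 mult.assoc)
  qed
  then show ?thesis using that[of "M * t0"] M(1) t0 by simp
qed

lemma time_scales: "time_scale 0 (1 / t0)" "time_scale 1 (- 1 / t0)" by (simp_all add: time_scale_def)

lemma AE_time_interior: "AE p in \<mu>. p \<in> Q0 \<longrightarrow> 0 < tm p \<and> tm p < t0"
  using AE_time_scale_pos[OF time_scales(1)] AE_time_scale_pos[OF time_scales(2)]
  by eventually_elim (use t0 in \<open>auto simp: zero_less_divide_iff\<close>)

lemma cont_tm: "continuous_on A tm" by (intro continuous_intros)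

text \<open>Use the weight \<open>t0 - t\<close> for \<open>f\<close>, which is 0 at time 0, and the
  weight \<open>t\<close> for \<open>g\<close>, which is 0 at time \<open>t0\<close>. Adding the two
  inequalities bounds the integral of \<open>f - g\<close> by \<open>t0\<close> times that of
  \<open>\<phi>\<close>, which is nonpositive; with \<open>g \<le> f\<close> all of them are
  equalities. Since \<open>t (t0 - t) = t0 (t0 - t) - (t0 - t)^2\<close>, equality for the first
  weight and the inequality for its square bound the product weight from above.\<close>

lemma integral_identities:
  "AE p in \<mu>. p \<in> Q0 \<longrightarrow> f (fst p) (tm p) = g (fst p) (tm p)"
  "I (\<lambda>p. tm p * (t0 - tm p) * \<phi> p + (t0 - 2 * tm p) * f (fst p) (tm p)) \<le> 0"
proof -
  let ?f = "\<lambda>p. f (fst p) (tm p)" and ?g = "\<lambda>p. g (fst p) (tm p)"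
  note cf = cont_w[OF adm_f] and cg = cont_w[OF adm_g]
  note ci = continuous_on_add continuous_on_mult continuous_on_diff cont_\<phi>Q cf cg cont_tm continuous_on_const continuous_on_power
  have 1: "0 \<le> I (\<lambda>p. (t0 - tm p) * \<phi> p - ?f p)"
  proof -
    obtain c where c: "c \<ge> 0" "\<And>x t. x \<in> S0 \<Longrightarrow> 0 \<le> t \<Longrightarrow> t \<le> t0 \<Longrightarrow> \<bar>f x t\<bar> \<le> c * (0 + t * (1 / t0))" by (rule f_time_bound) blast
    have "0 \<le> I (\<lambda>p. poly [:t0, -1:] (tm p) * \<phi> p + poly (pderiv [:t0, -1:]) (tm p) * f (fst p) (tm p))"
      by (rule subsolution_integral_limit[OF adm_f time_scales(1) _ _ _ c]) (use t0 in auto)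
    moreover have "poly [:t0, -1:] t = t0 - t" "poly (pderiv [:t0, -1:]) t = -1" for t by (simp_all add: pderiv_pCons)
    ultimately show ?thesis by simp
  qed
  have 2: "0 \<le> I (\<lambda>p. (t0 - tm p)\<^sup>2 * \<phi> p - 2 * (t0 - tm p) * ?f p)"
  proof -
    let ?a = "[:t0, -1:] * [:t0, -1:]"
    obtain c where c: "c \<ge> 0" "\<And>x t. x \<in> S0 \<Longrightarrow> 0 \<le> t \<Longrightarrow> t \<le> t0 \<Longrightarrow> \<bar>f x t\<bar> \<le> c * (0 + t * (1 / t0))" by (rule f_time_bound) blast
    have p: "poly ?a t = (t0 - t)\<^sup>2" for t by (simp add: power2_eq_square algebra_simps)
    have d: "poly (pderiv ?a) t = - (2 * (t0 - t))" for t by (simp add: pderiv_mult pderiv_pCons algebra_simps)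
    have "0 \<le> I (\<lambda>p. poly ?a (tm p) * \<phi> p + poly (pderiv ?a) (tm p) * f (fst p) (tm p))"
      by (rule subsolution_integral_limit[OF adm_f time_scales(1) _ _ _ c]) (unfold p, auto)
    then show ?thesis unfolding p d by (simp add: algebra_simps)
  qed
  have 3: "0 \<le> I (\<lambda>p. tm p * \<phi> p + ?g p)"
  proof -
    obtain c where c: "c \<ge> 0" "\<And>x t. x \<in> S0 \<Longrightarrow> 0 \<le> t \<Longrightarrow> t \<le> t0 \<Longrightarrow> \<bar>g x t\<bar> \<le> c * (1 + t * (- 1 / t0))" by (rule g_time_bound) blast
    have "0 \<le> I (\<lambda>p. poly [:0, 1:] (tm p) * \<phi> p + poly (pderiv [:0, 1:]) (tm p) * g (fst p) (tm p))"
      by (rule subsolution_integral_limit[OF adm_g time_scales(2) _ _ _ c]) auto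
    moreover have "poly [:0, 1:] t = t" "poly (pderiv [:0, 1:]) t = 1" for t :: real by (simp_all add: pderiv_pCons)
    ultimately show ?thesis by simp
  qed
  have m: "I \<phi> \<le> 0" using minimal by (simp add: I_def Q0_def)
  define i1 where "i1 = I (\<lambda>p. (t0 - tm p) * \<phi> p)"
  define i2 where "i2 = I (\<lambda>p. tm p * \<phi> p)"
  have 4: "I ?f \<le> i1" using 1 unfolding i1_def by (subst (asm) I_diff) (auto intro!: ci)
  have 5: "- i2 \<le> I ?g" using 3 unfolding i2_def by (subst (asm) I_add) (auto intro!: ci)
  have "i1 + i2 = I (\<lambda>p. t0 * \<phi> p)" unfolding i1_def i2_def
    by (subst I_add[symmetric]) (auto intro!: ci simp: algebra_simps)
  also have "\<dots> \<le> 0" unfolding I_cmult using m t0 by (simp add: mult_le_0_iff)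
  finally have 6: "i1 \<le> - i2" by simp
  have gf: "?g p \<le> ?f p" if "p \<in> Q0" for p using that g_le_f by (auto simp: Q0_def)
  have 7: "I ?g \<le> I ?f" by (rule I_mono[OF cg cf gf])
  have eq: "I ?f = i1" "I (\<lambda>p. ?f p - ?g p) = 0" using 4 5 6 7 by (auto simp: I_diff cf cg)
  have "AE p in \<mu>. indicator Q0 p *\<^sub>R (?f p - ?g p) = 0"
  proof (rule integral_nonneg_eq_0_iff_AE[THEN iffD1])
    show "integrable \<mu> (\<lambda>p. indicator Q0 p *\<^sub>R (?f p - ?g p))"
      using I_integrable[OF continuous_on_diff[OF cf cg]] unfolding set_integrable_def .
    show "AE p in \<mu>. 0 \<le> indicator Q0 p *\<^sub>R (?f p - ?g p)"
    proof (intro AE_I2)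
      fix p show "0 \<le> indicator Q0 p *\<^sub>R (?f p - ?g p)" using gf[of p] by (auto simp: indicator_def)
    qed
    show "(\<integral>p. indicator Q0 p *\<^sub>R (?f p - ?g p) \<partial>\<mu>) = 0" using eq(2) unfolding I_def set_lebesgue_integral_def .
  qed
  then show "AE p in \<mu>. p \<in> Q0 \<longrightarrow> f (fst p) (tm p) = g (fst p) (tm p)" by eventually_elim auto
  let ?i3 = "I (\<lambda>p. (t0 - tm p)\<^sup>2 * \<phi> p - 2 * (t0 - tm p) * ?f p)"
  have "(\<lambda>p. tm p * (t0 - tm p) * \<phi> p + (t0 - 2 * tm p) * ?f p)
     = (\<lambda>p. (t0 * ((t0 - tm p) * \<phi> p) - ((t0 - tm p)\<^sup>2 * \<phi> p - 2 * (t0 - tm p) * ?f p)) - t0 * ?f p)"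
    by (auto simp: fun_eq_iff power2_eq_square algebra_simps)
  then have "I (\<lambda>p. tm p * (t0 - tm p) * \<phi> p + (t0 - 2 * tm p) * ?f p)
     = I (\<lambda>p. (t0 * ((t0 - tm p) * \<phi> p) - ((t0 - tm p)\<^sup>2 * \<phi> p - 2 * (t0 - tm p) * ?f p)) - t0 * ?f p)" by simp
  also have "\<dots> = (I (\<lambda>p. t0 * ((t0 - tm p) * \<phi> p)) - ?i3) - I (\<lambda>p. t0 * ?f p)"
    by (subst I_diff, (intro ci)+, subst I_diff, (intro ci)+, simp)
  also have "\<dots> = - ?i3" unfolding I_cmult eq(1) i1_def by simp
  finally show "I (\<lambda>p. tm p * (t0 - tm p) * \<phi> p + (t0 - 2 * tm p) * ?f p) \<le> 0" using 2 by simp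
qed

end

text \<open>The derivative of \<open>(x, v, t) \<mapsto> d\<psi> \<circ> \<sigma>\<close> at \<open>p\<close> in the direction \<open>b\<close>.\<close>

definition ddsig :: "('a::euclidean_space \<times> real \<Rightarrow> real) \<Rightarrow> 'a \<times> 'a \<times> real \<Rightarrow> 'a \<times> 'a \<times> real \<Rightarrow> real" where
  "ddsig \<psi> p b = deriv1 (deriv1 \<psi> (fst (snd p), 1)) (fst b, snd (snd b)) (fst p, snd (snd p))
     + deriv1 \<psi> (fst (snd b), 0) (fst p, snd (snd p))"

lemma linear_basis_expansion:
  fixes L :: "'e::euclidean_space \<Rightarrow> real"
  assumes "linear L" shows "L u = (\<Sum>i\<in>Basis. (u \<bullet> i) * L i)"
proof -
  have "L u = L (\<Sum>i\<in>Basis. (u \<bullet> i) *\<^sub>R i)" by (simp add: euclidean_representation)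
  also have "\<dots> = (\<Sum>i\<in>Basis. (u \<bullet> i) * L i)" using assms by (simp add: linear_sum linear_scale)
  finally show ?thesis .
qed

text \<open>Expanding the direction \<open>(v, 1)\<close> in the basis separates the dependence on
  \<open>v\<close> from that of the derivatives on \<open>(x, t)\<close>, so the product rule
  applies to each term.\<close>

lemma has_derivative_dsig:
  fixes \<psi> :: "'a::euclidean_space \<times> real \<Rightarrow> real"
  assumes \<psi>: "smooth_fun \<psi>"
  shows "((\<lambda>p. deriv1 \<psi> (fst (snd p), 1) (fst p, snd (snd p))) has_derivative ddsig \<psi> p) (at p)"
proof -
  let ?bs = "\<lambda>p::'a \<times> 'a \<times> real. (fst p, snd (snd p))"
  let ?u = "\<lambda>p::'a \<times> 'a \<times> real. (fst (snd p), 1::real)"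
  have e1: "(\<lambda>p. deriv1 \<psi> (?u p) (?bs p)) = (\<lambda>p. \<Sum>i\<in>Basis. (?u p \<bullet> i) * deriv1 \<psi> i (?bs p))"
    by (rule ext) (rule linear_basis_expansion[OF deriv_linear[OF \<psi>]])
  have e2: "ddsig \<psi> p = (\<lambda>b. \<Sum>i\<in>Basis. (?u p \<bullet> i) * deriv1 (deriv1 \<psi> i) (?bs b) (?bs p) + ((fst (snd b), 0) \<bullet> i) * deriv1 \<psi> i (?bs p))"
    unfolding ddsig_def sum.distrib
    by (rule ext, rule arg_cong2[where f = "(+)"], rule linear_basis_expansion[OF deriv2_linear1[OF \<psi>]],
        rule linear_basis_expansion[OF deriv_linear[OF \<psi>]])
  have b: "bounded_linear ?bs" by (intro bounded_linear_Pair bounded_linear_fst bounded_linear_compose[OF bounded_linear_snd bounded_linear_snd])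
  have u: "((\<lambda>p. ?u p \<bullet> i) has_derivative (\<lambda>b. (fst (snd b), 0) \<bullet> i)) (at p)" for i
    by (auto intro!: derivative_eq_intros)
  have d: "((\<lambda>p. deriv1 \<psi> i (?bs p)) has_derivative (\<lambda>b. deriv1 (deriv1 \<psi> i) (?bs b) (?bs p))) (at p)" for i
    by (rule has_derivative_compose[OF bounded_linear_imp_has_derivative[OF b] smooth_fun_has_derivative[OF smooth_fun_frechet_derivative[OF \<psi>]]])
  show ?thesis unfolding e1 e2 by (intro has_derivative_sum has_derivative_mult[OF u d])
qed

lemma linear_ddsig: "smooth_fun \<psi> \<Longrightarrow> linear (ddsig \<psi> p)"
  using has_derivative_linear[OF has_derivative_dsig] .

lemma continuous_on_ddsig:
  fixes \<psi> :: "'a::euclidean_space \<times> real \<Rightarrow> real"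
  assumes \<psi>: "smooth_fun \<psi>" shows "continuous_on A (\<lambda>p. ddsig \<psi> p b)"
proof -
  let ?bs = "\<lambda>p::'a \<times> 'a \<times> real. (fst p, snd (snd p))"
  have c: "continuous_on A (\<lambda>p. h (?bs p))" if "smooth_fun h" for h
    by (rule continuous_on_compose2[OF smooth_fun_continuous[OF that, of UNIV]]) (auto intro!: continuous_intros)
  have e: "(\<lambda>p. ddsig \<psi> p b) = (\<lambda>p. (\<Sum>i\<in>Basis. ((fst (snd p), 1) \<bullet> i) * deriv1 (deriv1 \<psi> i) (?bs b) (?bs p)) + deriv1 \<psi> (fst (snd b), 0) (?bs p))"
    unfolding ddsig_def
    by (rule ext, rule arg_cong2[where f = "(+)"], rule linear_basis_expansion[OF deriv2_linear1[OF \<psi>]], rule refl)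
  show ?thesis unfolding e
    by (intro continuous_on_add continuous_on_sum continuous_on_mult c smooth_fun_frechet_derivative \<psi> continuous_on_inner
        continuous_on_Pair continuous_on_const continuous_on_fst continuous_on_snd continuous_on_id)
qed

section \<open>Contact points and the defect of the mollified value function\<close>

context jet_dual_measure
begin

text \<open>\<open>f\<close> has a paraboloid above it and \<open>g\<close> has one below, and
  \<open>g \<le> f\<close> with equality at the point. This forces the two gradients to agree and
  squeezes \<open>f\<close> between the paraboloids; the reflection carries the contact past the end
  times.\<close>

lemma contact:
  assumes t: "0 < t" "t < t0" and eq: "f x t = g x t"
  obtains l where "\<And>q. \<bar>snd q - t\<bar> \<le> t0 \<Longrightarrow> 
    \<bar>ext f q - ext f (x, t) - l \<bullet> (q - (x, t))\<bar> \<le> 3 * C2 * (norm (q - (x, t)))\<^sup>2"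
proof -
  obtain l where l: "\<And>y s. 0 \<le> s \<Longrightarrow> s \<le> t0 \<Longrightarrow> f y s \<le> f x t + l \<bullet> ((y, s) - (x, t)) + C2 * (norm ((y, s) - (x, t)))\<^sup>2"
    using supergradient[OF lip_f C2 f_second_diff t, of x] by blast
  have lip: "\<exists>M. time_lipschitz t0 \<rho> M (\<lambda>y s. - g y s)" for \<rho>
  proof -
    obtain M where M: "time_lipschitz t0 \<rho> M g" using lip_g by blast
    have "\<bar>- g y s - - g z s'\<bar> \<le> M * (norm (y - z) + \<bar>s - s'\<bar>)" 
      if "norm y \<le> \<rho>" "norm z \<le> \<rho>" "0 \<le> s'" "s' \<le> t0" "0 \<le> s" "s \<le> t0" for y z s s'
      using time_lipschitzD[OF M that] by linarith
    then show ?thesis using M unfolding time_lipschitz_def by blast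
  qed
  have sd: "- g (y + d) (s + h) + - g (y - d) (s - h) \<le> 2 * - g y s + C2 * ((norm d)\<^sup>2 + h\<^sup>2)"
    if "0 \<le> s - \<bar>h\<bar>" "s + \<bar>h\<bar> \<le> t0" for y d s h
    using g_second_diff[OF that, of y d] by linarith
  obtain l' where l': "\<And>y s. 0 \<le> s \<Longrightarrow> s \<le> t0 \<Longrightarrow> - g y s \<le> - g x t + l' \<bullet> ((y, s) - (x, t)) + C2 * (norm ((y, s) - (x, t)))\<^sup>2"
    using supergradient[OF lip C2 sd t, of x] by blast
  have "l = - l'"
  proof (rule contact_unique_gradient[of "min t (t0 - t)" "2 * C2"])
    show "0 < min t (t0 - t)" using t by simp
    show "0 \<le> 2 * C2" using C2 by simp
    fix u :: "'a \<times> real" assume u: "norm u \<le> min t (t0 - t)"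
    obtain y s where ys: "u = (y - x, s - t)" by (cases u) (metis add_diff_cancel_right')
    have "\<bar>s - t\<bar> \<le> norm u" using norm_snd_le[of "s - t" "y - x"] by (simp add: ys)
    then have s: "0 \<le> s" "s \<le> t0" using u by auto
    have uu: "(y, s) - (x, t) = u" by (simp add: ys)
    show "- l' \<bullet> u \<le> l \<bullet> u + 2 * C2 * (norm u)\<^sup>2"
      using l[OF s, of y] l'[OF s, of y] g_le_f[OF s, of y] eq unfolding uu by (simp add: inner_minus_left)
  qed
  have "\<bar>f y s - f x t - l \<bullet> ((y, s) - (x, t))\<bar> \<le> C2 * (norm ((y, s) - (x, t)))\<^sup>2" if s: "0 \<le> s" "s \<le> t0" for y s
  proof -
    have "l' \<bullet> ((y, s) - (x, t)) = - (l \<bullet> ((y, s) - (x, t)))" using \<open>l = - l'\<close> by (simp only: inner_minus_left)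
    then show ?thesis using l[OF s, of y] l'[OF s, of y] g_le_f[OF s, of y] eq by linarith
  qed
  then have "\<bar>ext f q - ext f (x, t) - l \<bullet> (q - (x, t))\<bar> \<le> 3 * C2 * (norm (q - (x, t)))\<^sup>2" if "\<bar>snd q - t\<bar> \<le> t0" for q
    by (intro reflect_ext_contact[OF _ _ C2 _ that]) (use t in auto)
  then show ?thesis using that by blast
qed

definition W where "W e = mollify bump e (ext f)"
definition \<gamma> where "\<gamma> e p = \<phi> p - dsig (W e) p"
definition touch where "touch p \<longleftrightarrow> p \<in> Q0 \<and> 0 < tm p \<and> tm p < t0 \<and> f (fst p) (tm p) = g (fst p) (tm p)"

lemma AE_touch: "AE p in \<mu>. touch p"
  using AE_Q0 integral_identities(1) AE_time_interior by eventually_elim (auto simp: touch_def)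

lemma smW: "e > 0 \<Longrightarrow> smooth_fun (W e)" unfolding W_def by (rule smooth_fun_mollify[OF kernel_bump cont_ext[OF adm_f]])

lemma contact_estimates:
  obtains B where "B \<ge> 0" "\<And>x v t e. touch (x, v, t) \<Longrightarrow> 0 < e \<Longrightarrow> 2 * e \<le> t0 \<Longrightarrow>
    \<bar>W e (x, t) - f x t\<bar> \<le> B * e\<^sup>2 \<and>
    (\<forall>u u'. \<bar>deriv1 (deriv1 (W e) u) u' (x, t)\<bar> \<le> B * norm u * norm u') \<and>
    (\<forall>u d. norm d \<le> e \<longrightarrow> \<bar>deriv1 (W e) u ((x, t) + d) - deriv1 (W e) u (x, t) - deriv1 (deriv1 (W e) u) d (x, t)\<bar>
        \<le> B * norm u * (norm d)\<^sup>2 / e)"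
proof -
  obtain A where A: "A \<ge> 0" and est:
    "\<And>(w::'a \<times> real \<Rightarrow> real) p g C e. continuous_on UNIV w \<Longrightarrow> e > 0 \<Longrightarrow> C \<ge> 0 \<Longrightarrow>
      (\<And>q. norm (q - p) \<le> 2 * e \<Longrightarrow> \<bar>w q - w p - g \<bullet> (q - p)\<bar> \<le> C * (norm (q - p))\<^sup>2) \<Longrightarrow>
      \<bar>mollify bump e w p - w p\<bar> \<le> A * C * e\<^sup>2 \<and>
      (\<forall>u. \<bar>deriv1 (mollify bump e w) u p - g \<bullet> u\<bar> \<le> A * C * e * norm u) \<and>
      (\<forall>u u'. \<bar>deriv1 (deriv1 (mollify bump e w) u) u' p\<bar> \<le> A * C * norm u * norm u') \<and>
      (\<forall>u d. norm d \<le> e \<longrightarrow> 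
        \<bar>deriv1 (mollify bump e w) u (p + d) - deriv1 (mollify bump e w) u p
           - deriv1 (deriv1 (mollify bump e w) u) d p\<bar> \<le> A * C * norm u * (norm d)\<^sup>2 / e)"
    using mollify_second_order_contact by blast
  show ?thesis
  proof (rule that[of "A * (3 * C2)"])
    show "A * (3 * C2) \<ge> 0" using A C2 by simp
    fix x v :: 'a and t e :: real assume a: "touch (x, v, t)" "0 < e" "2 * e \<le> t0"
    then have t: "0 < t" "t < t0" "f x t = g x t" by (auto simp: touch_def)
    obtain l where l: "\<And>q. \<bar>snd q - t\<bar> \<le> t0 \<Longrightarrow> 
      \<bar>ext f q - ext f (x, t) - l \<bullet> (q - (x, t))\<bar> \<le> 3 * C2 * (norm (q - (x, t)))\<^sup>2"
      using contact[OF t] by blast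
    have l2: "\<bar>ext f q - ext f (x, t) - l \<bullet> (q - (x, t))\<bar> \<le> 3 * C2 * (norm (q - (x, t)))\<^sup>2"
      if "norm (q - (x, t)) \<le> 2 * e" for q
    proof (rule l)
      have "\<bar>snd q - t\<bar> \<le> norm (q - (x, t))" using norm_snd_le[of "snd q - t" "fst q - x"] by (cases q) simp
      then show "\<bar>snd q - t\<bar> \<le> t0" using that a by linarith
    qed
    have c3: "0 \<le> 3 * C2" using C2 by simp
    have "ext f (x, t) = f x t" using t by (simp add: reflect_ext_id)
    then show "\<bar>W e (x, t) - f x t\<bar> \<le> A * (3 * C2) * e\<^sup>2 \<and>
      (\<forall>u u'. \<bar>deriv1 (deriv1 (W e) u) u' (x, t)\<bar> \<le> A * (3 * C2) * norm u * norm u') \<and>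
      (\<forall>u d. norm d \<le> e \<longrightarrow> \<bar>deriv1 (W e) u ((x, t) + d) - deriv1 (W e) u (x, t) - deriv1 (deriv1 (W e) u) d (x, t)\<bar>
        \<le> A * (3 * C2) * norm u * (norm d)\<^sup>2 / e)"
      using est[OF cont_ext[OF adm_f] a(2) c3 l2] unfolding W_def by auto
  qed
qed

text \<open>Equal to 1 within \<open>e\<close> of an end time and to 0 beyond \<open>2 * e\<close>:
  a continuous majorant of the indicator of the boundary layer, integrable by the rules for
  \<open>I\<close>.\<close>

definition cutoff where "cutoff e p = max 0 (min 1 (2 - min (tm p) (t0 - tm p) / e))"

text \<open>Closedness with the weight \<open>t (t0 - t)\<close> trades \<open>dsig (W e)\<close>
  for \<open>W e\<close>, which differs from \<open>f\<close> by \<open>O(e^2)\<close> at contact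
  points; with \<open>integral_identities\<close> the signed integral is at most
  \<open>O(e^2)\<close>. The negative part is \<open>O(e^2)\<close> in the interior by
  \<open>moll_sub\<close> and \<open>O(e)\<close> in the boundary layers.\<close>

lemma weighted_defect_bound:
  obtains k where "k \<ge> 0" "\<And>e. 0 < e \<Longrightarrow> e \<le> 1 \<Longrightarrow> 2 * e \<le> t0 \<Longrightarrow>
    I (\<lambda>p. \<bar>tm p * (t0 - tm p) * \<gamma> e p\<bar>) \<le> k * e\<^sup>2 + k * e * I (cutoff e)"
proof -
  obtain B where B: "B \<ge> 0" and est: "\<And>x v t e. touch (x, v, t) \<Longrightarrow> 0 < e \<Longrightarrow> 2 * e \<le> t0 \<Longrightarrow> \<bar>W e (x, t) - f x t\<bar> \<le> B * e\<^sup>2"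
  proof (rule contact_estimates)
    fix B :: real assume B: "B \<ge> 0" and *: "\<And>x v t e. touch (x, v, t) \<Longrightarrow> 0 < e \<Longrightarrow> 2 * e \<le> t0 \<Longrightarrow>
      \<bar>W e (x, t) - f x t\<bar> \<le> B * e\<^sup>2 \<and>
      (\<forall>u u'. \<bar>deriv1 (deriv1 (W e) u) u' (x, t)\<bar> \<le> B * norm u * norm u') \<and>
      (\<forall>u d. norm d \<le> e \<longrightarrow> \<bar>deriv1 (W e) u ((x, t) + d) - deriv1 (W e) u (x, t) - deriv1 (deriv1 (W e) u) d (x, t)\<bar>
        \<le> B * norm u * (norm d)\<^sup>2 / e)"
    show thesis by (rule that[OF B conjunct1[OF *]])
  qed
  obtain M where M: "M \<ge> 0" "\<And>x k. x \<in> S0 \<Longrightarrow> k \<le> 2 \<Longrightarrow> time_lipschitz t0 (norm x + k) M f"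
    using adm_lip_S0[OF adm_f] by blast
  define c where "c = 1 + 8 * M * (R + 1)"
  have c0: "c \<ge> 0" using M R by (simp add: c_def)
  define k where "k = t0 * B * \<mu>1 + 2 * (t0\<^sup>2 * C3) * \<mu>1 + 2 * (t0 * c)"
  have k0: "k \<ge> 0" using B \<mu>1 C3 t0 c0 by (simp add: k_def)
  show ?thesis
  proof (rule that[OF k0])
    fix e :: real assume e: "0 < e" "e \<le> 1" "2 * e \<le> t0"
    note cf = cont_w[OF adm_f]
    note cW = cont_W[OF smW[OF e(1)]] and cd = cont_dsig[OF smW[OF e(1)]]
    note ci = continuous_on_add continuous_on_mult continuous_on_diff cont_\<phi>Q cf cW cd cont_tm continuous_on_const
    let ?a = "\<lambda>p. tm p * (t0 - tm p)"
    have ccut: "continuous_on Q0 (cutoff e)" unfolding cutoff_def using e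
      by (intro continuous_on_max continuous_on_min continuous_on_divide ci) auto
    have cg: "continuous_on Q0 (\<gamma> e)" unfolding \<gamma>_def by (intro ci)
    have pa: "poly [:0, t0, -1:] t = t * (t0 - t)" "poly (pderiv [:0, t0, -1:]) t = t0 - 2 * t" for t
      by (simp_all add: pderiv_pCons algebra_simps)
    have "I (\<lambda>p. poly (pderiv [:0, t0, -1:]) (tm p) * W e (bs p) + poly [:0, t0, -1:] (tm p) * dsig (W e) p) = 0"
      by (rule poly_closedness[OF smW[OF e(1)]]) auto
    then have 0: "I (\<lambda>p. (t0 - 2 * tm p) * W e (bs p) + ?a p * dsig (W e) p) = 0" unfolding pa .
    have "I (\<lambda>p. ?a p * \<gamma> e p) = I (\<lambda>p. ?a p * \<gamma> e p) + I (\<lambda>p. (t0 - 2 * tm p) * W e (bs p) + ?a p * dsig (W e) p)"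
      unfolding 0 by simp
    also have "\<dots> = I (\<lambda>p. ?a p * \<gamma> e p + ((t0 - 2 * tm p) * W e (bs p) + ?a p * dsig (W e) p))"
      by (rule I_add[symmetric]) (intro ci cg)+
    also have "\<dots> \<le> I (\<lambda>p. (?a p * \<phi> p + (t0 - 2 * tm p) * f (fst p) (tm p)) + t0 * B * e\<^sup>2)"
    proof (rule I_mono_AE)
      show "AE p in \<mu>. p \<in> Q0 \<longrightarrow> ?a p * \<gamma> e p + ((t0 - 2 * tm p) * W e (bs p) + ?a p * dsig (W e) p)
         \<le> (?a p * \<phi> p + (t0 - 2 * tm p) * f (fst p) (tm p)) + t0 * B * e\<^sup>2"
        using AE_touch
      proof eventually_elim
        case (elim p)
        obtain x v t where p: "p = (x, v, t)" by (cases p) auto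
        have "\<bar>t0 - 2 * t\<bar> \<le> t0" using elim by (auto simp: p touch_def)
        then have "\<bar>(t0 - 2 * t) * (W e (x, t) - f x t)\<bar> \<le> t0 * (B * e\<^sup>2)"
          unfolding abs_mult using est[OF elim[unfolded p] e(1,3)] t0 by (intro mult_mono) auto
        then have "(t0 - 2 * t) * (W e (x, t) - f x t) \<le> t0 * (B * e\<^sup>2)" by (rule abs_le_D1)
        then show ?case by (simp add: p \<gamma>_def algebra_simps)
      qed
    qed (intro ci cg)+
    also have "\<dots> = I (\<lambda>p. ?a p * \<phi> p + (t0 - 2 * tm p) * f (fst p) (tm p)) + t0 * B * e\<^sup>2 * \<mu>1"
      by (subst I_add) (auto intro!: ci simp: I_const \<mu>1_def)
    also have "\<dots> \<le> t0 * B * e\<^sup>2 * \<mu>1" using integral_identities(2) by simp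
    finally have 1: "I (\<lambda>p. ?a p * \<gamma> e p) \<le> t0 * B * e\<^sup>2 * \<mu>1" .
    \<comment> \<open>The absolute value is the signed value plus twice the negative part, whence
      the factors 2.\<close>
    have "I (\<lambda>p. \<bar>?a p * \<gamma> e p\<bar>) \<le> I (\<lambda>p. ?a p * \<gamma> e p + (2 * (t0\<^sup>2 * C3) * e\<^sup>2 + 2 * (t0 * c) * e * cutoff e p))"
    proof (rule I_mono)
      fix p assume "p \<in> Q0"
      then obtain x v t where p: "p = (x, v, t)" and q: "x \<in> S0" "norm v \<le> R - 1" "0 \<le> t" "t \<le> t0"
        by (auto simp: Q0_def)
      have P: "(x, v, t) \<in> P" using \<open>p \<in> Q0\<close> Q0_P p by auto
      have vR: "norm v \<le> R" using q by simp
      have a0: "0 \<le> t * (t0 - t)" using q by simp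
      have cut: "0 \<le> cutoff e p" by (simp add: cutoff_def)
      have "- (t * (t0 - t) * \<gamma> e p) \<le> (t0\<^sup>2 * C3) * e\<^sup>2 + (t0 * c) * e * cutoff e p"
      proof (cases "e < t \<and> t + e < t0")
        case True
        have "- \<gamma> e p \<le> C3 * e\<^sup>2"
          using moll_sub[OF adm_f _ vR e(1), of x t] True r \<delta>_S0[OF q(1)] unfolding p \<gamma>_def W_def dsig_def by simp
        then have "t * (t0 - t) * - \<gamma> e p \<le> t * (t0 - t) * (C3 * e\<^sup>2)" by (rule mult_left_mono[OF _ a0])
        also have "\<dots> \<le> (t0 * t0) * (C3 * e\<^sup>2)" using q C3 by (intro mult_right_mono mult_mono) auto
        also have "\<dots> = (t0\<^sup>2 * C3) * e\<^sup>2" by (simp add: power2_eq_square)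
        also have "\<dots> \<le> (t0\<^sup>2 * C3) * e\<^sup>2 + (t0 * c) * e * cutoff e p" using t0 c0 e cut by simp
        finally show ?thesis by simp
      next
        case False
        then have "min t (t0 - t) \<le> e" by auto
        then have "min t (t0 - t) / e \<le> 1" using e by (simp add: divide_le_eq)
        then have cut1: "cutoff e p = 1" by (simp add: cutoff_def p)
        have "t * (t0 - t) \<le> t0 * e"
        proof (cases "t \<le> e")
          case True
          have "t * (t0 - t) \<le> e * t0" using True q e by (intro mult_mono) auto
          then show ?thesis by (simp add: mult.commute)
        next
          case 2: False
          have "t0 - t \<le> e" using 2 False by linarith
          then show ?thesis using q by (intro mult_mono) auto
        qed
        note ta = this
        have gc: "- \<gamma> e p \<le> c"
          using dsig_bound[OF adm_f M(1) M(2)[OF q(1) order_refl] e(1,2) vR, of t] \<phi>_le1[OF P]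
          unfolding c_def \<gamma>_def p W_def by linarith
        have "t * (t0 - t) * - \<gamma> e p \<le> (t0 * e) * c"
          by (rule order_trans[OF mult_left_mono[OF gc a0] mult_right_mono[OF ta c0]])
        moreover have "0 \<le> (t0\<^sup>2 * C3) * e\<^sup>2" using C3 by simp
        ultimately show ?thesis unfolding cut1 by (simp add: mult_ac)
      qed
      moreover have "0 \<le> (t0\<^sup>2 * C3) * e\<^sup>2 + (t0 * c) * e * cutoff e p" using C3 t0 c0 e cut by simp
      ultimately show "\<bar>?a p * \<gamma> e p\<bar> \<le> ?a p * \<gamma> e p + (2 * (t0\<^sup>2 * C3) * e\<^sup>2 + 2 * (t0 * c) * e * cutoff e p)"
        unfolding p fst_conv snd_conv by linarith
    qed (intro ci cg ccut continuous_on_rabs)+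
    also have "\<dots> = I (\<lambda>p. ?a p * \<gamma> e p) + (2 * (t0\<^sup>2 * C3) * e\<^sup>2 * \<mu>1 + 2 * (t0 * c) * e * I (cutoff e))"
      by (subst I_add, (intro ci cg ccut)+, subst I_add, (intro ci cg ccut)+, simp add: I_const I_cmult \<mu>1_def)
    also have "\<dots> \<le> t0 * B * e\<^sup>2 * \<mu>1 + (2 * (t0\<^sup>2 * C3) * e\<^sup>2 * \<mu>1 + 2 * (t0 * c) * e * I (cutoff e))" using 1 by simp
    also have "\<dots> \<le> k * e\<^sup>2 + k * e * I (cutoff e)"
    proof -
      have "0 \<le> I (cutoff e)" using I_mono[of "\<lambda>_. 0" "cutoff e"] ccut I_const[of 0] by (simp add: cutoff_def)
      then have "2 * (t0 * c) * (e * I (cutoff e)) \<le> k * (e * I (cutoff e))"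
        using e B \<mu>1 C3 t0 by (intro mult_right_mono) (auto simp: k_def)
      moreover have "(t0 * B * \<mu>1 + 2 * (t0\<^sup>2 * C3) * \<mu>1) * e\<^sup>2 \<le> k * e\<^sup>2"
        using t0 c0 by (intro mult_right_mono) (auto simp: k_def)
      ultimately show ?thesis by (simp add: algebra_simps)
    qed
    finally show "I (\<lambda>p. \<bar>?a p * \<gamma> e p\<bar>) \<le> k * e\<^sup>2 + k * e * I (cutoff e)" .
  qed
qed

text \<open>Divided by \<open>e\<close>, the bound becomes \<open>k * e + k * I (cutoff e)\<close>,
  and the layers shrink to the end times, which are null. Convergence in mean gives convergence
  almost everywhere along a subsequence; at a touching point the weight \<open>t (t0 - t)\<close> is
  positive and can be divided out.\<close>

lemma defect_subsequence:
  obtains e :: "nat \<Rightarrow> real" where "\<And>n. 0 < e n" "\<And>n. e n \<le> 1" "\<And>n. 2 * e n \<le> t0" "e \<longlonglongrightarrow> 0"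
    "AE p in \<mu>. touch p \<longrightarrow> (\<lambda>n. \<gamma> (e n) p / e n) \<longlonglongrightarrow> 0"
proof -
  obtain k where k: "k \<ge> 0" "\<And>e. 0 < e \<Longrightarrow> e \<le> 1 \<Longrightarrow> 2 * e \<le> t0 \<Longrightarrow>
    I (\<lambda>p. \<bar>tm p * (t0 - tm p) * \<gamma> e p\<bar>) \<le> k * e\<^sup>2 + k * e * I (cutoff e)"
    using weighted_defect_bound by blast
  define e where "e n = min 1 (t0 / 2) * inverse (real (Suc n))" for n
  have e0: "0 < e n" for n using t0 by (simp add: e_def)
  have e1: "e n \<le> min 1 (t0 / 2)" for n
  proof -
    have "e n \<le> min 1 (t0 / 2) * 1" unfolding e_def using t0 by (intro mult_left_mono) (auto simp: inverse_le_1_iff)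
    then show ?thesis by simp
  qed
  have e2: "e n \<le> 1" "2 * e n \<le> t0" for n using e1[of n] by auto
  have lim: "e \<longlonglongrightarrow> 0" unfolding e_def by (rule tendsto_mult_right_zero[OF LIMSEQ_inverse_real_of_nat])
  have cut: "(\<lambda>n. I (cutoff (e n))) \<longlonglongrightarrow> I (\<lambda>_. 0)"
  proof (rule I_dominated[where B = 1])
    show "continuous_on Q0 (cutoff (e n))" for n unfolding cutoff_def using e0[of n]
      by (intro continuous_on_max continuous_on_min continuous_on_divide continuous_on_diff cont_tm continuous_on_const) auto
    show "AE p in \<mu>. p \<in> Q0 \<longrightarrow> (\<lambda>n. cutoff (e n) p) \<longlonglongrightarrow> 0"
      using AE_touch
    proof eventually_elim
      case (elim p)
      define y where "y = min (tm p) (t0 - tm p)"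
      have y: "y > 0" using elim by (auto simp: y_def touch_def)
      have "\<forall>\<^sub>F n in sequentially. cutoff (e n) p = 0"
        using order_tendstoD(2)[OF lim half_gt_zero[OF y]]
      proof eventually_elim
        case (elim n)
        then have "2 \<le> y / e n" using e0[of n] by (simp add: le_divide_eq)
        then show ?case unfolding cutoff_def y_def by simp
      qed
      then show ?case by (intro impI tendsto_eventually)
    qed
    show "\<bar>cutoff (e n) p\<bar> \<le> 1" for n p by (simp add: cutoff_def)
  qed simp
  have I0: "I (\<lambda>_. 0) = 0" using I_const[of 0] by simp
  let ?u = "\<lambda>n p. indicator Q0 p *\<^sub>R (tm p * (t0 - tm p) * \<gamma> (e n) p / e n)"
  have cg: "continuous_on Q0 (\<lambda>p. tm p * (t0 - tm p) * \<gamma> (e n) p / e n)" for n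
    unfolding \<gamma>_def using e0[of n]
    by (intro continuous_on_divide continuous_on_mult continuous_on_diff cont_\<phi>Q cont_dsig[OF smW[OF e0]] cont_tm continuous_on_const) auto
  have "\<exists>r::nat \<Rightarrow> nat. strict_mono r \<and> (AE p in \<mu>. (\<lambda>n. ?u (r n) p) \<longlonglongrightarrow> 0)"
  proof (rule tendsto_L1_AE_subseq)
    show "integrable \<mu> (?u n)" for n using I_integrable[OF cg] unfolding set_integrable_def .
    have eq: "(\<integral>p. norm (?u n p) \<partial>\<mu>) = inverse (e n) * I (\<lambda>p. \<bar>tm p * (t0 - tm p) * \<gamma> (e n) p\<bar>)" for n
      unfolding I_cmult[symmetric] unfolding I_def set_lebesgue_integral_def
      by (rule Bochner_Integration.integral_cong) (use e0[of n] in \<open>auto simp: indicator_def abs_mult divide_inverse\<close>)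
    have le: "(\<integral>p. norm (?u n p) \<partial>\<mu>) \<le> k * e n + k * I (cutoff (e n))" for n
    proof -
      have "inverse (e n) * I (\<lambda>p. \<bar>tm p * (t0 - tm p) * \<gamma> (e n) p\<bar>) \<le> inverse (e n) * (k * (e n)\<^sup>2 + k * e n * I (cutoff (e n)))"
        using k(2)[OF e0 e2, of n] e0[of n] by (intro mult_left_mono) auto
      also have "\<dots> = k * e n + k * I (cutoff (e n))" using e0[of n] by (simp add: power2_eq_square field_simps)
      finally show ?thesis unfolding eq .
    qed
    have up: "(\<lambda>n. k * e n + k * I (cutoff (e n))) \<longlonglongrightarrow> 0"
      using tendsto_add[OF tendsto_mult[OF tendsto_const[of k] lim] tendsto_mult[OF tendsto_const[of k] cut]] by (simp add: I0)
    show "(\<lambda>n. \<integral>p. norm (?u n p) \<partial>\<mu>) \<longlonglongrightarrow> 0"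
      by (rule tendsto_sandwich[OF _ _ tendsto_const up]) (use le in \<open>auto intro!: always_eventually integral_nonneg_AE\<close>)
  qed
  then obtain rr where rr: "strict_mono (rr::nat \<Rightarrow> nat)" "AE p in \<mu>. (\<lambda>n. ?u (rr n) p) \<longlonglongrightarrow> 0" by blast
  have cancel: "inverse c * (c * z / w) = z / w" if "c \<noteq> 0" for c z w :: real using that by simp
  have ae: "AE p in \<mu>. touch p \<longrightarrow> (\<lambda>n. \<gamma> (e (rr n)) p / e (rr n)) \<longlonglongrightarrow> 0"
    using rr(2)
  proof eventually_elim
    case (elim p)
    show ?case
    proof
      assume p: "touch p"
      then have a: "tm p * (t0 - tm p) \<noteq> 0" and q: "p \<in> Q0" by (auto simp: touch_def)
      have "(\<lambda>n. inverse (tm p * (t0 - tm p)) * ?u (rr n) p) \<longlonglongrightarrow> inverse (tm p * (t0 - tm p)) * 0"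
        by (intro tendsto_mult tendsto_const elim)
      moreover have eq: "inverse (tm p * (t0 - tm p)) * ?u (rr n) p = \<gamma> (e (rr n)) p / e (rr n)" for n
        unfolding indicator_simps(1)[OF q] scaleR_one by (rule cancel[OF a])
      ultimately show "(\<lambda>n. \<gamma> (e (rr n)) p / e (rr n)) \<longlonglongrightarrow> 0" unfolding eq mult_zero_right by blast
    qed
  qed
  show ?thesis
    by (rule that[of "\<lambda>n. e (rr n)"]) (use e0 e2 LIMSEQ_subseq_LIMSEQ[OF lim rr(1), unfolded comp_def] ae in auto)
qed

end

section \<open>The derivative of the defect at contact points\<close>

context jet_dual_measure
begin

text \<open>\<open>moll_sub\<close> applies at the displaced point: its distance to
  \<open>S0\<close> is at most \<open>r\<close>, its speed at most \<open>R\<close>, and its time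
  stays more than \<open>e\<close> away from both ends.\<close>

lemma \<gamma>_shift_lower:
  assumes p: "touch (x, v, t)" and b: "norm b \<le> 1" and e: "0 < e" "e \<le> 1" "e \<le> r" "2 * e < t" "t + 2 * e < t0"
    and s: "\<bar>s\<bar> \<le> e"
  shows "- (C3 * e\<^sup>2) \<le> \<gamma> e ((x, v, t) + s *\<^sub>R b)"
proof -
  obtain bx bv bt where bb: "b = (bx, bv, bt)" by (cases b) auto
  have n: "norm bx \<le> 1" "norm bv \<le> 1" "\<bar>bt\<bar> \<le> 1"
    using b norm_fst_le[of bx "(bv, bt)"] norm_snd_le[of "(bv, bt)" bx] norm_fst_le[of bv bt] norm_snd_le[of bt bv]
    unfolding bb by auto
  have q: "x \<in> S0" "norm v \<le> R - 1" using p by (auto simp: touch_def Q0_def)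
  have sn: "norm (s *\<^sub>R y) \<le> e" if "norm y \<le> 1" for y :: 'a
    using mult_mono[OF s that] e by simp
  have "\<delta> (x + s *\<^sub>R bx) \<le> r"
    using \<delta>_lip[of "x + s *\<^sub>R bx" x] \<delta>_S0[OF q(1)] sn[OF n(1)] e by simp
  moreover have "norm (v + s *\<^sub>R bv) \<le> R"
    using norm_triangle_ineq[of v "s *\<^sub>R bv"] sn[OF n(2)] q e by linarith
  moreover have "\<bar>s * bt\<bar> \<le> e" using mult_mono[OF s n(3)] e by (simp add: abs_mult)
  then have "e < t + s * bt" "t + s * bt + e < t0" using e by linarith+
  ultimately have "dsig (W e) (x + s *\<^sub>R bx, v + s *\<^sub>R bv, t + s * bt) 
    \<le> \<phi> (x + s *\<^sub>R bx, v + s *\<^sub>R bv, t + s * bt) + C3 * e\<^sup>2"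
    unfolding W_def dsig_def fst_conv snd_conv by (intro moll_sub[OF adm_f] e(1))
  then show ?thesis by (simp add: \<gamma>_def bb)
qed

text \<open>The derivative of \<open>\<gamma> e\<close>, with \<open>G\<close> standing in for the
  gradient of \<open>\<phi>\<close>, which is available only through the jet.\<close>

definition d\<gamma> where "d\<gamma> e p b = G p \<bullet> b - ddsig (W e) p b"

text \<open>At a contact point the first derivatives of \<open>W e\<close> expand with an error of
  order \<open>s^2 / e\<close>, which dominates here; the Whitney remainder \<open>s^2\<close> of
  the jet is smaller since \<open>e \<le> 1\<close>.\<close>

lemma \<gamma>_shift_upper:
  obtains C where "C \<ge> 0" "\<And>p b e s. touch p \<Longrightarrow> norm b \<le> 1 \<Longrightarrow> 0 < e \<Longrightarrow> e \<le> 1 \<Longrightarrow> e \<le> r \<Longrightarrow> 2 * e < tm p \<Longrightarrow> tm p + 2 * e < t0 \<Longrightarrow>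
    \<bar>s\<bar> \<le> e \<Longrightarrow> \<gamma> e (p + s *\<^sub>R b) \<le> \<gamma> e p + s * d\<gamma> e p b + C * (s\<^sup>2 / e)"
proof (rule contact_estimates)
  fix B :: real assume B: "B \<ge> 0" and est: "\<And>x v t e. touch (x, v, t) \<Longrightarrow> 0 < e \<Longrightarrow> 2 * e \<le> t0 \<Longrightarrow>
    \<bar>W e (x, t) - f x t\<bar> \<le> B * e\<^sup>2 \<and>
    (\<forall>u u'. \<bar>deriv1 (deriv1 (W e) u) u' (x, t)\<bar> \<le> B * norm u * norm u') \<and>
    (\<forall>u d. norm d \<le> e \<longrightarrow> \<bar>deriv1 (W e) u ((x, t) + d) - deriv1 (W e) u (x, t) - deriv1 (deriv1 (W e) u) d (x, t)\<bar>
        \<le> B * norm u * (norm d)\<^sup>2 / e)"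
  define C where "C = 1 + B * (R + 1) + 2 * B"
  show thesis
  proof (rule that[of C])
    show "C \<ge> 0" using B R by (simp add: C_def)
    fix p b :: "'a \<times> 'a \<times> real" and e s :: real
    assume p0: "touch p" and b: "norm b \<le> 1" and e: "0 < e" "e \<le> 1" "e \<le> r" "2 * e < tm p" "tm p + 2 * e < t0"
      and s: "\<bar>s\<bar> \<le> e"
    obtain x v t where px: "p = (x, v, t)" by (cases p) auto
    obtain bx bv bt where bb: "b = (bx, bv, bt)" by (cases b) auto
    note p = p0[unfolded px]
    have q: "x \<in> S0" "norm v \<le> R - 1" using p by (auto simp: touch_def Q0_def)
    have vR: "norm v \<le> R" using q by simp
    have t: "2 * e < t" "t + 2 * e < t0" using e by (auto simp: px)
    have te: "2 * e \<le> t0" using t e by linarith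
    let ?W = "W e" and ?q = "(x, t)" and ?b = "(bx, bt)" and ?u = "(v, 1::real)" and ?w = "(bv, 0::real)"
    have nb: "norm ?b \<le> 1" "norm ?w \<le> 1"
    proof -
      have "(norm b)\<^sup>2 \<le> 1" using b by (simp add: power_le_one)
      then have "(norm bx)\<^sup>2 + ((norm bv)\<^sup>2 + bt\<^sup>2) \<le> 1" by (simp add: bb norm_Pair)
      then have "(norm bx)\<^sup>2 + bt\<^sup>2 \<le> 1" "(norm bv)\<^sup>2 \<le> 1"
        using zero_le_power2[of "norm bv"] zero_le_power2[of bt] zero_le_power2[of "norm bx"] by linarith+
      then show "norm ?b \<le> 1" "norm ?w \<le> 1" by (simp_all add: norm_Pair power2_le_imp_le[of _ 1] abs_square_le_1)
    qed
    have sb: "norm (s *\<^sub>R ?b) \<le> \<bar>s\<bar>" using nb(1) by (simp only: norm_scaleR) (simp add: mult_left_le)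
    then have sbe: "norm (s *\<^sub>R ?b) \<le> e" using s by linarith
    have sb2: "(norm (s *\<^sub>R ?b))\<^sup>2 \<le> s\<^sup>2" using power_mono[OF sb, of 2] by simp
    have d2: "deriv1 (deriv1 ?W z) (s *\<^sub>R ?b) ?q = s * deriv1 (deriv1 ?W z) ?b ?q" for z
      using linear_scale[OF deriv_linear[OF smooth_fun_frechet_derivative[OF smW[OF e(1)], where v = z], of ?q], of s ?b] by simp
    have rem: "deriv1 ?W z (?q + s *\<^sub>R ?b) \<ge> deriv1 ?W z ?q + s * deriv1 (deriv1 ?W z) ?b ?q - B * norm z * (s\<^sup>2 / e)
      \<and> deriv1 ?W z (?q + s *\<^sub>R ?b) \<le> deriv1 ?W z ?q + s * deriv1 (deriv1 ?W z) ?b ?q + B * norm z * (s\<^sup>2 / e)" for z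
    proof -
      have "\<bar>deriv1 ?W z (?q + s *\<^sub>R ?b) - deriv1 ?W z ?q - deriv1 (deriv1 ?W z) (s *\<^sub>R ?b) ?q\<bar> \<le> B * norm z * (norm (s *\<^sub>R ?b))\<^sup>2 / e"
        using est[OF p e(1) te] sbe by blast
      also have "\<dots> \<le> B * norm z * (s\<^sup>2 / e)" using sb2 B e
        unfolding times_divide_eq_right[symmetric] by (intro mult_left_mono divide_right_mono) auto
      finally show ?thesis unfolding d2 by linarith
    qed
    have nu: "norm ?u \<le> R + 1" by (rule norm_v1[OF vR])
    have s2e: "s\<^sup>2 / e \<ge> 0" "s\<^sup>2 \<le> s\<^sup>2 / e" using e by (auto simp: le_divide_eq mult_left_le)
    have r1: "deriv1 ?W ?u (?q + s *\<^sub>R ?b) \<ge> deriv1 ?W ?u ?q + s * deriv1 (deriv1 ?W ?u) ?b ?q - B * (R + 1) * (s\<^sup>2 / e)"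
    proof -
      have "B * norm ?u * (s\<^sup>2 / e) \<le> B * (R + 1) * (s\<^sup>2 / e)" using nu B s2e by (intro mult_right_mono mult_left_mono) auto
      then show ?thesis using rem[of ?u] by linarith
    qed
    \<comment> \<open>The velocity displacement pairs with a derivative of \<open>W e\<close> at the
      displaced base point. Moving that derivative back changes it by \<open>O(|s|)\<close>, so
      after multiplication by \<open>s\<close> the change is \<open>O(s^2)\<close>, hence
      \<open>O(s^2 / e)\<close>.\<close>
    have r2: "s * deriv1 ?W ?w (?q + s *\<^sub>R ?b) \<ge> s * deriv1 ?W ?w ?q - 2 * B * (s\<^sup>2 / e)"
    proof -
      define d where "d = deriv1 ?W ?w (?q + s *\<^sub>R ?b) - deriv1 ?W ?w ?q"
      have "\<bar>deriv1 (deriv1 ?W ?w) ?b ?q\<bar> \<le> B * norm ?w * norm ?b" using est[OF p e(1) te] by blast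
      also have "\<dots> \<le> B * 1 * 1" using nb B by (intro mult_mono) auto
      finally have h: "\<bar>s * deriv1 (deriv1 ?W ?w) ?b ?q\<bar> \<le> \<bar>s\<bar> * B" by (simp add: abs_mult mult_left_mono)
      have "B * norm ?w * (s\<^sup>2 / e) \<le> B * 1 * (s\<^sup>2 / e)" using nb B s2e by (intro mult_right_mono mult_left_mono) auto
      then have d: "\<bar>d\<bar> \<le> \<bar>s\<bar> * B + B * (s\<^sup>2 / e)" using rem[of ?w] h unfolding d_def by linarith
      have ss: "\<bar>s\<bar> * (\<bar>s\<bar> * B) = B * s\<^sup>2" by (simp add: power2_eq_square mult.assoc[symmetric])
      have "\<bar>s * d\<bar> \<le> \<bar>s\<bar> * (\<bar>s\<bar> * B + B * (s\<^sup>2 / e))" unfolding abs_mult by (rule mult_left_mono[OF d]) simp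
      also have "\<bar>s\<bar> * (\<bar>s\<bar> * B + B * (s\<^sup>2 / e)) = B * s\<^sup>2 + (\<bar>s\<bar> * B) * (s\<^sup>2 / e)" unfolding distrib_left ss by (simp only: mult.assoc)
      also have "\<dots> \<le> B * (s\<^sup>2 / e) + (1 * B) * (s\<^sup>2 / e)" using s e B s2e
        by (intro add_mono mult_left_mono mult_right_mono) auto
      finally have "- (s * d) \<le> 2 * B * (s\<^sup>2 / e)" by simp
      then show ?thesis unfolding d_def by (simp add: right_diff_distrib)
    qed
    have lin: "deriv1 ?W (v + s *\<^sub>R bv, 1) z = deriv1 ?W ?u z + s * deriv1 ?W ?w z" for z
    proof -
      have "(v + s *\<^sub>R bv, 1::real) = ?u + s *\<^sub>R ?w" by simp
      then show ?thesis using linear_add[OF deriv_linear[OF smW[OF e(1)], of z], of ?u "s *\<^sub>R ?w"]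
          linear_scale[OF deriv_linear[OF smW[OF e(1)], of z], of s ?w] by (simp del: scaleR_Pair add_Pair)
    qed
    have dp: "dsig ?W p = deriv1 ?W ?u ?q" by (simp add: dsig_def px)
    have dd: "ddsig ?W p b = deriv1 (deriv1 ?W ?u) ?b ?q + deriv1 ?W ?w ?q" by (simp add: ddsig_def px bb)
    have dpb: "dsig ?W (p + s *\<^sub>R b) = deriv1 ?W ?u (?q + s *\<^sub>R ?b) + s * deriv1 ?W ?w (?q + s *\<^sub>R ?b)"
      unfolding lin[symmetric] by (simp add: dsig_def px bb)
    have ds: "dsig ?W (p + s *\<^sub>R b) \<ge> dsig ?W p + s * ddsig ?W p b - (B * (R + 1) + 2 * B) * (s\<^sup>2 / e)"
      unfolding dpb dp dd distrib_left[of s] distrib_right[of "B * (R + 1)"] using r1 r2 by linarith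
    have P1: "p \<in> P" using p0 Q0_P by (auto simp: touch_def)
    have P2: "p + s *\<^sub>R b \<in> P"
    proof -
      have bn: "norm bx \<le> 1" "norm bv \<le> 1" "\<bar>bt\<bar> \<le> 1"
        using nb norm_fst_le[of bx bt] norm_snd_le[of bt bx] norm_fst_le[of bv "0::real"] by auto
      have sn: "norm (s *\<^sub>R y) \<le> e" if "norm y \<le> 1" for y :: 'a using mult_mono[OF s that] e by simp
      have "\<bar>s * bt\<bar> \<le> e" using mult_mono[OF s bn(3)] e by (simp add: abs_mult)
      then have "0 \<le> t + s * bt" "t + s * bt \<le> t0" using t e by linarith+
      moreover have "\<delta> (x + s *\<^sub>R bx) \<le> 5 * r"
        using \<delta>_lip[of "x + s *\<^sub>R bx" x] \<delta>_S0[OF q(1)] sn[OF bn(1)] e r by simp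
      moreover have "norm (v + s *\<^sub>R bv) \<le> R"
        using norm_triangle_ineq[of v "s *\<^sub>R bv"] sn[OF bn(2)] q e by linarith
      ultimately show ?thesis unfolding px bb by (simp add: in_P)
    qed
    have "\<phi> (p + s *\<^sub>R b) - \<phi> p - s * (G p \<bullet> b) \<le> (norm (s *\<^sub>R b))\<^sup>2"
      using is_jetD(5)[OF jet P1 P2] by simp
    also have "\<dots> \<le> s\<^sup>2" using b by (simp add: power_mult_distrib mult_left_le power_le_one)
    finally have "\<phi> (p + s *\<^sub>R b) \<le> \<phi> p + s * (G p \<bullet> b) + s\<^sup>2 / e" using s2e by linarith
    then show "\<gamma> e (p + s *\<^sub>R b) \<le> \<gamma> e p + s * d\<gamma> e p b + C * (s\<^sup>2 / e)"
      using ds unfolding \<gamma>_def d\<gamma>_def C_def by (simp add: algebra_simps)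
  qed
qed

text \<open>A bound uniform in \<open>e\<close>, for dominated convergence: contact controls the
  second derivatives of \<open>W e\<close>, the Lipschitz constant of \<open>f\<close> the
  first.\<close>

lemma d\<gamma>_bound:
  obtains C where "C \<ge> 0" "\<And>p b e. touch p \<Longrightarrow> norm b \<le> 1 \<Longrightarrow> 0 < e \<Longrightarrow> e \<le> 1 \<Longrightarrow> 2 * e \<le> t0 \<Longrightarrow> \<bar>d\<gamma> e p b\<bar> \<le> C"
proof (rule contact_estimates)
  fix B :: real assume B: "B \<ge> 0" and est: "\<And>x v t e. touch (x, v, t) \<Longrightarrow> 0 < e \<Longrightarrow> 2 * e \<le> t0 \<Longrightarrow>
    \<bar>W e (x, t) - f x t\<bar> \<le> B * e\<^sup>2 \<and>
    (\<forall>u u'. \<bar>deriv1 (deriv1 (W e) u) u' (x, t)\<bar> \<le> B * norm u * norm u') \<and>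
    (\<forall>u d. norm d \<le> e \<longrightarrow> \<bar>deriv1 (W e) u ((x, t) + d) - deriv1 (W e) u (x, t) - deriv1 (deriv1 (W e) u) d (x, t)\<bar>
        \<le> B * norm u * (norm d)\<^sup>2 / e)"
  obtain M where M: "M \<ge> 0" "\<And>x k. x \<in> S0 \<Longrightarrow> k \<le> 2 \<Longrightarrow> time_lipschitz t0 (norm x + k) M f"
    using adm_lip_S0[OF adm_f] by blast
  show thesis
  proof (rule that[of "1 + B * (R + 1) + 8 * M"])
    show "0 \<le> 1 + B * (R + 1) + 8 * M" using B M R by simp
    fix p b :: "'a \<times> 'a \<times> real" and e :: real
    assume p0: "touch p" and b: "norm b \<le> 1" and e: "0 < e" "e \<le> 1" "2 * e \<le> t0"
    obtain x v t where px: "p = (x, v, t)" by (cases p) auto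
    obtain bx bv bt where bb: "b = (bx, bv, bt)" by (cases b) auto
    note p = p0[unfolded px]
    have q: "x \<in> S0" "norm v \<le> R" using p by (auto simp: touch_def Q0_def)
    have nb: "norm (bx, bt) \<le> 1" "norm (bv, 0::real) \<le> 1"
    proof -
      have "(norm b)\<^sup>2 \<le> 1" using b by (simp add: power_le_one)
      then have "(norm bx)\<^sup>2 + ((norm bv)\<^sup>2 + bt\<^sup>2) \<le> 1" by (simp add: bb norm_Pair)
      then have "(norm bx)\<^sup>2 + bt\<^sup>2 \<le> 1" "(norm bv)\<^sup>2 \<le> 1"
        using zero_le_power2[of "norm bv"] zero_le_power2[of bt] zero_le_power2[of "norm bx"] by linarith+
      then show "norm (bx, bt) \<le> 1" "norm (bv, 0::real) \<le> 1" by (simp_all add: norm_Pair power2_le_imp_le[of _ 1] abs_square_le_1)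
    qed
    have P1: "p \<in> P" using p0 Q0_P by (auto simp: touch_def)
    have "\<bar>G p \<bullet> b\<bar> \<le> norm (G p) * norm b" by (rule Cauchy_Schwarz_ineq2)
    also have "\<dots> \<le> 1 * 1" using is_jetD(2)[OF jet P1] b by (intro mult_mono) auto
    finally have 1: "\<bar>G p \<bullet> b\<bar> \<le> 1" by simp
    have "\<bar>deriv1 (deriv1 (W e) (v, 1)) (bx, bt) (x, t)\<bar> \<le> B * norm (v, 1::real) * norm (bx, bt)"
      using est[OF p e(1,3)] by blast
    also have "\<dots> \<le> B * (R + 1) * 1" using B nb norm_v1[OF q(2)] R by (intro mult_mono) auto
    finally have 2: "\<bar>deriv1 (deriv1 (W e) (v, 1)) (bx, bt) (x, t)\<bar> \<le> B * (R + 1)" by simp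
    have Mx: "time_lipschitz t0 (norm (fst (x, t)) + 2) M f" using M(2)[OF q(1), of 2] by simp
    have "\<bar>deriv1 (W e) (bv, 0) (x, t)\<bar> \<le> 8 * M * norm (bv, 0::real)"
      unfolding W_def by (rule mollify_deriv_bound[OF Mx t0_nonneg e(1,2) cont_ext[OF adm_f]])
    also have "\<dots> \<le> 8 * M * 1" using nb M by (intro mult_left_mono) auto
    finally show "\<bar>d\<gamma> e p b\<bar> \<le> 1 + B * (R + 1) + 8 * M"
      using 1 2 unfolding d\<gamma>_def ddsig_def px bb fst_conv snd_conv by linarith
  qed
qed

text \<open>The lower bound for \<open>\<gamma>\<close> is compared with its expansion at \<open>p \<plusminus> \<lambda> e b\<close> for a fixed small \<open>\<lambda>\<close>.\<close>

lemma d\<gamma>_limit: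
  assumes e: "\<And>n. 0 < e n" "\<And>n. e n \<le> 1" "e \<longlonglongrightarrow> 0" and p: "touch p" and lim: "(\<lambda>n. \<gamma> (e n) p / e n) \<longlonglongrightarrow> 0"
    and b: "norm b \<le> 1"
  shows "(\<lambda>n. d\<gamma> (e n) p b) \<longlonglongrightarrow> 0"
proof (rule \<gamma>_shift_upper)
  fix C :: real assume C: "C \<ge> 0" and up: "\<And>p b e s. touch p \<Longrightarrow> norm b \<le> 1 \<Longrightarrow> 0 < e \<Longrightarrow> e \<le> 1 \<Longrightarrow> e \<le> r \<Longrightarrow> 2 * e < tm p \<Longrightarrow> tm p + 2 * e < t0 \<Longrightarrow>
    \<bar>s\<bar> \<le> e \<Longrightarrow> \<gamma> e (p + s *\<^sub>R b) \<le> \<gamma> e p + s * d\<gamma> e p b + C * (s\<^sup>2 / e)"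
  obtain x v t where px: "p = (x, v, t)" by (cases p) auto
  have t: "0 < tm p" "tm p < t0" using p by (auto simp: touch_def)
  show ?thesis
  proof (rule LIMSEQ_I)
    fix \<kappa> :: real assume \<kappa>: "\<kappa> > 0"
    define l where "l = min 1 (\<kappa> / (2 * (C + 1)))"
    have l: "0 < l" "l \<le> 1" using \<kappa> C by (auto simp: l_def)
    have cancel: "c * (\<kappa> / (2 * c)) = \<kappa> / 2" if "c \<noteq> 0" for c using that by simp
    have "C * l \<le> (C + 1) * (\<kappa> / (2 * (C + 1)))" using C l by (intro mult_mono) (auto simp: l_def)
    also have "\<dots> = \<kappa> / 2" by (rule cancel) (use C in simp)
    finally have Cl: "C * l \<le> \<kappa> / 2" .
    have "(\<lambda>n. \<gamma> (e n) p / e n + C3 * e n) \<longlonglongrightarrow> 0 + C3 * 0" by (intro tendsto_add lim tendsto_mult tendsto_const e(3))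
    then have "\<forall>\<^sub>F n in sequentially. \<gamma> (e n) p / e n + C3 * e n < l * \<kappa> / 2"
      by (rule order_tendstoD(2)) (use l \<kappa> in simp)
    moreover have "\<forall>\<^sub>F n in sequentially. e n < min r (min (tm p / 2) ((t0 - tm p) / 2))"
      by (rule order_tendstoD(2)[OF e(3)]) (use t r in simp)
    ultimately have "\<forall>\<^sub>F n in sequentially. norm (d\<gamma> (e n) p b - 0) < \<kappa>"
    proof eventually_elim
      case (elim n)
      let ?e = "e n" and ?d = "d\<gamma> (e n) p b"
      have en: "?e \<le> r" "2 * ?e < tm p" "tm p + 2 * ?e < t0" using elim by auto
      have key: "- (C3 * ?e\<^sup>2) \<le> \<gamma> ?e p + s * ?d + C * (s\<^sup>2 / ?e)" if s: "\<bar>s\<bar> \<le> ?e" for s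
        using \<gamma>_shift_lower[OF p[unfolded px] b e(1,2), of n s] en s up[OF p b e(1,2) en s] unfolding px by simp
      have le: "l * ?e \<le> ?e" using l e(1)[of n] by simp
      have s2: "(l * ?e)\<^sup>2 / ?e = l\<^sup>2 * ?e" "(- (l * ?e))\<^sup>2 / ?e = l\<^sup>2 * ?e" using e(1)[of n] by (auto simp: power2_eq_square)
      have "- (C3 * ?e\<^sup>2) \<le> \<gamma> ?e p + (l * ?e) * ?d + C * (l\<^sup>2 * ?e)" "- (C3 * ?e\<^sup>2) \<le> \<gamma> ?e p - (l * ?e) * ?d + C * (l\<^sup>2 * ?e)"
        using key[of "l * ?e"] key[of "- (l * ?e)"] le l e(1)[of n] unfolding s2 by (auto simp: abs_mult)
      then have "(l * ?e) * \<bar>?d\<bar> \<le> \<gamma> ?e p + C3 * ?e\<^sup>2 + C * (l\<^sup>2 * ?e)" by (auto simp: abs_if)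
      then have "((l * ?e) * \<bar>?d\<bar>) / ?e \<le> (\<gamma> ?e p + C3 * ?e\<^sup>2 + C * (l\<^sup>2 * ?e)) / ?e" using e(1)[of n] by (intro divide_right_mono) auto
      then have "l * \<bar>?d\<bar> \<le> (\<gamma> ?e p / ?e + C3 * ?e) + l * (C * l)" 
        using e(1)[of n] by (simp add: add_divide_distrib power2_eq_square mult_ac)
      also have "\<dots> < l * \<kappa> / 2 + l * (\<kappa> / 2)" using elim(1) Cl l by (intro add_less_le_mono mult_left_mono) auto
      also have "\<dots> = l * \<kappa>" by simp
      finally show ?case using l by simp
    qed
    then show "\<exists>n0. \<forall>n\<ge>n0. norm (d\<gamma> (e n) p b - 0) < \<kappa>" unfolding eventually_sequentially .
  qed
qed

lemma set_integrable_mult_continuous: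
  fixes h k :: "'a \<times> 'a \<times> real \<Rightarrow> real"
  assumes h: "set_integrable \<mu> Q0 h" and k: "continuous_on Q0 k"
  shows "set_integrable \<mu> Q0 (\<lambda>p. h p * k p)"
proof -
  have "bounded (k ` Q0)" by (intro compact_imp_bounded compact_continuous_image k compact_Q0)
  then obtain B where B: "\<And>p. p \<in> Q0 \<Longrightarrow> \<bar>k p\<bar> \<le> B" unfolding bounded_iff by (metis image_eqI real_norm_def)
  have eq: "(\<lambda>p. indicator Q0 p *\<^sub>R (h p * k p)) = (\<lambda>p. (indicator Q0 p *\<^sub>R h p) * (indicator Q0 p *\<^sub>R k p))"
    by (auto simp: indicator_def fun_eq_iff)
  show ?thesis unfolding set_integrable_def
  proof (rule Bochner_Integration.integrable_bound)
    show "integrable \<mu> (\<lambda>p. B * (indicator Q0 p *\<^sub>R h p))"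
      using h unfolding set_integrable_def by (rule integrable_mult_right)
    show "(\<lambda>p. indicator Q0 p *\<^sub>R (h p * k p)) \<in> borel_measurable \<mu>" unfolding eq
      by (rule borel_measurable_times[OF borel_measurable_integrable[OF h[unfolded set_integrable_def]] cont_measurable[OF k]])
    show "AE p in \<mu>. norm (indicator Q0 p *\<^sub>R (h p * k p)) \<le> norm (B * (indicator Q0 p *\<^sub>R h p))"
    proof (intro AE_I2)
      fix p
      have "\<bar>h p\<bar> * \<bar>k p\<bar> \<le> \<bar>h p\<bar> * \<bar>B\<bar>" if "p \<in> Q0" using B[OF that] by (intro mult_left_mono) auto
      then show "norm (indicator Q0 p *\<^sub>R (h p * k p)) \<le> norm (B * (indicator Q0 p *\<^sub>R h p))"
        by (auto simp: indicator_def abs_mult mult.commute)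
    qed
  qed
qed

lemma set_integrable_sum':
  "(\<And>i. i \<in> J \<Longrightarrow> set_integrable \<mu> Q0 (h i)) \<Longrightarrow> set_integrable \<mu> Q0 (\<lambda>p. \<Sum>i\<in>J. h i p)"
  for h :: "'i \<Rightarrow> 'a \<times> 'a \<times> real \<Rightarrow> real"
  unfolding set_integrable_def scaleR_sum_right by (rule Bochner_Integration.integrable_sum)

text \<open>By \<open>exact\<close> the part coming from \<open>W e\<close> contributes nothing, so
  the integral of \<open>d\<gamma>\<close> along \<open>X\<close> is the same for all scales; it
  tends to 0 by dominated convergence, with a multiple of the coordinates of \<open>X\<close> as
  majorant.\<close>

proposition jet_annihilates:
  fixes X :: "'a \<times> 'a \<times> real \<Rightarrow> 'a \<times> 'a \<times> real"
  assumes X: "\<And>b. b \<in> Basis \<Longrightarrow> set_integrable \<mu> Q0 (\<lambda>p. X p \<bullet> b)"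
    and exact: "\<And>\<psi>. smooth_fun \<psi> \<Longrightarrow> (LINT p:Q0|\<mu>. ddsig \<psi> p (X p)) = 0"
  shows "(LINT p:Q0|\<mu>. G p \<bullet> X p) = 0"
proof (rule defect_subsequence)
  fix e :: "nat \<Rightarrow> real" assume e: "\<And>n. 0 < e n" "\<And>n. e n \<le> 1" "\<And>n. 2 * e n \<le> t0" "e \<longlonglongrightarrow> 0"
    and ae: "AE p in \<mu>. touch p \<longrightarrow> (\<lambda>n. \<gamma> (e n) p / e n) \<longlonglongrightarrow> 0"
  obtain C where C: "C \<ge> 0" "\<And>p b e. touch p \<Longrightarrow> norm b \<le> 1 \<Longrightarrow> 0 < e \<Longrightarrow> e \<le> 1 \<Longrightarrow> 2 * e \<le> t0 \<Longrightarrow> \<bar>d\<gamma> e p b\<bar> \<le> C"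
    by (rule d\<gamma>_bound) blast
  have cG: "continuous_on Q0 (\<lambda>p. G p \<bullet> b)" for b
    by (intro continuous_on_inner continuous_on_const continuous_on_subset[OF cont_G Q0_P])
  have GX: "G p \<bullet> X p = (\<Sum>b\<in>Basis. (X p \<bullet> b) * (G p \<bullet> b))" for p
    by (subst euclidean_inner) (simp add: mult.commute)
  have dX: "ddsig \<psi> p (X p) = (\<Sum>b\<in>Basis. (X p \<bullet> b) * ddsig \<psi> p b)" if "smooth_fun \<psi>" for \<psi> p
    by (rule linear_basis_expansion[OF linear_ddsig[OF that]])
  have iG: "set_integrable \<mu> Q0 (\<lambda>p. G p \<bullet> X p)"
    unfolding GX by (intro set_integrable_sum' set_integrable_mult_continuous X cG)
  have id: "set_integrable \<mu> Q0 (\<lambda>p. ddsig \<psi> p (X p))" if "smooth_fun \<psi>" for \<psi>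
    unfolding dX[OF that] by (intro set_integrable_sum' set_integrable_mult_continuous X continuous_on_ddsig[OF that])
  let ?D = "\<lambda>n p. indicator Q0 p *\<^sub>R (G p \<bullet> X p - ddsig (W (e n)) p (X p))"
  have D: "G p \<bullet> X p - ddsig (W (e n)) p (X p) = (\<Sum>b\<in>Basis. (X p \<bullet> b) * d\<gamma> (e n) p b)" for n p
    unfolding GX dX[OF smW[OF e(1)]] d\<gamma>_def by (simp add: sum_subtractf[symmetric] right_diff_distrib)
  have iD: "integrable \<mu> (?D n)" for n
    using set_integral_diff(1)[OF iG id[OF smW[OF e(1)]]] unfolding set_integrable_def .
  have val: "(\<integral>p. ?D n p \<partial>\<mu>) = (LINT p:Q0|\<mu>. G p \<bullet> X p)" for n
    using set_integral_diff(2)[OF iG id[OF smW[OF e(1)]]] exact[OF smW[OF e(1)], of n]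
    unfolding set_lebesgue_integral_def by simp
  have "(\<lambda>n. \<integral>p. ?D n p \<partial>\<mu>) \<longlonglongrightarrow> (\<integral>p. 0 \<partial>\<mu>)"
  proof (rule integral_dominated_convergence[where w = "\<lambda>p. \<Sum>b\<in>Basis. \<bar>indicator Q0 p *\<^sub>R (X p \<bullet> b)\<bar> * C"])
    show "integrable \<mu> (\<lambda>p. \<Sum>b\<in>Basis. \<bar>indicator Q0 p *\<^sub>R (X p \<bullet> b)\<bar> * C)"
      using X unfolding set_integrable_def
      by (intro Bochner_Integration.integrable_sum integrable_mult_left Bochner_Integration.integrable_abs)
    show "?D n \<in> borel_measurable \<mu>" for n using iD by (rule borel_measurable_integrable)
    show "AE p in \<mu>. (\<lambda>n. ?D n p) \<longlonglongrightarrow> 0"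
      using AE_touch ae
    proof eventually_elim
      case (elim p)
      have "(\<lambda>n. indicator Q0 p *\<^sub>R (\<Sum>b\<in>Basis. (X p \<bullet> b) * d\<gamma> (e n) p b)) \<longlonglongrightarrow> indicator Q0 p *\<^sub>R (\<Sum>b\<in>Basis. (X p \<bullet> b) * 0)"
        using elim by (intro tendsto_scaleR tendsto_const tendsto_sum tendsto_mult d\<gamma>_limit[OF e(1,2,4)]) auto
      then show ?case unfolding D by simp
    qed
    show "AE p in \<mu>. norm (?D n p) \<le> (\<Sum>b\<in>Basis. \<bar>indicator Q0 p *\<^sub>R (X p \<bullet> b)\<bar> * C)" for n
      using AE_touch
    proof eventually_elim
      case (elim p)
      have "norm (?D n p) \<le> (\<Sum>b\<in>Basis. \<bar>indicator Q0 p *\<^sub>R (X p \<bullet> b)\<bar> * \<bar>d\<gamma> (e n) p b\<bar>)"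
        unfolding D scaleR_sum_right by (rule order_trans[OF norm_sum]) (simp add: abs_mult mult.assoc)
      also have "\<dots> \<le> (\<Sum>b\<in>Basis. \<bar>indicator Q0 p *\<^sub>R (X p \<bullet> b)\<bar> * C)"
        by (intro sum_mono mult_left_mono C(2)[OF elim _ e(1-3)]) auto
      finally show ?case .
    qed
  qed simp
  then show ?thesis unfolding val by (simp add: LIMSEQ_const_iff)
qed

end

section \<open>Minimax and the deformation\<close>

text \<open>Convexity of \<open>J\<close> as seen through \<open>Fam\<close>: a mixed index is one
  at which all members of \<open>Fam\<close> take the mixed values. It survives restriction to the
  indices where a member of \<open>Fam\<close> is positive, as the induction below requires.\<close>

definition mixable :: "('j \<Rightarrow> real) set \<Rightarrow> 'j set \<Rightarrow> bool" where
  "mixable Fam J \<longleftrightarrow> (\<forall>i\<in>J. \<forall>j\<in>J. \<forall>t\<in>{0..1}. \<exists>k\<in>J. \<forall>F\<in>Fam. F k = (1 - t) * F i + t * F j)"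

lemma mixable_mono:
  assumes "mixable Fam J" "A \<subseteq> Fam" shows "mixable A J"
  unfolding mixable_def
proof (intro ballI)
  fix i j and t :: real assume a: "i \<in> J" "j \<in> J" "t \<in> {0..1}"
  from assms(1)[unfolded mixable_def, rule_format, OF a] obtain k where "k \<in> J" "\<forall>F\<in>Fam. F k = (1 - t) * F i + t * F j" by (elim bexE)
  then show "\<exists>k\<in>J. \<forall>F\<in>A. F k = (1 - t) * F i + t * F j" using assms(2) by (intro bexI[of _ k]) auto
qed

text \<open>The image of \<open>J\<close> in the plane is convex and avoids the open positive
  quadrant. A separating line has a nonnegative normal \<open>(c, d)\<close>, and normalising it
  gives the weight \<open>d / (c + d)\<close>.\<close>

lemma two_function_minimax:
  fixes f g :: "'j \<Rightarrow> real"
  assumes mix: "mixable {f, g} J" and neg: "\<And>j. j \<in> J \<Longrightarrow> f j \<le> 0 \<or> g j \<le> 0"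
  obtains t where "0 \<le> t" "t \<le> 1" "\<forall>j\<in>J. (1 - t) * f j + t * g j \<le> 0"
proof (cases "J = {}")
  case True
  then show ?thesis using that[of 0] by simp
next
  case False
  let ?C = "(\<lambda>j. (f j, g j)) ` J" and ?D = "{0<..} \<times> {0<..} :: (real \<times> real) set"
  have "convex ?C" unfolding convex_alt
  proof (intro ballI allI impI)
    fix z z' and u :: real assume z: "z \<in> ?C" "z' \<in> ?C" and u: "0 \<le> u \<and> u \<le> 1"
    then obtain i j where ij: "i \<in> J" "j \<in> J" "z = (f i, g i)" "z' = (f j, g j)" by auto
    have "u \<in> {0..1}" using u by simp
    then obtain k where "k \<in> J" "\<forall>F\<in>{f, g}. F k = (1 - u) * F i + u * F j" 
      using mix ij(1,2) unfolding mixable_def by blast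
    then show "(1 - u) *\<^sub>R z + u *\<^sub>R z' \<in> ?C" unfolding ij by (intro image_eqI[of _ _ k]) auto
  qed
  moreover have "convex ?D" by (intro convex_Times) auto
  moreover have "?C \<noteq> {}" "?D \<noteq> {}" using False by auto
  moreover have "?C \<inter> ?D = {}" using neg by (auto simp: not_le[symmetric]) blast
  ultimately obtain a b where a: "a \<noteq> 0" and C: "\<And>z. z \<in> ?C \<Longrightarrow> a \<bullet> z \<le> b" and D: "\<And>z. z \<in> ?D \<Longrightarrow> b \<le> a \<bullet> z"
    using separating_hyperplane_sets[of ?C ?D] by blast
  obtain c d where cd: "a = (c, d)" by (cases a)
  have D': "b \<le> c * x + d * y" if "0 < x" "0 < y" for x y using D[of "(x, y)"] that by (simp add: cd)
  \<comment> \<open>A negative coefficient would make \<open>c * x + d * y\<close> unbounded below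
    on the quadrant.\<close>
  have c0: "0 \<le> c"
  proof (rule ccontr)
    assume n: "\<not> 0 \<le> c"
    then have "0 < (\<bar>d\<bar> + \<bar>b\<bar> + 1) / - c" by (intro divide_pos_pos) auto
    from D'[OF this, of 1] have "b \<le> c * ((\<bar>d\<bar> + \<bar>b\<bar> + 1) / - c) + d" by simp
    moreover have "c * ((\<bar>d\<bar> + \<bar>b\<bar> + 1) / - c) = - (\<bar>d\<bar> + \<bar>b\<bar> + 1)" using n by simp
    ultimately show False by linarith
  qed
  have d0: "0 \<le> d"
  proof (rule ccontr)
    assume n: "\<not> 0 \<le> d"
    then have "0 < (\<bar>c\<bar> + \<bar>b\<bar> + 1) / - d" by (intro divide_pos_pos) auto
    from D'[OF _ this, of 1] have "b \<le> c + d * ((\<bar>c\<bar> + \<bar>b\<bar> + 1) / - d)" by simp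
    moreover have "d * ((\<bar>c\<bar> + \<bar>b\<bar> + 1) / - d) = - (\<bar>c\<bar> + \<bar>b\<bar> + 1)" using n by simp
    ultimately show False by linarith
  qed
  have s: "c + d > 0" using a c0 d0 by (auto simp: cd zero_prod_def)
  have b: "b \<le> 0"
  proof (rule ccontr)
    assume n: "\<not> b \<le> 0"
    let ?x = "b / (2 * (c + d))"
    have half: "w * (b / (2 * w)) = b / 2" if "w \<noteq> 0" for w using that by simp
    have "b \<le> c * ?x + d * ?x" by (rule D') (use n s in simp_all)
    also have "\<dots> = (c + d) * ?x" by (rule distrib_right[symmetric])
    also have "\<dots> = b / 2" by (rule half) (use s in simp)
    finally show False using n by simp
  qed
  show ?thesis
  proof (rule that[of "d / (c + d)"], goal_cases)
    case 3
    show ?case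
    proof
    fix j assume "j \<in> J"
    then have "c * f j + d * g j \<le> 0" using C[of "(f j, g j)"] b by (auto simp: cd)
    moreover have "1 - d / (c + d) = c / (c + d)" using s by (simp add: field_simps)
    ultimately show "(1 - d / (c + d)) * f j + d / (c + d) * g j \<le> 0"
      using s by (simp add: add_divide_distrib[symmetric] divide_le_0_iff)
    qed
  qed (use c0 d0 s in auto)
qed

text \<open>Remove one member \<open>F\<close> and keep the indices where it is positive; these are
  still mixable. The induction hypothesis yields some \<open>H \<le> 0\<close> there, so at every
  index \<open>F\<close> or \<open>H\<close> is nonpositive, and the case of two functions
  applies.\<close>

lemma finite_minimax:
  fixes Fam :: "('j \<Rightarrow> real) set"
  assumes conv: "\<And>F H t. F \<in> Fam \<Longrightarrow> H \<in> Fam \<Longrightarrow> 0 \<le> t \<Longrightarrow> t \<le> 1 \<Longrightarrow> (\<lambda>j. (1 - t) * F j + t * H j) \<in> Fam"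
    and A: "finite A" "A \<noteq> {}" "A \<subseteq> Fam" and mix: "mixable Fam J"
    and neg: "\<And>j. j \<in> J \<Longrightarrow> \<exists>F\<in>A. F j \<le> 0"
  shows "\<exists>H\<in>Fam. \<forall>j\<in>J. H j \<le> 0"
  using A mix neg
proof (induction A arbitrary: J rule: finite_ne_induct)
  case (singleton F)
  then show ?case by auto
next
  case (insert F A)
  define J' where "J' = {j\<in>J. 0 < F j}"
  have "mixable Fam J'"
    unfolding mixable_def
  proof (intro ballI)
    fix i j and t :: real assume ij: "i \<in> J'" "j \<in> J'" and t: "t \<in> {0..1}"
    then obtain k where k: "k \<in> J" "\<And>H. H \<in> Fam \<Longrightarrow> H k = (1 - t) * H i + t * H j"
      using insert.prems(2) unfolding mixable_def J'_def by blast
    have F: "F \<in> Fam" using insert.prems by blast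
    have "0 < (1 - t) * F i + t * F j"
    proof (cases "t = 0")
      case False
      then show ?thesis using ij t by (intro add_nonneg_pos mult_nonneg_nonneg mult_pos_pos) (auto simp: J'_def)
    qed (use ij in \<open>auto simp: J'_def\<close>)
    then have "k \<in> J'" using k(1) k(2)[OF F] by (simp add: J'_def)
    then show "\<exists>k\<in>J'. \<forall>H\<in>Fam. H k = (1 - t) * H i + t * H j" using k(2) by blast
  qed
  moreover have "\<exists>H\<in>A. H j \<le> 0" if "j \<in> J'" for j
  proof -
    have "j \<in> J" "\<not> F j \<le> 0" using that by (auto simp: J'_def)
    then show ?thesis using insert.prems(3)[of j] by blast
  qed
  ultimately obtain H where H: "H \<in> Fam" "\<forall>j\<in>J'. H j \<le> 0" using insert.IH[of J'] insert.prems(1) by blast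
  have F: "F \<in> Fam" using insert.prems by blast
  have "mixable {F, H} J" by (rule mixable_mono[OF insert.prems(2)]) (use F H(1) in auto)
  moreover have "F j \<le> 0 \<or> H j \<le> 0" if "j \<in> J" for j using H(2) that by (force simp: J'_def)
  ultimately obtain t where "0 \<le> t" "t \<le> 1" "\<forall>j\<in>J. (1 - t) * F j + t * H j \<le> 0"
    by (rule two_function_minimax) blast
  then show ?case using conv[OF F H(1), of t] by (intro bexI[of _ "\<lambda>j. (1 - t) * F j + t * H j"]) auto
qed

text \<open>Pairs of a function and its gradient, normalised to vanish off \<open>P\<close> so that they form a compact
  set for pointwise convergence.\<close>

definition jets :: "'p::euclidean_space set \<Rightarrow> ('p \<Rightarrow> real \<times> 'p) set" where
  "jets P = {h. is_jet P (\<lambda>p. fst (h p)) (\<lambda>p. snd (h p)) \<and> (\<forall>p. p \<notin> P \<longrightarrow> h p = 0)}"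

text \<open>The product of balls is compact by Tychonoff's theorem, and each defining condition
  involves at most two points, so it is closed for pointwise convergence.\<close>

lemma compact_jets: "compact (jets P)"
proof -
  let ?B = "PiE UNIV (\<lambda>p::'a. cball 0 1 \<times> cball 0 1) :: ('a \<Rightarrow> real \<times> 'a) set"
  have "compactin (product_topology (\<lambda>i::'a. euclidean :: (real \<times> 'a) topology) UNIV) ?B"
    unfolding compactin_PiE by (auto intro!: compact_Times)
  then have B: "compact ?B" unfolding euclidean_product_topology by simp
  let ?C1 = "\<lambda>p q. {h::'a \<Rightarrow> real \<times> 'a. \<bar>fst (h p)\<bar> \<le> 1 \<and> norm (snd (h p)) \<le> 1 \<and> 
    \<bar>fst (h p) - fst (h q)\<bar> \<le> norm (p - q) \<and> norm (snd (h p) - snd (h q)) \<le> norm (p - q) \<and>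
    \<bar>fst (h q) - fst (h p) - snd (h p) \<bullet> (q - p)\<bar> \<le> (norm (q - p))\<^sup>2}"
  let ?C2 = "\<lambda>p. {h::'a \<Rightarrow> real \<times> 'a. h p = 0}"
  have eq: "jets P = ?B \<inter> ((\<Inter>p\<in>P. \<Inter>q\<in>P. ?C1 p q) \<inter> (\<Inter>p\<in>-P. ?C2 p))" (is "_ = ?r")
  proof
    show "?r \<subseteq> jets P" unfolding jets_def is_jet_def by auto
    show "jets P \<subseteq> ?r"
    proof
      fix h assume h: "h \<in> jets P"
      have "h p \<in> cball 0 1 \<times> cball 0 1" for p
      proof (cases "p \<in> P")
        case True
        then show ?thesis using h by (auto simp: jets_def is_jet_def mem_Times_iff)
      next
        case False
        then show ?thesis using h by (simp add: jets_def zero_prod_def)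
      qed
      then have "h \<in> ?B" by auto
      then show "h \<in> ?r" using h by (auto simp: jets_def is_jet_def)
    qed
  qed
  have cc: "continuous_on UNIV (\<lambda>h::'a \<Rightarrow> real \<times> 'a. h p)" for p by (rule continuous_on_product_coordinates)
  have c1: "closed (?C1 p q)" for p q
    by (intro closed_Collect_conj closed_Collect_le continuous_on_const continuous_on_rabs continuous_on_norm
        continuous_on_diff continuous_on_inner continuous_on_fst continuous_on_snd cc)
  have c2: "closed (?C2 p)" for p by (intro closed_Collect_eq cc continuous_on_const)
  have "closed ((\<Inter>p\<in>P. \<Inter>q\<in>P. ?C1 p q) \<inter> (\<Inter>p\<in>-P. ?C2 p))"
    by (intro closed_Int closed_INT ballI c1 c2)
  then show ?thesis unfolding eq by (rule compact_Int_closed[OF B])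
qed

lemma jets_mix:
  assumes i: "i \<in> jets P" and j: "j \<in> jets P" and t: "0 \<le> t" "t \<le> 1"
  shows "(\<lambda>p. (1 - t) *\<^sub>R i p + t *\<^sub>R j p) \<in> jets P"
proof -
  have mix: "norm ((1 - t) *\<^sub>R x + t *\<^sub>R y) \<le> c" if "norm x \<le> c" "norm y \<le> c" for x y :: "'c::real_normed_vector" and c
    using convexD_alt[OF convex_cball[of 0 c], of x y t] that t by simp
  have mixr: "\<bar>(1 - t) * x + t * y\<bar> \<le> c" if "\<bar>x\<bar> \<le> c" "\<bar>y\<bar> \<le> c" for x y c :: real
    using mix[of x c y] that by simp
  note D = is_jetD[of P "\<lambda>p. fst (i p)" "\<lambda>p. snd (i p)"] is_jetD[of P "\<lambda>p. fst (j p)" "\<lambda>p. snd (j p)"]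
  have ii: "is_jet P (\<lambda>p. fst (i p)) (\<lambda>p. snd (i p))" and jj: "is_jet P (\<lambda>p. fst (j p)) (\<lambda>p. snd (j p))"
    using i j by (auto simp: jets_def)
  let ?f = "\<lambda>p. (1 - t) * fst (i p) + t * fst (j p)" and ?g = "\<lambda>p. (1 - t) *\<^sub>R snd (i p) + t *\<^sub>R snd (j p)"
  have "is_jet P ?f ?g" unfolding is_jet_def
  proof (intro ballI conjI)
    fix p assume p: "p \<in> P"
    show "\<bar>?f p\<bar> \<le> 1" by (intro mixr is_jetD(1)[OF ii p] is_jetD(1)[OF jj p])
    show "norm (?g p) \<le> 1" by (intro mix is_jetD(2)[OF ii p] is_jetD(2)[OF jj p])
    fix q assume q: "q \<in> P"
    have "?f p - ?f q = (1 - t) * (fst (i p) - fst (i q)) + t * (fst (j p) - fst (j q))" by (simp add: algebra_simps)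
    then show "\<bar>?f p - ?f q\<bar> \<le> norm (p - q)" using mixr[OF is_jetD(3)[OF ii p q] is_jetD(3)[OF jj p q]] by simp
    have "?g p - ?g q = (1 - t) *\<^sub>R (snd (i p) - snd (i q)) + t *\<^sub>R (snd (j p) - snd (j q))"
      by (simp add: scaleR_diff_right)
    then show "norm (?g p - ?g q) \<le> norm (p - q)" using mix[OF is_jetD(4)[OF ii p q] is_jetD(4)[OF jj p q]] by simp
    have "?f q - ?f p - ?g p \<bullet> (q - p) = (1 - t) * (fst (i q) - fst (i p) - snd (i p) \<bullet> (q - p)) + t * (fst (j q) - fst (j p) - snd (j p) \<bullet> (q - p))"
      unfolding inner_add_left inner_scaleR_left by (simp add: algebra_simps)
    then show "\<bar>?f q - ?f p - ?g p \<bullet> (q - p)\<bar> \<le> (norm (q - p))\<^sup>2"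
      using mixr[OF is_jetD(5)[OF ii p q] is_jetD(5)[OF jj p q]] by simp
  qed
  then show ?thesis using i j by (auto simp: jets_def)
qed

lemma minus_jet: 
  assumes "is_jet P \<phi> G" shows "is_jet P (\<lambda>p. - \<phi> p) (\<lambda>p. - G p)"
  unfolding is_jet_def
proof (intro ballI conjI)
  fix p q assume p: "p \<in> P" and q: "q \<in> P"
  note D = is_jetD[OF assms p]
  show "\<bar>- \<phi> p\<bar> \<le> 1" "norm (- G p) \<le> 1" using D(1,2) by simp_all
  have "- \<phi> p - - \<phi> q = - (\<phi> p - \<phi> q)" "- G p - - G q = - (G p - G q)"
    "- \<phi> q - - \<phi> p - - G p \<bullet> (q - p) = - (\<phi> q - \<phi> p - G p \<bullet> (q - p))" by simp_all
  then show "\<bar>- \<phi> p - - \<phi> q\<bar> \<le> norm (p - q)" "norm (- G p - - G q) \<le> norm (p - q)"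
    "\<bar>- \<phi> q - - \<phi> p - - G p \<bullet> (q - p)\<bar> \<le> (norm (q - p))\<^sup>2"
    using D(3-5)[OF q] by (simp_all only: abs_minus_cancel norm_minus_cancel)
qed

lemma jets_uminus: "h \<in> jets P \<Longrightarrow> (\<lambda>p. - h p) \<in> jets P"
  using minus_jet[of P "\<lambda>p. fst (h p)" "\<lambda>p. snd (h p)"] by (simp add: jets_def)

text \<open>Jets share a Lipschitz constant, so closeness at a finite net of \<open>P\<close> gives
  closeness on all of \<open>P\<close>; pointwise neighbourhoods contain uniform ones.\<close>

lemma jets_uniform_neighbourhood:
  fixes P :: "'p::euclidean_space set"
  assumes P: "compact P" and h0: "h0 \<in> jets P" and e: "e > 0"
  obtains N where "open N" "h0 \<in> N" "\<And>h p. h \<in> jets P \<inter> N \<Longrightarrow> p \<in> P \<Longrightarrow> norm (h p - h0 p) \<le> e"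
proof -
  \<comment> \<open>As a map into pairs a jet has Lipschitz constant 2; two such errors and the one
    at the net point make \<open>2 + 1 + 2\<close> fifths of \<open>e\<close>.\<close>
  obtain k where k: "k \<subseteq> P" "finite k" "P \<subseteq> (\<Union>p\<in>k. ball p (e / 5))"
    by (rule compactE_image[OF P, of P "\<lambda>p. ball p (e / 5)"]) (use e in auto)
  define N where "N = (\<Inter>p\<in>k. {h::'p \<Rightarrow> real \<times> 'p. norm (h p - h0 p) < e / 5})"
  have "open N" unfolding N_def
    by (intro open_INT k(2) ballI open_Collect_less continuous_on_const continuous_on_norm continuous_on_diff
        continuous_on_product_coordinates)
  moreover have "h0 \<in> N" using e by (simp add: N_def)
  moreover have "norm (h p - h0 p) \<le> e" if h: "h \<in> jets P \<inter> N" and p: "p \<in> P" for h p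
  proof -
    obtain q where q: "q \<in> k" "norm (p - q) < e / 5" using k(3) p by (auto simp: dist_norm norm_minus_commute)
    have qP: "q \<in> P" using q k by blast
    have lip: "norm (j p - j q) \<le> 2 * norm (p - q)" if "j \<in> jets P" for j
    proof -
      have "is_jet P (\<lambda>p. fst (j p)) (\<lambda>p. snd (j p))" using that by (simp add: jets_def)
      note D = is_jetD(3)[OF this p qP] is_jetD(4)[OF this p qP]
      have "norm (j p - j q) \<le> norm (fst (j p - j q)) + norm (snd (j p - j q))"
        using norm_Pair_le[of "fst (j p - j q)" "snd (j p - j q)"] unfolding prod.collapse .
      then show ?thesis using D by simp
    qed
    have "h p - h0 p = (h p - h q) + (h q - h0 q) + (h0 q - h0 p)" by simp
    then have "norm (h p - h0 p) \<le> norm (h p - h q) + norm (h q - h0 q) + norm (h0 q - h0 p)"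
      by (metis norm_add_rule_thm order_refl add_mono norm_triangle_le)
    moreover have "norm (h q - h0 q) < e / 5" using h q by (auto simp: N_def)
    ultimately show ?thesis using lip[of h] lip[OF h0] h q by (simp add: norm_minus_commute)
  qed
  ultimately show ?thesis by (rule that)
qed

section \<open>Approximation by the cone of closed measures\<close>

locale deformation_setup =
  fixes U :: "'a::euclidean_space set" and t0 r R :: real and S0 :: "'a set"
    and P :: "('a \<times> 'a \<times> real) set" and \<mu> :: "('a \<times> 'a \<times> real) measure"
    and X :: "'a \<times> 'a \<times> real \<Rightarrow> 'a \<times> 'a \<times> real"
  assumes U: "open U" and t0: "t0 > 0" and r: "r > 0" and R: "R \<ge> 1"
    and S0: "compact S0" "S0 \<noteq> {}" and K_U: "{x. infdist x S0 \<le> 5 * r} \<subseteq> U"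
    and P: "compact P" and Q_P: "{x. infdist x S0 \<le> 5 * r} \<times> cball 0 R \<times> {0..t0} \<subseteq> P"
    and mu: "closed_on U t0 (S0 \<times> cball 0 (R - 1) \<times> {0..t0}) \<mu>"
    and X: "\<And>b. b \<in> Basis \<Longrightarrow> set_integrable \<mu> (S0 \<times> cball 0 (R - 1) \<times> {0..t0}) (\<lambda>p. X p \<bullet> b)"
    and exact: "\<And>\<psi>. smooth_fun \<psi> \<Longrightarrow> (LINT p:S0 \<times> cball 0 (R - 1) \<times> {0..t0}|\<mu>. ddsig \<psi> p (X p)) = 0"
begin

abbreviation QU where "QU \<equiv> {x. infdist x S0 \<le> 5 * r} \<times> cball (0::'a) R \<times> {0..t0}"
abbreviation Q\<mu> where "Q\<mu> \<equiv> S0 \<times> cball (0::'a) (R - 1) \<times> {0..t0}"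

definition D where "D = diameter P"

lemma diam: "p \<in> P \<Longrightarrow> q \<in> P \<Longrightarrow> norm (p - q) \<le> D"
  using diameter_bounded_bound[OF compact_imp_bounded[OF P]] by (simp add: D_def dist_norm)

lemma jet_dual_measureI:
  assumes "is_jet P \<phi> G" "\<And>\<nu>. closed_on U t0 QU \<nu> \<Longrightarrow> 0 \<le> (LINT p:QU|\<nu>. \<phi> p)" "(LINT p:Q\<mu>|\<mu>. \<phi> p) \<le> 0"
  shows "jet_dual_measure U t0 r R D S0 P \<phi> G \<mu>"
  by unfold_locales (use assms U t0 r R S0 K_U Q_P diam mu in auto)

lemma zero_jet: "is_jet P (\<lambda>_. 0) (\<lambda>_. 0)" by (simp add: is_jet_def)

text \<open>The zero jet satisfies the dual hypotheses trivially; through it the facts about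
  \<open>\<mu>\<close>, the tube and the carrier become available.\<close>

interpretation z: jet_dual_measure U t0 r R D S0 P "\<lambda>_. 0" "\<lambda>_. 0" \<mu>
  by (rule jet_dual_measureI[OF zero_jet]) (simp_all add: set_lebesgue_integral_def)

lemma Q\<mu>_def: "z.Q0 = Q\<mu>" by (simp add: z.Q0_def)

lemma Q\<mu>_P: "Q\<mu> \<subseteq> P" using z.Q0_P unfolding Q\<mu>_def .

lemma compact_QU: "compact QU" by (intro compact_Times z.compact_Kc compact_cball compact_Icc)

lemma QU_TI: "QU \<subseteq> TI U t0" using K_U by (auto simp: TI_def)

lemma QU_borel: "QU \<in> sets borel" using compact_imp_closed[OF compact_QU] by auto

lemma integrable_QU:
  fixes h :: "'a \<times> 'a \<times> real \<Rightarrow> real"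
  assumes "closed_on U t0 QU \<nu>" "continuous_on QU h" shows "set_integrable \<nu> QU h"
  using concentrated_on_integrable[OF _ compact_QU order_refl QU_borel assms(2)] assms(1) by (simp add: closed_on_def)

lemma mu_QU: "closed_on U t0 QU \<mu>"
proof -
  have "Q\<mu> \<subseteq> QU" using R r by auto
  then have "concentrated_on QU \<mu>"
    using concentrated_on_subset[OF _ _ _ compact_imp_closed[OF compact_QU]] z.conc z.compact_Q0 compact_imp_closed
    unfolding Q\<mu>_def by blast
  then show ?thesis using mu by (simp add: closed_on_def)
qed

lemma sets_closed_on: "closed_on U t0 QU \<nu> \<Longrightarrow> sets \<nu> = sets borel"
  by (simp add: closed_on_def concentrated_on_def)

lemma LINT_comb:
  fixes h :: "'a \<times> 'a \<times> real \<Rightarrow> real"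
  assumes "closed_on U t0 QU \<nu>1" "closed_on U t0 QU \<nu>2" "0 \<le> a" "0 \<le> b" "continuous_on QU h"
  shows "(LINT p:QU|comb_measure a \<nu>1 b \<nu>2. h p) = a * (LINT p:QU|\<nu>1. h p) + b * (LINT p:QU|\<nu>2. h p)"
  by (intro set_integral_comb integrable_QU assms) (simp add: sets_closed_on assms)

lemmas closed_on_comb_QU = closed_on_comb[OF _ _ compact_QU QU_TI U]

text \<open>The error of replacing \<open>\<eta>\<close> by \<open>\<nu> - c \<mu>\<close> on the
  test function recorded in \<open>h\<close>. On jets it is affine in \<open>(\<nu>, c)\<close> and
  linear in \<open>h\<close>, as the minimax argument requires.\<close>

definition defect :: "('a \<times> 'a \<times> real) measure \<Rightarrow> real \<Rightarrow> ('a \<times> 'a \<times> real \<Rightarrow> real \<times> 'a \<times> 'a \<times> real) \<Rightarrow> real" where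
  "defect \<nu> c h = (LINT p:Q\<mu>|\<mu>. snd (h p) \<bullet> X p) + c * (LINT p:Q\<mu>|\<mu>. fst (h p)) - (LINT p:QU|\<nu>. fst (h p))"

lemma jets_jet: "h \<in> jets P \<Longrightarrow> is_jet P (\<lambda>p. fst (h p)) (\<lambda>p. snd (h p))" by (simp add: jets_def)

lemma jets_integrable:
  assumes h: "h \<in> jets P"
  shows "set_integrable \<mu> Q\<mu> (\<lambda>p. fst (h p))" "set_integrable \<mu> Q\<mu> (\<lambda>p. snd (h p) \<bullet> X p)" 
    "closed_on U t0 QU \<nu> \<Longrightarrow> set_integrable \<nu> QU (\<lambda>p. fst (h p))" "continuous_on QU (\<lambda>p. fst (h p))"
proof -
  note j = jets_jet[OF h]
  show "set_integrable \<mu> Q\<mu> (\<lambda>p. fst (h p))"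
    using z.I_integrable continuous_on_subset[OF jet_continuous[OF j] Q\<mu>_P] unfolding Q\<mu>_def by blast
  show c: "continuous_on QU (\<lambda>p. fst (h p))" by (rule continuous_on_subset[OF jet_continuous[OF j] Q_P])
  show "closed_on U t0 QU \<nu> \<Longrightarrow> set_integrable \<nu> QU (\<lambda>p. fst (h p))" by (rule integrable_QU[OF _ c])
  have e: "snd (h p) \<bullet> X p = (\<Sum>b\<in>Basis. (X p \<bullet> b) * (snd (h p) \<bullet> b))" for p
    by (subst euclidean_inner) (simp add: mult.commute)
  have "set_integrable \<mu> z.Q0 (\<lambda>p. \<Sum>b\<in>Basis. (X p \<bullet> b) * (snd (h p) \<bullet> b))"
    by (intro z.set_integrable_sum' z.set_integrable_mult_continuous continuous_on_inner continuous_on_const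
        continuous_on_subset[OF jet_gradient_continuous[OF j] z.Q0_P]) (unfold Q\<mu>_def, rule X)
  then show "set_integrable \<mu> Q\<mu> (\<lambda>p. snd (h p) \<bullet> X p)" unfolding e Q\<mu>_def .
qed

text \<open>Continuity for uniform convergence with \<open>(\<nu>, c)\<close> fixed; it extends a
  bound at one jet to a neighbourhood.\<close>

lemma defect_continuous:
  assumes \<nu>: "closed_on U t0 QU \<nu>" and c: "c \<ge> 0"
  obtains C where "C \<ge> 0" "\<And>h h' e. h \<in> jets P \<Longrightarrow> h' \<in> jets P \<Longrightarrow> 0 \<le> e \<Longrightarrow> (\<And>p. p \<in> P \<Longrightarrow> norm (h p - h' p) \<le> e) \<Longrightarrow>
     defect \<nu> c h \<le> defect \<nu> c h' + C * e"
proof -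
  have one: "continuous_on QU (\<lambda>p. 1::real)" by (rule continuous_on_const)
  have i1: "set_integrable \<mu> Q\<mu> (\<lambda>p. 1::real)" using z.I_integrable[of "\<lambda>p. 1"] unfolding Q\<mu>_def by simp
  note i2 = integrable_QU[OF \<nu> one]
  have iX: "set_integrable \<mu> Q\<mu> (\<lambda>p. \<Sum>b\<in>Basis. \<bar>X p \<bullet> b\<bar>)"
    by (rule z.set_integrable_sum'[unfolded Q\<mu>_def]) (intro set_integrable_abs X)
  define k1 where "k1 = (LINT p:Q\<mu>|\<mu>. (\<Sum>b\<in>Basis. \<bar>X p \<bullet> b\<bar>))"
  define k2 where "k2 = (LINT p:Q\<mu>|\<mu>. (1::real))"
  define k3 where "k3 = (LINT p:QU|\<nu>. (1::real))"
  have k: "0 \<le> k1" "0 \<le> k2" "0 \<le> k3" unfolding k1_def k2_def k3_def set_lebesgue_integral_def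
    by (auto intro!: Bochner_Integration.integral_nonneg sum_nonneg)
  show ?thesis
  proof (rule that[of "k1 + c * k2 + k3"])
    show "0 \<le> k1 + c * k2 + k3" using k c by simp
    fix h h' and e :: real assume h: "h \<in> jets P" "h' \<in> jets P" and e: "0 \<le> e" and close: "\<And>p. p \<in> P \<Longrightarrow> norm (h p - h' p) \<le> e"
    have f: "\<bar>fst (h p) - fst (h' p)\<bar> \<le> e" if "p \<in> P" for p
      using norm_fst_le[of "fst (h p - h' p)" "snd (h p - h' p)"] close[OF that] unfolding prod.collapse by simp
    have g: "norm (snd (h p) - snd (h' p)) \<le> e" if "p \<in> P" for p
      using norm_snd_le[of "snd (h p - h' p)" "fst (h p - h' p)"] close[OF that] unfolding prod.collapse by simp
    have "(LINT p:Q\<mu>|\<mu>. snd (h p) \<bullet> X p) - (LINT p:Q\<mu>|\<mu>. snd (h' p) \<bullet> X p) = (LINT p:Q\<mu>|\<mu>. snd (h p) \<bullet> X p - snd (h' p) \<bullet> X p)"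
      by (rule set_integral_diff(2)[symmetric]) (intro jets_integrable h)+
    also have "\<dots> \<le> (LINT p:Q\<mu>|\<mu>. e * (\<Sum>b\<in>Basis. \<bar>X p \<bullet> b\<bar>))"
    proof (rule set_integral_mono)
      show "set_integrable \<mu> Q\<mu> (\<lambda>p. snd (h p) \<bullet> X p - snd (h' p) \<bullet> X p)" by (intro set_integral_diff(1) jets_integrable h)
      show "set_integrable \<mu> Q\<mu> (\<lambda>p. e * (\<Sum>b\<in>Basis. \<bar>X p \<bullet> b\<bar>))" using iX by simp
      fix p assume "p \<in> Q\<mu>"
      then have p: "p \<in> P" using Q\<mu>_P by blast
      have "snd (h p) \<bullet> X p - snd (h' p) \<bullet> X p = (snd (h p) - snd (h' p)) \<bullet> X p" by (simp add: inner_diff_left)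
      also have "\<dots> \<le> norm (snd (h p) - snd (h' p)) * norm (X p)" by (rule norm_cauchy_schwarz)
      also have "\<dots> \<le> e * (\<Sum>b\<in>Basis. \<bar>X p \<bullet> b\<bar>)" by (intro mult_mono g[OF p] norm_le_l1 e norm_ge_zero)
      finally show "snd (h p) \<bullet> X p - snd (h' p) \<bullet> X p \<le> e * (\<Sum>b\<in>Basis. \<bar>X p \<bullet> b\<bar>)" .
    qed
    also have "\<dots> = e * k1" unfolding k1_def by simp
    finally have 1: "(LINT p:Q\<mu>|\<mu>. snd (h p) \<bullet> X p) - (LINT p:Q\<mu>|\<mu>. snd (h' p) \<bullet> X p) \<le> e * k1" .
    have "(LINT p:Q\<mu>|\<mu>. fst (h p)) - (LINT p:Q\<mu>|\<mu>. fst (h' p)) = (LINT p:Q\<mu>|\<mu>. fst (h p) - fst (h' p))"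
      by (rule set_integral_diff(2)[symmetric]) (intro jets_integrable h)+
    also have "\<dots> \<le> (LINT p:Q\<mu>|\<mu>. e * 1)"
    proof (rule set_integral_mono)
      show "set_integrable \<mu> Q\<mu> (\<lambda>p. fst (h p) - fst (h' p))" by (intro set_integral_diff(1) jets_integrable h)
      show "set_integrable \<mu> Q\<mu> (\<lambda>p. e * 1)" by (rule set_integrable_mult_right[OF i1])
      fix p assume "p \<in> Q\<mu>"
      then have p: "p \<in> P" using Q\<mu>_P by blast
      show "fst (h p) - fst (h' p) \<le> e * 1" using abs_le_D1[OF f[OF p]] by simp
    qed
    also have "\<dots> = e * k2" unfolding k2_def by (rule set_integral_mult_right)
    finally have 2: "(LINT p:Q\<mu>|\<mu>. fst (h p)) - (LINT p:Q\<mu>|\<mu>. fst (h' p)) \<le> e * k2" .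
    have "(LINT p:QU|\<nu>. fst (h' p)) - (LINT p:QU|\<nu>. fst (h p)) = (LINT p:QU|\<nu>. fst (h' p) - fst (h p))"
      by (rule set_integral_diff(2)[symmetric]) (intro jets_integrable h \<nu>)+
    also have "\<dots> \<le> (LINT p:QU|\<nu>. e * 1)"
    proof (rule set_integral_mono)
      show "set_integrable \<nu> QU (\<lambda>p. fst (h' p) - fst (h p))" by (intro set_integral_diff(1) jets_integrable h \<nu>)
      show "set_integrable \<nu> QU (\<lambda>p. e * 1)" by (rule set_integrable_mult_right[OF i2])
      fix p assume "p \<in> QU"
      then have p: "p \<in> P" using Q_P by blast
      show "fst (h' p) - fst (h p) \<le> e * 1" using abs_le_D2[OF f[OF p]] by simp
    qed
    also have "\<dots> = e * k3" unfolding k3_def by (rule set_integral_mult_right)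
    finally have 3: "(LINT p:QU|\<nu>. fst (h' p)) - (LINT p:QU|\<nu>. fst (h p)) \<le> e * k3" .
    have "c * (LINT p:Q\<mu>|\<mu>. fst (h p)) - c * (LINT p:Q\<mu>|\<mu>. fst (h' p)) \<le> c * (e * k2)"
      unfolding right_diff_distrib[symmetric] by (rule mult_left_mono[OF 2 c])
    then show "defect \<nu> c h \<le> defect \<nu> c h' + (k1 + c * k2 + k3) * e"
      using 1 3 unfolding defect_def by (simp add: algebra_simps)
  qed
qed

text \<open>If the defect stays above \<open>\<kappa>\<close> on the whole cone, scaling
  \<open>\<nu>\<close> and \<open>c\<close> shows that the function of \<open>h\<close> has
  nonpositive integral against every closed measure and nonnegative integral against
  \<open>\<mu>\<close>. Then \<open>- h\<close> satisfies the dual hypotheses, so its derivative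
  along \<open>X\<close> integrates to 0, and the zero measure with \<open>c = 0\<close> contradicts
  the lower bound.\<close>

lemma defect_pointwise:
  assumes h: "h \<in> jets P" and \<kappa>: "\<kappa> > 0"
  obtains \<nu> c where "closed_on U t0 QU \<nu>" "c \<ge> 0" "defect \<nu> c h < \<kappa>"
proof (rule ccontr)
  note goal = that
  assume no: "\<not> thesis"
  have ge: "\<kappa> \<le> defect \<nu> c h" if "closed_on U t0 QU \<nu>" "c \<ge> 0" for \<nu> c
  proof (rule ccontr)
    assume "\<not> \<kappa> \<le> defect \<nu> c h"
    then show False using no goal[OF that] by simp
  qed
  define \<eta> where "\<eta> = (LINT p:Q\<mu>|\<mu>. snd (h p) \<bullet> X p)"
  define m where "m = (LINT p:Q\<mu>|\<mu>. fst (h p))"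
  note ch = jets_integrable(4)[OF h]
  have scaled: "\<kappa> \<le> \<eta> + c * m - s * (LINT p:QU|\<nu>. fst (h p))" if \<nu>: "closed_on U t0 QU \<nu>" and c: "c \<ge> 0" and s: "s \<ge> 0" for \<nu> c s
  proof -
    \<comment> \<open>The combination with coefficients \<open>s\<close> and 0 is the multiple
      \<open>s \<nu>\<close>.\<close>
    have "closed_on U t0 QU (comb_measure s \<nu> 0 \<nu>)" by (rule closed_on_comb_QU[OF \<nu> \<nu> s order_refl])
    from ge[OF this c] show ?thesis unfolding defect_def \<eta>_def m_def LINT_comb[OF \<nu> \<nu> s order_refl ch] by simp
  qed
  have nonneg: "0 \<le> x" if "\<And>s. s \<ge> 0 \<Longrightarrow> \<kappa> \<le> \<eta> + s * x" for x
  proof (rule ccontr)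
    assume x: "\<not> 0 \<le> x"
    have "0 \<le> \<bar>\<eta>\<bar> / - x" using x by (intro divide_nonneg_nonneg) auto
    from that[OF this] show False using x \<kappa> by (simp add: abs_if split: if_splits)
  qed
  have \<nu>0: "(LINT p:QU|\<nu>. fst (h p)) \<le> 0" if \<nu>: "closed_on U t0 QU \<nu>" for \<nu>
    using nonneg[of "- (LINT p:QU|\<nu>. fst (h p))"] scaled[OF \<nu> order_refl] by simp
  have m0: "0 \<le> m" using nonneg[of m] scaled[OF mu_QU _ order_refl] by simp
  interpret d: jet_dual_measure U t0 r R D S0 P "\<lambda>p. - fst (h p)" "\<lambda>p. - snd (h p)" \<mu>
  proof (rule jet_dual_measureI)
    show "is_jet P (\<lambda>p. - fst (h p)) (\<lambda>p. - snd (h p))" by (rule minus_jet[OF jets_jet[OF h]])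
    show "0 \<le> (LINT p:QU|\<nu>. - fst (h p))" if "closed_on U t0 QU \<nu>" for \<nu>
      using \<nu>0[OF that] by (simp add: set_lebesgue_integral_def)
    show "(LINT p:Q\<mu>|\<mu>. - fst (h p)) \<le> 0" using m0 by (simp add: m_def set_lebesgue_integral_def)
  qed
  have "(LINT p:Q\<mu>|\<mu>. - snd (h p) \<bullet> X p) = 0"
    using d.jet_annihilates[of X] X exact unfolding d.Q0_def by blast
  then have "\<eta> = 0" by (simp add: \<eta>_def set_lebesgue_integral_def)
  then show False using scaled[OF mu_QU order_refl order_refl] \<kappa> by simp
qed

text \<open>Near each jet some pair \<open>(\<nu>, c)\<close> makes the defect at most
  \<open>\<kappa>\<close>; compactness leaves finitely many pairs, and \<open>finite_minimax\<close>
  merges them into one.\<close>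

proposition cone_approximation:
  assumes \<kappa>: "\<kappa> > 0"
  obtains \<nu> c where "closed_on U t0 QU \<nu>" "c \<ge> 0" "\<And>h. h \<in> jets P \<Longrightarrow> \<bar>defect \<nu> c h\<bar> \<le> \<kappa>"
proof -
  \<comment> \<open>Affinity of \<open>defect\<close> in the measure relies on integrability of the
    jet, so the functions are set to 0 off \<open>jets P\<close>; convex combinations are then again
    of this form.\<close>
  define Fam where "Fam = {(\<lambda>h. if h \<in> jets P then defect \<nu> c h - \<kappa> else 0) | \<nu> c. closed_on U t0 QU \<nu> \<and> c \<ge> 0}"
  have FamI: "(\<lambda>h. if h \<in> jets P then defect \<nu> c h - \<kappa> else 0) \<in> Fam" if "closed_on U t0 QU \<nu>" "c \<ge> 0" for \<nu> c
    unfolding Fam_def using that by blast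
  have FamE: "\<exists>\<nu> c. F = (\<lambda>h. if h \<in> jets P then defect \<nu> c h - \<kappa> else 0) \<and> closed_on U t0 QU \<nu> \<and> c \<ge> 0" if "F \<in> Fam" for F
    using that unfolding Fam_def by blast
  have conv: "(\<lambda>h. (1 - t) * F h + t * H h) \<in> Fam"
    if F: "F \<in> Fam" "H \<in> Fam" and t: "0 \<le> t" "t \<le> 1" for F H t
  proof -
    obtain \<nu>1 c1 where 1: "F = (\<lambda>h. if h \<in> jets P then defect \<nu>1 c1 h - \<kappa> else 0)" "closed_on U t0 QU \<nu>1" "c1 \<ge> 0" using FamE[OF F(1)] by blast
    obtain \<nu>2 c2 where 2: "H = (\<lambda>h. if h \<in> jets P then defect \<nu>2 c2 h - \<kappa> else 0)" "closed_on U t0 QU \<nu>2" "c2 \<ge> 0" using FamE[OF F(2)] by blast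
    let ?\<nu> = "comb_measure (1 - t) \<nu>1 t \<nu>2" and ?c = "(1 - t) * c1 + t * c2"
    have t': "0 \<le> 1 - t" using t by simp
    have \<nu>: "closed_on U t0 QU ?\<nu>" by (rule closed_on_comb_QU[OF 1(2) 2(2) t' t(1)])
    have c: "?c \<ge> 0" using t 1 2 by simp
    have "defect ?\<nu> ?c h = (1 - t) * defect \<nu>1 c1 h + t * defect \<nu>2 c2 h" if "h \<in> jets P" for h
      unfolding defect_def LINT_comb[OF 1(2) 2(2) t' t(1) jets_integrable(4)[OF that]] by (simp add: algebra_simps)
    then have "(\<lambda>h. (1 - t) * F h + t * H h) = (\<lambda>h. if h \<in> jets P then defect ?\<nu> ?c h - \<kappa> else 0)"
      unfolding 1(1) 2(1) by (auto simp: fun_eq_iff algebra_simps)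
    then show ?thesis using FamI[OF \<nu> c] by (simp only:)
  qed
  have mix: "mixable Fam (jets P)" unfolding mixable_def
  proof (intro ballI)
    fix i j and t :: real assume ij: "i \<in> jets P" "j \<in> jets P" and t: "t \<in> {0..1}"
    let ?k = "\<lambda>p. (1 - t) *\<^sub>R i p + t *\<^sub>R j p"
    have k: "?k \<in> jets P" by (rule jets_mix[OF ij]) (use t in auto)
    have lin: "(LINT p:A|M. (1 - t) * f p + t * g p) = (1 - t) * (LINT p:A|M. f p) + t * (LINT p:A|M. g p)"
      if "set_integrable M A f" "set_integrable M A g" for A f g and M :: "('a \<times> 'a \<times> real) measure"
      using set_integral_add(2)[OF set_integrable_mult_right[of "1 - t", OF that(1)] set_integrable_mult_right[of t, OF that(2)]] by simp
    have "defect \<nu> c ?k = (1 - t) * defect \<nu> c i + t * defect \<nu> c j" if \<nu>: "closed_on U t0 QU \<nu>" for \<nu> c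
    proof -
      have a: "(LINT p:Q\<mu>|\<mu>. snd (?k p) \<bullet> X p) = (1 - t) * (LINT p:Q\<mu>|\<mu>. snd (i p) \<bullet> X p) + t * (LINT p:Q\<mu>|\<mu>. snd (j p) \<bullet> X p)"
        using lin[OF jets_integrable(2)[OF ij(1)] jets_integrable(2)[OF ij(2)]] by (simp add: inner_add_left)
      have b: "(LINT p:Q\<mu>|\<mu>. fst (?k p)) = (1 - t) * (LINT p:Q\<mu>|\<mu>. fst (i p)) + t * (LINT p:Q\<mu>|\<mu>. fst (j p))"
        using lin[OF jets_integrable(1)[OF ij(1)] jets_integrable(1)[OF ij(2)]] by simp
      have c: "(LINT p:QU|\<nu>. fst (?k p)) = (1 - t) * (LINT p:QU|\<nu>. fst (i p)) + t * (LINT p:QU|\<nu>. fst (j p))"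
        using lin[OF jets_integrable(3)[OF ij(1) \<nu>] jets_integrable(3)[OF ij(2) \<nu>]] by simp
      show ?thesis unfolding defect_def a b c by (simp add: algebra_simps)
    qed
    then have "F ?k = (1 - t) * F i + t * F j" if "F \<in> Fam" for F
      using FamE[OF that] k ij by (auto simp: algebra_simps)
    then show "\<exists>k\<in>jets P. \<forall>F\<in>Fam. F k = (1 - t) * F i + t * F j" using k by blast
  qed
  have "\<exists>FN. fst FN \<in> Fam \<and> open (snd FN) \<and> h \<in> snd FN \<and> (\<forall>h'\<in>jets P \<inter> snd FN. fst FN h' \<le> 0)" if h: "h \<in> jets P" for h
  proof -
    obtain \<nu> c where \<nu>: "closed_on U t0 QU \<nu>" "c \<ge> 0" "defect \<nu> c h < \<kappa>" by (rule defect_pointwise[OF h \<kappa>])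
    obtain C where C: "C \<ge> 0" "\<And>h h' e. h \<in> jets P \<Longrightarrow> h' \<in> jets P \<Longrightarrow> 0 \<le> e \<Longrightarrow> (\<And>p. p \<in> P \<Longrightarrow> norm (h p - h' p) \<le> e) \<Longrightarrow>
       defect \<nu> c h \<le> defect \<nu> c h' + C * e" using defect_continuous[OF \<nu>(1,2)] by blast
    define e where "e = (\<kappa> - defect \<nu> c h) / (C + 1)"
    have e: "e > 0" using \<nu>(3) C by (simp add: e_def)
    obtain N where N: "open N" "h \<in> N" "\<And>h' p. h' \<in> jets P \<inter> N \<Longrightarrow> p \<in> P \<Longrightarrow> norm (h' p - h p) \<le> e"
      using jets_uniform_neighbourhood[OF P h e] by blast
    have "defect \<nu> c h' \<le> \<kappa>" if h': "h' \<in> jets P \<inter> N" for h'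
    proof -
      have "defect \<nu> c h' \<le> defect \<nu> c h + C * e" using C(2)[of h' h e] h' h e N(3)[OF h'] by simp
      also have "C * e \<le> (C + 1) * e" using e by simp
      also have "(C + 1) * e = \<kappa> - defect \<nu> c h" using C by (simp add: e_def)
      finally show ?thesis by simp
    qed
    then show ?thesis using FamI[OF \<nu>(1,2)] N(1,2)
      by (intro exI[of _ "((\<lambda>h. if h \<in> jets P then defect \<nu> c h - \<kappa> else 0), N)"]) auto
  qed
  then have "\<forall>h\<in>jets P. \<exists>FN. fst FN \<in> Fam \<and> open (snd FN) \<and> h \<in> snd FN \<and> (\<forall>h'\<in>jets P \<inter> snd FN. fst FN h' \<le> 0)" by blast
  from bchoice[OF this] obtain FN where FN: "\<forall>h\<in>jets P. fst (FN h) \<in> Fam \<and> open (snd (FN h)) \<and> h \<in> snd (FN h) \<and> (\<forall>h'\<in>jets P \<inter> snd (FN h). fst (FN h) h' \<le> 0)" by blast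
  obtain C' where C': "C' \<subseteq> jets P" "finite C'" "jets P \<subseteq> (\<Union>h\<in>C'. snd (FN h))"
    by (rule compactE_image[OF compact_jets, of "jets P" "\<lambda>h. snd (FN h)" P]) (use FN in blast)+
  have zj: "(\<lambda>p. 0) \<in> jets P" using zero_jet by (simp add: jets_def)
  have "\<exists>H\<in>Fam. \<forall>j\<in>jets P. H j \<le> 0"
  proof (rule finite_minimax[OF conv _ _ _ mix])
    show "finite ((\<lambda>h. fst (FN h)) ` C')" using C' by blast
    show "(\<lambda>h. fst (FN h)) ` C' \<noteq> {}" using C' zj by blast
    show "(\<lambda>h. fst (FN h)) ` C' \<subseteq> Fam" using C' FN by blast
    show "\<exists>F\<in>(\<lambda>h. fst (FN h)) ` C'. F h \<le> 0" if hJ: "h \<in> jets P" for h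
    proof -
      have "h \<in> (\<Union>h\<in>C'. snd (FN h))" using C'(3) hJ by (rule subsetD)
      then obtain h' where "h' \<in> C'" "h \<in> snd (FN h')" by blast
      then show ?thesis using C'(1) FN hJ by blast
    qed
  qed
  then obtain H where H: "H \<in> Fam" "\<forall>j\<in>jets P. H j \<le> 0" by blast
  from FamE[OF H(1)] obtain \<nu> c where \<nu>: "H = (\<lambda>h. if h \<in> jets P then defect \<nu> c h - \<kappa> else 0)" "closed_on U t0 QU \<nu>" "c \<ge> 0" by blast
  have le: "defect \<nu> c h \<le> \<kappa>" if "h \<in> jets P" for h using bspec[OF H(2) that] that unfolding \<nu>(1) by simp
  \<comment> \<open>\<open>- h\<close> is a jet too, which makes the one-sided bound
    two-sided.\<close>
  have "\<bar>defect \<nu> c h\<bar> \<le> \<kappa>" if h: "h \<in> jets P" for h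
  proof -
    have "defect \<nu> c (\<lambda>p. - h p) = - defect \<nu> c h"
      by (simp add: defect_def set_lebesgue_integral_def)
    then show ?thesis using le[OF h] le[OF jets_uminus[OF h]] by linarith
  qed
  then show ?thesis using that[OF \<nu>(2,3)] by blast
qed

end

section \<open>Test functions as multiples of jets\<close>

lemma concentrated_set_integral:
  fixes h :: "'p::euclidean_space \<Rightarrow> real"
  assumes \<nu>: "concentrated_on Q \<nu>" and Q: "closed Q" "Q \<subseteq> A" and h: "(\<lambda>p. indicator A p *\<^sub>R h p) \<in> borel_measurable \<nu>"
  shows "(LINT p:A|\<nu>. h p) = (LINT p:Q|\<nu>. h p)"
  unfolding set_lebesgue_integral_def
proof (rule integral_cong_AE[OF h])
  have e: "(\<lambda>p. indicator Q p *\<^sub>R h p) = (\<lambda>p. indicator Q p * (indicator A p *\<^sub>R h p))"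
    using Q(2) by (auto simp: indicator_def fun_eq_iff)
  have "Q \<in> sets \<nu>" using \<nu> Q(1) by (simp add: concentrated_on_def)
  then show "(\<lambda>p. indicator Q p *\<^sub>R h p) \<in> borel_measurable \<nu>" unfolding e
    by (intro borel_measurable_times borel_measurable_indicator h)
  show "AE p in \<nu>. indicator A p *\<^sub>R h p = indicator Q p *\<^sub>R h p"
    using concentrated_on_AE[OF \<nu> Q(1)] by eventually_elim (use Q(2) in \<open>auto simp: indicator_def\<close>)
qed

lemma smooth_imp_continuous_on: "\<phi> \<in> smooth A \<Longrightarrow> continuous_on A (iter_deriv A ws \<phi>)"
  by (auto simp: smooth_def intro: differentiable_imp_continuous_on)

text \<open>Continuity of the next derivatives bounds them on the compact set, and convexity turns
  the bound into a Lipschitz estimate.\<close>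

lemma smooth_deriv_Lipschitz:
  fixes \<phi> :: "'b::euclidean_space \<Rightarrow> real"
  assumes \<phi>: "\<phi> \<in> smooth A" and P: "compact P" "convex P" "P \<subseteq> A"
  obtains c where "c \<ge> 0" "\<And>p u. p \<in> P \<Longrightarrow> \<bar>frechet_derivative (iter_deriv A ws \<phi>) (at p within A) u\<bar> \<le> c * norm u"
    "\<And>p q. p \<in> P \<Longrightarrow> q \<in> P \<Longrightarrow> \<bar>iter_deriv A ws \<phi> p - iter_deriv A ws \<phi> q\<bar> \<le> c * norm (p - q)"
proof -
  let ?f = "iter_deriv A ws \<phi>"
  let ?D = "\<lambda>p. frechet_derivative ?f (at p within A)"
  have d: "(?f has_derivative ?D p) (at p within A)" if "p \<in> A" for p
    using \<phi> that by (auto simp: smooth_def differentiable_on_def frechet_derivative_works)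
  have "bounded (iter_deriv A (b # ws) \<phi> ` P)" for b
    by (intro compact_imp_bounded compact_continuous_image continuous_on_subset[OF smooth_imp_continuous_on[OF \<phi>] P(3)] P(1))
  then have "\<forall>b. \<exists>c. \<forall>p\<in>P. \<bar>?D p b\<bar> \<le> c"
    unfolding bounded_iff by simp
  from choice[OF this] obtain cc where cc: "\<And>b p. p \<in> P \<Longrightarrow> \<bar>?D p b\<bar> \<le> cc b" by blast
  define m where "m = (\<Sum>b\<in>(Basis::'b set). \<bar>cc b\<bar>)"
  have m: "\<bar>?D p b\<bar> \<le> m" if "p \<in> P" "b \<in> Basis" for p b
  proof -
    have "\<bar>?D p b\<bar> \<le> \<bar>cc b\<bar>" using cc[OF that(1), of b] by linarith
    also have "\<dots> \<le> m" unfolding m_def by (rule member_le_sum) (use that in auto)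
    finally show ?thesis .
  qed
  have b: "\<bar>?D p u\<bar> \<le> (DIM('b) * m) * norm u" if "p \<in> P" for p u
    by (rule linear_bound_Basis[OF has_derivative_linear[OF d] m[OF that]]) (use that P(3) in auto)
  show ?thesis
  proof (rule that[of "DIM('b) * m"])
    show "0 \<le> DIM('b) * m" by (simp add: m_def sum_nonneg)
    show "\<bar>?D p u\<bar> \<le> DIM('b) * m * norm u" if "p \<in> P" for p u by (rule b[OF that])
    fix p q assume pq: "p \<in> P" "q \<in> P"
    have "norm (?f p - ?f q) \<le> (DIM('b) * m) * norm (p - q)"
    proof (rule differentiable_bound[OF P(2) _ _ pq])
      show "(?f has_derivative ?D x) (at x within P)" if "x \<in> P" for x
        by (rule has_derivative_subset[OF d P(3)]) (use that P(3) in auto)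
      show "onorm (?D x) \<le> DIM('b) * m" if "x \<in> P" for x
        by (rule onorm_le) (use b[OF that] in simp)
    qed
    then show "\<bar>?f p - ?f q\<bar> \<le> DIM('b) * m * norm (p - q)" by simp
  qed
qed

definition grad :: "'b::euclidean_space set \<Rightarrow> ('b \<Rightarrow> real) \<Rightarrow> 'b \<Rightarrow> 'b" where
  "grad A \<phi> p = (\<Sum>b\<in>Basis. frechet_derivative \<phi> (at p within A) b *\<^sub>R b)"

lemma grad_inner:
  assumes "\<phi> \<in> smooth A" "p \<in> A" shows "grad A \<phi> p \<bullet> u = frechet_derivative \<phi> (at p within A) u"
proof -
  let ?D = "frechet_derivative \<phi> (at p within A)"
  have "?D u = (\<Sum>b\<in>Basis. (u \<bullet> b) * ?D b)"
    by (rule linear_basis_expansion[OF has_derivative_linear[OF smooth_has_derivative[OF assms]]])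
  then show ?thesis unfolding grad_def inner_sum_left inner_scaleR_left by (simp add: inner_commute mult.commute)
qed

text \<open>On a compact convex set a smooth function satisfies all jet inequalities up to one
  constant, whose inverse is \<open>k\<close>. The uniform bound for jets thus reaches every test
  function, at a rate depending on it only through \<open>k\<close>.\<close>

lemma smooth_scaled_jet:
  fixes \<phi> :: "'b::euclidean_space \<Rightarrow> real"
  assumes \<phi>: "\<phi> \<in> smooth A" and P: "compact P" "convex P" "P \<subseteq> A"
  obtains k where "k > 0" "is_jet P (\<lambda>p. k * \<phi> p) (\<lambda>p. k *\<^sub>R grad A \<phi> p)"
proof -
  let ?D = "\<lambda>p. frechet_derivative \<phi> (at p within A)"
  let ?n = "real DIM('b)"
  have d: "(\<phi> has_derivative ?D p) (at p within A)" if "p \<in> A" for p by (rule smooth_has_derivative[OF \<phi> that])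
  have "bounded (\<phi> ` P)" 
    using compact_imp_bounded[OF compact_continuous_image[OF continuous_on_subset[OF smooth_imp_continuous_on[OF \<phi>, of "[]"] P(3)] P(1)]] by simp
  then obtain c0 where c0: "\<And>p. p \<in> P \<Longrightarrow> \<bar>\<phi> p\<bar> \<le> c0" unfolding bounded_iff by auto
  obtain c1 where c1: "c1 \<ge> 0" "\<And>p u. p \<in> P \<Longrightarrow> \<bar>?D p u\<bar> \<le> c1 * norm u"
    "\<And>p q. p \<in> P \<Longrightarrow> q \<in> P \<Longrightarrow> \<bar>\<phi> p - \<phi> q\<bar> \<le> c1 * norm (p - q)"
    by (rule smooth_deriv_Lipschitz[OF \<phi> P, of "[]", unfolded iter_deriv.simps]) blast
  have "\<exists>c. 0 \<le> c \<and> (\<forall>p\<in>P. \<forall>q\<in>P. \<bar>?D p b - ?D q b\<bar> \<le> c * norm (p - q))" for b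
  proof (rule smooth_deriv_Lipschitz[OF \<phi> P, of "[b]", unfolded iter_deriv.simps])
    fix c :: real assume "0 \<le> c" "\<And>p q. p \<in> P \<Longrightarrow> q \<in> P \<Longrightarrow> \<bar>?D p b - ?D q b\<bar> \<le> c * norm (p - q)"
    then show ?thesis by blast
  qed
  then have "\<forall>b. \<exists>c. 0 \<le> c \<and> (\<forall>p\<in>P. \<forall>q\<in>P. \<bar>?D p b - ?D q b\<bar> \<le> c * norm (p - q))" by blast
  from choice[OF this] obtain cc where "\<forall>b. 0 \<le> cc b \<and> (\<forall>p\<in>P. \<forall>q\<in>P. \<bar>?D p b - ?D q b\<bar> \<le> cc b * norm (p - q))" by blast
  then have cc: "\<And>b. 0 \<le> cc b" "\<And>b p q. p \<in> P \<Longrightarrow> q \<in> P \<Longrightarrow> \<bar>?D p b - ?D q b\<bar> \<le> cc b * norm (p - q)" by blast+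
  define m where "m = (\<Sum>b\<in>(Basis::'b set). cc b)"
  have m0: "m \<ge> 0" unfolding m_def by (intro sum_nonneg cc)
  have grad_lip: "norm (grad A \<phi> p - grad A \<phi> q) \<le> m * norm (p - q)" if "p \<in> P" "q \<in> P" for p q
  proof -
    have "grad A \<phi> p - grad A \<phi> q = (\<Sum>b\<in>Basis. (?D p b - ?D q b) *\<^sub>R b)"
      by (simp add: grad_def sum_subtractf scaleR_diff_left)
    also have "norm \<dots> \<le> (\<Sum>b\<in>(Basis::'b set). cc b * norm (p - q))"
      by (rule order_trans[OF norm_sum sum_mono]) (use cc(2)[OF that] in simp)
    finally show ?thesis by (simp add: m_def sum_distrib_right)
  qed
  have grad_b: "norm (?D p b *\<^sub>R b) \<le> c1" if "p \<in> P" "b \<in> Basis" for p b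
    using c1(2)[OF that(1), of b] that(2) by simp
  have grad_le: "norm (grad A \<phi> p) \<le> ?n * c1" if "p \<in> P" for p
  proof -
    have "norm (grad A \<phi> p) \<le> (\<Sum>b\<in>(Basis::'b set). c1)"
      unfolding grad_def by (rule order_trans[OF norm_sum sum_mono]) (use grad_b[OF that] in auto)
    then show ?thesis by simp
  qed
  have taylor: "\<bar>\<phi> q - \<phi> p - grad A \<phi> p \<bullet> (q - p)\<bar> \<le> m * (norm (q - p))\<^sup>2" if p: "p \<in> P" and q: "q \<in> P" for p q
  proof -
    let ?S = "closed_segment p q"
    have SP: "?S \<subseteq> P" by (rule closed_segment_subset[OF p q P(2)])
    have SA: "?S \<subseteq> A" using SP P(3) by blast
    have "norm (\<phi> q - \<phi> p - ?D p (q - p)) \<le> norm (q - p) * (m * norm (q - p))"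
    proof (rule differentiable_bound_linearization[of p q ?S \<phi> ?D])
      show "p + t *\<^sub>R (q - p) \<in> ?S" if "t \<in> {0..1}" for t
        using that by (auto simp: in_segment algebra_simps intro!: exI[of _ t])
      show "(\<phi> has_derivative ?D x) (at x within ?S)" if "x \<in> ?S" for x
        by (rule has_derivative_subset[OF d SA]) (use that SA in auto)
      show "onorm (?D x - ?D p) \<le> m * norm (q - p)" if x: "x \<in> ?S" for x
      proof (rule onorm_le)
        fix u
        have xP: "x \<in> P" "x \<in> A" "p \<in> A" using x SP SA p P(3) by auto
        have "(?D x - ?D p) u = (grad A \<phi> x - grad A \<phi> p) \<bullet> u"
          by (simp add: inner_diff_left grad_inner[OF \<phi>] xP)
        also have "norm \<dots> \<le> norm (grad A \<phi> x - grad A \<phi> p) * norm u" by (simp add: Cauchy_Schwarz_ineq2)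
        also have "\<dots> \<le> (m * norm (x - p)) * norm u" by (intro mult_right_mono grad_lip xP p) auto
        also have "\<dots> \<le> (m * norm (q - p)) * norm u"
          using segment_bound(1)[OF x] m0 by (intro mult_right_mono mult_left_mono) auto
        finally show "norm ((?D x - ?D p) u) \<le> m * norm (q - p) * norm u" .
      qed
    qed auto
    moreover have "grad A \<phi> p \<bullet> (q - p) = ?D p (q - p)" by (rule grad_inner[OF \<phi>]) (use p P(3) in auto)
    ultimately show ?thesis by (simp add: power2_eq_square mult_ac)
  qed
  \<comment> \<open>The sum dominates the constants of the five jet inequalities; the final 1 keeps
    it positive.\<close>
  define c where "c = \<bar>c0\<bar> + c1 + ?n * c1 + m + 1"
  have nc: "?n * c1 \<ge> 0" using c1 by simp
  have c: "c > 0" "\<bar>c0\<bar> \<le> c" "c1 \<le> c" "?n * c1 \<le> c" "m \<le> c" using c1(1) m0 nc unfolding c_def by linarith+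
  let ?k = "inverse c"
  have scale: "?k * x \<le> y" if "x \<le> c' * y" "c' \<le> c" "0 \<le> y" for x y c'
  proof -
    have "x \<le> c * y" using that mult_right_mono[OF that(2,3)] by linarith
    then show ?thesis using c(1) by (simp add: inverse_eq_divide divide_le_eq mult.commute)
  qed
  show ?thesis
  proof (rule that[of ?k])
    show "?k > 0" using c by simp
    have k0: "\<bar>?k\<bar> = ?k" using c by simp
    show "is_jet P (\<lambda>p. ?k * \<phi> p) (\<lambda>p. ?k *\<^sub>R grad A \<phi> p)"
      unfolding is_jet_def
    proof (intro ballI conjI)
      fix p assume p: "p \<in> P"
      show "\<bar>?k * \<phi> p\<bar> \<le> 1" unfolding abs_mult k0 by (rule scale[OF _ c(2)]) (use c0[OF p] in auto)
      show "norm (?k *\<^sub>R grad A \<phi> p) \<le> 1" unfolding norm_scaleR k0 by (rule scale[OF _ c(4)]) (use grad_le[OF p] in auto)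
      fix q assume q: "q \<in> P"
      have "\<bar>?k * \<phi> p - ?k * \<phi> q\<bar> = ?k * \<bar>\<phi> p - \<phi> q\<bar>" unfolding right_diff_distrib[symmetric] abs_mult k0 ..
      then show "\<bar>?k * \<phi> p - ?k * \<phi> q\<bar> \<le> norm (p - q)" using scale[OF c1(3)[OF p q] c(3)] by simp
      have "norm (?k *\<^sub>R grad A \<phi> p - ?k *\<^sub>R grad A \<phi> q) = ?k * norm (grad A \<phi> p - grad A \<phi> q)"
        unfolding scaleR_diff_right[symmetric] norm_scaleR k0 ..
      then show "norm (?k *\<^sub>R grad A \<phi> p - ?k *\<^sub>R grad A \<phi> q) \<le> norm (p - q)" using scale[OF grad_lip[OF p q] c(5)] by simp
      have "?k * \<phi> q - ?k * \<phi> p - (?k *\<^sub>R grad A \<phi> p) \<bullet> (q - p) = ?k * (\<phi> q - \<phi> p - grad A \<phi> p \<bullet> (q - p))"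
        by (simp add: right_diff_distrib)
      then have "\<bar>?k * \<phi> q - ?k * \<phi> p - (?k *\<^sub>R grad A \<phi> p) \<bullet> (q - p)\<bar> = ?k * \<bar>\<phi> q - \<phi> p - grad A \<phi> p \<bullet> (q - p)\<bar>"
        by (simp only: abs_mult k0)
      then show "\<bar>?k * \<phi> q - ?k * \<phi> p - (?k *\<^sub>R grad A \<phi> p) \<bullet> (q - p)\<bar> \<le> (norm (q - p))\<^sup>2"
        using scale[OF taylor[OF p q] c(5)] by simp
    qed
  qed
qed

context deformation_setup
begin

text \<open>Letting the approximation index grow as slowly as needed while \<open>s\<close> tends to \<open>0\<close> keeps
  \<open>1 - s c\<^sub>n\<close> nonnegative.\<close>

lemma deformation_exists:
  assumes P_conv: "convex P" and P_TI: "P \<subseteq> TI UNIV t0"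
    and \<eta>: "\<And>\<phi>. \<phi> \<in> smooth (TI UNIV t0) \<Longrightarrow> \<eta> \<phi> = (LINT p:Q\<mu>|\<mu>. grad (TI UNIV t0) \<phi> p \<bullet> X p)"
  shows "can_be_deformed U t0 \<mu> \<eta>"
proof -
  have "\<exists>nc. closed_on U t0 QU (fst nc) \<and> snd nc \<ge> 0 \<and> (\<forall>h\<in>jets P. \<bar>defect (fst nc) (snd nc) h\<bar> \<le> inverse (real (Suc n)))" for n
  proof -
    have "0 < inverse (real (Suc n))" by simp
    then obtain \<nu> c where "closed_on U t0 QU \<nu>" "c \<ge> 0" "\<And>h. h \<in> jets P \<Longrightarrow> \<bar>defect \<nu> c h\<bar> \<le> inverse (real (Suc n))"
      using cone_approximation by blast
    then show ?thesis by (intro exI[of _ "(\<nu>, c)"]) simp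
  qed
  then obtain nc where nc: "\<And>n. closed_on U t0 QU (fst (nc n))" "\<And>n. snd (nc n) \<ge> 0" 
    "\<And>n h. h \<in> jets P \<Longrightarrow> \<bar>defect (fst (nc n)) (snd (nc n)) h\<bar> \<le> inverse (real (Suc n))" by metis
  define \<nu> where "\<nu> n = fst (nc n)" for n
  define c where "c n = snd (nc n)" for n
  note nc = nc[folded \<nu>_def c_def]
  \<comment> \<open>The indices usable at parameter \<open>s\<close>: \<open>n * s \<le> 1\<close>
    makes the set finite for \<open>s > 0\<close>, so that a largest index exists, and
    \<open>s * c n \<le> 1\<close> keeps the weight of \<open>\<mu>\<close> nonnegative. Each fixed
    index is usable once \<open>s\<close> is small.\<close>
  define A where "A s = {n. real n * s \<le> 1 \<and> s * c n \<le> 1}" for s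
  have finA: "finite (A s)" if "s > 0" for s
  proof (rule finite_subset)
    show "A s \<subseteq> {..nat \<lceil>1 / s\<rceil>}"
    proof
      fix n assume "n \<in> A s"
      then have "real n \<le> 1 / s" using that by (simp add: A_def le_divide_eq)
      then show "n \<in> {..nat \<lceil>1 / s\<rceil>}" by (simp add: le_nat_iff) linarith
    qed
  qed simp
  \<comment> \<open>The family stays at \<open>\<mu>\<close> for \<open>s = 0\<close> and wherever
    no index is usable; the latter does not happen for small positive \<open>s\<close>.\<close>
  define m where "m s = (if 0 < s \<and> A s \<noteq> {} then comb_measure (1 - s * c (Max (A s))) \<mu> s (\<nu> (Max (A s))) else \<mu>)" for s
  have m_closed: "closed_on U t0 QU (m s)" for s
  proof (cases "0 < s \<and> A s \<noteq> {}")
    case True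
    then have "Max (A s) \<in> A s" using finA by simp
    then have "0 \<le> 1 - s * c (Max (A s))" by (simp add: A_def)
    then show ?thesis unfolding m_def using True by (simp add: closed_on_comb_QU mu_QU nc(1))
  next
    case False
    show ?thesis unfolding m_def if_not_P[OF False] by (rule mu_QU)
  qed
  have "((\<lambda>s. LINT p:TI UNIV t0|m s. \<phi> p) has_real_derivative \<eta> \<phi>) (at_right 0)" if \<phi>: "\<phi> \<in> smooth (TI UNIV t0)" for \<phi>
  proof -
    let ?T = "TI UNIV t0 :: ('a \<times> 'a \<times> real) set"
    have TB: "?T \<in> sets borel" by (rule TI_borel[OF open_UNIV])
    have c\<phi>: "continuous_on ?T \<phi>" using smooth_imp_continuous_on[OF \<phi>, of "[]"] by simp
    have QT: "QU \<subseteq> ?T" using Q_P P_TI by blast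
    have int: "(LINT p:?T|\<rho>. \<phi> p) = (LINT p:QU|\<rho>. \<phi> p)" if "closed_on U t0 QU \<rho>" for \<rho>
    proof (rule concentrated_set_integral[OF _ compact_imp_closed[OF compact_QU] QT])
      show con: "concentrated_on QU \<rho>" using that by (simp add: closed_on_def)
      show "(\<lambda>p. indicator ?T p *\<^sub>R \<phi> p) \<in> borel_measurable \<rho>"
        using concentrated_on_integrable[OF con compact_QU QT TB c\<phi>] unfolding set_integrable_def by (rule borel_measurable_integrable)
    qed
    have cQ: "continuous_on QU \<phi>" by (rule continuous_on_subset[OF c\<phi> QT])
    obtain k where k: "k > 0" and jet: "is_jet P (\<lambda>p. k * \<phi> p) (\<lambda>p. k *\<^sub>R grad ?T \<phi> p)"
      by (rule smooth_scaled_jet[OF \<phi> P P_conv P_TI])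
    define h where "h p = (if p \<in> P then (k * \<phi> p, k *\<^sub>R grad ?T \<phi> p) else 0)" for p
    have h: "h \<in> jets P" using jet by (simp add: jets_def is_jet_def h_def)
    define I0 where "I0 = (LINT p:QU|\<mu>. \<phi> p)"
    have "Q\<mu> \<subseteq> QU" using R r by auto
    have \<mu>c: "concentrated_on Q\<mu> \<mu>" using mu by (simp add: closed_on_def)
    have Q\<mu>c: "closed Q\<mu>" by (intro compact_imp_closed compact_Times S0 compact_cball compact_Icc)
    have I0_eq: "I0 = (LINT p:Q\<mu>|\<mu>. \<phi> p)" unfolding I0_def
    proof (rule concentrated_set_integral[OF \<mu>c Q\<mu>c \<open>Q\<mu> \<subseteq> QU\<close>])
      show "(\<lambda>p. indicator QU p *\<^sub>R \<phi> p) \<in> borel_measurable \<mu>"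
        using integrable_QU[OF mu_QU cQ] unfolding set_integrable_def by (rule borel_measurable_integrable)
    qed
    have Q\<mu>B: "Q\<mu> \<in> sets \<mu>" using \<mu>c Q\<mu>c by (simp add: concentrated_on_def)
    have Q\<mu>P: "Q\<mu> \<subseteq> P" by (rule Q\<mu>_P)
    have "defect (\<nu> n) (c n) h = k * (\<eta> \<phi> + c n * I0 - (LINT p:QU|\<nu> n. \<phi> p))" for n
    proof -
      have 1: "(LINT p:Q\<mu>|\<mu>. snd (h p) \<bullet> X p) = k * \<eta> \<phi>"
      proof -
        have "(LINT p:Q\<mu>|\<mu>. snd (h p) \<bullet> X p) = (LINT p:Q\<mu>|\<mu>. k * (grad ?T \<phi> p \<bullet> X p))"
          by (rule set_lebesgue_integral_cong[OF Q\<mu>B]) (use Q\<mu>P in \<open>auto simp: h_def subset_iff\<close>)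
        then show ?thesis unfolding \<eta>[OF \<phi>] by simp
      qed
      have 2: "(LINT p:Q\<mu>|\<mu>. fst (h p)) = k * I0"
      proof -
        have "(LINT p:Q\<mu>|\<mu>. fst (h p)) = (LINT p:Q\<mu>|\<mu>. k * \<phi> p)"
          by (rule set_lebesgue_integral_cong[OF Q\<mu>B]) (use Q\<mu>P in \<open>auto simp: h_def subset_iff\<close>)
        then show ?thesis unfolding I0_eq by simp
      qed
      have 3: "(LINT p:QU|\<nu> n. fst (h p)) = k * (LINT p:QU|\<nu> n. \<phi> p)"
      proof -
        have "(LINT p:QU|\<nu> n. fst (h p)) = (LINT p:QU|\<nu> n. k * \<phi> p)"
          by (rule set_lebesgue_integral_cong) (use Q_P QU_borel sets_closed_on[OF nc(1)] in \<open>auto simp: h_def subset_iff\<close>)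
        then show ?thesis by simp
      qed
      show ?thesis unfolding defect_def 1 2 3 by (simp add: algebra_simps)
    qed
    then have *: "k * \<bar>\<eta> \<phi> + c n * I0 - (LINT p:QU|\<nu> n. \<phi> p)\<bar> \<le> inverse (real (Suc n))" for n
      using nc(3)[OF h, of n] k by (simp add: abs_mult)
    have approx: "\<bar>(LINT p:QU|\<nu> n. \<phi> p) - c n * I0 - \<eta> \<phi>\<bar> \<le> inverse (real (Suc n)) / k" for n
    proof -
      have "\<bar>(LINT p:QU|\<nu> n. \<phi> p) - c n * I0 - \<eta> \<phi>\<bar> = \<bar>\<eta> \<phi> + c n * I0 - (LINT p:QU|\<nu> n. \<phi> p)\<bar>" by linarith
      then show ?thesis using *[of n] k by (simp only: pos_le_divide_eq mult.commute)
    qed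
    \<comment> \<open>Since \<open>m s\<close> differs from \<open>\<mu>\<close> by
      \<open>s (\<nu> - c \<mu>)\<close> for the largest usable index, the difference quotient is
      exactly the approximating functional; no limit of measures is taken.\<close>
    have quot: "((LINT p:?T|m s. \<phi> p) - (LINT p:?T|m 0. \<phi> p)) / (s - 0) = (LINT p:QU|\<nu> (Max (A s)). \<phi> p) - c (Max (A s)) * I0"
      if s: "0 < s" "A s \<noteq> {}" for s
    proof -
      let ?n = "Max (A s)"
      have "?n \<in> A s" using finA s by simp
      then have n: "0 \<le> 1 - s * c ?n" by (simp add: A_def)
      have "(LINT p:?T|m s. \<phi> p) = (1 - s * c ?n) * I0 + s * (LINT p:QU|\<nu> ?n. \<phi> p)"
        unfolding int[OF m_closed] using s LINT_comb[OF mu_QU nc(1) n less_imp_le[OF s(1)] cQ] by (simp add: m_def I0_def)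
      moreover have "(LINT p:?T|m 0. \<phi> p) = I0" unfolding int[OF m_closed] by (simp add: m_def I0_def)
      ultimately have "(LINT p:?T|m s. \<phi> p) - (LINT p:?T|m 0. \<phi> p) = s * ((LINT p:QU|\<nu> ?n. \<phi> p) - c ?n * I0)"
        by (simp add: algebra_simps)
      then show ?thesis using s by simp
    qed
    show ?thesis unfolding has_field_derivative_iff
    proof (rule tendstoI)
      fix e :: real assume e: "e > 0"
      obtain n0 where n0: "inverse (real (Suc n0)) < e * k" using reals_Archimedean[of "e * k"] e k by auto
      \<comment> \<open>Below \<open>s0\<close> the index \<open>n0\<close> is usable, so the
        largest usable index is at least \<open>n0\<close>, and the error bound decreases with the
        index.\<close>
      define s0 where "s0 = min (inverse (real (Suc n0))) (inverse (c n0 + 1))"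
      have s0: "s0 > 0" using nc(2)[of n0] by (simp add: s0_def)
      have "dist (((LINT p:?T|m s. \<phi> p) - (LINT p:?T|m 0. \<phi> p)) / (s - 0)) (\<eta> \<phi>) < e" if s: "0 < s" "s < s0" for s
      proof -
        have "real n0 * s \<le> real (Suc n0) * inverse (real (Suc n0))" using s by (intro mult_mono) (auto simp: s0_def)
        moreover have "s * c n0 \<le> inverse (c n0 + 1) * (c n0 + 1)" using s nc(2)[of n0] by (intro mult_mono) (auto simp: s0_def)
        ultimately have A: "n0 \<in> A s" using nc(2)[of n0] by (simp add: A_def)
        then have "n0 \<le> Max (A s)" using finA[OF s(1)] by simp
        then have "inverse (real (Suc (Max (A s)))) \<le> inverse (real (Suc n0))" by (intro le_imp_inverse_le) auto
        then have "inverse (real (Suc (Max (A s)))) < e * k" using n0 by linarith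
        then have "inverse (real (Suc (Max (A s)))) / k < e" using k by (simp only: pos_divide_less_eq)
        moreover have "A s \<noteq> {}" using A by blast
        ultimately show ?thesis using approx[of "Max (A s)"] unfolding dist_real_def quot[OF s(1) \<open>A s \<noteq> {}\<close>] by linarith
      qed
      then show "\<forall>\<^sub>F s in at_right 0. dist (((LINT p:?T|m s. \<phi> p) - (LINT p:?T|m 0. \<phi> p)) / (s - 0)) (\<eta> \<phi>) < e"
        unfolding eventually_at_right_field using s0 by blast
    qed
  qed
  moreover have "m s \<in> closed_measures U t0" for s by (rule closed_on_imp_closed_measures[OF m_closed compact_QU QU_TI])
  moreover have "m 0 = \<mu>" by (simp add: m_def)
  ultimately show ?thesis unfolding can_be_deformed_def by blast
qed

end

theorem measure_deformable:
  fixes U :: "'a::euclidean_space set" and t0 :: real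
    and \<mu> :: "('a \<times> 'a \<times> real) measure"
    and X :: "'a \<times> 'a \<times> real \<Rightarrow> 'a \<times> 'a \<times> real"
  assumes U: "open U" and t0: "t0 > 0" and mu: "\<mu> \<in> closed_measures U t0"
    and int: "\<And>\<phi>. \<phi> \<in> smooth (TI UNIV t0) \<Longrightarrow> set_integrable \<mu> (TI UNIV t0) (vf_deriv t0 X \<phi>)"
    and \<eta>: "\<And>\<phi>. \<phi> \<in> smooth (TI UNIV t0) \<Longrightarrow> \<eta> \<phi> = (LINT p:TI UNIV t0|\<mu>. vf_deriv t0 X \<phi> p)"
    and exact: "\<And>\<phi>. \<phi> \<in> smooth (BI UNIV t0) \<Longrightarrow> (LINT p:TI UNIV t0|\<mu>. vf_deriv t0 X (d_sigma UNIV t0 \<phi>) p) = 0"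
  shows "can_be_deformed U t0 \<mu> \<eta>"
proof -
  let ?T = "TI UNIV t0 :: ('a \<times> 'a \<times> real) set"
  define S where "S = measure_support \<mu>"
  have S: "compact S" "S \<subseteq> TI U t0" using mu by (auto simp: closed_measures_def S_def)
  note uT = unique_derivatives_TI[OF open_UNIV t0, where 'a = 'a] and uB = unique_derivatives_BI[OF open_UNIV t0, where 'a = 'a]
  show ?thesis
  proof (cases "S = {}")
    \<comment> \<open>With empty support \<open>\<mu>\<close> is null, all integrals vanish and the
      constant family serves.\<close>
    case True
    then have "closed_on U t0 {} \<mu>" by (intro closed_measures_imp_closed_on mu) (auto simp: S_def)
    then have ae: "AE p in \<mu>. p \<in> {}" by (intro concentrated_on_AE) (auto simp: closed_on_def)
    have z: "(LINT p:A|\<mu>. f p) = 0" for A and f :: "'a \<times> 'a \<times> real \<Rightarrow> real"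
      unfolding set_lebesgue_integral_def by (rule integral_eq_zero_AE) (use ae in eventually_elim, simp)
    show ?thesis unfolding can_be_deformed_def
      by (intro exI[of _ "\<lambda>_. \<mu>"] conjI refl allI impI ballI mu) (simp add: \<eta> z)
  next
    case False
    define S0 where "S0 = fst ` S"
    have cS0: "compact S0" unfolding S0_def by (intro compact_continuous_image continuous_intros S(1))
    have S0: "S0 \<noteq> {}" "S0 \<subseteq> U" using False S(2) by (auto simp: S0_def TI_def)
    obtain b where b: "\<And>p. p \<in> S \<Longrightarrow> norm p \<le> b" using compact_imp_bounded[OF S(1)] unfolding bounded_iff by blast
    \<comment> \<open>\<open>b\<close> bounds the velocities in the support; the extra 1 is the room
      between \<open>R - 1\<close> and \<open>R\<close>.\<close>
    define R where "R = max 0 b + 1"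
    obtain \<epsilon> where \<epsilon>: "\<epsilon> > 0" "(\<Union>x\<in>S0. ball x \<epsilon>) \<subseteq> U" 
      by (rule compact_subset_open_imp_ball_epsilon_subset[OF cS0 U S0(2)])
    \<comment> \<open>The largest tube radius \<open>5 * r\<close> is then
      \<open>\<epsilon> / 2\<close>, so the closed tube stays inside the open
      \<open>\<epsilon>\<close>-neighbourhood of \<open>S0\<close>.\<close>
    define r where "r = \<epsilon> / 10"
    let ?K = "{x. infdist x S0 \<le> 5 * r}"
    have K_U: "?K \<subseteq> U"
    proof
      fix x assume x: "x \<in> ?K"
      obtain y where "y \<in> S0" "infdist x S0 = dist x y" using infdist_attains_inf[OF compact_imp_closed[OF cS0] S0(1)] by blast
      then have "x \<in> ball y \<epsilon>" "y \<in> S0" using x \<epsilon>(1) by (auto simp: r_def dist_commute)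
      then show "x \<in> U" using \<epsilon>(2) by blast
    qed
    have "compact ?K" by (rule compact_infdist_le[OF S0(1) cS0]) (use \<epsilon> in \<open>simp add: r_def\<close>)
    then have "bounded ?K" by (rule compact_imp_bounded)
    then obtain \<rho> where "\<forall>x\<in>?K. norm x \<le> \<rho>" unfolding bounded_iff by (elim exE)
    then have \<rho>: "norm x \<le> \<rho>" if "x \<in> ?K" for x using that by (rule bspec)
    \<comment> \<open>The tube need not be convex, but the Taylor estimates for test functions need
      segments; so jets live on a product of balls and an interval, which may leave \<open>U\<close>
      while the measures do not.\<close>
    define P where "P = cball (0::'a) \<rho> \<times> cball (0::'a) R \<times> {0..t0}"
    let ?Q = "S0 \<times> cball (0::'a) (R - 1) \<times> {0..t0}"
    have SQ: "S \<subseteq> ?Q"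
    proof
      fix p assume p: "p \<in> S"
      obtain x v t where px: "p = (x, v, t)" by (cases p) auto
      have "norm v \<le> norm p" using norm_snd_le[of "(v, t)" x] norm_fst_le[of v t] by (simp add: px)
      then have "norm v \<le> R - 1" using b[OF p] by (simp add: R_def)
      moreover have "x \<in> S0" using imageI[OF p, of fst] by (simp add: S0_def px)
      moreover have "p \<in> TI U t0" using p S(2) by blast
      ultimately show "p \<in> ?Q" by (simp add: px TI_def)
    qed
    have cQ: "closed ?Q" by (intro compact_imp_closed compact_Times cS0 compact_cball compact_Icc)
    have QT: "?Q \<subseteq> ?T" by (auto simp: TI_def)
    have muQ: "closed_on U t0 ?Q \<mu>" by (rule closed_measures_imp_closed_on[OF mu SQ[unfolded S_def] cQ])
    then have con: "concentrated_on ?Q \<mu>" by (simp add: closed_on_def)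
    have s\<mu>: "sets \<mu> = sets borel" using con by (simp add: concentrated_on_def)
    have QB: "?Q \<in> sets \<mu>" using cQ s\<mu> by simp
    \<comment> \<open>The derivative of a linear test function along \<open>X\<close> is a
      coordinate of \<open>X\<close>, so the integrability hypothesis on test functions gives that
      of the coordinates.\<close>
    have XT: "set_integrable \<mu> ?T (\<lambda>p. X p \<bullet> b)" for b
    proof -
      have smooth_fun: "smooth_fun (\<lambda>p::'a \<times> 'a \<times> real. p \<bullet> b)" by (rule smooth_fun_linear[OF bounded_linear_inner_left])
      have "vf_deriv t0 X (\<lambda>p. p \<bullet> b) p = X p \<bullet> b" if "p \<in> ?T" for p
        unfolding vf_deriv_def
        by (subst frechet_derivative_within_eq[OF uT that bounded_linear_imp_has_derivative[OF bounded_linear_inner_left]]) (rule refl)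
      then show ?thesis
        using int[OF smooth_fun_imp_smooth[OF uT smooth_fun]] set_integrable_cong[OF refl refl, of ?T "vf_deriv t0 X (\<lambda>p. p \<bullet> b)" "\<lambda>p. X p \<bullet> b" \<mu>] by blast
    qed
    have vd: "vf_deriv t0 X (d_sigma UNIV t0 \<psi>) p = ddsig \<psi> p (X p)" if \<psi>: "smooth_fun \<psi>" and p: "p \<in> ?T" for \<psi> p
    proof -
      have "((\<lambda>p. deriv1 \<psi> (fst (snd p), 1) (fst p, snd (snd p))) has_derivative ddsig \<psi> p) (at p within ?T)"
        by (rule has_derivative_at_withinI[OF has_derivative_dsig[OF \<psi>]])
      then have "(d_sigma UNIV t0 \<psi> has_derivative ddsig \<psi> p) (at p within ?T)"
      proof (rule has_derivative_transform[OF p, rotated])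
        fix q assume q: "q \<in> ?T"
        obtain x v t where qx: "q = (x, v, t)" "(x, t) \<in> BI UNIV t0" using q by (auto simp: TI_def BI_def)
        have "frechet_derivative \<psi> (at (x, t) within BI UNIV t0) = frechet_derivative \<psi> (at (x, t))"
          by (rule frechet_derivative_within_eq[OF uB qx(2) has_derivative_at_withinI[OF smooth_fun_has_derivative[OF \<psi>]]])
        then show "d_sigma UNIV t0 \<psi> q = deriv1 \<psi> (fst (snd q), 1) (fst q, snd (snd q))" by (simp add: qx d_sigma_def)
      qed
      then show ?thesis unfolding vf_deriv_def by (simp add: frechet_derivative_within_eq[OF uT p])
    qed
    interpret deformation_setup U t0 r R S0 P \<mu> X
    proof
      show "open U" "t0 > 0" "compact S0" "S0 \<noteq> {}" "?K \<subseteq> U" by fact+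
      show "r > 0" "R \<ge> 1" using \<epsilon> by (simp_all add: r_def R_def)
      show "compact P" unfolding P_def by (intro compact_Times compact_cball compact_Icc)
      show "?K \<times> cball 0 R \<times> {0..t0} \<subseteq> P" using \<rho> by (auto simp: P_def)
      show "closed_on U t0 ?Q \<mu>" by (rule muQ)
      show "set_integrable \<mu> ?Q (\<lambda>p. X p \<bullet> b)" for b by (rule set_integrable_subset[OF XT QB QT])
      fix \<psi> :: "'a \<times> real \<Rightarrow> real" assume \<psi>: "smooth_fun \<psi>"
      \<comment> \<open>Written in coordinates, the derivative along \<open>X\<close> gets its
        measurability from the coordinates of \<open>X\<close> and the continuity of
        \<open>ddsig\<close>.\<close>
      have eq: "(\<lambda>p. indicator ?T p *\<^sub>R vf_deriv t0 X (d_sigma UNIV t0 \<psi>) p) = (\<lambda>p. \<Sum>b\<in>Basis. (indicator ?T p *\<^sub>R (X p \<bullet> b)) * ddsig \<psi> p b)"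
      proof
        fix p show "indicator ?T p *\<^sub>R vf_deriv t0 X (d_sigma UNIV t0 \<psi>) p = (\<Sum>b\<in>Basis. (indicator ?T p *\<^sub>R (X p \<bullet> b)) * ddsig \<psi> p b)"
        proof (cases "p \<in> ?T")
          case True
          then show ?thesis using vd[OF \<psi> True] linear_basis_expansion[OF linear_ddsig[OF \<psi>], of p "X p"] by simp
        qed simp
      qed
      have "(\<lambda>p. indicator ?T p *\<^sub>R vf_deriv t0 X (d_sigma UNIV t0 \<psi>) p) \<in> borel_measurable \<mu>"
        unfolding eq
      proof (intro borel_measurable_sum borel_measurable_times)
        fix b show "(\<lambda>p. indicator ?T p *\<^sub>R (X p \<bullet> b)) \<in> borel_measurable \<mu>"
          using XT unfolding set_integrable_def by (rule borel_measurable_integrable)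
        show "(\<lambda>p. ddsig \<psi> p b) \<in> borel_measurable \<mu>"
          using borel_measurable_continuous_onI[OF continuous_on_ddsig[OF \<psi>], of b] measurable_cong_sets[OF s\<mu> refl] by blast
      qed
      then have "(LINT p:?T|\<mu>. vf_deriv t0 X (d_sigma UNIV t0 \<psi>) p) = (LINT p:?Q|\<mu>. vf_deriv t0 X (d_sigma UNIV t0 \<psi>) p)"
        by (rule concentrated_set_integral[OF con cQ QT])
      also have "\<dots> = (LINT p:?Q|\<mu>. ddsig \<psi> p (X p))"
        by (rule set_lebesgue_integral_cong[OF QB]) (use vd[OF \<psi>] QT in blast)
      finally show "(LINT p:?Q|\<mu>. ddsig \<psi> p (X p)) = 0" using exact[OF smooth_fun_imp_smooth[OF uB \<psi>]] by simp
    qed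
    show ?thesis
    proof (rule deformation_exists)
      show "convex P" unfolding P_def by (intro convex_Times) auto
      show "P \<subseteq> ?T" by (auto simp: P_def TI_def)
      fix \<phi> :: "'a \<times> 'a \<times> real \<Rightarrow> real" assume \<phi>: "\<phi> \<in> smooth ?T"
      have "(LINT p:?T|\<mu>. vf_deriv t0 X \<phi> p) = (LINT p:?Q|\<mu>. vf_deriv t0 X \<phi> p)"
        by (rule concentrated_set_integral[OF con cQ QT borel_measurable_integrable[OF int[OF \<phi>, unfolded set_integrable_def]]])
      also have "\<dots> = (LINT p:?Q|\<mu>. grad ?T \<phi> p \<bullet> X p)"
        by (rule set_lebesgue_integral_cong[OF QB]) (use grad_inner[OF \<phi>] QT in \<open>auto simp: vf_deriv_def subset_iff\<close>)
      finally show "\<eta> \<phi> = (LINT p:?Q|\<mu>. grad ?T \<phi> p \<bullet> X p)" using \<eta>[OF \<phi>] by simp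
    qed
  qed
qed

theorem corollary13:
  fixes U :: "(real ^ 'n) set" and t0 :: real
    and \<mu> :: "((real ^ 'n) \<times> (real ^ 'n) \<times> real) measure"
    and X :: "(real ^ 'n) \<times> (real ^ 'n) \<times> real \<Rightarrow> (real ^ 'n) \<times> (real ^ 'n) \<times> real"
    and \<eta> :: "((real ^ 'n) \<times> (real ^ 'n) \<times> real \<Rightarrow> real) \<Rightarrow> real"
  assumes "open U" and "t0 > 0"
    and "\<mu> \<in> closed_measures U t0"
    and "X \<in> borel_measurable (restrict_space borel (TI UNIV t0))"
    and "closure (support_on (TI UNIV t0) X) \<subseteq> TI U t0"
    and "\<eta> \<in> compact_distributions (TI U t0)"
    and "\<And>\<phi>. \<phi> \<in> smooth (TI UNIV t0) \<Longrightarrow> set_integrable \<mu> (TI UNIV t0) (vf_deriv t0 X \<phi>)"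
    and "\<And>\<phi>. \<phi> \<in> smooth (TI UNIV t0) \<Longrightarrow> \<eta> \<phi> = (LINT p:TI UNIV t0|\<mu>. vf_deriv t0 X \<phi> p)"
    and "\<And>\<phi>. \<phi> \<in> smooth (BI UNIV t0) \<Longrightarrow>
           (LINT p:TI UNIV t0|\<mu>. vf_deriv t0 X (d_sigma UNIV t0 \<phi>) p) = 0"
  shows "can_be_deformed U t0 \<mu> \<eta>"
  by (rule measure_deformable[OF assms(1,2,3,7,8,9)])

end
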